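(* Fix $p$, $1<p<\infty$, let $p'=\frac p{p-1}$, and suppose $\phi$ is a non-trivial weight on $\mathbb R_+=(0,\infty)$ satisfying $$\int_0^\infty\phi(s)\min\left[1,s^{-p}\right]ds<\infty\quad\text{and}\quad\int_0^\infty\phi(s)\max\left[1,s^{-p}\right]ds=\infty .$$ Define $$\psi=\frac{(P\phi)(Q_p\phi)}{\left[P(Q_p\phi)\right]^{p'+1}},\quad\text{where}\quad (P\phi)(t)=t^{-1}\int_0^t\phi(s)\,ds,\quad (Q_p\phi)(t)=pt^{p-1}\int_t^\infty\phi(s)s^{-p}\,ds .$$ Let $T_K$ be a Calderón–Zygmund operator on $\mathbb R^n$. Then $T_K$ maps $\Gamma_{p,\phi}(\mathbb R^n)$ into $\Gamma_{p,\phi}(\mathbb R^n)$ if there exists $c$, $0<c<1$, such that for all $t\in\mathbb R_+$ $$\int_0^{ct}\phi(s)\,ds+c^pt^p\int_t^\infty\phi(s)s^{-p}\,ds\le\frac12\left[\int_0^t\phi(s)\,ds+t^p\int_t^\infty\phi(s)s^{-p}\,ds\right]$$ and $$\int_0^{ct}\psi(s)\,ds+c^{p'}t^{p'}\int_t^\infty\psi(s)s^{-p'}\,ds\le\frac12\left[\int_0^t\psi(s)\,ds+t^{p'}\int_t^\infty\psi(s)s^{-p'}\,ds\right].$$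
   Context: A weight on $\mathbb R_+$ is a positive locally integrable function. The weight $\phi$ is non-trivial if $\int_1^\infty\phi(t)t^{-p}\,dt<\infty$ and $\int_0^c\phi(t)t^{-p}\,dt=\infty$ for all $c\in(0,\infty)$. For a Lebesgue measurable real-valued $f$ on $\mathbb R^n$, let $f^*(t):=\inf\{\lambda>0:|\{x:|f(x)|>\lambda\}|\le t\}$ and $f^{**}(t):=t^{-1}\int_0^tf^*(s)\,ds$, $t>0$. Put $\rho_{p,\phi}(f):=\left[\int_0^\infty f^{**}(t)^p\phi(t)\,dt\right]^{1/p}$ and $\Gamma_{p,\phi}(\mathbb R^n):=\{f:\rho_{p,\phi}(f)<\infty\}$. A function $K$ on $\mathbb R^n\setminus\{0\}$, locally integrable away from the origin, is a Calderón–Zygmund kernel if: (i) there is $C_1>0$, independent of $0<\varepsilon<N$, with $\left|\int_{\varepsilon<|x|<N}K(x)\,dx\right|\le C_1$, and for each $N>0$ the limit $\lim_{\varepsilon\to0+}\int_{\varepsilon<|x|<N}K(x)\,dx$ exists; (ii) there is $C_2>0$, independent of $R>0$, with $\int_{|x|<R}|x||K(x)|\,dx\le C_2R$; (iii) there is $C_3>0$, independent of $y\in\mathbb R^n\setminus\{0\}$, with $\int_{|x|>2|y|}|K(x-y)-K(x)|\,dx\le C_3$; (iv) there is $C_4>0$, independent of $R>0$ and of points $x_1,x_2,x_3\in\mathbb R^n$ within distance $\frac R2$ of one another and each at distance greater than $R$ from $y$, such that $|K(x_1-y)-K(x_2-y)|\le C_4\frac{|x_1-x_2|}{|x_3-y|^{n+1}}$.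 The Calderón–Zygmund operator with kernel $K$ is $(T_Kf)(x):=\lim_{\varepsilon\to0+}\int_{|x-y|>\varepsilon}K(x-y)f(y)\,dy$, which is defined for a.e. $x\in\mathbb R^n$ for all measurable $f$ with $\int_{\mathbb R^n}\frac{|f(y)|}{1+|y|^n}\,dy<\infty$. *)

theory Defs
  imports "HOL-Analysis.Analysis"
begin

text \<open>
  Nonnegative quantities that may be infinite (integrals of positive functions, rearrangements,
  norms) take values in \<^typ>\<open>ennreal\<close>, so that divergence is not confused with the value 0.
  A real weight \<open>\<phi>\<close> enters such expressions as \<open>\<lambda>t. ennreal (\<phi> t)\<close>, and only its values on
  \<open>{0<..}\<close> are used.
\<close>

text \<open>Powers of extended nonnegative reals; used only with exponent \<open>a > 0\<close>.\<close>

definition epowr :: "ennreal \<Rightarrow> real \<Rightarrow> ennreal" where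
  "epowr x a = (if x = \<infinity> then \<infinity> else ennreal (enn2real x powr a))"


subsection \<open>Weights\<close>

definition weight :: "(real \<Rightarrow> real) \<Rightarrow> bool" where
  "weight \<phi> \<longleftrightarrow>
     (\<forall>t>0. 0 < \<phi> t) \<and>
     (\<forall>S. compact S \<and> S \<subseteq> {0<..} \<longrightarrow> \<phi> absolutely_integrable_on S)"

definition nontrivial_weight :: "real \<Rightarrow> (real \<Rightarrow> real) \<Rightarrow> bool" where
  "nontrivial_weight p \<phi> \<longleftrightarrow>
     weight \<phi> \<and>
     (\<integral>\<^sup>+t\<in>{1<..}. ennreal (\<phi> t * t powr (-p)) \<partial>lebesgue) < \<infinity> \<and>
     (\<forall>c>0. (\<integral>\<^sup>+t\<in>{0<..<c}. ennreal (\<phi> t * t powr (-p)) \<partial>lebesgue) = \<infinity>)"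

definition P_avg :: "(real \<Rightarrow> ennreal) \<Rightarrow> real \<Rightarrow> ennreal" where
  "P_avg w t = ennreal (1 / t) * (\<integral>\<^sup>+s\<in>{0<..<t}. w s \<partial>lebesgue)"

definition Q_op :: "real \<Rightarrow> (real \<Rightarrow> ennreal) \<Rightarrow> real \<Rightarrow> ennreal" where
  "Q_op p w t =
     ennreal (p * t powr (p - 1)) * (\<integral>\<^sup>+s\<in>{t<..}. w s * ennreal (s powr (-p)) \<partial>lebesgue)"

definition dual_weight :: "real \<Rightarrow> (real \<Rightarrow> ennreal) \<Rightarrow> real \<Rightarrow> ennreal" where
  "dual_weight p w t =
     (P_avg w t * Q_op p w t) / epowr (P_avg (Q_op p w) t) (p / (p - 1) + 1)"


subsection \<open>Rearrangements and the Lorentz Gamma space\<close>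

text \<open>The infimum is \<open>\<infinity>\<close> if no \<open>r\<close> qualifies.\<close>

definition rearr :: "(real^'n \<Rightarrow> real) \<Rightarrow> real \<Rightarrow> ennreal" where
  "rearr f t =
     (INF r\<in>{r::real. 0 < r \<and> emeasure lebesgue {x. \<bar>f x\<bar> > r} \<le> ennreal t}. ennreal r)"

definition rearr_avg :: "(real^'n \<Rightarrow> real) \<Rightarrow> real \<Rightarrow> ennreal" where
  "rearr_avg f = P_avg (rearr f)"

definition Gamma_norm :: "real \<Rightarrow> (real \<Rightarrow> real) \<Rightarrow> (real^'n \<Rightarrow> real) \<Rightarrow> ennreal" where
  "Gamma_norm p \<phi> f =
     epowr (\<integral>\<^sup>+t\<in>{0<..}. epowr (rearr_avg f t) p * ennreal (\<phi> t) \<partial>lebesgue) (1 / p)"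

definition Gamma_space :: "real \<Rightarrow> (real \<Rightarrow> real) \<Rightarrow> (real^'n \<Rightarrow> real) set" where
  "Gamma_space p \<phi> = {f. f \<in> borel_measurable lebesgue \<and> Gamma_norm p \<phi> f < \<infinity>}"


subsection \<open>Calderon-Zygmund kernels and operators\<close>

text \<open>
  Kernels are total functions, but their value at 0 is irrelevant: it is either outside the
  domain of the integrals or, in the third condition, excluded since \<open>\<bar>x\<bar> > 2\<bar>y\<bar>\<close>.
\<close>

definition CZ_kernel :: "(real^'n \<Rightarrow> real) \<Rightarrow> bool" where
  "CZ_kernel K \<longleftrightarrow>
     (\<forall>S. compact S \<and> 0 \<notin> S \<longrightarrow> K absolutely_integrable_on S) \<and>
     (\<exists>C1>0. \<forall>\<epsilon> N. 0 < \<epsilon> \<and> \<epsilon> < N \<longrightarrow>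
        \<bar>LINT x:{x. \<epsilon> < norm x \<and> norm x < N}|lebesgue. K x\<bar> \<le> C1) \<and>
     (\<forall>N>0. \<exists>l.
        ((\<lambda>\<epsilon>. LINT x:{x. \<epsilon> < norm x \<and> norm x < N}|lebesgue. K x) \<longlongrightarrow> l) (at_right 0)) \<and>
     (\<exists>C2>0. \<forall>R>0.
        (\<integral>\<^sup>+x\<in>{x. norm x < R}. ennreal (norm x * \<bar>K x\<bar>) \<partial>lebesgue) \<le> ennreal (C2 * R)) \<and>
     (\<exists>C3>0. \<forall>y. y \<noteq> 0 \<longrightarrow>
        (\<integral>\<^sup>+x\<in>{x. norm x > 2 * norm y}. ennreal \<bar>K (x - y) - K x\<bar> \<partial>lebesgue) \<le> ennreal C3) \<and>
     (\<exists>C4>0. \<forall>R>0. \<forall>x1 x2 x3 y.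
        dist x1 x2 \<le> R / 2 \<and> dist x1 x3 \<le> R / 2 \<and> dist x2 x3 \<le> R / 2 \<and>
        dist x1 y > R \<and> dist x2 y > R \<and> dist x3 y > R \<longrightarrow>
        \<bar>K (x1 - y) - K (x2 - y)\<bar> \<le> C4 * (norm (x1 - x2) / norm (x3 - y) ^ (CARD('n) + 1)))"

definition CZ_trunc :: "(real^'n \<Rightarrow> real) \<Rightarrow> (real^'n \<Rightarrow> real) \<Rightarrow> real \<Rightarrow> real^'n \<Rightarrow> real" where
  "CZ_trunc K f \<epsilon> x = (LINT y:{y. norm (x - y) > \<epsilon>}|lebesgue. K (x - y) * f y)"

text \<open>The truncated integrals must converge absolutely, as otherwise the Bochner integral in
  \<open>CZ_trunc\<close> would be 0 by convention.\<close>

definition CZ_defined_at :: "(real^'n \<Rightarrow> real) \<Rightarrow> (real^'n \<Rightarrow> real) \<Rightarrow> real^'n \<Rightarrow> bool" where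
  "CZ_defined_at K f x \<longleftrightarrow>
     (\<forall>\<epsilon>>0. set_integrable lebesgue {y. norm (x - y) > \<epsilon>} (\<lambda>y. K (x - y) * f y)) \<and>
     (\<exists>l. ((\<lambda>\<epsilon>. CZ_trunc K f \<epsilon> x) \<longlongrightarrow> l) (at_right 0))"

text \<open>Meaningful only at points where \<open>CZ_defined_at K f x\<close> holds.\<close>

definition CZ_operator :: "(real^'n \<Rightarrow> real) \<Rightarrow> (real^'n \<Rightarrow> real) \<Rightarrow> real^'n \<Rightarrow> real" where
  "CZ_operator K f x = Lim (at_right 0) (\<lambda>\<epsilon>. CZ_trunc K f \<epsilon> x)"

definition CZ_maps_into ::
  "(real^'n \<Rightarrow> real) \<Rightarrow> (real^'n \<Rightarrow> real) set \<Rightarrow> (real^'n \<Rightarrow> real) set \<Rightarrow> bool" where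
  "CZ_maps_into K X Y \<longleftrightarrow>
     (\<forall>f\<in>X. (AE x in lebesgue. CZ_defined_at K f x) \<and> CZ_operator K f \<in> Y)"

end

theory Submission
  imports Defs
begin

text \<open>
  Both hypotheses are dyadic growth bounds for the fundamental function
  \<open>g(t) = \<integral>\<^sub>0\<^sup>t \<phi> + t\<^sup>p \<integral>\<^sub>t\<^sup>\<infinity> \<phi>(s) s\<^bsup>-p\<^esup> ds\<close>: the first one says that \<open>g(t / 2\<^sup>k)\<close> decays
  geometrically, and the second one, since the fundamental function of \<open>\<psi>\<close> is comparable to
  \<open>t\<^bsup>p'\<^esup> g(t)\<^bsup>1-p'\<^esup>\<close>, that \<open>g(2\<^sup>k t)\<close> exceeds \<open>g(t)\<close> by at most \<open>2\<^bsup>kp\<^esup>\<close> times a geometrically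
  decaying factor. Weak type (1,1), duality and Cotlar's argument yield
  \<open>(T f)\<^sup>*(t) \<le> C \<Sum>\<^sub>k (k + 1) f\<^bsup>**\<^esup>(2\<^sup>k t)\<close>, so \<open>(T f)\<^bsup>**\<^esup>(t)\<close> is at most a multiple of the sum of
  \<open>(k + 1) 2\<^bsup>-j\<^esup> f\<^bsup>**\<^esup>(2\<^bsup>k-j\<^esup> t)\<close>. By Hardy's lemma the norm of a dilate of \<open>f\<^bsup>**\<^esup>\<close> is controlled by the
  corresponding growth factor of \<open>g\<close>, and these factors make the double sum converge.
\<close>

section \<open>Lebesgue measure on Euclidean space\<close>

text \<open>A function of the Gamma space need be neither integrable nor square integrable. The
  operator is therefore studied on the pieces of f between the heights f**(2^k t). The k-th piece
  lives on a set of measure about 2^k t, and its image may be ignored only on a set of measure about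
  2^-k t. Weak type (1,1) alone would achieve this at a height of order 4^k f**(2^k t), which is far
  too much. The exponential decay for bounded pieces achieves it at a height of order (k + 1)
  f**(2^k t), and this is the origin of the weight k + 1. Up to the limit of the truncations,
  everything is proved for the kernel cut to an annulus a < |x| <= b, where all integrals converge
  absolutely; what has to be watched is that the final constants do not depend on a and b. The
  comparison between the fundamental function of \<psi> and that of \<phi> needs lower bounds, hence
  room to double in both directions: g doubles towards infinity because of the condition on \<phi>,
  and t^-p g(t) doubles towards 0 because of the divergence in the definition of a non-trivial
  weight.\<close>

abbreviation nn_lborel :: "('a::euclidean_space \<Rightarrow> ennreal) \<Rightarrow> ennreal" (binder "LBNN " 10)
  where "nn_lborel f \<equiv> integral\<^sup>N lborel f"

abbreviation ind :: "'a set \<Rightarrow> 'a \<Rightarrow> 'b::zero_neq_one" where "ind \<equiv> indicator"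

abbreviation L1 :: "('a::euclidean_space \<Rightarrow> real) \<Rightarrow> real" where "L1 f \<equiv> (LBINT x. \<bar>f x\<bar>)"

lemma lborel_distr_reflect:
  "distr lborel borel (\<lambda>x. c - x) = (lborel :: 'a::euclidean_space measure)"
  using lborel_affine[of "-1" c] by (simp add: density_1)

lemma nn_integral_lborel_reflect:
  fixes f :: "'a::euclidean_space \<Rightarrow> ennreal"
  assumes [measurable]: "f \<in> borel_measurable borel"
  shows "(LBNN x. f (c - x)) = (LBNN x. f x)"
  by (subst (2) lborel_distr_reflect[of c, symmetric], subst nn_integral_distr) auto

lemma nn_integral_lborel_translate:
  fixes f :: "'a::euclidean_space \<Rightarrow> ennreal"
  assumes [measurable]: "f \<in> borel_measurable borel"
  shows "(LBNN x. f (x - c)) = (LBNN x. f x)"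
  by (subst (2) lborel_distr_plus[of "-c", symmetric], subst nn_integral_distr) auto

lemma lebesgue_integral_lborel_reflect:
  fixes f :: "'a::euclidean_space \<Rightarrow> real"
  assumes [measurable]: "f \<in> borel_measurable borel"
  shows "(LBINT x. f (c - x)) = (LBINT x. f x)"
  by (subst (2) lborel_distr_reflect[of c, symmetric], subst integral_distr) auto

lemma integrable_lborel_reflect:
  fixes f :: "'a::euclidean_space \<Rightarrow> real"
  assumes "integrable lborel f"
  shows "integrable lborel (\<lambda>x. f (c - x))"
proof -
  have "integrable (distr lborel borel (\<lambda>x. c - x)) f" using assms by (simp add: lborel_distr_reflect)
  then show ?thesis by (subst (asm) integrable_distr_eq) (use assms in auto)
qed

lemma cball_in_borel [measurable]: "cball (x :: 'a::euclidean_space) r \<in> sets borel"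
  by simp

abbreviation ball_vol :: "'a::euclidean_space itself \<Rightarrow> real" where
  "ball_vol _ \<equiv> unit_ball_vol (real DIM('a))"

section \<open>Integrals of powers of the distance over dyadic shells\<close>

lemma exists_dyadic_shell:
  fixes z R :: real
  assumes "0 < R" "R < z"
  obtains j where "2 ^ j * R < z" "z \<le> 2 ^ Suc j * R"
proof -
  obtain m where "z / R < 2 ^ m" using real_arch_pow[of 2 "z / R"] by auto
  then have m: "z \<le> 2 ^ m * R" using assms by (simp add: field_simps)
  define k where "k = (LEAST k. z \<le> 2 ^ k * R)"
  have k: "z \<le> 2 ^ k * R" unfolding k_def using m by (rule LeastI)
  then have "k \<noteq> 0" using assms by (cases k) auto
  then obtain j where j: "k = Suc j" by (cases k) auto
  then have "\<not> z \<le> 2 ^ j * R" unfolding k_def by (intro not_less_Least) (simp add: k_def)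
  with j k that[of j] show ?thesis by simp
qed

lemma power2_powr: "(2 ^ j) powr a = ((2::real) powr a) ^ j"
  by (simp add: powr_powr mult.commute flip: powr_realpow)

lemma powr_diff_mult_power:
  fixes z :: real
  assumes "0 < z"
  shows "z powr (a - real n) * z ^ n = z powr a"
  using assms by (simp add: powr_diff powr_realpow)

lemma suminf_ennreal_geometric:
  fixes q c :: real
  assumes "0 \<le> q" "q < 1" "0 \<le> c"
  shows "(\<Sum>j. L * ennreal (c * q ^ j)) = L * ennreal (c / (1 - q))"
proof -
  have "(\<lambda>j. c * q ^ j) sums (c * (1 / (1 - q)))" using assms by (intro sums_mult geometric_sums) auto
  then have "(\<Sum>j. ennreal (c * q ^ j)) = ennreal (c / (1 - q))" using assms by (intro suminf_ennreal_eq) auto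
  then show ?thesis by simp
qed

lemma ennreal_term_le_suminf: "f j \<le> (\<Sum>j. f j :: ennreal)"
  using sum_le_suminf[of f "{j}"] by simp

text \<open>Common form of the dyadic decompositions: every point of the support only has to be
  covered by some term. Disjointness of the shells is not asked for, since overlaps merely enlarge
  the sum.\<close>

lemma nn_integral_le_suminf:
  fixes c :: "nat \<Rightarrow> ennreal"
  assumes h: "\<And>j. h j \<in> borel_measurable M" and le: "\<And>y. f y \<noteq> 0 \<Longrightarrow> \<exists>j. f y \<le> c j * h j y"
  shows "(\<integral>\<^sup>+y. f y \<partial>M) \<le> (\<Sum>j. c j * (\<integral>\<^sup>+y. h j y \<partial>M))"
proof -
  have "(\<integral>\<^sup>+y. f y \<partial>M) \<le> (\<integral>\<^sup>+y. (\<Sum>j. c j * h j y) \<partial>M)"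
  proof (intro nn_integral_mono)
    fix y
    show "f y \<le> (\<Sum>j. c j * h j y)"
    proof (cases "f y = 0")
      case False
      then obtain j where "f y \<le> c j * h j y" using le by blast
      also have "\<dots> \<le> (\<Sum>j. c j * h j y)" by (rule ennreal_term_le_suminf)
      finally show ?thesis .
    qed simp
  qed
  also have "\<dots> = (\<Sum>j. \<integral>\<^sup>+y. c j * h j y \<partial>M)" using h by (intro nn_integral_suminf borel_measurable_times_ennreal) auto
  also have "\<dots> = (\<Sum>j. c j * (\<integral>\<^sup>+y. h j y \<partial>M))" using h by (intro arg_cong[of _ _ suminf] ext nn_integral_cmult) auto
  finally show ?thesis .
qed

text \<open>On the shell of radius about \<open>2 ^ j * R\<close> the power is at most
  \<open>(2 ^ j * R) powr (- n - b)\<close>, while \<open>avg\<close> bounds the mass of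
  \<open>w\<close> by a multiple of \<open>(2 ^ Suc j * R) ^ n\<close>, with n the dimension. What
  remains is a geometric series of ratio \<open>2 powr (-b)\<close>. It is applied with
  \<open>w = 1\<close> to kernel differences and with the absolute value of a function in Cotlar's
  comparison, where \<open>avg\<close> is a bound for the maximal function.\<close>

lemma nn_integral_far_le:
  fixes w :: "'a::euclidean_space \<Rightarrow> ennreal"
  assumes [measurable]: "w \<in> borel_measurable borel"
    and avg: "\<And>r. 0 < r \<Longrightarrow>
      (LBNN y. w y * ind (cball x r) y) \<le> L * ennreal (r ^ DIM('a))"
    and b: "0 < b" and R: "0 < R"
  shows "(LBNN y. w y * ennreal (norm (y - x) powr (- real DIM('a) - b))
            * ind {y. R < norm (y - x)} y)
         \<le> L * ennreal (2 ^ DIM('a) * R powr (-b) / (1 - 2 powr (-b)))"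
proof -
  let ?n = "DIM('a)"
  define s where "s j = (2 ^ j * R) powr (- real ?n - b)" for j :: nat
  have q: "2 powr (-b) < (1::real)" using b by (simp add: powr_less_one)
  have "(LBNN y. w y * ennreal (norm (y - x) powr (- real ?n - b))
            * ind {y. R < norm (y - x)} y)
     \<le> (\<Sum>j. ennreal (s j) * (LBNN y. w y * ind (cball x (2 ^ Suc j * R)) y))"
  proof (rule nn_integral_le_suminf)
    fix y :: 'a
    assume "w y * ennreal (norm (y - x) powr (- real ?n - b)) * ind {y. R < norm (y - x)} y \<noteq> 0"
    then have "R < norm (y - x)" by (auto simp: indicator_def split: if_splits)
    then obtain j where j: "2 ^ j * R < norm (y - x)" "norm (y - x) \<le> 2 ^ Suc j * R"
      using exists_dyadic_shell[OF R] by blast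
    have "norm (y - x) powr (- real ?n - b) \<le> s j" unfolding s_def using j R b by (intro powr_mono2') auto
    moreover have "y \<in> cball x (2 ^ Suc j * R)" using j by (simp add: dist_norm norm_minus_commute)
    ultimately show "\<exists>j. w y * ennreal (norm (y - x) powr (- real ?n - b)) * ind {y. R < norm (y - x)} y
        \<le> ennreal (s j) * (w y * ind (cball x (2 ^ Suc j * R)) y)"
      by (intro exI[of _ j]) (simp add: mult.commute mult_left_mono ennreal_leI indicator_def)
  qed measurable
  also have "\<dots> \<le> (\<Sum>j. L * ennreal (2 ^ ?n * R powr (-b) * (2 powr (-b)) ^ j))"
  proof (intro suminf_le)
    fix j
    have "s j * (2 ^ Suc j * R) ^ ?n = 2 ^ ?n * R powr (-b) * (2 powr (-b)) ^ j"
    proof -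
      have "s j * (2 ^ Suc j * R) ^ ?n = 2 ^ ?n * ((2 ^ j * R) powr (- b - real ?n) * (2 ^ j * R) ^ ?n)"
        by (simp add: s_def power_mult_distrib minus_diff_commute[of b])
      also have "\<dots> = 2 ^ ?n * (2 ^ j * R) powr (-b)" using R by (subst powr_diff_mult_power) auto
      also have "\<dots> = 2 ^ ?n * R powr (-b) * (2 powr (-b)) ^ j" using R by (simp add: powr_mult power2_powr)
      finally show ?thesis .
    qed
    moreover have "ennreal (s j) * (LBNN y. w y * ind (cball x (2 ^ Suc j * R)) y)
        \<le> ennreal (s j) * (L * ennreal ((2 ^ Suc j * R) ^ ?n))" using R by (intro mult_left_mono avg) auto
    moreover have "\<dots> = L * ennreal (s j * (2 ^ Suc j * R) ^ ?n)"
      using R by (simp add: ennreal_mult s_def mult.left_commute)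
    ultimately show "ennreal (s j) * (LBNN y. w y * ind (cball x (2 ^ Suc j * R)) y)
        \<le> L * ennreal (2 ^ ?n * R powr (-b) * (2 powr (-b)) ^ j)" by simp
  qed auto
  also have "\<dots> = L * ennreal (2 ^ ?n * R powr (-b) / (1 - 2 powr (-b)))"
    using q by (intro suminf_ennreal_geometric) auto
  finally show ?thesis .
qed

text \<open>Mirror image of \<open>nn_integral_far_le\<close>, with shells shrinking to
  \<open>x\<close>. The bound \<open>b \<le> 1\<close> makes the exponent nonpositive in every
  dimension, so the power is largest at the inner radius of a shell.\<close>

lemma nn_integral_near_le:
  fixes x :: "'a::euclidean_space"
  assumes b: "0 < b" "b \<le> 1" and R: "0 < R"
  shows "(LBNN y. ennreal (norm (y - x) powr (b - real DIM('a))) * ind (cball x R) y)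
         \<le> ennreal (ball_vol TYPE('a) * 2 ^ DIM('a) * R powr b / (1 - 2 powr (-b)))"
proof -
  let ?n = "DIM('a)"
  have n: "b \<le> real ?n" using b DIM_positive[where 'a='a] by linarith
  define s where "s j = (R / 2 ^ Suc j) powr (b - real ?n)" for j :: nat
  have q: "2 powr (-b) < (1::real)" using b by (simp add: powr_less_one)
  have "(LBNN y. ennreal (norm (y - x) powr (b - real ?n)) * ind (cball x R) y)
     \<le> (\<Sum>j. ennreal (s j) * (LBNN y. ind (cball x (R / 2 ^ j)) y))"
  proof (rule nn_integral_le_suminf)
    fix y :: 'a
    assume "ennreal (norm (y - x) powr (b - real ?n)) * ind (cball x R) y \<noteq> 0"
    then have True: "y \<noteq> x \<and> norm (y - x) \<le> R" by (auto simp: dist_norm norm_minus_commute split: split_indicator_asm)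
    define z where "z = norm (y - x)"
    have "0 < z" using True by (simp add: z_def)
    have z: "0 < z" "z < 2 * R" using True R by (auto simp: z_def intro: le_less_trans)
    \<comment> \<open>The lemma on shells needs a strict inequality, and \<open>z = R\<close> is
      possible; hence it is applied to \<open>2 * R\<close>. The index is then one too large, except
      for \<open>j = 0\<close>, where \<open>z = R\<close>.\<close>
    obtain j where j: "2 ^ j * z < 2 * R" "2 * R \<le> 2 ^ Suc j * z" using exists_dyadic_shell[OF z] by blast
    have R2: "R / 2 ^ j \<le> z" "z < R / 2 ^ j * 2" using j by (auto simp: field_simps)
    have "\<exists>i. R / 2 ^ Suc i \<le> z \<and> z \<le> R / 2 ^ i"
    proof (cases j)
      case 0
      then show ?thesis using R2 True R by (intro exI[of _ 0]) (auto simp: z_def)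
    next
      case (Suc i)
      then show ?thesis using R2 by (intro exI[of _ i]) (auto simp: field_simps)
    qed
    then obtain i where i: "R / 2 ^ Suc i \<le> z" "z \<le> R / 2 ^ i" by blast
    have "norm (y - x) powr (b - real ?n) \<le> s i"
      unfolding s_def z_def[symmetric] using i R b n by (intro powr_mono2') auto
    moreover have "y \<in> cball x (R / 2 ^ i)" using i by (simp add: dist_norm norm_minus_commute z_def)
    ultimately show "\<exists>j. ennreal (norm (y - x) powr (b - real ?n)) * ind (cball x R) y
      \<le> ennreal (s j) * ind (cball x (R / 2 ^ j)) y"
      using True by (intro exI[of _ i]) (simp add: mult.commute mult_left_mono ennreal_leI dist_norm norm_minus_commute)
  qed measurable
  also have "\<dots> = (\<Sum>j. ennreal (s j) * emeasure lborel (cball x (R / 2 ^ j)))" by simp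
  also have "\<dots> \<le> (\<Sum>j. 1 * ennreal (ball_vol TYPE('a) * 2 ^ ?n * R powr b * (2 powr (-b)) ^ j))"
  proof (intro suminf_le)
    fix j
    have "s j * (ball_vol TYPE('a) * (R / 2 ^ j) ^ ?n)
        = ball_vol TYPE('a) * 2 ^ ?n * ((R / 2 ^ Suc j) powr (b - real ?n) * (R / 2 ^ Suc j) ^ ?n)"
      by (simp add: s_def power_mult_distrib power_divide)
    also have "\<dots> = ball_vol TYPE('a) * 2 ^ ?n * (R / 2 ^ Suc j) powr b" using R by (subst powr_diff_mult_power) auto
    also have "\<dots> \<le> ball_vol TYPE('a) * 2 ^ ?n * (R / 2 ^ j) powr b"
      using R b by (intro mult_left_mono powr_mono2) (auto simp: field_simps)
    also have "(R / 2 ^ j) powr b = R powr b * (2 powr (-b)) ^ j"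
      using R by (simp add: powr_divide power2_powr powr_minus power_inverse) (simp add: divide_inverse)
    finally have "s j * (ball_vol TYPE('a) * (R / 2 ^ j) ^ ?n)
      \<le> ball_vol TYPE('a) * 2 ^ ?n * R powr b * (2 powr (-b)) ^ j" by (simp add: mult.assoc)
    then show "ennreal (s j) * emeasure lborel (cball x (R / 2 ^ j))
        \<le> 1 * ennreal (ball_vol TYPE('a) * 2 ^ ?n * R powr b * (2 powr (-b)) ^ j)"
      using R by (simp add: emeasure_cball ennreal_leI s_def flip: ennreal_mult)
  qed auto
  also have "\<dots> = 1 * ennreal (ball_vol TYPE('a) * 2 ^ ?n * R powr b / (1 - 2 powr (-b)))"
    using q by (intro suminf_ennreal_geometric) auto
  finally show ?thesis by simp
qed

text \<open>By scale invariance each of the \<open>k\<close> shells contributes at most the same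
  constant. This logarithmic growth is the source of the factor \<open>real k + 1\<close> in
  \<open>cinf_lev_integral\<close>.\<close>

lemma nn_integral_log_le:
  fixes x :: "'a::euclidean_space"
  assumes a: "0 < a"
  shows "(LBNN y. ennreal (1 / norm (y - x) ^ DIM('a)) * ind {y. a < norm (y - x) \<and> norm (y - x) \<le> 2 ^ k * a} y)
         \<le> ennreal (real k * 2 ^ DIM('a) * ball_vol TYPE('a))"
proof (induction k)
  case 0
  have "ind {y. a < norm (y - x) \<and> norm (y - x) \<le> 2 ^ 0 * a} y = (0::ennreal)" for y by (auto simp: indicator_def)
  then show ?case by simp
next
  case (Suc k)
  let ?n = "DIM('a)"
  have "(LBNN y. ennreal (1 / norm (y - x) ^ ?n) * ind {y. a < norm (y - x) \<and> norm (y - x) \<le> 2 ^ Suc k * a} y)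
     \<le> (LBNN y. ennreal (1 / norm (y - x) ^ ?n) * ind {y. a < norm (y - x) \<and> norm (y - x) \<le> 2 ^ k * a} y
            + ennreal (1 / (2 ^ k * a) ^ ?n) * ind (cball x (2 ^ Suc k * a)) y)"
  proof (intro nn_integral_mono)
    fix y :: 'a
    have "1 / norm (y - x) ^ ?n \<le> 1 / (2 ^ k * a) ^ ?n" if "\<not> norm (y - x) \<le> 2 ^ k * a"
    proof -
      have "0 < 2 ^ k * a" using a by simp
      then show ?thesis using that a by (intro divide_left_mono power_mono mult_pos_pos zero_less_power) auto
    qed
    then show "ennreal (1 / norm (y - x) ^ ?n) * ind {y. a < norm (y - x) \<and> norm (y - x) \<le> 2 ^ Suc k * a} y
      \<le> ennreal (1 / norm (y - x) ^ ?n) * ind {y. a < norm (y - x) \<and> norm (y - x) \<le> 2 ^ k * a} y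
            + ennreal (1 / (2 ^ k * a) ^ ?n) * ind (cball x (2 ^ Suc k * a)) y"
      by (auto simp: indicator_def dist_norm norm_minus_commute ennreal_leI)
  qed
  also have "\<dots> = (LBNN y. ennreal (1 / norm (y - x) ^ ?n) * ind {y. a < norm (y - x) \<and> norm (y - x) \<le> 2 ^ k * a} y)
      + ennreal (1 / (2 ^ k * a) ^ ?n) * emeasure lborel (cball x (2 ^ Suc k * a))"
    by (subst nn_integral_add) (auto simp: nn_integral_cmult)
  also have "ennreal (1 / (2 ^ k * a) ^ ?n) * emeasure lborel (cball x (2 ^ Suc k * a))
      = ennreal (2 ^ ?n * ball_vol TYPE('a))"
    using a by (simp add: emeasure_cball flip: ennreal_mult) (simp add: power_mult_distrib)
  also have "(LBNN y. ennreal (1 / norm (y - x) ^ ?n) * ind {y. a < norm (y - x) \<and> norm (y - x) \<le> 2 ^ k * a} y)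
      + ennreal (2 ^ ?n * ball_vol TYPE('a)) \<le> ennreal (real k * 2 ^ ?n * ball_vol TYPE('a)) + ennreal (2 ^ ?n * ball_vol TYPE('a))"
    by (intro add_right_mono Suc)
  also have "\<dots> = ennreal (real (Suc k) * 2 ^ ?n * ball_vol TYPE('a))"
    by (subst ennreal_plus[symmetric]) (auto simp: algebra_simps)
  finally show ?case .
qed

text \<open>With \<open>x = h / b\<close> the volume is a multiple of (1 + x)^n - (1 - x)^n. The
  first power is at most 1 + 2^n x by convexity, the second at least 1 - n x by Bernoulli. The
  quotient \<open>b ^ DIM('a) / b\<close> stands for the power n - 1.\<close>

lemma emeasure_layer_le:
  assumes h: "0 \<le> h" "h \<le> b" and b: "0 < b"
  shows "emeasure lborel {u::'a::euclidean_space. b - h \<le> norm u \<and> norm u \<le> b + h}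
         \<le> ennreal (ball_vol TYPE('a) * (2 ^ DIM('a) + DIM('a)) * (h * b ^ DIM('a) / b))"
proof -
  let ?n = "DIM('a)"
  define x where "x = h / b"
  have x: "0 \<le> x" "x \<le> 1" using assms by (auto simp: x_def)
  have "{u::'a. b - h \<le> norm u \<and> norm u \<le> b + h} = cball 0 (b + h) - ball 0 (b - h)" by auto
  also have "emeasure lborel (cball 0 (b + h) - ball (0::'a) (b - h))
      = emeasure lborel (cball 0 (b + h) :: 'a set) - emeasure lborel (ball 0 (b - h) :: 'a set)"
  proof (rule emeasure_Diff)
    show "emeasure lborel (ball (0::'a) (b - h)) \<noteq> \<infinity>" using emeasure_lborel_ball_finite[of "0::'a" "b - h"] by simp
    show "ball (0::'a) (b - h) \<subseteq> cball 0 (b + h)"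
      using h by (intro order_trans[OF ball_subset_cball subset_cball]) simp
  qed auto
  also have "\<dots> = ennreal (ball_vol TYPE('a) * (b + h) ^ ?n - ball_vol TYPE('a) * (b - h) ^ ?n)"
    using assms by (simp add: emeasure_cball emeasure_ball ennreal_minus)
  also have "ball_vol TYPE('a) * (b + h) ^ ?n - ball_vol TYPE('a) * (b - h) ^ ?n
      \<le> ball_vol TYPE('a) * (2 ^ ?n + ?n) * (h * b ^ ?n / b)"
  proof -
    have 1: "(1 + x) ^ m \<le> 1 + x * 2 ^ m" for m
    proof (induction m)
      case (Suc m)
      have "(1 + x) ^ Suc m = (1 + x) ^ m + x * (1 + x) ^ m" by (simp add: algebra_simps)
      also have "\<dots> \<le> (1 + x * 2 ^ m) + x * 2 ^ m" using Suc x by (intro add_mono mult_left_mono power_mono) auto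
      finally show ?case by simp
    qed (use x in simp)
    have "1 + real ?n * (-x) \<le> (1 + (-x)) ^ ?n" using x by (intro Bernoulli_inequality) auto
    with 1[of ?n] have "(1 + x) ^ ?n - (1 - x) ^ ?n \<le> (2 ^ ?n + ?n) * x" by (simp add: algebra_simps)
    then have "ball_vol TYPE('a) * b ^ ?n * ((1 + x) ^ ?n - (1 - x) ^ ?n)
        \<le> ball_vol TYPE('a) * b ^ ?n * ((2 ^ ?n + ?n) * x)" using b by (intro mult_left_mono) auto
    moreover have "(b + h) ^ ?n = b ^ ?n * (1 + x) ^ ?n" "(b - h) ^ ?n = b ^ ?n * (1 - x) ^ ?n"
      using b by (auto simp: x_def field_simps simp flip: power_mult_distrib)
    ultimately have "ball_vol TYPE('a) * (b + h) ^ ?n - ball_vol TYPE('a) * (b - h) ^ ?n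
        \<le> ball_vol TYPE('a) * b ^ ?n * ((2 ^ ?n + ?n) * x)" by (simp only: right_diff_distrib mult.assoc)
    then show ?thesis by (simp add: x_def mult_ac)
  qed
  finally show ?thesis using ennreal_leI by blast
qed

text \<open>Fatou's lemma for indicators: because the inequality \<open>l < \<bar>g x\<bar>\<close>
  is strict, it holds for \<open>f m x\<close> as soon as \<open>m\<close> is large. All
  distribution estimates pass to limits of truncations through this lemma.\<close>

lemma emeasure_limit_le:
  fixes g :: "'a \<Rightarrow> real"
  assumes [measurable]: "\<And>m. f m \<in> borel_measurable M" "g \<in> borel_measurable M"
    and lim: "AE x in M. (\<lambda>m. f m x) \<longlonglongrightarrow> g x"
    and le: "\<And>m. emeasure M {x\<in>space M. l < \<bar>f m x\<bar>} \<le> c"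
  shows "emeasure M {x\<in>space M. l < \<bar>g x\<bar>} \<le> c"
proof -
  have "emeasure M {x\<in>space M. l < \<bar>g x\<bar>} = (\<integral>\<^sup>+x. ind {x\<in>space M. l < \<bar>g x\<bar>} x \<partial>M)" by simp
  also have "\<dots> \<le> (\<integral>\<^sup>+x. liminf (\<lambda>m. ind {x\<in>space M. l < \<bar>f m x\<bar>} x) \<partial>M)"
  proof (intro nn_integral_mono_AE)
    show "AE x in M. ind {x\<in>space M. l < \<bar>g x\<bar>} x
        \<le> (liminf (\<lambda>m. ind {x\<in>space M. l < \<bar>f m x\<bar>} x) :: ennreal)" using lim AE_space
    proof eventually_elim
      case (elim x)
      show ?case
      proof (cases "l < \<bar>g x\<bar>")
        case True
        have "(\<lambda>m. \<bar>f m x\<bar>) \<longlonglongrightarrow> \<bar>g x\<bar>" using elim by (intro tendsto_intros)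
        then have "\<forall>\<^sub>F m in sequentially. l < \<bar>f m x\<bar>" using True by (rule order_tendstoD)
        then have "\<forall>\<^sub>F m in sequentially. (1::ennreal) \<le> ind {x\<in>space M. l < \<bar>f m x\<bar>} x"
          by eventually_elim (use elim in simp)
        then have "1 \<le> liminf (\<lambda>m. ind {x\<in>space M. l < \<bar>f m x\<bar>} x :: ennreal)" by (rule Liminf_bounded)
        then show ?thesis by (rule order_trans[rotated]) (simp add: indicator_def)
      qed auto
    qed
  qed
  also have "\<dots> \<le> liminf (\<lambda>m. \<integral>\<^sup>+x. ind {x\<in>space M. l < \<bar>f m x\<bar>} x \<partial>M)" by (intro nn_integral_liminf) auto
  also have "\<dots> = liminf (\<lambda>m. emeasure M {x\<in>space M. l < \<bar>f m x\<bar>})" by simp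
  also have "\<dots> \<le> liminf (\<lambda>m. c)" by (intro Liminf_mono) (simp add: le)
  finally show ?thesis by (simp add: Liminf_const)
qed

section \<open>Density of Hoelder functions\<close>

text \<open>Hoelder exponent 1/2 represents any exponent strictly between 0 and 1: uniformly in the
  truncation, singular integrals preserve Hoelder continuity but neither boundedness nor Lipschitz
  continuity. The constant and the radius are explicit because Krein's argument has to follow them
  through iterations.\<close>

definition hoelder_supp :: "real \<Rightarrow> real \<Rightarrow> ('a::euclidean_space \<Rightarrow> real) \<Rightarrow> bool" where
  "hoelder_supp H R f \<longleftrightarrow> 0 \<le> H \<and> 0 \<le> R \<and>
     (\<forall>x y. \<bar>f x - f y\<bar> \<le> H * sqrt (norm (x - y))) \<and> (\<forall>x. R < norm x \<longrightarrow> f x = 0)"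

lemma hoelder_suppD:
  assumes "hoelder_supp H R f"
  shows "0 \<le> H" "0 \<le> R" "\<bar>f x - f y\<bar> \<le> H * sqrt (norm (x - y))" "R < norm x \<Longrightarrow> f x = 0"
  using assms by (auto simp: hoelder_supp_def)

lemma hoelder_supp_continuous:
  assumes f: "hoelder_supp H R f"
  shows "continuous_on UNIV f"
proof -
  have "isCont f x" for x
  proof -
    have "((\<lambda>y. H * sqrt (norm (y - x))) \<longlongrightarrow> H * sqrt (norm (x - x))) (at x)" by (intro tendsto_intros)
    then have lim: "((\<lambda>y. H * sqrt (norm (y - x))) \<longlongrightarrow> 0) (at x)" by simp
    have "((\<lambda>y. f y - f x) \<longlongrightarrow> 0) (at x)" by (rule Lim_null_comparison[OF _ lim]) (simp add: hoelder_suppD(3)[OF f])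
    then show ?thesis by (simp add: isCont_def LIM_zero_iff)
  qed
  then show ?thesis by (simp add: continuous_at_imp_continuous_on)
qed

lemma hoelder_supp_borel: "hoelder_supp H R f \<Longrightarrow> f \<in> borel_measurable borel"
  using hoelder_supp_continuous borel_measurable_continuous_onI by blast

text \<open>Compare with a point of norm \<open>R + 1\<close>, where the function vanishes; it lies
  within distance \<open>2 * R + 1\<close> of every point of the ball.\<close>

lemma hoelder_supp_bound:
  fixes f :: "'a::euclidean_space \<Rightarrow> real"
  assumes f: "hoelder_supp H R f"
  shows "\<bar>f x\<bar> \<le> H * sqrt (2 * R + 1)"
proof (cases "R < norm x")
  case True
  then show ?thesis using hoelder_suppD[OF f] by simp
next
  case False
  obtain e :: 'a where e: "norm e = R + 1" using vector_choose_size[of "R + 1"] hoelder_suppD(2)[OF f] by auto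
  have "\<bar>f x\<bar> = \<bar>f x - f e\<bar>" using e hoelder_suppD(4)[OF f, of e] by simp
  also have "\<dots> \<le> H * sqrt (norm (x - e))" by (rule hoelder_suppD[OF f])
  also have "\<dots> \<le> H * sqrt (2 * R + 1)" using e False norm_triangle_ineq4[of x e] hoelder_suppD(1)[OF f]
    by (intro mult_left_mono real_sqrt_le_mono) auto
  finally show ?thesis .
qed

lemma integrable_bounded_supp:
  fixes f :: "'a::euclidean_space \<Rightarrow> real"
  assumes [measurable]: "f \<in> borel_measurable borel" and "\<And>x. \<bar>f x\<bar> \<le> B" "\<And>x. R < norm x \<Longrightarrow> f x = 0"
  shows "integrable lborel f"
proof (rule Bochner_Integration.integrable_bound)
  show "integrable lborel (\<lambda>x. B * ind (cball (0::'a) R) x)" using emeasure_lborel_cball_finite[of "0::'a" R]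
    by (intro integrable_mult_right integrable_real_indicator) auto
  have "0 \<le> B" using assms(2)[of undefined] by linarith
  then show "AE x in lborel. norm (f x) \<le> norm (B * ind (cball (0::'a) R) x)"
    using assms(2,3) by (intro AE_I2) (auto simp: indicator_def not_le)
qed auto

lemma hoelder_supp_integrable:
  assumes "hoelder_supp H R f"
  shows "integrable lborel f"
  using hoelder_supp_bound[OF assms] hoelder_suppD(4)[OF assms] hoelder_supp_borel[OF assms]
  by (rule integrable_bounded_supp[rotated])

lemma hoelder_supp_add:
  assumes f: "hoelder_supp H R f" and g: "hoelder_supp H' R' g"
  shows "hoelder_supp (H + H') (max R R') (\<lambda>x. f x + g x)"
  unfolding hoelder_supp_def
proof (intro conjI allI impI)
  fix x y
  show "\<bar>f x + g x - (f y + g y)\<bar> \<le> (H + H') * sqrt (norm (x - y))"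
    using hoelder_suppD(3)[OF f, of x y] hoelder_suppD(3)[OF g, of x y] by (simp add: distrib_right)
qed (use hoelder_suppD[OF f] hoelder_suppD[OF g] in auto)

lemma hoelder_supp_cmult:
  assumes f: "hoelder_supp H R f"
  shows "hoelder_supp (\<bar>c\<bar> * H) R (\<lambda>x. c * f x)"
  unfolding hoelder_supp_def
proof (intro conjI allI impI)
  fix x y
  show "\<bar>c * f x - c * f y\<bar> \<le> \<bar>c\<bar> * H * sqrt (norm (x - y))" using hoelder_suppD(3)[OF f, of x y]
    by (simp add: mult.assoc mult_left_mono flip: right_diff_distrib abs_mult)
       (simp add: abs_mult mult_left_mono)
qed (use hoelder_suppD[OF f] in auto)

lemma hoelder_supp_clip:
  assumes f: "hoelder_supp H R f" and M: "0 \<le> M"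
  shows "hoelder_supp H R (\<lambda>x. max (-M) (min M (f x)))"
  unfolding hoelder_supp_def
proof (intro conjI allI impI)
  fix x y
  have "\<bar>max (-M) (min M (f x)) - max (-M) (min M (f y))\<bar> \<le> \<bar>f x - f y\<bar>" by (auto simp: max_def min_def)
  then show "\<bar>max (-M) (min M (f x)) - max (-M) (min M (f y))\<bar> \<le> H * sqrt (norm (x - y))"
    using hoelder_suppD(3)[OF f, of x y] by linarith
qed (use hoelder_suppD[OF f] M in auto)

definition hoelder_approx :: "('a::euclidean_space \<Rightarrow> real) \<Rightarrow> bool" where
  "hoelder_approx f \<longleftrightarrow> integrable lborel f \<and>
     (\<forall>e>0. \<exists>H R h. hoelder_supp H R h \<and> (LBINT x. \<bar>f x - h x\<bar>) < e)"

lemma hoelder_approx_supp: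
  assumes "hoelder_supp H R f"
  shows "hoelder_approx f"
  unfolding hoelder_approx_def
  by (intro conjI allI impI hoelder_supp_integrable[OF assms] exI[of _ H] exI[of _ R] exI[of _ f]) (auto simp: assms)

text \<open>Dominated convergence. The hypotheses are shaped after the limit case of
  \<open>integrable_induct\<close>, where the dominating function is twice the limit.\<close>

lemma hoelder_approx_limit:
  fixes f :: "'a::euclidean_space \<Rightarrow> real"
  assumes s: "\<And>i. hoelder_approx (s i)" and w: "integrable lborel w"
    and f[measurable]: "f \<in> borel_measurable borel"
    and lim: "\<And>x. (\<lambda>i. s i x) \<longlonglongrightarrow> f x" and dom: "\<And>i x. \<bar>s i x\<bar> \<le> w x"
  shows "hoelder_approx f"
  unfolding hoelder_approx_def
proof (intro conjI allI impI)
  have int_s: "integrable lborel (s i)" for i using s by (simp add: hoelder_approx_def)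
  then have [measurable]: "s i \<in> borel_measurable borel" for i by auto
  have w': "\<bar>f x\<bar> \<le> w x" for x using tendsto_rabs[OF lim[of x]] dom by (auto intro: LIMSEQ_le_const2)
  show int_f: "integrable lborel f"
    by (rule Bochner_Integration.integrable_bound[OF w]) (auto intro!: AE_I2 order_trans[OF w'])
  fix e :: real assume e: "0 < e"
  have "(\<lambda>i. (LBINT x. \<bar>f x - s i x\<bar>)) \<longlonglongrightarrow> (\<integral>x. 0 \<partial>(lborel :: 'a measure))"
  proof (rule integral_dominated_convergence[where w = "\<lambda>x. 2 * w x"])
    show "AE x in lborel. (\<lambda>i. \<bar>f x - s i x\<bar>) \<longlonglongrightarrow> 0"
    proof (rule AE_I2)
      fix x
      show "(\<lambda>i. \<bar>f x - s i x\<bar>) \<longlonglongrightarrow> 0" using tendsto_rabs[OF tendsto_diff[OF tendsto_const[of "f x"] lim[of x]]] by simp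
    qed
    show "AE x in lborel. norm \<bar>f x - s i x\<bar> \<le> 2 * w x" for i
    proof (rule AE_I2)
      fix x
      show "norm \<bar>f x - s i x\<bar> \<le> 2 * w x" using w'[of x] dom[of i x] by simp
    qed
  qed (use w in auto)
  then have "\<forall>\<^sub>F i in sequentially. (LBINT x. \<bar>f x - s i x\<bar>) < e / 2" by (rule order_tendstoD) (use e in simp)
  then obtain i where i: "(LBINT x. \<bar>f x - s i x\<bar>) < e / 2" by (auto simp: eventually_sequentially)
  obtain H R h where h: "hoelder_supp H R h" "(LBINT x. \<bar>s i x - h x\<bar>) < e / 2"
    using s[of i] e unfolding hoelder_approx_def by (meson half_gt_zero)
  have "(LBINT x. \<bar>f x - h x\<bar>) \<le> (LBINT x. \<bar>f x - s i x\<bar> + \<bar>s i x - h x\<bar>)"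
    using int_f int_s hoelder_supp_integrable[OF h(1)] by (intro integral_mono) auto
  also have "\<dots> = (LBINT x. \<bar>f x - s i x\<bar>) + (LBINT x. \<bar>s i x - h x\<bar>)"
    using int_f int_s hoelder_supp_integrable[OF h(1)] by (intro Bochner_Integration.integral_add) auto
  also have "\<dots> < e" using i h(2) by simp
  finally show "\<exists>H R h. hoelder_supp H R h \<and> (LBINT x. \<bar>f x - h x\<bar>) < e" using h(1) by blast
qed

lemma hoelder_approx_add:
  fixes f g :: "'a::euclidean_space \<Rightarrow> real"
  assumes f: "hoelder_approx f" and g: "hoelder_approx g"
  shows "hoelder_approx (\<lambda>x. f x + g x)"
  unfolding hoelder_approx_def
proof (intro conjI allI impI)
  have int: "integrable lborel f" "integrable lborel g" using f g by (auto simp: hoelder_approx_def)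
  then show "integrable lborel (\<lambda>x. f x + g x)" by simp
  fix e :: real assume e: "0 < e"
  obtain H R h where h: "hoelder_supp H R h" "(LBINT x. \<bar>f x - h x\<bar>) < e / 2"
    using f e unfolding hoelder_approx_def by (meson half_gt_zero)
  obtain H' R' h' where h': "hoelder_supp H' R' h'" "(LBINT x. \<bar>g x - h' x\<bar>) < e / 2"
    using g e unfolding hoelder_approx_def by (meson half_gt_zero)
  note int = int hoelder_supp_integrable[OF h(1)] hoelder_supp_integrable[OF h'(1)]
  have "(LBINT x. \<bar>f x + g x - (h x + h' x)\<bar>) \<le> (LBINT x. \<bar>f x - h x\<bar> + \<bar>g x - h' x\<bar>)"
    using int by (intro integral_mono) auto
  also have "\<dots> = (LBINT x. \<bar>f x - h x\<bar>) + (LBINT x. \<bar>g x - h' x\<bar>)"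
    using int by (intro Bochner_Integration.integral_add) auto
  also have "\<dots> < e" using h(2) h'(2) by simp
  finally show "\<exists>H R k. hoelder_supp H R k \<and> (LBINT x. \<bar>f x + g x - k x\<bar>) < e"
    using hoelder_supp_add[OF h(1) h'(1)] by blast
qed

lemma hoelder_approx_cmult:
  fixes f :: "'a::euclidean_space \<Rightarrow> real"
  assumes f: "hoelder_approx f"
  shows "hoelder_approx (\<lambda>x. c * f x)"
  unfolding hoelder_approx_def
proof (intro conjI allI impI)
  have int: "integrable lborel f" using f by (auto simp: hoelder_approx_def)
  then show "integrable lborel (\<lambda>x. c * f x)" by simp
  fix e :: real assume e: "0 < e"
  have "0 < e / (\<bar>c\<bar> + 1)" using e by simp
  then obtain H R h where h: "hoelder_supp H R h" "(LBINT x. \<bar>f x - h x\<bar>) < e / (\<bar>c\<bar> + 1)"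
    using f unfolding hoelder_approx_def by meson
  have "(LBINT x. \<bar>c * f x - c * h x\<bar>) = (LBINT x. \<bar>c\<bar> * \<bar>f x - h x\<bar>)"
    by (intro Bochner_Integration.integral_cong) (auto simp flip: right_diff_distrib abs_mult)
  also have "\<dots> = \<bar>c\<bar> * (LBINT x. \<bar>f x - h x\<bar>)" by simp
  also have "\<dots> \<le> \<bar>c\<bar> * (e / (\<bar>c\<bar> + 1))" using h by (intro mult_left_mono) auto
  also have "\<dots> < e" using e by (simp add: field_simps)
  finally show "\<exists>H R k. hoelder_supp H R k \<and> (LBINT x. \<bar>c * f x - k x\<bar>) < e"
    using hoelder_supp_cmult[OF h(1)] by blast
qed

text \<open>The bump is Lipschitz with constant \<open>m\<close> and takes values in [0, 1]. Hence
  the square of a difference of two values is at most the difference itself, thus at most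
  \<open>m * norm (x - y)\<close>, and this is the Hoelder bound. As \<open>m\<close> is at least 1,
  the bump vanishes at distance 1 from \<open>T\<close>.\<close>

lemma hoelder_supp_bump:
  fixes T :: "'a::euclidean_space set"
  assumes T: "T \<subseteq> cball 0 R" "T \<noteq> {}" and m: "1 \<le> m" and R: "0 \<le> R"
  shows "hoelder_supp (sqrt m) (R + 1) (\<lambda>x. max 0 (1 - m * infdist x T))"
  unfolding hoelder_supp_def
proof (intro conjI allI impI)
  fix x y :: 'a
  define a where "a = \<bar>max 0 (1 - m * infdist x T) - max 0 (1 - m * infdist y T)\<bar>"
  have "a \<le> \<bar>m * infdist x T - m * infdist y T\<bar>" by (auto simp: a_def max_def)
  also have "\<dots> = m * \<bar>infdist x T - infdist y T\<bar>" using m by (simp add: abs_mult flip: right_diff_distrib)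
  also have "\<dots> \<le> m * norm (x - y)"
    using m infdist_triangle_abs[of x T y] by (intro mult_left_mono) (auto simp: dist_norm)
  finally have 1: "a \<le> m * norm (x - y)" .
  have "0 \<le> m * infdist x T" "0 \<le> m * infdist y T" using m infdist_nonneg[of x T] infdist_nonneg[of y T] by simp_all
  then have 2: "0 \<le> a" "a \<le> 1" by (auto simp: a_def max_def)
  have "a * a \<le> a * 1" using 2 by (intro mult_left_mono) auto
  then have "a \<le> sqrt (m * norm (x - y))" using 1 by (intro real_le_rsqrt) (simp add: power2_eq_square)
  then show "\<bar>max 0 (1 - m * infdist x T) - max 0 (1 - m * infdist y T)\<bar> \<le> sqrt m * sqrt (norm (x - y))"
    by (simp add: a_def real_sqrt_mult)
next
  fix x :: 'a assume x: "R + 1 < norm x"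
  have "1 \<le> infdist x T" unfolding infdist_def using T
  proof (simp, intro cINF_greatest)
    fix z assume "z \<in> T"
    then have "norm z \<le> R" using T by auto
    then show "1 \<le> dist x z" using x norm_triangle_ineq2[of x z] by (simp add: dist_norm)
  qed
  then have "1 \<le> m * infdist x T" using m by (metis mult_mono' mult_1 zero_le_one)
  then show "max 0 (1 - m * infdist x T) = 0" by simp
qed (use m R in auto)

lemma hoelder_approx_compact:
  fixes T :: "'a::euclidean_space set"
  assumes T: "compact T"
  shows "hoelder_approx (ind T)"
proof (cases "T = {}")
  case True
  have "hoelder_supp 0 0 (ind {} :: 'a \<Rightarrow> real)" by (simp add: hoelder_supp_def)
  with True show ?thesis by (auto intro: hoelder_approx_supp)
next
  case False
  obtain R where R: "0 < R" "T \<subseteq> cball 0 R"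
  proof -
    obtain b where b: "0 < b" "\<forall>x\<in>T. norm x \<le> b" using compact_imp_bounded[OF T] by (auto simp: bounded_pos)
    then show ?thesis by (intro that[of b]) auto
  qed
  let ?s = "\<lambda>i x. max 0 (1 - real (Suc i) * infdist x T)"
  have bump: "hoelder_supp (sqrt (real (Suc i))) (R + 1) (?s i)" for i using R False by (intro hoelder_supp_bump) auto
  show ?thesis
  proof (rule hoelder_approx_limit[where s = ?s and w = "ind (cball 0 (R + 1))"])
    show "hoelder_approx (?s i)" for i by (rule hoelder_approx_supp[OF bump])
    show "integrable lborel (ind (cball (0::'a) (R + 1)) :: 'a \<Rightarrow> real)"
      using emeasure_lborel_cball_finite[of "0::'a" "R + 1"] by (intro integrable_real_indicator) auto
    show "ind T \<in> borel_measurable borel" using T by (simp add: borel_closed compact_imp_closed)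
    fix x :: 'a
    show "\<bar>?s i x\<bar> \<le> ind (cball 0 (R + 1)) x" for i using hoelder_suppD(4)[OF bump, of x i] infdist_nonneg[of x T]
      by (auto simp: indicator_def not_less max_def)
    show "(\<lambda>i. ?s i x) \<longlonglongrightarrow> ind T x"
    proof (cases "x \<in> T")
      case True
      then show ?thesis by simp
    next
      case x: False
      then have d: "0 < infdist x T" using T False by (simp add: compact_imp_closed infdist_pos_not_in_closed)
      obtain N where "1 / infdist x T < real N" using reals_Archimedean2 by blast
      then have N: "1 < real N * infdist x T" using d by (simp add: field_simps)
      have "\<forall>\<^sub>F i in sequentially. ?s i x = 0" unfolding eventually_sequentially
      proof (intro exI[of _ N] allI impI)
        fix i assume "N \<le> i"
        then have "real N * infdist x T \<le> real (Suc i) * infdist x T" using d by (intro mult_right_mono) auto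
        then show "?s i x = 0" using N by simp
      qed
      then show ?thesis using x by (simp add: tendsto_eventually)
    qed
  qed
qed

text \<open>Inner regularity supplies a closed subset, compact since \<open>S\<close> is bounded,
  and the error in mean is the measure of the difference.\<close>

lemma hoelder_approx_borel_bounded:
  fixes S :: "'a::euclidean_space set"
  assumes S[measurable]: "S \<in> sets borel" and b: "bounded S"
  shows "hoelder_approx (ind S)"
proof -
  have inner: "\<exists>T. compact T \<and> T \<subseteq> S \<and> emeasure lborel (S - T) < ennreal e" if e: "0 < e" for e
  proof -
    obtain T where T: "closed T" "T \<subseteq> S" "emeasure lebesgue (S - T) < ennreal e"
    proof (rule sets_lebesgue_inner_closed)
      show "S \<in> sets lebesgue" using S by simp
    qed (use e in auto)
    moreover have "compact T" using T b by (meson bounded_subset compact_eq_bounded_closed)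
    moreover have "emeasure lebesgue (S - T) = emeasure lborel (S - T)" using T S by (simp add: emeasure_completion)
    ultimately show ?thesis by metis
  qed
  have int: "integrable lborel (ind S :: 'a \<Rightarrow> real)"
    using b emeasure_bounded_finite[OF b] by (intro integrable_real_indicator) auto
  show ?thesis unfolding hoelder_approx_def
  proof (intro conjI allI impI int)
    fix e :: real assume e: "0 < e"
    obtain T where T: "compact T" "T \<subseteq> S" "emeasure lborel (S - T) < ennreal (e / 2)" using inner[of "e / 2"] e
      by auto
    have [measurable]: "T \<in> sets borel" using T by (simp add: borel_closed compact_imp_closed)
    obtain H R h where h: "hoelder_supp H R h" "(LBINT x. \<bar>ind T x - h x\<bar>) < e / 2"
      using hoelder_approx_compact[OF T(1)] e unfolding hoelder_approx_def by (meson half_gt_zero)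
    have intT: "integrable lborel (ind T :: 'a \<Rightarrow> real)"
      using hoelder_approx_compact[OF T(1)] by (simp add: hoelder_approx_def)
    have "(LBINT x. \<bar>indicat_real S x - ind T x\<bar>) = (LBINT x. ind (S - T) x)"
      using T(2) by (intro Bochner_Integration.integral_cong) (auto simp: indicator_def)
    also have "\<dots> < e / 2"
    proof -
      have "emeasure lborel (S - T) = ennreal (measure lborel (S - T))"
        using T(3) by (intro emeasure_eq_ennreal_measure) auto
      then show ?thesis using T(3) by (simp add: ennreal_less_iff)
    qed
    finally have 1: "(LBINT x. \<bar>indicat_real S x - ind T x\<bar>) < e / 2" .
    have "(LBINT x. \<bar>ind S x - h x\<bar>)
        \<le> (LBINT x. \<bar>ind S x - ind T x\<bar> + \<bar>ind T x - h x\<bar>)"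
      using int intT hoelder_supp_integrable[OF h(1)] by (intro integral_mono) auto
    also have "\<dots> = (LBINT x. \<bar>ind S x - ind T x\<bar>) + (LBINT x. \<bar>ind T x - h x\<bar>)"
      using int intT hoelder_supp_integrable[OF h(1)] by (intro Bochner_Integration.integral_add) auto
    also have "\<dots> < e" using 1 h(2) by simp
    finally show "\<exists>H R h. hoelder_supp H R h \<and> (LBINT x. \<bar>ind S x - h x\<bar>) < e" using h(1) by blast
  qed
qed

lemma hoelder_approx_borel:
  fixes S :: "'a::euclidean_space set"
  assumes S[measurable]: "S \<in> sets borel" and fin: "emeasure lborel S < \<infinity>"
  shows "hoelder_approx (ind S)"
proof (rule hoelder_approx_limit[where s = "\<lambda>i. ind (S \<inter> cball 0 (real i))" and w = "ind S"])
  show "hoelder_approx (ind (S \<inter> cball 0 (real i)) :: 'a \<Rightarrow> real)" for i by (intro hoelder_approx_borel_bounded) auto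
  show "integrable lborel (ind S :: 'a \<Rightarrow> real)" using fin by (intro integrable_real_indicator) auto
  fix x :: 'a
  obtain N where N: "norm x < real N" using reals_Archimedean2 by blast
  have "\<forall>\<^sub>F i in sequentially. ind (S \<inter> cball 0 (real i)) x = (ind S x :: real)" unfolding eventually_sequentially
    using N by (intro exI[of _ N]) (auto simp: indicator_def)
  then show "(\<lambda>i. ind (S \<inter> cball 0 (real i)) x :: real) \<longlonglongrightarrow> ind S x" by (rule tendsto_eventually)
qed (auto simp: indicator_def)

lemma integrable_imp_hoelder_approx:
  fixes f :: "'a::euclidean_space \<Rightarrow> real"
  assumes "integrable lborel f"
  shows "hoelder_approx f"
  using assms
proof (induction rule: integrable_induct)
  case (base A c)
  then show ?case using hoelder_approx_cmult[OF hoelder_approx_borel, of A c] by (simp add: mult.commute)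
next
  case (add f g)
  then show ?case by (intro hoelder_approx_add)
next
  case (lim f s)
  then show ?case by (intro hoelder_approx_limit[where s = s and f = f and w = "\<lambda>x. 2 * \<bar>f x\<bar>"]) auto
qed

lemma hoelder_dense:
  fixes f :: "'a::euclidean_space \<Rightarrow> real"
  assumes "integrable lborel f" "0 < e"
  obtains H R h where "hoelder_supp H R h" "(LBINT x. \<bar>f x - h x\<bar>) < e"
  using integrable_imp_hoelder_approx[OF assms(1)] assms(2) unfolding hoelder_approx_def by blast

section \<open>Selection of balls with large averages\<close>

lemma integral_cball_le:
  fixes f :: "'a::euclidean_space \<Rightarrow> real"
  assumes "integrable lborel f" "\<And>x. 0 \<le> f x"
  shows "(LBINT y. ind (cball x r) y * f y) \<le> (LBINT y. f y)"
  using assms integrable_real_mult_indicator[OF _ assms(1), of "cball x r"]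
  by (intro integral_mono) (auto simp: mult.commute[of "ind _ _"] split: split_indicator)

text \<open>For every centre with some ball of mean above \<open>l\<close>, the set
  \<open>big x\<close> of all such radii is bounded because \<open>f\<close> is integrable. A radius
  is chosen that belongs to \<open>big x\<close> while five times it does not. Vitali's covering
  lemma then yields disjoint balls of large mean, whose total volume is controlled by the integral
  of \<open>f\<close>; their fivefold enlargements have mean at most \<open>l\<close> and still
  cover the set where the maximal function exceeds \<open>l\<close>. The index set \<open>I\<close>
  allows for finite and empty families.\<close>

lemma vitali_selection:
  fixes f :: "'a::euclidean_space \<Rightarrow> real"
  assumes f: "integrable lborel f" and nonneg: "\<And>x. 0 \<le> f x" and l: "0 < l"
  obtains c :: "nat \<Rightarrow> 'a" and r :: "nat \<Rightarrow> real" and I :: "nat set" where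
    "\<And>i. i \<in> I \<Longrightarrow> 0 < r i"
    "\<And>i j. i \<in> I \<Longrightarrow> j \<in> I \<Longrightarrow> i \<noteq> j \<Longrightarrow> cball (c i) (r i) \<inter> cball (c j) (r j) = {}"
    "\<And>i. i \<in> I \<Longrightarrow> (LBINT y. ind (cball (c i) (5 * r i)) y * f y) \<le> l * (ball_vol TYPE('a) * (5 * r i) ^ DIM('a))"
    "\<And>x t. 0 < t \<Longrightarrow> l * (ball_vol TYPE('a) * t ^ DIM('a)) < (LBINT y. ind (cball x t) y * f y)
        \<Longrightarrow> x \<in> (\<Union>i\<in>I. cball (c i) (5 * r i))"
    "\<And>s. 0 \<le> s \<Longrightarrow> emeasure lborel (\<Union>i\<in>I. cball (c i) (s * r i)) \<le> ennreal (s ^ DIM('a) * (LBINT y. f y) / l)"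
proof -
  let ?n = "DIM('a)" and ?V = "ball_vol TYPE('a)"
  define F where "F x t = (LBINT y. ind (cball x t) y * f y)" for x t
  define big where "big x = {t. 0 < t \<and> l * (?V * t ^ ?n) < F x t}" for x
  define N where "N = (LBINT y. f y)"
  define S where "S = {x. big x \<noteq> {}}"
  define B where "B = max 1 (N / (l * ?V))"
  have V: "0 < ?V" by simp
  have B: "t \<le> B" if "t \<in> big x" for x t
  proof (cases "t \<le> 1")
    case False
    have "t \<le> t ^ ?n" using False by (intro self_le_power) auto
    moreover have "l * (?V * t ^ ?n) < N"
      using that integral_cball_le[OF f nonneg, of x t] by (auto simp: big_def F_def N_def)
    then have "t ^ ?n < N / (l * ?V)" using l V by (simp add: field_simps)
    ultimately show ?thesis by (simp add: B_def)
  qed (simp add: B_def)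
  have "\<exists>t. t \<in> big x \<and> 5 * t \<notin> big x" if "x \<in> S" for x
  proof -
    have ne: "big x \<noteq> {}" using that by (simp add: S_def)
    have bdd: "bdd_above (big x)" using B by (intro bdd_aboveI)
    obtain t0 where t0: "t0 \<in> big x" using ne by blast
    have "0 < Sup (big x)" using cSup_upper[OF t0 bdd] t0 by (simp add: big_def)
    then have "Sup (big x) / 5 < Sup (big x)" by simp
    \<comment> \<open>Any radius above a fifth of the supremum will do, because five times it
      exceeds the supremum.\<close>
    then obtain t where t: "t \<in> big x" "Sup (big x) / 5 < t" using less_cSupD[OF ne] by blast
    then have "5 * t \<notin> big x" using cSup_upper[OF _ bdd, of "5 * t"] by auto
    with t show ?thesis by blast
  qed
  then obtain rad where rad: "\<And>x. x \<in> S \<Longrightarrow> rad x \<in> big x" "\<And>x. x \<in> S \<Longrightarrow> 5 * rad x \<notin> big x" by metis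
  have "S \<subseteq> (\<Union>x\<in>S. cball x (rad x))" using rad(1) by (force simp: big_def)
  moreover have "\<And>x. x \<in> S \<Longrightarrow> 0 < rad x \<and> rad x \<le> B" using rad(1) B by (auto simp: big_def)
  ultimately obtain C where C: "countable C" "C \<subseteq> S"
    "pairwise (\<lambda>x y. disjnt (cball x (rad x)) (cball y (rad y))) C"
    "S \<subseteq> (\<Union>x\<in>C. cball x (5 * rad x))" by (rule Vitali_covering_lemma_cballs[where a = "\<lambda>x. x" and r = rad]) blast
  define I where "I = to_nat_on C ` C"
  define c where "c = from_nat_into C"
  define r where "r i = rad (c i)" for i
  have cI: "c i \<in> C" if "i \<in> I" for i using that C(1) by (auto simp: I_def c_def)
  have c_inj: "c i \<noteq> c j" if "i \<in> I" "j \<in> I" "i \<noteq> j" for i j using that C(1) by (auto simp: I_def c_def)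
  have c_surj: "\<exists>i\<in>I. c i = x" if "x \<in> C" for x
    using that C(1) by (intro bexI[of _ "to_nat_on C x"]) (auto simp: I_def c_def)
  have disj: "cball (c i) (r i) \<inter> cball (c j) (r j) = {}" if "i \<in> I" "j \<in> I" "i \<noteq> j" for i j
    using C(3) cI[OF that(1)] cI[OF that(2)] c_inj[OF that] by (auto simp: pairwise_def disjnt_def r_def)
  have big: "r i \<in> big (c i)" "5 * r i \<notin> big (c i)" if "i \<in> I" for i using rad cI[OF that] C(2) by (auto simp: r_def)
  show thesis
  proof (rule that)
    show "0 < r i" if "i \<in> I" for i using big[OF that] by (simp add: big_def)
    then show "(LBINT y. ind (cball (c i) (5 * r i)) y * f y) \<le> l * (?V * (5 * r i) ^ ?n)" if "i \<in> I" for i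
      using big[OF that] that by (auto simp: big_def F_def not_less)
    show "x \<in> (\<Union>i\<in>I. cball (c i) (5 * r i))"
      if "0 < t" "l * (?V * t ^ ?n) < (LBINT y. ind (cball x t) y * f y)" for x t
    proof -
      have "x \<in> S" using that by (auto simp: S_def big_def F_def)
      then obtain y where "y \<in> C" "x \<in> cball y (5 * rad y)" using C(4) by blast
      then show ?thesis using c_surj[of y] by (auto simp: r_def)
    qed
    fix s :: real assume s: "0 \<le> s"
    define Q where "Q t i = (if i \<in> I then cball (c i) (t * r i) else {})" for t i
    have "emeasure lborel (\<Union>i\<in>I. cball (c i) (s * r i)) = emeasure lborel (\<Union>i. Q s i)"
      by (intro arg_cong[where f = "emeasure lborel"]) (auto simp: Q_def split: if_splits)
    also have "\<dots> \<le> (\<Sum>i. emeasure lborel (Q s i))" by (intro emeasure_subadditive_countably) (auto simp: Q_def)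
    also have "\<dots> \<le> (\<Sum>i. ennreal (s ^ ?n / l) * (LBNN y. ennreal (f y) * ind (Q 1 i) y))"
    proof (intro suminf_le)
      fix i
      show "emeasure lborel (Q s i) \<le> ennreal (s ^ ?n / l) * (LBNN y. ennreal (f y) * ind (Q 1 i) y)"
      proof (cases "i \<in> I")
        case True
        have pos: "0 < r i" using big[OF True] by (simp add: big_def)
        have "(LBNN y. ennreal (f y) * ind (Q 1 i) y)
          = (LBNN y. ennreal (ind (cball (c i) (r i)) y * f y))"
          using True by (intro nn_integral_cong) (auto simp: Q_def indicator_def)
        also have "\<dots> = ennreal (F (c i) (r i))" unfolding F_def using f nonneg
          by (intro nn_integral_eq_integral) (auto simp: integrable_real_mult_indicator mult.commute[of "ind _ _"])
        finally have eq: "(LBNN y. ennreal (f y) * ind (Q 1 i) y) = ennreal (F (c i) (r i))" .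
        have "?V * (s * r i) ^ ?n = s ^ ?n / l * (l * (?V * r i ^ ?n))" using l by (simp add: power_mult_distrib)
        also have "\<dots> \<le> s ^ ?n / l * F (c i) (r i)"
          using big[OF True] l s by (intro mult_left_mono) (auto simp: big_def)
        finally have "ennreal (?V * (s * r i) ^ ?n) \<le> ennreal (s ^ ?n / l) * ennreal (F (c i) (r i))"
          using l s by (subst ennreal_mult'[symmetric]) (auto intro: ennreal_leI)
        then show ?thesis using True eq s pos by (simp add: Q_def emeasure_cball)
      qed (simp add: Q_def)
    qed auto
    also have "\<dots> = ennreal (s ^ ?n / l) * (LBNN y. (\<Sum>i. ennreal (f y) * ind (Q 1 i) y))"
      using f by (subst nn_integral_suminf) (auto simp: Q_def)
    also have "(LBNN y. (\<Sum>i. ennreal (f y) * ind (Q 1 i) y)) \<le> (LBNN y. ennreal (f y))"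
    proof (intro nn_integral_mono)
      fix y
      have "disjoint_family (Q 1)" using disj by (auto simp: disjoint_family_on_def Q_def)
      then have "(\<Sum>i. ind (Q 1 i) y :: ennreal) = ind (\<Union>i. Q 1 i) y" by (rule suminf_indicator)
      then show "(\<Sum>i. ennreal (f y) * ind (Q 1 i) y) \<le> ennreal (f y)" by (simp add: indicator_def)
    qed
    also have "\<dots> = ennreal N" unfolding N_def using f nonneg by (intro nn_integral_eq_integral) auto
    also have "ennreal (s ^ ?n / l) * ennreal N = ennreal (s ^ ?n * (LBINT y. f y) / l)"
      using l s by (subst ennreal_mult'[symmetric]) (auto simp: N_def)
    finally show "emeasure lborel (\<Union>i\<in>I. cball (c i) (s * r i)) \<le> ennreal (s ^ ?n * (LBINT y. f y) / l)"
      by (simp add: mult_left_mono)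
  qed (use disj in auto)
qed

section \<open>Truncated singular integrals\<close>

text \<open>Open inside and closed outside, so that consecutive annuli fit together exactly in
  \<open>ctrunc_split\<close>. The open annuli of \<open>CZ_kernel\<close> differ from these by a
  null sphere, see \<open>ctrunc_integral_eq\<close>.\<close>

definition ann :: "real \<Rightarrow> real \<Rightarrow> 'a::euclidean_space set" where
  "ann a b = {x. a < norm x \<and> norm x \<le> b}"

definition ctrunc :: "('a::euclidean_space \<Rightarrow> real) \<Rightarrow> real \<Rightarrow> real \<Rightarrow> 'a \<Rightarrow> real" where
  "ctrunc K a b x = ind (ann a b) x * K x"

text \<open>With both truncations the kernel is bounded and integrable, so the operator is defined
  everywhere on integrable functions and bounded by a multiple of their L^1 norm. That crude bound
  depends on \<open>a\<close> and serves only for limits and for finiteness.\<close>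

definition cop :: "('a::euclidean_space \<Rightarrow> real) \<Rightarrow> real \<Rightarrow> real \<Rightarrow> ('a \<Rightarrow> real) \<Rightarrow> 'a \<Rightarrow> real" where
  "cop K a b f x = (LBINT y. ctrunc K a b (x - y) * f y)"

lemma nn_integral_add3:
  assumes "f \<in> borel_measurable M" "g \<in> borel_measurable M" "h \<in> borel_measurable M"
  shows "(\<integral>\<^sup>+x. f x + g x + h x \<partial>M) = (\<integral>\<^sup>+x. f x \<partial>M) + (\<integral>\<^sup>+x. g x \<partial>M) + (\<integral>\<^sup>+x. h x \<partial>M)"
  using assms by (simp add: nn_integral_add)

lemma ann_borel [measurable]: "ann a b \<in> sets borel"
  unfolding ann_def by measurable

text \<open>Pointwise Calderon-Zygmund conditions. They are extracted from \<open>CZ_kernel\<close>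
  in \<open>CZ_kernel_cz_pv\<close>; in particular \<open>size\<close> comes from averaging the
  integral bound with the help of \<open>smooth\<close>. A single constant \<open>A\<close> serves
  all three.\<close>

locale cz =
  fixes K :: "'a::euclidean_space \<Rightarrow> real" and A :: real
  assumes A_pos: "0 < A"
    and K_borel [measurable]: "K \<in> borel_measurable borel"
    and size: "x \<noteq> 0 \<Longrightarrow> \<bar>K x\<bar> \<le> A / norm x ^ DIM('a)"
    and smooth: "3 * norm y < norm x \<Longrightarrow> \<bar>K x - K (x - y)\<bar> \<le> A * norm y / norm x ^ (DIM('a) + 1)"
    and cancel: "0 < a \<Longrightarrow> a < b \<Longrightarrow> \<bar>(LBINT x. ctrunc K a b x)\<bar> \<le> A"
begin

lemma ctrunc_borel [measurable]: "ctrunc K a b \<in> borel_measurable borel"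
  unfolding ctrunc_def[abs_def] by measurable

lemma ctrunc_bound:
  assumes "0 < a"
  shows "\<bar>ctrunc K a b x\<bar> \<le> A / a ^ DIM('a)"
proof (cases "x \<in> ann a b")
  case True
  then have x: "a < norm x" "x \<noteq> 0" using assms by (auto simp: ann_def)
  have "\<bar>K x\<bar> \<le> A / norm x ^ DIM('a)" using size x by blast
  also have "\<dots> \<le> A / a ^ DIM('a)" using x assms A_pos by (intro divide_left_mono power_mono mult_pos_pos) auto
  finally show ?thesis using True by (simp add: ctrunc_def)
next
  case False
  then show ?thesis using A_pos assms by (simp add: ctrunc_def)
qed

lemma ctrunc_mult_bound:
  assumes "0 < a"
  shows "\<bar>ctrunc K a b x * c\<bar> \<le> A / a ^ DIM('a) * \<bar>c\<bar>"
  using ctrunc_bound[OF assms] by (simp add: abs_mult mult_right_mono del: times_divide_eq_left)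

lemma ctrunc_eq_0: "b < norm x \<Longrightarrow> ctrunc K a b x = 0"
  by (simp add: ctrunc_def ann_def)

lemma ctrunc_integrable: "0 < a \<Longrightarrow> integrable lborel (ctrunc K a b)"
  by (rule integrable_bounded_supp[where B = "A / a ^ DIM('a)" and R = b])
     (auto simp: ctrunc_bound ctrunc_eq_0)

lemma ctrunc_split:
  "a \<le> c \<Longrightarrow> c \<le> b \<Longrightarrow> ctrunc K a b x = ctrunc K a c x + ctrunc K c b x" by (auto simp: ctrunc_def ann_def indicator_def)

text \<open>The transpose of \<open>cop K a b\<close> has the reflected kernel, see
  \<open>cop_duality\<close>. Invariance of the locale under reflection makes every estimate
  available for the transpose as well.\<close>

lemma cz_reflect: "cz (\<lambda>x. K (- x)) A"
proof
  show "\<bar>K (- x)\<bar> \<le> A / norm x ^ DIM('a)" if "x \<noteq> 0" for x using size[of "- x"] that by simp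
  show "\<bar>K (- x) - K (- (x - y))\<bar> \<le> A * norm y / norm x ^ (DIM('a) + 1)" if "3 * norm y < norm x" for x y
    using smooth[of "- y" "- x"] that by simp
  show "\<bar>(LBINT x. ctrunc (\<lambda>x. K (- x)) a b x)\<bar> \<le> A" if "0 < a" "a < b" for a b
  proof -
    have "(LBINT x. ctrunc (\<lambda>x. K (- x)) a b x) = (LBINT x. ctrunc K a b (0 - x))"
      by (intro Bochner_Integration.integral_cong) (auto simp: ctrunc_def ann_def indicator_def)
    also have "\<dots> = (LBINT x. ctrunc K a b x)" by (intro lebesgue_integral_lborel_reflect) simp
    finally show ?thesis using cancel that by simp
  qed
qed (use A_pos in auto)

lemma cop_integrable:
  assumes a: "0 < a" and f: "integrable lborel f"
  shows "integrable lborel (\<lambda>y. ctrunc K a b (x - y) * f y)"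
proof (rule Bochner_Integration.integrable_bound)
  show "integrable lborel (\<lambda>y. A / a ^ DIM('a) * f y)" using f by simp
  show "AE y in lborel. norm (ctrunc K a b (x - y) * f y) \<le> norm (A / a ^ DIM('a) * f y)"
    using ctrunc_mult_bound[OF a, of b] A_pos a by (intro AE_I2) (simp add: abs_mult)
qed (use f in auto)

lemma cop_bound:
  assumes a: "0 < a" and f: "integrable lborel f"
  shows "\<bar>cop K a b f x\<bar> \<le> A / a ^ DIM('a) * L1 f"
proof -
  have "\<bar>cop K a b f x\<bar> \<le> (LBINT y. \<bar>ctrunc K a b (x - y) * f y\<bar>)" unfolding cop_def by (rule integral_abs_bound)
  also have "\<dots> \<le> (LBINT y. A / a ^ DIM('a) * \<bar>f y\<bar>)"
    using ctrunc_mult_bound[OF a, of b] cop_integrable[OF a f, of b x] f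
    by (intro integral_mono integrable_abs integrable_mult_right) auto
  finally show ?thesis by simp
qed

lemma cop_borel [measurable]:
  assumes [measurable]: "f \<in> borel_measurable borel"
  shows "cop K a b f \<in> borel_measurable borel"
proof -
  have "(\<lambda>x. (LBINT y. ctrunc K a b (x - y) * f y)) \<in> borel_measurable lborel"
    by (rule lborel.borel_measurable_lebesgue_integral) measurable
  then show ?thesis by (simp add: cop_def[abs_def])
qed

lemma cop_diff:
  assumes "0 < a" "integrable lborel f" "integrable lborel g"
  shows "cop K a b (\<lambda>y. f y - g y) x = cop K a b f x - cop K a b g x"
  unfolding cop_def right_diff_distrib by (intro Bochner_Integration.integral_diff cop_integrable assms)

lemma cop_conv:
  assumes [measurable]: "f \<in> borel_measurable borel"
  shows "cop K a b f x = (LBINT y. ctrunc K a b y * f (x - y))"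
proof -
  have "cop K a b f x = (LBINT y. ctrunc K a b (x - y) * f (x - (x - y)))" by (simp add: cop_def)
  also have "\<dots> = (LBINT y. ctrunc K a b y * f (x - y))"
    by (intro lebesgue_integral_lborel_reflect[of "\<lambda>y. ctrunc K a b y * f (x - y)"]) measurable
  finally show ?thesis .
qed

text \<open>If both points lie in the annulus, \<open>smooth\<close> gives the first term. If
  exactly one does, then \<open>u\<close> is within \<open>h\<close> of one of the two boundary
  spheres, and the difference is a single kernel value. The last two terms account for these
  layers.\<close>

lemma ctrunc_diff_pointwise:
  assumes h: "0 < h" "norm v \<le> h" "3 * h \<le> a" and ab: "a < b" and q: "0 \<le> q" "q \<le> 1"
  defines "D \<equiv> \<lambda>c. 2 * A * 3 ^ DIM('a) * (c powr q / c ^ DIM('a))"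
  shows "\<bar>ctrunc K a b u - ctrunc K a b (u - v)\<bar> * norm u powr q
    \<le> A * h * (norm u powr (- real DIM('a) - (1 - q)) * ind {u. 2 * h < norm (u - 0)} u)
      + D a * ind {u. a - h \<le> norm u \<and> norm u \<le> a + h} u
      + D b * ind {u. b - h \<le> norm u \<and> norm u \<le> b + h} u"
    (is "?L \<le> ?F + ?A + ?B")
proof -
  let ?n = "DIM('a)"
  have F: "0 \<le> ?F" using A_pos h by auto
  have D: "0 \<le> D c" if "0 \<le> c" for c using A_pos that by (simp add: D_def)
  have tri: "norm u - h \<le> norm (u - v)" "norm (u - v) - h \<le> norm u"
    using norm_triangle_ineq2[of u v] norm_triangle_ineq4[of u v] h by linarith+
  \<comment> \<open>In a layer around radius c the argument of the kernel has norm at least c / 3,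
    which costs 3^n by \<open>size\<close>, and \<open>u\<close> has norm at most 2 c, which costs
    at most 2 because \<open>q \<le> 1\<close>. This explains \<open>D\<close>.\<close>
  have layer: "\<bar>K w\<bar> * norm u powr q \<le> D c"
    if c: "3 * h \<le> c" "c - h \<le> norm u" "norm u \<le> c + h" and w: "norm u - h \<le> norm w" for c w
  proof -
    have w3: "c / 3 \<le> norm w" "0 < c" using c w h by auto
    then have "w \<noteq> 0" by auto
    then have "\<bar>K w\<bar> \<le> A / norm w ^ ?n" by (rule size)
    also have "\<dots> \<le> A / (c / 3) ^ ?n"
      using w3 A_pos by (intro divide_left_mono power_mono mult_pos_pos zero_less_power) auto
    finally have 1: "\<bar>K w\<bar> \<le> A * 3 ^ ?n / c ^ ?n" by (simp add: power_divide)
    have "norm u powr q \<le> (2 * c) powr q" using c h q by (intro powr_mono2) auto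
    also have "\<dots> \<le> 2 * c powr q" using w3 q powr_mono[of q 1 2] by (simp add: powr_mult)
    finally have "\<bar>K w\<bar> * norm u powr q \<le> (A * 3 ^ ?n / c ^ ?n) * (2 * c powr q)"
      using 1 A_pos w3 by (intro mult_mono) auto
    then show ?thesis by (simp add: D_def mult_ac)
  qed
  consider "u \<in> ann a b" "u - v \<in> ann a b" | "u \<notin> ann a b" "u - v \<notin> ann a b"
    | "u \<in> ann a b" "u - v \<notin> ann a b" | "u \<notin> ann a b" "u - v \<in> ann a b" by blast
  then show ?thesis
  proof cases
    case 1
    then have b: "0 \<le> b" and u: "a < norm u" using h by (auto simp: ann_def)
    have "3 * norm v < norm u" using h u by linarith
    then have "\<bar>K u - K (u - v)\<bar> \<le> A * norm v / norm u ^ (?n + 1)" by (rule smooth)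
    also have "\<dots> \<le> A * h / norm u ^ (?n + 1)" using A_pos h by (intro divide_right_mono mult_left_mono) auto
    finally have "\<bar>K u - K (u - v)\<bar> * norm u powr q \<le> A * h / norm u ^ (?n + 1) * norm u powr q"
      by (intro mult_right_mono) auto
    also have "\<dots> = A * h * norm u powr (- real ?n - (1 - q))"
    proof -
      have "norm u powr (- real ?n - (1 - q)) = norm u powr (q - real (?n + 1))" by (simp add: algebra_simps)
      also have "\<dots> = norm u powr q / norm u ^ (?n + 1)"
      proof -
        have "norm u powr real (?n + 1) = norm u ^ (?n + 1)" using u h by (intro powr_realpow) auto
        then show ?thesis by (simp only: powr_diff)
      qed
      finally show ?thesis by simp
    qed
    finally have "?L \<le> ?F" using 1 u h by (simp add: ctrunc_def)
    moreover have "0 \<le> ?A" "0 \<le> ?B" using D b h by auto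
    ultimately show ?thesis by linarith
  next
    case 2
    moreover have "0 \<le> ?A" "0 \<le> ?B" using D h ab by auto
    ultimately show ?thesis using F by (simp add: ctrunc_def)
  next
    case 3
    then have b: "0 \<le> b" "a \<le> b" "3 * h \<le> b" and u: "a < norm u" "norm u \<le> b" using h by (auto simp: ann_def)
    have AB: "0 \<le> ?A" "0 \<le> ?B" using D b h by auto
    have L: "?L = \<bar>K u\<bar> * norm u powr q" using 3 by (simp add: ctrunc_def)
    have "norm (u - v) \<le> a \<or> b < norm (u - v)" using 3 by (auto simp: ann_def)
    then show ?thesis
    proof
      assume "norm (u - v) \<le> a"
      then have "\<bar>K u\<bar> * norm u powr q \<le> D a" "a - h \<le> norm u" "norm u \<le> a + h" using u tri h by (auto intro!: layer)
      then show ?thesis unfolding L using F AB by simp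
    next
      assume "b < norm (u - v)"
      then have "\<bar>K u\<bar> * norm u powr q \<le> D b" "b - h \<le> norm u" "norm u \<le> b + h"
        using u tri h b by (auto intro!: layer)
      then show ?thesis unfolding L using F AB by simp
    qed
  next
    case 4
    then have b: "0 \<le> b" "a \<le> b" "3 * h \<le> b" and u: "a < norm (u - v)" "norm (u - v) \<le> b"
      using h by (auto simp: ann_def)
    have AB: "0 \<le> ?A" "0 \<le> ?B" using D b h by auto
    have L: "?L = \<bar>K (u - v)\<bar> * norm u powr q" using 4 by (simp add: ctrunc_def)
    have "norm u \<le> a \<or> b < norm u" using 4 by (auto simp: ann_def)
    then show ?thesis
    proof
      assume "norm u \<le> a"
      then have "\<bar>K (u - v)\<bar> * norm u powr q \<le> D a" "a - h \<le> norm u" "norm u \<le> a + h"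
        using u tri h by (auto intro!: layer)
      then show ?thesis unfolding L using F AB by simp
    next
      assume "b < norm u"
      then have "\<bar>K (u - v)\<bar> * norm u powr q \<le> D b" "b - h \<le> norm u" "norm u \<le> b + h"
        using u tri h b by (auto intro!: layer)
      then show ?thesis unfolding L using F AB by simp
    qed
  qed
qed

text \<open>Hoermander's condition with a power weight, uniform in the truncation. The smooth term
  decays like |u|^(-n-(1-s)), integrable at infinity since s < 1. A layer at radius c has volume of
  order h c^(n-1) and integrand of order c^(s-n), and c^(s-1) is at most h^(s-1). The case s = 0
  serves for atoms, the case s = 1/2 for Hoelder continuity.\<close>

lemma ctrunc_diff_integral:
  assumes s: "0 \<le> s" "s < 1"
  obtains C where "0 < C" "\<And>a b h v. 0 < h \<Longrightarrow> norm v \<le> h \<Longrightarrow> 3 * h \<le> a \<Longrightarrow>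
    (LBNN u. ennreal (\<bar>ctrunc K a b u - ctrunc K a b (u - v)\<bar> * norm u powr s)) \<le> ennreal (C * h powr s)"
proof -
  let ?n = "DIM('a)" and ?V = "ball_vol TYPE('a)"
  define z where "z = 1 - s"
  have z: "0 < z" using s by (simp add: z_def)
  have q: "2 powr (-z) < (1::real)" using z by (simp add: powr_less_one)
  define D where "D c = 2 * A * 3 ^ DIM('a) * (c powr s / c ^ DIM('a))" for c
  define C1 where "C1 = A * ?V * 2 ^ ?n / (1 - 2 powr (-z))"
  define C2 where "C2 = 2 * A * 3 ^ ?n * ?V * (2 ^ ?n + ?n)"
  have C: "0 < C1" "0 < C2"
    using A_pos q by (auto simp: C1_def C2_def intro!: mult_pos_pos divide_pos_pos add_pos_nonneg)
  have layer: "(LBNN u. ennreal (D c * ind {u::'a. c - h \<le> norm u \<and> norm u \<le> c + h} u)) \<le> ennreal (C2 * h powr s)"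
    if "0 < h" "3 * h \<le> c" for c h
  proof -
    have c: "0 < c" "h \<le> c" using that by auto
    have "(LBNN u. ennreal (D c * ind {u::'a. c - h \<le> norm u \<and> norm u \<le> c + h} u))
      = ennreal (D c) * emeasure lborel {u::'a. c - h \<le> norm u \<and> norm u \<le> c + h}"
      using c A_pos by (subst nn_integral_cmult_indicator[symmetric])
         (auto intro!: nn_integral_cong simp: D_def indicator_def)
    also have "\<dots> \<le> ennreal (D c) * ennreal (?V * (2 ^ ?n + ?n) * (h * c ^ ?n / c))"
      using that c by (intro mult_left_mono emeasure_layer_le) auto
    also have "\<dots> = ennreal (D c * (?V * (2 ^ ?n + ?n) * (h * c ^ ?n / c)))"
      using c A_pos that by (intro ennreal_mult[symmetric]) (auto simp: D_def)
    also have "D c * (?V * (2 ^ ?n + ?n) * (h * c ^ ?n / c)) = C2 * (h * (c powr s / c)) * (c ^ ?n / c ^ ?n)"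
      by (simp add: D_def C2_def)
    also have "\<dots> = C2 * (h * (c powr s / c))" using c by simp
    also have "c powr s / c = c powr (-z)" using c by (simp add: z_def powr_diff)
    also have "C2 * (h * c powr (-z)) \<le> C2 * (h * h powr (-z))"
      using c that C z by (intro mult_left_mono powr_mono2') auto
    also have "h * h powr (-z) = h powr s" using that by (simp add: z_def powr_diff)
    finally show ?thesis by (simp add: ennreal_leI)
  qed
  show thesis
  proof
    show "0 < C1 + 2 * C2" using C by simp
    fix a b h :: real and v :: 'a
    assume h: "0 < h" "norm v \<le> h" "3 * h \<le> a"
    let ?L = "\<lambda>u. \<bar>ctrunc K a b u - ctrunc K a b (u - v)\<bar> * norm u powr s"
    show "(LBNN u. ennreal (?L u)) \<le> ennreal ((C1 + 2 * C2) * h powr s)"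
    proof (cases "a < b")
      case False
      then have "ctrunc K a b u = 0" for u by (auto simp: ctrunc_def ann_def)
      then show ?thesis by simp
    next
      case True
      let ?F = "\<lambda>u::'a. A * h * (norm u powr (- real ?n - z) * ind {u. 2 * h < norm (u - 0)} u)"
      let ?A = "\<lambda>u. D a * ind {u::'a. a - h \<le> norm u \<and> norm u \<le> a + h} u"
      let ?B = "\<lambda>u. D b * ind {u::'a. b - h \<le> norm u \<and> norm u \<le> b + h} u"
      have nonneg: "0 \<le> ?F u" "0 \<le> ?A u" "0 \<le> ?B u" for u using A_pos h True by (auto simp: D_def)
      have "(LBNN u. ennreal (?L u)) \<le> (LBNN u. ennreal (?F u) + ennreal (?A u) + ennreal (?B u))"
      proof (intro nn_integral_mono)
        fix u
        have "?L u \<le> ?F u + ?A u + ?B u" unfolding D_def z_def using h s True by (intro ctrunc_diff_pointwise) auto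
        then show "ennreal (?L u) \<le> ennreal (?F u) + ennreal (?A u) + ennreal (?B u)"
          using nonneg by (simp flip: ennreal_plus add: ennreal_leI)
      qed
      also have "\<dots> = (LBNN u. ennreal (?F u)) + (LBNN u. ennreal (?A u)) + (LBNN u. ennreal (?B u))"
        by (rule nn_integral_add3[of "\<lambda>u. ennreal (?F u)" _ "\<lambda>u. ennreal (?A u)" "\<lambda>u. ennreal (?B u)"]) measurable
      also have "(LBNN u. ennreal (?F u))
          = ennreal (A * h) * (LBNN u. 1 * ennreal (norm (u - 0) powr (- real ?n - z)) * ind {u::'a. 2 * h < norm (u - 0)} u)"
        using A_pos h by (subst nn_integral_cmult[symmetric], measurable)
          (auto intro!: nn_integral_cong simp: ennreal_mult indicator_def)
      also have "\<dots> \<le> ennreal (A * h) * (ennreal ?V * ennreal (2 ^ ?n * (2 * h) powr (-z) / (1 - 2 powr (-z))))"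
        using h z by (intro mult_left_mono nn_integral_far_le)
          (auto simp: emeasure_cball ennreal_mult)
      also have "\<dots> = ennreal (C1 * (h * (2 * h) powr (-z)))" using A_pos h q by (simp add: C1_def flip: ennreal_mult)
      also have "\<dots> \<le> ennreal (C1 * h powr s)"
      proof (intro ennreal_leI mult_left_mono)
        have "h * (2 * h) powr (-z) \<le> h * h powr (-z)" using h z by (intro mult_left_mono powr_mono2') auto
        also have "\<dots> = h powr s" using h by (simp add: z_def powr_diff)
        finally show "h * (2 * h) powr (-z) \<le> h powr s" .
      qed (use C in auto)
      finally have "(LBNN u. ennreal (?L u)) \<le> ennreal (C1 * h powr s) + ennreal (C2 * h powr s) + ennreal (C2 * h powr s)"
        using layer[of h a] layer[of h b] h True by (auto intro: add_mono order_trans)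
      also have "\<dots> = ennreal (C1 * h powr s + C2 * h powr s + C2 * h powr s)" using C by (simp flip: ennreal_plus)
      also have "C1 * h powr s + C2 * h powr s + C2 * h powr s = (C1 + 2 * C2) * h powr s"
        by (simp add: algebra_simps)
      finally show ?thesis .
    qed
  qed
qed

end

section \<open>Boundedness on Hoelder spaces and on $L^2$\<close>

context cz
begin

lemma ctrunc_sqrt_integral:
  obtains C where "0 < C"
    "\<And>a c r. 0 < a \<Longrightarrow> c \<le> r \<Longrightarrow> 0 < r \<Longrightarrow>
      (LBNN y. ennreal (\<bar>ctrunc K a c y\<bar> * sqrt (norm y))) \<le> ennreal (C * sqrt r)"
proof -
  let ?n = "DIM('a)" and ?V = "ball_vol TYPE('a)"
  have q: "2 powr (-(1/2)) < (1::real)" by (simp add: powr_less_one)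
  define C where "C = A * (?V * 2 ^ ?n / (1 - 2 powr (-(1/2))))"
  show thesis
  proof
    show "0 < C" using A_pos q by (auto simp: C_def intro!: mult_pos_pos divide_pos_pos)
    fix a c r :: real assume a: "0 < a" and c: "c \<le> r" and r: "0 < r"
    have "(LBNN y. ennreal (\<bar>ctrunc K a c y\<bar> * sqrt (norm y)))
      \<le> (LBNN y. ennreal A * (ennreal (norm (y - 0) powr (1/2 - real ?n)) * ind (cball (0::'a) r) y))"
    proof (intro nn_integral_mono)
      fix y
      show "ennreal (\<bar>ctrunc K a c y\<bar> * sqrt (norm y))
        \<le> ennreal A * (ennreal (norm (y - 0) powr (1/2 - real ?n)) * ind (cball 0 r) y)"
      proof (cases "y \<in> ann a c")
        case True
        then have y: "0 < norm y" "norm y \<le> r" using a c by (auto simp: ann_def)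
        then have "\<bar>K y\<bar> * sqrt (norm y) \<le> A / norm y ^ ?n * sqrt (norm y)"
          using size[of y] by (intro mult_right_mono) auto
        also have "\<dots> = A * norm y powr (1/2 - real ?n)" using y by (simp add: powr_diff powr_half_sqrt powr_realpow)
        finally show ?thesis using True y A_pos by (simp add: ctrunc_def ennreal_leI flip: ennreal_mult)
      qed (simp add: ctrunc_def)
    qed
    also have "\<dots> = ennreal A * (LBNN y. ennreal (norm (y - 0) powr (1/2 - real ?n)) * ind (cball (0::'a) r) y)"
      by (intro nn_integral_cmult) measurable
    also have "\<dots> \<le> ennreal A * ennreal (?V * 2 ^ ?n * r powr (1/2) / (1 - 2 powr (-(1/2))))"
      using r by (intro mult_left_mono nn_integral_near_le) auto
    also have "\<dots> = ennreal (C * sqrt r)" using A_pos q r by (simp add: C_def powr_half_sqrt flip: ennreal_mult)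
    finally show "(LBNN y. ennreal (\<bar>ctrunc K a c y\<bar> * sqrt (norm y))) \<le> ennreal (C * sqrt r)" .
  qed
qed

text \<open>At scales up to a multiple of the distance of \<open>x\<close> and \<open>x'\<close> the
  two values are estimated separately: after subtracting \<open>f x\<close> and \<open>f x'\<close>
  the Hoelder condition makes the kernel integrable at 0, and the subtracted constants meet the
  integral of the kernel, which \<open>cancel\<close> bounds.\<close>

lemma cop_hoelder_near:
  obtains C where "0 < C"
    "\<And>a c H R f x x'. 0 < a \<Longrightarrow> a < c \<Longrightarrow> c \<le> 3 * norm (x - x') \<Longrightarrow> hoelder_supp H R f \<Longrightarrow>
      \<bar>cop K a c f x - cop K a c f x'\<bar> \<le> C * H * sqrt (norm (x - x'))"
proof -
  obtain C where C: "0 < C" "\<And>a c r. 0 < a \<Longrightarrow> c \<le> r \<Longrightarrow> 0 < r \<Longrightarrow>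
      (LBNN y. ennreal (\<bar>ctrunc K a c y\<bar> * sqrt (norm y))) \<le> ennreal (C * sqrt r)" using ctrunc_sqrt_integral by blast
  show thesis
  proof
    show "0 < 2 * C * sqrt 3 + A" using C A_pos by (simp add: add_pos_pos)
    fix a c H R :: real and f :: "'a \<Rightarrow> real" and x x' :: 'a
    assume a: "0 < a" and ac: "a < c" and c: "c \<le> 3 * norm (x - x')" and f: "hoelder_supp H R f"
    have [measurable]: "f \<in> borel_measurable borel" by (rule hoelder_supp_borel[OF f])
    have H: "0 \<le> H" by (rule hoelder_suppD[OF f])
    let ?k = "ctrunc K a c"
    have int_k: "integrable lborel ?k" by (rule ctrunc_integrable[OF a])
    have int_kf: "integrable lborel (\<lambda>y. ?k y * f (z - y))" for z
      using integrable_lborel_reflect[OF cop_integrable[OF a hoelder_supp_integrable[OF f], of c z], of z] by simp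
    define g where "g y = (f (x - y) - f x) - (f (x' - y) - f x')" for y
    have "integrable lborel (\<lambda>y. (?k y * f (x - y) - ?k y * f x) - (?k y * f (x' - y) - ?k y * f x'))"
      using int_k int_kf by (intro Bochner_Integration.integrable_diff integrable_mult_left)
    then have int_g: "integrable lborel (\<lambda>y. ?k y * g y)" by (simp add: g_def algebra_simps)
    have "cop K a c f x - cop K a c f x' = (LBINT y. ?k y * f (x - y) - ?k y * f (x' - y))"
      using int_kf by (simp add: cop_conv)
    also have "\<dots> = (LBINT y. ?k y * g y + (f x - f x') * ?k y)"
      by (intro Bochner_Integration.integral_cong) (auto simp: g_def algebra_simps)
    also have "\<dots> = (LBINT y. ?k y * g y) + (f x - f x') * (LBINT y. ?k y)" using int_g int_k by simp
    finally have eq: "cop K a c f x - cop K a c f x' = (LBINT y. ?k y * g y) + (f x - f x') * (LBINT y. ?k y)" .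
    have g: "\<bar>g y\<bar> \<le> 2 * H * sqrt (norm y)" for y
      using hoelder_suppD(3)[OF f, of "x - y" x] hoelder_suppD(3)[OF f, of "x' - y" x'] by (simp add: g_def)
    have "ennreal \<bar>(LBINT y. ?k y * g y)\<bar> \<le> (LBNN y. ennreal \<bar>?k y * g y\<bar>)"
      using integral_norm_bound_ennreal[OF int_g] by simp
    also have "\<dots> \<le> (LBNN y. ennreal (2 * H) * ennreal (\<bar>?k y\<bar> * sqrt (norm y)))"
    proof (intro nn_integral_mono)
      fix y
      have "\<bar>?k y * g y\<bar> \<le> \<bar>?k y\<bar> * (2 * H * sqrt (norm y))" unfolding abs_mult by (intro mult_left_mono g) auto
      then show "ennreal \<bar>?k y * g y\<bar> \<le> ennreal (2 * H) * ennreal (\<bar>?k y\<bar> * sqrt (norm y))"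
        using H by (simp flip: ennreal_mult add: ennreal_leI mult_ac)
    qed
    also have "\<dots> = ennreal (2 * H) * (LBNN y. ennreal (\<bar>?k y\<bar> * sqrt (norm y)))"
      by (intro nn_integral_cmult) measurable
    also have "\<dots> \<le> ennreal (2 * H) * ennreal (C * sqrt (3 * norm (x - x')))"
      using c a ac by (intro mult_left_mono C(2)) auto
    also have "\<dots> = ennreal (2 * C * sqrt 3 * H * sqrt (norm (x - x')))"
      using H C by (simp add: real_sqrt_mult mult_ac flip: ennreal_mult)
    finally have 1: "\<bar>(LBINT y. ?k y * g y)\<bar> \<le> 2 * C * sqrt 3 * H * sqrt (norm (x - x'))"
      using H C by (subst (asm) ennreal_le_iff) auto
    have "\<bar>(f x - f x') * (LBINT y. ?k y)\<bar> \<le> (H * sqrt (norm (x - x'))) * A"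
      unfolding abs_mult using H by (intro mult_mono hoelder_suppD(3)[OF f] cancel a ac) auto
    with 1 show "\<bar>cop K a c f x - cop K a c f x'\<bar> \<le> (2 * C * sqrt 3 + A) * H * sqrt (norm (x - x'))"
      unfolding eq by (simp add: algebra_simps)
  qed
qed

text \<open>At larger scales the two translated kernels have the same integral, so
  \<open>f x\<close> may be subtracted under the integral of their difference. The weight created by
  the Hoelder condition is the one of \<open>ctrunc_diff_integral\<close> for
  \<open>s = 1/2\<close>.\<close>

lemma cop_hoelder_far:
  obtains C where "0 < C"
    "\<And>c b H R f x x'. 0 < norm (x - x') \<Longrightarrow> 3 * norm (x - x') \<le> c \<Longrightarrow> hoelder_supp H R f \<Longrightarrow>
      \<bar>cop K c b f x - cop K c b f x'\<bar> \<le> C * H * sqrt (norm (x - x'))"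
proof -
  obtain C where C: "0 < C" "\<And>a b h v. 0 < h \<Longrightarrow> norm v \<le> h \<Longrightarrow> 3 * h \<le> a \<Longrightarrow>
    (LBNN u. ennreal (\<bar>ctrunc K a b u - ctrunc K a b (u - v)\<bar> * norm u powr (1/2))) \<le> ennreal (C * h powr (1/2))"
    using ctrunc_diff_integral[of "1/2"] by auto
  show thesis
  proof
    show "0 < C" by (rule C)
    fix c b H R :: real and f :: "'a \<Rightarrow> real" and x x' :: 'a
    assume h: "0 < norm (x - x')" and c: "3 * norm (x - x') \<le> c" and f: "hoelder_supp H R f"
    have [measurable]: "f \<in> borel_measurable borel" by (rule hoelder_supp_borel[OF f])
    have H: "0 \<le> H" by (rule hoelder_suppD[OF f])
    have c0: "0 < c" using h c by linarith
    let ?k = "ctrunc K c b"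
    define v where "v = x - x'"
    have int_k: "integrable lborel (\<lambda>z. ?k (w - z))" for w by (intro integrable_lborel_reflect ctrunc_integrable c0)
    have int_kf: "integrable lborel (\<lambda>y. ?k (w - y) * f y)" for w
      by (intro cop_integrable hoelder_supp_integrable[OF f] c0)
    let ?d = "\<lambda>z. ?k (x - z) - ?k (x' - z)"
    have "integrable lborel (\<lambda>z. (?k (x - z) * f z - ?k (x' - z) * f z) - (?k (x - z) * f x - ?k (x' - z) * f x))"
      using int_k int_kf by (intro Bochner_Integration.integrable_diff integrable_mult_left)
    then have int_d: "integrable lborel (\<lambda>z. ?d z * (f z - f x))" by (simp add: algebra_simps)
    have k0: "(LBINT z. ?k (x - z)) = (LBINT z. ?k (x' - z))" using lebesgue_integral_lborel_reflect[of ?k] by simp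
    have "cop K c b f x - cop K c b f x' = (LBINT z. ?k (x - z) * f z - ?k (x' - z) * f z)"
      using int_kf by (simp add: cop_def)
    also have "\<dots> = (LBINT z. ?d z * (f z - f x) + f x * (?k (x - z) - ?k (x' - z)))"
      by (intro Bochner_Integration.integral_cong) (auto simp: algebra_simps)
    also have "\<dots> = (LBINT z. ?d z * (f z - f x)) + f x * ((LBINT z. ?k (x - z)) - (LBINT z. ?k (x' - z)))"
      using int_d int_k by (subst Bochner_Integration.integral_add) auto
    finally have eq: "cop K c b f x - cop K c b f x' = (LBINT z. ?d z * (f z - f x))" using k0 by simp
    have "ennreal \<bar>(LBINT z. ?d z * (f z - f x))\<bar> \<le> (LBNN z. ennreal \<bar>?d z * (f z - f x)\<bar>)"
      using integral_norm_bound_ennreal[OF int_d] by simp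
    also have "\<dots> \<le> (LBNN z. ennreal H * ennreal (\<bar>?d z\<bar> * norm (x - z) powr (1/2)))"
    proof (intro nn_integral_mono)
      fix z
      have "\<bar>?d z * (f z - f x)\<bar> \<le> \<bar>?d z\<bar> * (H * sqrt (norm (x - z)))"
        unfolding abs_mult using hoelder_suppD(3)[OF f, of z x] by (intro mult_left_mono) (auto simp: norm_minus_commute)
      then show "ennreal \<bar>?d z * (f z - f x)\<bar> \<le> ennreal H * ennreal (\<bar>?d z\<bar> * norm (x - z) powr (1/2))"
        using H by (simp flip: ennreal_mult add: ennreal_leI mult_ac powr_half_sqrt)
    qed
    also have "\<dots> = ennreal H * (LBNN z. ennreal (\<bar>?d z\<bar> * norm (x - z) powr (1/2)))"
      by (intro nn_integral_cmult) measurable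
    also have "(LBNN z. ennreal (\<bar>?d z\<bar> * norm (x - z) powr (1/2)))
        = (LBNN z. ennreal (\<bar>?k (x - z) - ?k ((x - z) - v)\<bar> * norm (x - z) powr (1/2)))"
      by (simp add: v_def algebra_simps)
    also have "\<dots> = (LBNN u. ennreal (\<bar>?k u - ?k (u - v)\<bar> * norm u powr (1/2)))"
      by (rule nn_integral_lborel_reflect) measurable
    also have "\<dots> \<le> ennreal (C * norm (x - x') powr (1/2))" using h c by (intro C(2)) (auto simp: v_def)
    finally have "ennreal \<bar>(LBINT z. ?d z * (f z - f x))\<bar> \<le> ennreal H * ennreal (C * norm (x - x') powr (1/2))"
      by (simp add: mult_left_mono)
    also have "\<dots> = ennreal (C * H * sqrt (norm (x - x')))"
      using H C by (simp add: powr_half_sqrt mult_ac flip: ennreal_mult)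
    finally have "\<bar>(LBINT z. ?d z * (f z - f x))\<bar> \<le> C * H * sqrt (norm (x - x'))"
      using H C by (subst (asm) ennreal_le_iff) auto
    then show "\<bar>cop K c b f x - cop K c b f x'\<bar> \<le> C * H * sqrt (norm (x - x'))" unfolding eq .
  qed
qed

lemma cop_supp:
  assumes f: "\<And>x. R < norm x \<Longrightarrow> f x = 0" and x: "R + b < norm x"
  shows "cop K a b f x = 0"
proof -
  have "ctrunc K a b (x - y) * f y = 0" for y
  proof (cases "R < norm y")
    case False
    then have "b < norm (x - y)" using x norm_triangle_ineq2[of x y] by linarith
    then show ?thesis by (simp add: ctrunc_eq_0)
  qed (simp add: f)
  then have "(\<lambda>y. ctrunc K a b (x - y) * f y) = (\<lambda>_. 0)" by blast
  then show ?thesis by (simp add: cop_def)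
qed

lemma cop_hoelder:
  obtains C where "0 < C"
    "\<And>a b H R f. 0 < a \<Longrightarrow> a < b \<Longrightarrow> hoelder_supp H R f \<Longrightarrow> hoelder_supp (C * H) (R + b) (cop K a b f)"
proof -
  obtain C1 where C1: "0 < C1"
    "\<And>a c H R f x x'. 0 < a \<Longrightarrow> a < c \<Longrightarrow> c \<le> 3 * norm (x - x') \<Longrightarrow> hoelder_supp H R f \<Longrightarrow>
      \<bar>cop K a c f x - cop K a c f x'\<bar> \<le> C1 * H * sqrt (norm (x - x'))" using cop_hoelder_near by blast
  obtain C2 where C2: "0 < C2"
    "\<And>c b H R f x x'. 0 < norm (x - x') \<Longrightarrow> 3 * norm (x - x') \<le> c \<Longrightarrow> hoelder_supp H R f \<Longrightarrow>
      \<bar>cop K c b f x - cop K c b f x'\<bar> \<le> C2 * H * sqrt (norm (x - x'))" using cop_hoelder_far by blast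
  show thesis
  proof
    show "0 < C1 + C2" using C1 C2 by simp
    fix a b H R :: real and f :: "'a \<Rightarrow> real"
    assume a: "0 < a" "a < b" and f: "hoelder_supp H R f"
    have H: "0 \<le> H" "0 \<le> R" using hoelder_suppD[OF f] by auto
    show "hoelder_supp ((C1 + C2) * H) (R + b) (cop K a b f)" unfolding hoelder_supp_def
    proof (intro conjI allI impI)
      fix x x' :: 'a
      show "\<bar>cop K a b f x - cop K a b f x'\<bar> \<le> (C1 + C2) * H * sqrt (norm (x - x'))"
      proof (cases "x = x'")
        case False
        define h where "h = norm (x - x')"
        have h: "0 < h" using False by (simp add: h_def)
        \<comment> \<open>The natural splitting radius \<open>3 * h\<close>, forced into the
          interval from \<open>a\<close> to \<open>b\<close>. If it is clamped at an end, the near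
          or the far part is empty.\<close>
        define c where "c = max a (min b (3 * h))"
        have c: "a \<le> c" "c \<le> b" using a by (auto simp: c_def)
        have split: "cop K a b f z = cop K a c f z + cop K c b f z" for z
          unfolding cop_def ctrunc_split[OF c] distrib_right
          using a c by (intro Bochner_Integration.integral_add cop_integrable hoelder_supp_integrable[OF f]) auto
        have triv: "cop K d d f z = 0" for d z
        proof -
          have "ctrunc K d d y = 0" for y by (auto simp: ctrunc_def ann_def)
          then show ?thesis by (simp add: cop_def)
        qed
        have nonneg: "0 \<le> C1 * H * sqrt h" "0 \<le> C2 * H * sqrt h" using C1 C2 H h by auto
        have 1: "\<bar>cop K a c f x - cop K a c f x'\<bar> \<le> C1 * H * sqrt h"
        proof (cases "a < c")
          case True
          then have "c \<le> 3 * norm (x - x')" by (auto simp: c_def h_def)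
          then show ?thesis unfolding h_def using True a f by (intro C1)
        next
          case False
          then have "c = a" using c by simp
          then show ?thesis using nonneg by (simp add: triv)
        qed
        have 2: "\<bar>cop K c b f x - cop K c b f x'\<bar> \<le> C2 * H * sqrt h"
        proof (cases "c < b")
          case True
          then have "3 * norm (x - x') \<le> c" by (auto simp: c_def h_def)
          then show ?thesis unfolding h_def using h f by (intro C2) (auto simp: h_def)
        next
          case False
          then have "c = b" using c by simp
          then show ?thesis using nonneg by (simp add: triv)
        qed
        show ?thesis using 1 2 unfolding split h_def by (simp add: algebra_simps)
      qed simp
    next
      fix x :: 'a assume "R + b < norm x"
      then show "cop K a b f x = 0" using hoelder_suppD(4)[OF f] cop_supp by blast
    qed (use C1 C2 H a in auto)
  qed
qed

text \<open>Fubini applies for merely integrable functions because the truncated kernel is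
  bounded.\<close>

lemma cop_duality:
  assumes a: "0 < a" and f: "integrable lborel f" and g: "integrable lborel g"
  shows "(LBINT x. cop K a b f x * g x) = (LBINT y. f y * cop (\<lambda>x. K (- x)) a b g y)"
proof -
  have [measurable]: "f \<in> borel_measurable borel" "g \<in> borel_measurable borel" using f g by auto
  let ?F = "\<lambda>x y. ctrunc K a b (x - y) * f y * g x"
  have int: "integrable (lborel \<Otimes>\<^sub>M lborel) (case_prod ?F)"
  proof (rule lborel_pair.Fubini_integrable)
    show "case_prod ?F \<in> borel_measurable (lborel \<Otimes>\<^sub>M lborel)" by measurable
    show "AE x in lborel. integrable lborel (\<lambda>y. case (x, y) of (x, y) \<Rightarrow> ?F x y)" using cop_integrable[OF a f] by auto
    show "integrable lborel (\<lambda>x. (LBINT y. norm (case (x, y) of (x, y) \<Rightarrow> ?F x y)))"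
    proof (rule Bochner_Integration.integrable_bound)
      show "integrable lborel (\<lambda>x. A / a ^ DIM('a) * L1 f * g x)" using g by simp
      show "AE x in lborel. norm (LBINT y. norm (case (x, y) of (x, y) \<Rightarrow> ?F x y))
          \<le> norm (A / a ^ DIM('a) * L1 f * g x)"
      proof (rule AE_I2)
        fix x
        have "(LBINT y. \<bar>ctrunc K a b (x - y) * f y\<bar>) \<le> (LBINT y. A / a ^ DIM('a) * \<bar>f y\<bar>)"
          using ctrunc_mult_bound[OF a, of b] cop_integrable[OF a f, of b x] f
          by (intro integral_mono integrable_abs integrable_mult_right) auto
        then have "(LBINT y. \<bar>ctrunc K a b (x - y) * f y\<bar>) * \<bar>g x\<bar>
          \<le> A / a ^ DIM('a) * L1 f * \<bar>g x\<bar>" by (intro mult_right_mono) auto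
        moreover have "(LBINT y. norm (case (x, y) of (x, y) \<Rightarrow> ?F x y))
            = (LBINT y. \<bar>ctrunc K a b (x - y) * f y\<bar>) * \<bar>g x\<bar>" by (simp add: abs_mult[of _ "g x"])
        ultimately show "norm (LBINT y. norm (case (x, y) of (x, y) \<Rightarrow> ?F x y))
          \<le> norm (A / a ^ DIM('a) * L1 f * g x)" using A_pos a by (simp add: abs_mult)
      qed
      show "(\<lambda>x. (LBINT y. norm (case (x, y) of (x, y) \<Rightarrow> ?F x y))) \<in> borel_measurable lborel"
        by (rule lborel.borel_measurable_lebesgue_integral) measurable
    qed
  qed
  have "(LBINT x. cop K a b f x * g x) = (LBINT x. (LBINT y. ?F x y))" by (simp add: cop_def)
  also have "\<dots> = (LBINT y. (LBINT x. ?F x y))" by (rule lborel_pair.Fubini_integral[OF int, symmetric])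
  also have "\<dots> = (LBINT y. (LBINT x. f y * (ctrunc (\<lambda>x. K (- x)) a b (y - x) * g x)))"
    by (intro Bochner_Integration.integral_cong)
       (auto simp: ctrunc_def ann_def indicator_def norm_minus_commute)
  also have "\<dots> = (LBINT y. f y * cop (\<lambda>x. K (- x)) a b g y)" by (simp add: cop_def)
  finally show ?thesis .
qed

end

text \<open>Log-convexity makes the ratios of consecutive terms increase. Were the first ratio
  \<open>r\<close> larger than \<open>L\<close>, then \<open>q m\<close> would be at least
  \<open>r ^ m * q 0\<close>, which outgrows \<open>L ^ m\<close> times any polynomial.\<close>

lemma log_convex_growth:
  fixes q :: "nat \<Rightarrow> real"
  assumes nonneg: "\<And>m. 0 \<le> q m" and conv: "\<And>m. q (Suc m) ^ 2 \<le> q m * q (Suc (Suc m))"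
    and growth: "\<And>m. q m \<le> D * L ^ m * (real m + 1) ^ s" and L: "0 < L"
  shows "q 1 \<le> L * q 0"
proof (rule ccontr)
  assume neg: "\<not> q 1 \<le> L * q 0"
  have q1: "0 < q 1"
    using neg nonneg[of 0] L by (meson less_eq_real_def linorder_not_le mult_nonneg_nonneg order_trans)
  have "q 0 \<noteq> 0" using conv[of 0] q1 by auto
  then have q0: "0 < q 0" using nonneg[of 0] by simp
  define r where "r = q 1 / q 0"
  have r: "L < r" "0 < r" using neg q0 q1 L by (auto simp: r_def field_simps)
  have step: "0 < q m \<and> r * q m \<le> q (Suc m)" for m
  proof (induction m)
    case 0
    then show ?case using q0 by (simp add: r_def)
  next
    case (Suc m)
    then have pos: "0 < q (Suc m)" using r by (smt (verit) mult_pos_pos)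
    have "r * q m * q (Suc m) \<le> q (Suc m) * q (Suc m)" using Suc pos by (intro mult_right_mono) auto
    also have "\<dots> \<le> q m * q (Suc (Suc m))" using conv[of m] by (simp add: power2_eq_square)
    finally have "q m * (r * q (Suc m)) \<le> q m * q (Suc (Suc m))" by (simp add: mult_ac)
    then show ?case using Suc pos by (simp add: mult_le_cancel_left)
  qed
  have lower: "r ^ m * q 0 \<le> q m" for m
  proof (induction m)
    case (Suc m)
    have "r ^ Suc m * q 0 = r * (r ^ m * q 0)" by simp
    also have "\<dots> \<le> r * q m" using Suc r by (intro mult_left_mono) auto
    finally show ?case using step[of m] by linarith
  qed simp
  define t where "t = L / r"
  have t: "0 < t" "t < 1" using r L by (auto simp: t_def)
  have bound: "q 0 \<le> D * (t ^ m * (real m + 1) ^ s)" for m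
  proof -
    have "r ^ m * q 0 \<le> D * L ^ m * (real m + 1) ^ s" using lower[of m] growth[of m] by linarith
    then have "q 0 \<le> D * L ^ m * (real m + 1) ^ s / r ^ m" using r by (simp add: pos_le_divide_eq mult.commute)
    then show ?thesis using r by (simp add: t_def power_divide)
  qed
  \<comment> \<open>Splitting \<open>t\<close> into \<open>s + 1\<close> equal factors reduces the
    claim to the limit of \<open>real m * u ^ m\<close>: each of the \<open>s\<close> polynomial
    factors receives its own \<open>u ^ m\<close>.\<close>
  define u where "u = t powr (1 / (real s + 1))"
  have u: "0 < u" "u < 1" "u ^ (s + 1) = t"
  proof -
    show "0 < u" using t by (simp add: u_def)
    have "t powr (1 / (real s + 1)) < 1 powr (1 / (real s + 1))" using t by (intro powr_less_mono2) auto
    then show "u < 1" by (simp add: u_def)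
    have "u ^ (s + 1) = u powr real (s + 1)" using t by (intro powr_realpow[symmetric]) (simp add: u_def)
    also have "\<dots> = t powr (1 / (real s + 1) * real (s + 1))" unfolding u_def by (rule powr_powr)
    also have "1 / (real s + 1) * real (s + 1) = 1" by (simp add: field_simps)
    finally show "u ^ (s + 1) = t" using t by simp
  qed
  have nu: "norm u < 1" using u by simp
  have l: "(\<lambda>m. real m * u ^ m) \<longlonglongrightarrow> 0" "(\<lambda>m. u ^ m) \<longlonglongrightarrow> 0"
    by (rule powser_times_n_limit_0[OF nu], rule LIMSEQ_power_zero[OF nu])
  have "(\<lambda>m. D * ((real m * u ^ m + u ^ m) ^ s * u ^ m)) \<longlonglongrightarrow> D * ((0 + 0) ^ s * 0)"
    by (intro tendsto_mult tendsto_const tendsto_power tendsto_add l)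
  moreover have "(real m * u ^ m + u ^ m) ^ s * u ^ m = t ^ m * (real m + 1) ^ s" for m
  proof -
    have "(real m * u ^ m + u ^ m) ^ s * u ^ m = ((real m + 1) * u ^ m) ^ s * u ^ m" by (simp add: algebra_simps)
    also have "\<dots> = (real m + 1) ^ s * (u ^ (s + 1)) ^ m" by (simp add: power_mult_distrib mult_ac flip: power_mult)
    finally show ?thesis by (simp only: u mult.commute)
  qed
  ultimately have "(\<lambda>m. D * (t ^ m * (real m + 1) ^ s)) \<longlonglongrightarrow> D * 0" by simp
  then have "q 0 \<le> D * 0" by (rule tendsto_lowerbound) (auto simp: bound)
  with q0 show False by simp
qed

lemma Cauchy_Schwarz_lebesgue_integral:
  fixes u v :: "'a \<Rightarrow> real"
  assumes int: "integrable M (\<lambda>x. u x ^ 2)" "integrable M (\<lambda>x. v x ^ 2)" "integrable M (\<lambda>x. u x * v x)"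
    and [measurable]: "u \<in> borel_measurable M" "v \<in> borel_measurable M"
  shows "(\<integral>x. u x * v x \<partial>M) ^ 2 \<le> (\<integral>x. u x ^ 2 \<partial>M) * (\<integral>x. v x ^ 2 \<partial>M)"
proof -
  have "ennreal ((\<integral>x. u x * v x \<partial>M) ^ 2) = ennreal \<bar>\<integral>x. u x * v x \<partial>M\<bar> ^ 2" by (simp add: ennreal_power)
  also have "\<dots> \<le> (\<integral>\<^sup>+x. ennreal \<bar>u x\<bar> * ennreal \<bar>v x\<bar> \<partial>M) ^ 2" using integral_norm_bound_ennreal[OF int(3)]
    by (intro power_mono) (auto simp: abs_mult ennreal_mult)
  also have "\<dots> \<le> (\<integral>\<^sup>+x. ennreal \<bar>u x\<bar> ^ 2 \<partial>M) * (\<integral>\<^sup>+x. ennreal \<bar>v x\<bar> ^ 2 \<partial>M)"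
    by (rule Cauchy_Schwarz_nn_integral) measurable
  also have "\<dots> = ennreal (\<integral>x. u x ^ 2 \<partial>M) * ennreal (\<integral>x. v x ^ 2 \<partial>M)"
    using int(1,2) by (simp add: ennreal_power nn_integral_eq_integral)
  also have "\<dots> = ennreal ((\<integral>x. u x ^ 2 \<partial>M) * (\<integral>x. v x ^ 2 \<partial>M))" by (simp add: ennreal_mult)
  finally show ?thesis by (simp add: ennreal_le_iff)
qed

lemma hoelder_supp_mult_integrable:
  assumes f: "hoelder_supp H R f" and g: "hoelder_supp H' R' g"
  shows "integrable lborel (\<lambda>x. f x * g x)"
proof (rule integrable_bounded_supp)
  show "(\<lambda>x. f x * g x) \<in> borel_measurable borel"
    using hoelder_supp_borel[OF f] hoelder_supp_borel[OF g] by measurable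
  show "\<bar>f x * g x\<bar> \<le> (H * sqrt (2 * R + 1)) * (H' * sqrt (2 * R' + 1))" for x
    unfolding abs_mult using hoelder_suppD[OF f]
    by (intro mult_mono hoelder_supp_bound[OF f] hoelder_supp_bound[OF g]) auto
  show "f x * g x = 0" if "R < norm x" for x using hoelder_suppD(4)[OF f] that by simp
qed

lemma hoelder_supp_Cauchy_Schwarz:
  assumes f: "hoelder_supp H R f" and g: "hoelder_supp H' R' g"
  shows "(LBINT x. f x * g x) ^ 2 \<le> (LBINT x. f x ^ 2) * (LBINT x. g x ^ 2)"
  using hoelder_supp_mult_integrable[OF f g] hoelder_supp_mult_integrable[OF f f]
    hoelder_supp_mult_integrable[OF g g] hoelder_supp_borel[OF f] hoelder_supp_borel[OF g]
  by (intro Cauchy_Schwarz_lebesgue_integral) (auto simp: power2_eq_square)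

lemma hoelder_supp_integral_square_le:
  fixes f :: "'a::euclidean_space \<Rightarrow> real"
  assumes f: "hoelder_supp H R f"
  shows "(LBINT x. f x ^ 2) \<le> H ^ 2 * (2 * R + 1) * (ball_vol TYPE('a) * R ^ DIM('a))"
proof -
  have R: "0 \<le> R" "0 \<le> H" using hoelder_suppD[OF f] by auto
  have "(LBINT x. f x ^ 2) \<le> (LBINT x. H ^ 2 * (2 * R + 1) * ind (cball (0::'a) R) x)"
  proof (rule integral_mono)
    show "integrable lborel (\<lambda>x. f x ^ 2)" using hoelder_supp_mult_integrable[OF f f] by (simp add: power2_eq_square)
    show "integrable lborel (\<lambda>x. H ^ 2 * (2 * R + 1) * ind (cball (0::'a) R) x)"
      using emeasure_lborel_cball_finite[of "0::'a" R] by (intro integrable_mult_right integrable_real_indicator) auto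
    fix x :: 'a
    show "f x ^ 2 \<le> H ^ 2 * (2 * R + 1) * ind (cball (0::'a) R) x"
    proof (cases "R < norm x")
      case False
      have "\<bar>f x\<bar> ^ 2 \<le> (H * sqrt (2 * R + 1)) ^ 2" by (intro power_mono hoelder_supp_bound[OF f]) auto
      then show ?thesis using False R by (simp add: power_mult_distrib)
    qed (use hoelder_suppD[OF f] in auto)
  qed
  also have "\<dots> = H ^ 2 * (2 * R + 1) * (ball_vol TYPE('a) * R ^ DIM('a))" using R by (simp add: content_cball)
  finally show ?thesis .
qed

context cz
begin

text \<open>
  Krein's trick: for the self-adjoint operator \<open>S = T\<^sup>t T\<close> the sequence \<open>\<parallel>S\<^sup>m f\<parallel>\<^sup>2\<close> is
  log-convex, and the Hoelder bound for \<open>S\<close> together with the linear growth of supports limits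
  its exponential growth rate. Hence the Hoelder bound is also an \<open>L\<^sup>2\<close> bound.
\<close>

lemma cop_L2_hoelder:
  obtains C where "0 < C"
    "\<And>a b H R f. 0 < a \<Longrightarrow> a < b \<Longrightarrow> hoelder_supp H R f \<Longrightarrow>
      (LBINT x. cop K a b f x ^ 2) \<le> C * (LBINT x. f x ^ 2)"
proof -
  define K' where "K' = (\<lambda>x. K (- x))"
  interpret r: cz K' A unfolding K'_def by (rule cz_reflect)
  have K'': "(\<lambda>x. K' (- x)) = K" by (simp add: K'_def)
  obtain C1 where C1: "0 < C1"
    "\<And>a b H R f. 0 < a \<Longrightarrow> a < b \<Longrightarrow> hoelder_supp H R f \<Longrightarrow> hoelder_supp (C1 * H) (R + b) (cop K a b f)"
    using cop_hoelder by blast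
  obtain C2 where C2: "0 < C2"
    "\<And>a b H R f. 0 < a \<Longrightarrow> a < b \<Longrightarrow> hoelder_supp H R f \<Longrightarrow> hoelder_supp (C2 * H) (R + b) (cop K' a b f)"
    using r.cop_hoelder by blast
  define L where "L = C2 * C1"
  have L: "0 < L" using C1 C2 by (simp add: L_def)
  show thesis
  proof
    show "0 < L" by (rule L)
    fix a b H R :: real and f :: "'a \<Rightarrow> real"
    assume a: "0 < a" "a < b" and f: "hoelder_supp H R f"
    let ?V = "ball_vol TYPE('a)"
    have H: "0 \<le> H" "0 \<le> R" "0 < b" using hoelder_suppD[OF f] a by auto
    define S where "S g = cop K' a b (cop K a b g)" for g
    define u where "u m = (S ^^ m) f" for m
    have u_Suc: "u (Suc m) = S (u m)" "u 0 = f" for m by (simp_all add: u_def)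
    have u: "hoelder_supp (L ^ m * H) (R + 2 * real m * b) (u m)" for m
    proof (induction m)
      case (Suc m)
      have "hoelder_supp (C2 * (C1 * (L ^ m * H))) (R + 2 * real m * b + b + b) (u (Suc m))"
        unfolding u_Suc S_def by (intro C1 C2 a Suc)
      then show ?case by (simp add: L_def algebra_simps)
    qed (use f in \<open>simp add: u_def\<close>)
    have S_sym: "(LBINT x. S g x * h x) = (LBINT x. cop K a b g x * cop K a b h x)"
      if g: "hoelder_supp G P g" and h: "hoelder_supp G' P' h" for G P g G' P' h unfolding S_def
      using r.cop_duality[OF a(1) hoelder_supp_integrable[OF C1(2)[OF a g]] hoelder_supp_integrable[OF h]]
      by (simp add: K'')
    define q where "q m = (LBINT x. u m x ^ 2)" for m
    have q1: "q 1 \<le> L ^ 2 * q 0"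
    proof (rule log_convex_growth)
      show "0 \<le> q m" for m by (simp add: q_def)
      show "q (Suc m) ^ 2 \<le> q m * q (Suc (Suc m))" for m
      proof -
        have "q (Suc m) = (LBINT x. S (u m) x * u (Suc m) x)" by (simp add: q_def u_Suc power2_eq_square)
        also have "\<dots> = (LBINT x. S (u (Suc m)) x * u m x)" unfolding S_sym[OF u u] by (simp add: mult.commute)
        also have "\<dots> = (LBINT x. u m x * u (Suc (Suc m)) x)" by (simp add: u_Suc mult.commute)
        finally show ?thesis using hoelder_supp_Cauchy_Schwarz[OF u[of m] u[of "Suc (Suc m)"]] by (simp add: q_def)
      qed
      \<comment> \<open>Every application of \<open>S\<close> enlarges the support radius by
        \<open>2 * b\<close>, so that radius is at most \<open>(R + 2 * b) * (real m + 1)\<close>.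
        The degree is the dimension, from the volume of the support, plus one, from the square of
        the sup bound.\<close>
      define D where "D = H ^ 2 * (2 * R + 4 * b + 1) * (?V * (R + 2 * b) ^ DIM('a))"
      show "q m \<le> D * (L ^ 2) ^ m * (real m + 1) ^ (DIM('a) + 1)" for m
      proof -
        define P where "P = R + 2 * real m * b"
        have P: "0 \<le> P" "P \<le> (R + 2 * b) * (real m + 1)" "2 * P + 1 \<le> (2 * R + 4 * b + 1) * (real m + 1)"
          using H by (auto simp: P_def algebra_simps)
        have "q m \<le> (L ^ m * H) ^ 2 * (2 * P + 1) * (?V * P ^ DIM('a))"
          unfolding q_def P_def by (rule hoelder_supp_integral_square_le[OF u])
        also have "\<dots> \<le> (L ^ m * H) ^ 2 * ((2 * R + 4 * b + 1) * (real m + 1)) * (?V * ((R + 2 * b) * (real m + 1)) ^ DIM('a))"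
          using P H L by (intro mult_mono power_mono mult_nonneg_nonneg) auto
        also have "\<dots> = D * (L ^ 2) ^ m * (real m + 1) ^ (DIM('a) + 1)"
        proof -
          have "(L ^ m) ^ 2 = (L ^ 2) ^ m" by (metis mult.commute power_mult)
          then show ?thesis unfolding D_def power_mult_distrib by (simp only: power_add power_one_right mult_ac)
        qed
        finally show ?thesis .
      qed
      show "0 < L ^ 2" using L by simp
    qed
    have q0: "0 \<le> q 0" by (simp add: q_def)
    \<comment> \<open>Return from \<open>S\<close> to \<open>T\<close>: the squared norm of T f is
      the inner product of f with S f, and Cauchy-Schwarz applies.\<close>
    have "(LBINT x. cop K a b f x ^ 2) ^ 2 \<le> q 0 * q 1"
    proof -
      have "(LBINT x. cop K a b f x ^ 2) = (LBINT x. S f x * f x)"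
        unfolding S_sym[OF f f] by (simp add: power2_eq_square)
      also have "\<dots> = (LBINT x. u 0 x * u 1 x)" by (intro Bochner_Integration.integral_cong) (simp_all add: u_def)
      finally have "(LBINT x. cop K a b f x ^ 2) = (LBINT x. u 0 x * u 1 x)" .
      then show ?thesis using hoelder_supp_Cauchy_Schwarz[OF u[of 0] u[of 1]] by (simp add: q_def)
    qed
    also have "\<dots> \<le> q 0 * (L ^ 2 * q 0)" by (intro mult_left_mono q1 q0)
    also have "\<dots> = (L * q 0) ^ 2" by (simp add: power2_eq_square)
    finally have "(LBINT x. cop K a b f x ^ 2) \<le> L * q 0" by (rule power2_le_imp_le) (use L q0 in simp)
    then show "(LBINT x. cop K a b f x ^ 2) \<le> L * (LBINT x. f x ^ 2)" by (simp add: q_def u_def)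
  qed
qed

text \<open>Approximation in mean by Hoelder functions clipped at height \<open>M\<close> is also
  approximation in square mean, since the squares differ by at most \<open>2 * M\<close> times the
  difference. For fixed \<open>a\<close> the images converge pointwise, and Fatou's lemma carries
  the bound over.\<close>

lemma cop_L2:
  obtains C where "0 < C"
    "\<And>a b M f. 0 < a \<Longrightarrow> a < b \<Longrightarrow> integrable lborel f \<Longrightarrow> (\<And>x. \<bar>f x\<bar> \<le> M) \<Longrightarrow>
      (LBNN x. ennreal (cop K a b f x ^ 2)) \<le> ennreal (C * (LBINT x. f x ^ 2))"
proof -
  obtain C where C: "0 < C"
    "\<And>a b H R f. 0 < a \<Longrightarrow> a < b \<Longrightarrow> hoelder_supp H R f \<Longrightarrow>
      (LBINT x. cop K a b f x ^ 2) \<le> C * (LBINT x. f x ^ 2)" using cop_L2_hoelder by blast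
  obtain C1 where C1: "0 < C1"
    "\<And>a b H R f. 0 < a \<Longrightarrow> a < b \<Longrightarrow> hoelder_supp H R f \<Longrightarrow> hoelder_supp (C1 * H) (R + b) (cop K a b f)"
    using cop_hoelder by blast
  show thesis
  proof
    show "0 < C" by (rule C)
    fix a b M :: real and f :: "'a \<Rightarrow> real"
    assume a: "0 < a" "a < b" and f: "integrable lborel f" and M: "\<And>x. \<bar>f x\<bar> \<le> M"
    have M0: "0 \<le> M" using M[of 0] by linarith
    have [measurable]: "f \<in> borel_measurable borel" using f by auto
    have f2: "integrable lborel (\<lambda>x. f x ^ 2)"
    proof (rule Bochner_Integration.integrable_bound)
      show "integrable lborel (\<lambda>x. M * f x)" using f by simp
      show "AE x in lborel. norm (f x ^ 2) \<le> norm (M * f x)"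
      proof (rule AE_I2)
        fix x
        have "\<bar>f x\<bar> * \<bar>f x\<bar> \<le> M * \<bar>f x\<bar>" by (intro mult_right_mono M) auto
        then show "norm (f x ^ 2) \<le> norm (M * f x)" using M0 by (simp add: power2_eq_square abs_mult)
      qed
    qed auto
    have "\<exists>H R h. hoelder_supp H R h \<and> (LBINT x. \<bar>f x - h x\<bar>) < inverse (real (Suc j)) \<and> (\<forall>x. \<bar>h x\<bar> \<le> M)" for j
    proof -
      obtain H R h where h: "hoelder_supp H R h" "(LBINT x. \<bar>f x - h x\<bar>) < inverse (real (Suc j))"
        using hoelder_dense[OF f, of "inverse (real (Suc j))"] by auto
      define h' where "h' x = max (-M) (min M (h x))" for x
      have h': "hoelder_supp H R h'" unfolding h'_def by (rule hoelder_supp_clip[OF h(1) M0])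
      have "(LBINT x. \<bar>f x - h' x\<bar>) \<le> (LBINT x. \<bar>f x - h x\<bar>)"
      proof (intro integral_mono integrable_abs Bochner_Integration.integrable_diff f hoelder_supp_integrable[OF h(1)] hoelder_supp_integrable[OF h'])
        fix x
        show "\<bar>f x - h' x\<bar> \<le> \<bar>f x - h x\<bar>" using M[of x] by (auto simp: h'_def max_def min_def)
      qed
      moreover have "\<bar>h' x\<bar> \<le> M" for x using M0 by (auto simp: h'_def max_def min_def)
      ultimately show ?thesis using h h' by (meson le_less_trans)
    qed
    then obtain H R h where h: "\<And>j. hoelder_supp (H j) (R j) (h j)"
      "\<And>j. (LBINT x. \<bar>f x - h j x\<bar>) < inverse (real (Suc j))" "\<And>j x. \<bar>h j x\<bar> \<le> M" by metis
    have [measurable]: "h j \<in> borel_measurable borel" for j by (rule hoelder_supp_borel[OF h(1)])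
    have lim: "(\<lambda>j. cop K a b (h j) x) \<longlonglongrightarrow> cop K a b f x" for x
    proof -
      have "(\<lambda>j. cop K a b (h j) x - cop K a b f x) \<longlonglongrightarrow> 0"
      proof (rule Lim_null_comparison)
        show "\<forall>\<^sub>F j in sequentially. norm (cop K a b (h j) x - cop K a b f x) \<le> A / a ^ DIM('a) * inverse (real (Suc j))"
        proof (intro always_eventually allI)
          fix j
          have "\<bar>cop K a b (h j) x - cop K a b f x\<bar> = \<bar>cop K a b (\<lambda>y. f y - h j y) x\<bar>"
            using a f hoelder_supp_integrable[OF h(1)] by (simp add: cop_diff)
          also have "\<dots> \<le> A / a ^ DIM('a) * (LBINT y. \<bar>f y - h j y\<bar>)"
            using a f hoelder_supp_integrable[OF h(1)] by (intro cop_bound) auto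
          also have "\<dots> \<le> A / a ^ DIM('a) * inverse (real (Suc j))"
            using h(2)[of j] A_pos a by (intro mult_left_mono) auto
          finally show "norm (cop K a b (h j) x - cop K a b f x) \<le> A / a ^ DIM('a) * inverse (real (Suc j))" by simp
        qed
        show "(\<lambda>j. A / a ^ DIM('a) * inverse (real (Suc j))) \<longlonglongrightarrow> 0"
          using tendsto_mult_left[OF LIMSEQ_inverse_real_of_nat, of "A / a ^ DIM('a)"] by simp
      qed
      then show ?thesis by (simp add: LIM_zero_iff)
    qed
    have le: "(LBNN x. ennreal (cop K a b (h j) x ^ 2))
        \<le> ennreal (C * (LBINT x. f x ^ 2) + C * (2 * M) * inverse (real (Suc j)))" for j
    proof -
      have hj: "hoelder_supp (C1 * H j) (R j + b) (cop K a b (h j))" by (intro C1 a h)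
      have "(LBNN x. ennreal (cop K a b (h j) x ^ 2)) = ennreal (LBINT x. cop K a b (h j) x ^ 2)"
        using hoelder_supp_mult_integrable[OF hj hj] by (intro nn_integral_eq_integral) (auto simp: power2_eq_square)
      also have "\<dots> \<le> ennreal (C * (LBINT x. h j x ^ 2))" by (intro ennreal_leI C(2)[OF a h(1)])
      finally have 1: "(LBNN x. ennreal (cop K a b (h j) x ^ 2)) \<le> ennreal (C * (LBINT x. h j x ^ 2))" .
      have "C * (LBINT x. h j x ^ 2) \<le> C * (LBINT x. f x ^ 2 + 2 * M * \<bar>f x - h j x\<bar>)"
      proof (intro mult_left_mono integral_mono)
        show "integrable lborel (\<lambda>x. h j x ^ 2)"
          using hoelder_supp_mult_integrable[OF h(1) h(1), of j j] by (simp add: power2_eq_square)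
        show "integrable lborel (\<lambda>x. f x ^ 2 + 2 * M * \<bar>f x - h j x\<bar>)"
          using f f2 hoelder_supp_integrable[OF h(1)] by simp
        fix x
        have "h j x ^ 2 - f x ^ 2 = (h j x - f x) * (h j x + f x)" by (simp add: power2_eq_square algebra_simps)
        also have "\<dots> \<le> \<bar>h j x - f x\<bar> * \<bar>h j x + f x\<bar>" unfolding abs_mult[symmetric] by simp
        also have "\<dots> \<le> \<bar>h j x - f x\<bar> * (2 * M)" using M[of x] h(3)[of j x] by (intro mult_left_mono) auto
        finally show "h j x ^ 2 \<le> f x ^ 2 + 2 * M * \<bar>f x - h j x\<bar>" by (simp add: abs_minus_commute mult_ac)
      qed (use C in auto)
      also have "\<dots> = C * ((LBINT x. f x ^ 2) + 2 * M * (LBINT x. \<bar>f x - h j x\<bar>))"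
        using f f2 hoelder_supp_integrable[OF h(1)] by simp
      also have "\<dots> \<le> C * ((LBINT x. f x ^ 2) + 2 * M * inverse (real (Suc j)))"
        using C M0 h(2)[of j] by (intro mult_left_mono add_left_mono) auto
      also have "\<dots> = C * (LBINT x. f x ^ 2) + C * (2 * M) * inverse (real (Suc j))"
        by (simp only: distrib_left mult.assoc)
      finally show ?thesis by (intro order_trans[OF 1] ennreal_leI)
    qed
    have "(LBNN x. ennreal (cop K a b f x ^ 2)) = (LBNN x. liminf (\<lambda>j. ennreal (cop K a b (h j) x ^ 2)))"
    proof (intro nn_integral_cong)
      fix x
      have "(\<lambda>j. ennreal (cop K a b (h j) x ^ 2)) \<longlonglongrightarrow> ennreal (cop K a b f x ^ 2)"
        by (intro tendsto_ennrealI tendsto_power lim)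
      then show "ennreal (cop K a b f x ^ 2) = liminf (\<lambda>j. ennreal (cop K a b (h j) x ^ 2))"
        by (rule lim_imp_Liminf[OF trivial_limit_sequentially, symmetric])
    qed
    also have "\<dots> \<le> liminf (\<lambda>j. (LBNN x. ennreal (cop K a b (h j) x ^ 2)))" by (intro nn_integral_liminf) measurable
    also have "\<dots> \<le> liminf (\<lambda>j. ennreal (C * (LBINT x. f x ^ 2) + C * (2 * M) * inverse (real (Suc j))))"
      by (intro Liminf_mono always_eventually allI le)
    also have "\<dots> = ennreal (C * (LBINT x. f x ^ 2))"
    proof (rule lim_imp_Liminf)
      have "(\<lambda>j. C * (LBINT x. f x ^ 2) + C * (2 * M) * inverse (real (Suc j))) \<longlonglongrightarrow> C * (LBINT x. f x ^ 2) + C * (2 * M) * 0"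
        by (intro tendsto_intros LIMSEQ_inverse_real_of_nat)
      then show "(\<lambda>j. ennreal (C * (LBINT x. f x ^ 2) + C * (2 * M) * inverse (real (Suc j)))) \<longlonglongrightarrow> ennreal (C * (LBINT x. f x ^ 2))"
        by (intro tendsto_ennrealI) simp
    qed simp
    finally show "(LBNN x. ennreal (cop K a b f x ^ 2)) \<le> ennreal (C * (LBINT x. f x ^ 2))" .
  qed
qed

end

section \<open>The weak type (1,1) bound\<close>

lemma suminf_integral_disjoint_le:
  fixes f :: "'a::euclidean_space \<Rightarrow> real"
  assumes f: "integrable lborel f" and Q: "disjoint_family Q" "\<And>i. Q i \<in> sets borel"
  shows "(\<Sum>i. ennreal (LBINT y. ind (Q i) y * \<bar>f y\<bar>)) \<le> ennreal (L1 f)"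
proof -
  note [measurable] = Q(2)
  have [measurable]: "f \<in> borel_measurable borel" using f by auto
  have "ennreal (LBINT y. ind (Q i) y * \<bar>f y\<bar>) = (LBNN y. ennreal \<bar>f y\<bar> * ind (Q i) y)" for i
  proof -
    have "integrable lborel (\<lambda>y. \<bar>f y\<bar> * ind (Q i) y)" using f by (intro integrable_real_mult_indicator) auto
    then have "ennreal (LBINT y. \<bar>f y\<bar> * ind (Q i) y) = (LBNN y. ennreal (\<bar>f y\<bar> * ind (Q i) y))"
      by (intro nn_integral_eq_integral[symmetric]) auto
    then show ?thesis by (simp add: mult.commute[of "ind _ _"] ennreal_mult' ennreal_indicator)
  qed
  then have "(\<Sum>i. ennreal (LBINT y. ind (Q i) y * \<bar>f y\<bar>)) = (\<Sum>i. (LBNN y. ennreal \<bar>f y\<bar> * ind (Q i) y))" by simp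
  also have "\<dots> = (LBNN y. (\<Sum>i. ennreal \<bar>f y\<bar> * ind (Q i) y))" by (intro nn_integral_suminf[symmetric]) measurable
  also have "\<dots> \<le> (LBNN y. ennreal \<bar>f y\<bar>)"
  proof (intro nn_integral_mono)
    fix y
    show "(\<Sum>i. ennreal \<bar>f y\<bar> * ind (Q i) y) \<le> ennreal \<bar>f y\<bar>"
      unfolding ennreal_suminf_cmult suminf_indicator[OF Q(1)] by (auto split: split_indicator)
  qed
  also have "\<dots> = ennreal (L1 f)" using f by (intro nn_integral_eq_integral) auto
  finally show ?thesis .
qed

text \<open>Continuity takes the place of Lebesgue's differentiation theorem. This is the reason why
  the weak type bound is first proved for Hoelder functions.\<close>

lemma abs_le_of_averages:
  fixes f :: "'a::euclidean_space \<Rightarrow> real"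
  assumes cont: "continuous_on UNIV f" and f: "integrable lborel f"
    and avg: "\<And>t. 0 < t \<Longrightarrow> (LBINT y. ind (cball x t) y * \<bar>f y\<bar>) \<le> l * (ball_vol TYPE('a) * t ^ DIM('a))"
  shows "\<bar>f x\<bar> \<le> l"
proof (rule ccontr)
  let ?V = "ball_vol TYPE('a)"
  assume "\<not> \<bar>f x\<bar> \<le> l"
  then obtain l' where l': "l < l'" "l' < \<bar>f x\<bar>" using dense not_le by metis
  have "isCont (\<lambda>y. \<bar>f y\<bar>) x" using cont by (simp add: continuous_on_eq_continuous_at)
  then have "\<forall>\<^sub>F y in at x. l' < \<bar>f y\<bar>" unfolding isCont_def by (rule order_tendstoD) (rule l')
  then obtain d where d: "0 < d" "\<And>y. y \<noteq> x \<Longrightarrow> dist y x < d \<Longrightarrow> l' < \<bar>f y\<bar>" by (auto simp: eventually_at)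
  define t where "t = d / 2"
  have t: "0 < t" using d by (simp add: t_def)
  have t2: "l' < \<bar>f y\<bar>" if "y \<in> cball x t" for y using that d l' t by (cases "y = x") (auto simp: t_def dist_commute)
  have int: "integrable lborel (\<lambda>y. ind (cball x t) y * \<bar>f y\<bar>)"
    using integrable_real_mult_indicator[of "cball x t" lborel "\<lambda>y. \<bar>f y\<bar>"] f by (simp add: mult.commute)
  have "l' * (?V * t ^ DIM('a)) = (LBINT y. l' * ind (cball x t) y)" using t by (simp add: content_cball)
  also have "\<dots> \<le> (LBINT y. ind (cball x t) y * \<bar>f y\<bar>)"
  proof (rule integral_mono[OF _ int])
    show "integrable lborel (\<lambda>y. l' * ind (cball x t) y)"
      using emeasure_lborel_cball_finite[of x t] by (intro integrable_mult_right integrable_real_indicator) auto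
    show "l' * ind (cball x t) y \<le> ind (cball x t) y * \<bar>f y\<bar>" for y using t2[of y] by (auto simp: indicator_def)
  qed
  also have "\<dots> \<le> l * (?V * t ^ DIM('a))" by (rule avg[OF t])
  finally have "l' \<le> l" using t by (simp add: mult_le_cancel_right)
  with l' show False by simp
qed

context cz
begin

text \<open>Since \<open>g\<close> has mean zero, the value of the kernel at the centre may be
  subtracted. Off the fourfold ball only distances above \<open>3 * \<rho>\<close> occur, so the
  inner truncation may be raised to \<open>max a (3 * \<rho>)\<close>, which brings
  \<open>ctrunc_diff_integral\<close> with \<open>h = \<rho>\<close> and exponent 0 into
  play.\<close>

lemma cop_atom:
  obtains C where "0 < C"
    "\<And>a b c \<rho> g. 0 < a \<Longrightarrow> 0 < \<rho> \<Longrightarrow> integrable lborel g \<Longrightarrow> (LBINT y. g y) = 0 \<Longrightarrow>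
      (\<And>y. y \<notin> cball c \<rho> \<Longrightarrow> g y = 0) \<Longrightarrow>
      (LBNN x. ennreal \<bar>cop K a b g x\<bar> * ind (- cball c (4 * \<rho>)) x) \<le> ennreal (C * L1 g)"
proof -
  obtain C where C: "0 < C" "\<And>a b h v. 0 < h \<Longrightarrow> norm v \<le> h \<Longrightarrow> 3 * h \<le> a \<Longrightarrow>
    (LBNN u. ennreal (\<bar>ctrunc K a b u - ctrunc K a b (u - v)\<bar> * norm u powr 0)) \<le> ennreal (C * h powr 0)"
    using ctrunc_diff_integral[of 0] by auto
  show thesis
  proof
    show "0 < C" by (rule C)
    fix a b \<rho> :: real and c :: 'a and g :: "'a \<Rightarrow> real"
    assume a: "0 < a" and \<rho>: "0 < \<rho>" and g: "integrable lborel g" and g0: "(LBINT y. g y) = 0"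
      and supp: "\<And>y. y \<notin> cball c \<rho> \<Longrightarrow> g y = 0"
    have [measurable]: "g \<in> borel_measurable borel" using g by auto
    let ?k = "ctrunc K (max a (3 * \<rho>)) b"
    have inner: "(LBNN x. ennreal \<bar>?k (x - y) - ?k (x - c)\<bar>) \<le> ennreal C" if "y \<in> cball c \<rho>" for y
    proof -
      define v where "v = y - c"
      have v: "norm v \<le> \<rho>" using that by (simp add: v_def dist_norm norm_minus_commute)
      have "(LBNN x. ennreal \<bar>?k (x - y) - ?k (x - c)\<bar>) = (LBNN x. ennreal \<bar>?k ((x - c) - v) - ?k (x - c)\<bar>)"
        by (simp add: v_def)
      also have "\<dots> = (LBNN u. ennreal \<bar>?k (u - v) - ?k u\<bar>)" by (rule nn_integral_lborel_translate) measurable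
      also have "\<dots> = (LBNN u. ennreal (\<bar>?k u - ?k (u - v)\<bar> * norm u powr 0))"
      proof (intro nn_integral_cong)
        fix u :: 'a
        show "ennreal \<bar>?k (u - v) - ?k u\<bar> = ennreal (\<bar>?k u - ?k (u - v)\<bar> * norm u powr 0)"
        \<comment> \<open>The value of \<open>0 powr 0\<close> is 0, so at this point the left side
          has to vanish too. It does, because neither \<open>0\<close> nor \<open>- v\<close> lies
          in the annulus.\<close>
        proof (cases "u = 0")
          case True
          then have "u \<notin> ann (max a (3 * \<rho>)) b" "u - v \<notin> ann (max a (3 * \<rho>)) b" using a \<rho> v by (auto simp: ann_def)
          then show ?thesis by (simp add: ctrunc_def)
        qed (simp add: abs_minus_commute)
      qed
      also have "\<dots> \<le> ennreal (C * \<rho> powr 0)" using \<rho> v by (intro C(2)) auto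
      finally show ?thesis using \<rho> by simp
    qed
    have far: "ennreal \<bar>cop K a b g x\<bar> \<le> (LBNN y. ennreal \<bar>?k (x - y) - ?k (x - c)\<bar> * ennreal \<bar>g y\<bar>)"
      if "x \<notin> cball c (4 * \<rho>)" for x
    proof -
      have x: "4 * \<rho> < norm (x - c)" using that by (simp add: dist_norm norm_minus_commute)
      have eq: "ctrunc K a b (x - y) = ?k (x - y)" if "y \<in> cball c \<rho>" for y
      proof -
        have "norm (y - c) \<le> \<rho>" using that by (simp add: dist_norm norm_minus_commute)
        moreover have "norm (x - c) \<le> norm (x - y) + norm (y - c)"
          using norm_triangle_ineq[of "x - y" "y - c"] by simp
        ultimately have "3 * \<rho> < norm (x - y)" using x by linarith
        then show ?thesis by (auto simp: ctrunc_def ann_def indicator_def)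
      qed
      have "cop K a b g x = (LBINT y. ?k (x - y) * g y)" unfolding cop_def
      proof (intro Bochner_Integration.integral_cong refl)
        fix y
        show "ctrunc K a b (x - y) * g y = ?k (x - y) * g y" using eq[of y] supp[of y] by (cases "y \<in> cball c \<rho>") auto
      qed
      also have "\<dots> = (LBINT y. ?k (x - y) * g y - ?k (x - c) * g y)"
        using g g0 a by (subst Bochner_Integration.integral_diff) (auto intro!: cop_integrable)
      also have "\<dots> = (LBINT y. (?k (x - y) - ?k (x - c)) * g y)" by (simp add: algebra_simps)
      finally have "cop K a b g x = (LBINT y. (?k (x - y) - ?k (x - c)) * g y)" .
      moreover have "integrable lborel (\<lambda>y. ?k (x - y) * g y - ?k (x - c) * g y)"
        using g a by (intro Bochner_Integration.integrable_diff cop_integrable) auto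
      then have "integrable lborel (\<lambda>y. (?k (x - y) - ?k (x - c)) * g y)" by (simp add: algebra_simps)
      then have "ennreal (norm (LBINT y. (?k (x - y) - ?k (x - c)) * g y))
          \<le> (LBNN y. ennreal (norm ((?k (x - y) - ?k (x - c)) * g y)))" by (rule integral_norm_bound_ennreal)
      ultimately show ?thesis by (simp add: abs_mult ennreal_mult)
    qed
    have "(LBNN x. ennreal \<bar>cop K a b g x\<bar> * ind (- cball c (4 * \<rho>)) x)
      \<le> (LBNN x. (LBNN y. ennreal \<bar>?k (x - y) - ?k (x - c)\<bar> * ennreal \<bar>g y\<bar>))"
      using far by (intro nn_integral_mono) (auto simp: indicator_def)
    also have "\<dots> = (LBNN y. (LBNN x. ennreal \<bar>?k (x - y) - ?k (x - c)\<bar> * ennreal \<bar>g y\<bar>))"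
      by (rule lborel_pair.Fubini'[symmetric]) measurable
    also have "\<dots> = (LBNN y. (LBNN x. ennreal \<bar>?k (x - y) - ?k (x - c)\<bar>) * ennreal \<bar>g y\<bar>)"
      by (intro nn_integral_cong nn_integral_multc) measurable
    also have "\<dots> \<le> (LBNN y. ennreal C * ennreal \<bar>g y\<bar>)"
    proof (intro nn_integral_mono)
      fix y
      show "(LBNN x. ennreal \<bar>?k (x - y) - ?k (x - c)\<bar>) * ennreal \<bar>g y\<bar> \<le> ennreal C * ennreal \<bar>g y\<bar>"
        using inner[of y] supp[of y] by (cases "y \<in> cball c \<rho>") (auto intro: mult_right_mono)
    qed
    also have "\<dots> = ennreal C * (LBNN y. ennreal \<bar>g y\<bar>)" by (intro nn_integral_cmult) measurable
    also have "(LBNN y. ennreal \<bar>g y\<bar>) = ennreal (L1 g)" using g by (intro nn_integral_eq_integral) auto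
    also have "ennreal C * ennreal (L1 g) = ennreal (C * L1 g)" using C by (intro ennreal_mult[symmetric]) auto
    finally show "(LBNN x. ennreal \<bar>cop K a b g x\<bar> * ind (- cball c (4 * \<rho>)) x) \<le> ennreal (C * L1 g)" .
  qed
qed

end

section \<open>Calderon-Zygmund decomposition and weak type\<close>

lemma emeasure_ge_square_le:
  fixes u :: "'a \<Rightarrow> real"
  assumes [measurable]: "u \<in> borel_measurable M" and t: "0 < t"
    and le: "(\<integral>\<^sup>+x. ennreal (u x ^ 2) \<partial>M) \<le> ennreal B"
  shows "emeasure M {x\<in>space M. t < \<bar>u x\<bar>} \<le> ennreal (B / t ^ 2)"
proof -
  have "emeasure M {x\<in>space M. t < \<bar>u x\<bar>} \<le> emeasure M {x\<in>space M. 1 \<le> ennreal (1 / t ^ 2) * ennreal (u x ^ 2)}"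
  proof (intro emeasure_mono)
    show "{x \<in> space M. t < \<bar>u x\<bar>} \<subseteq> {x \<in> space M. 1 \<le> ennreal (1 / t ^ 2) * ennreal (u x ^ 2)}"
    proof safe
      fix x assume "t < \<bar>u x\<bar>"
      then have "t ^ 2 \<le> \<bar>u x\<bar> ^ 2" using t by (intro power_mono) auto
      then have "1 \<le> 1 / t ^ 2 * u x ^ 2" using t by (simp add: field_simps)
      then show "1 \<le> ennreal (1 / t ^ 2) * ennreal (u x ^ 2)"
        by (subst ennreal_mult[symmetric]) (auto simp: ennreal_le_iff simp flip: ennreal_1)
    qed
  qed measurable
  also have "\<dots> \<le> ennreal (1 / t ^ 2) * (\<integral>\<^sup>+x. ennreal (u x ^ 2) * ind (space M) x \<partial>M)"
    by (intro nn_integral_Markov_inequality) measurable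
  also have "\<dots> = ennreal (1 / t ^ 2) * (\<integral>\<^sup>+x. ennreal (u x ^ 2) \<partial>M)"
    by (intro arg_cong[where f = "\<lambda>x. ennreal (1 / t ^ 2) * x"] nn_integral_cong) auto
  also have "\<dots> \<le> ennreal (1 / t ^ 2) * ennreal B" by (intro mult_left_mono le) auto
  also have "\<dots> = ennreal (B / t ^ 2)" using t by (subst ennreal_mult'[symmetric]) auto
  finally show ?thesis .
qed

lemma emeasure_ge_integral_le:
  fixes u :: "'a \<Rightarrow> real"
  assumes [measurable]: "u \<in> borel_measurable M" "E \<in> sets M" and t: "0 < t"
    and le: "(\<integral>\<^sup>+x. ennreal \<bar>u x\<bar> * ind (- E) x \<partial>M) \<le> ennreal B"
  shows "emeasure M {x\<in>space M. t < \<bar>u x\<bar>} \<le> emeasure M E + ennreal (B / t)"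
proof -
  have "emeasure M {x\<in>space M. t < \<bar>u x\<bar>}
    \<le> emeasure M (E \<union> {x\<in>space M - E. 1 \<le> ennreal (1 / t) * ennreal \<bar>u x\<bar>})"
  proof (intro emeasure_mono)
    show "{x \<in> space M. t < \<bar>u x\<bar>} \<subseteq> E \<union> {x \<in> space M - E. 1 \<le> ennreal (1 / t) * ennreal \<bar>u x\<bar>}"
    proof safe
      fix x assume "t < \<bar>u x\<bar>"
      then have "1 \<le> 1 / t * \<bar>u x\<bar>" using t by (simp add: field_simps)
      then show "1 \<le> ennreal (1 / t) * ennreal \<bar>u x\<bar>"
        using t by (subst ennreal_mult[symmetric]) (auto simp: ennreal_le_iff simp flip: ennreal_1)
    qed
  qed measurable
  also have "\<dots> \<le> emeasure M E + emeasure M {x\<in>space M - E. 1 \<le> ennreal (1 / t) * ennreal \<bar>u x\<bar>}"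
    by (intro emeasure_subadditive) measurable
  also have "emeasure M {x\<in>space M - E. 1 \<le> ennreal (1 / t) * ennreal \<bar>u x\<bar>} \<le> ennreal (1 / t) * (\<integral>\<^sup>+x. ennreal \<bar>u x\<bar> * ind (space M - E) x \<partial>M)"
    by (intro nn_integral_Markov_inequality) measurable
  also have "(\<integral>\<^sup>+x. ennreal \<bar>u x\<bar> * ind (space M - E) x \<partial>M) = (\<integral>\<^sup>+x. ennreal \<bar>u x\<bar> * ind (- E) x \<partial>M)"
    by (intro nn_integral_cong) (auto simp: indicator_def)
  also have "ennreal (1 / t) * \<dots> \<le> ennreal (1 / t) * ennreal B" by (intro mult_left_mono le) auto
  also have "\<dots> = ennreal (B / t)" using t by (subst ennreal_mult'[symmetric]) auto
  finally show ?thesis by (simp add: add_left_mono)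
qed

text \<open>A point of some \<open>B j\<close> is assigned to that \<open>j\<close>; any other point
  is assigned to the first \<open>E i\<close> that contains it.\<close>

lemma exists_disjoint_enlargement:
  fixes B E :: "nat \<Rightarrow> 'a set"
  assumes disj: "\<And>i j. i \<in> I \<Longrightarrow> j \<in> I \<Longrightarrow> i \<noteq> j \<Longrightarrow> B i \<inter> B j = {}"
    and sub: "\<And>i. i \<in> I \<Longrightarrow> B i \<subseteq> E i"
    and sets: "\<And>i. i \<in> I \<Longrightarrow> B i \<in> sets M" "\<And>i. i \<in> I \<Longrightarrow> E i \<in> sets M"
  obtains Q where "disjoint_family Q" "\<And>i. Q i \<in> sets M" "\<And>i. i \<in> I \<Longrightarrow> B i \<subseteq> Q i"
    "\<And>i. i \<in> I \<Longrightarrow> Q i \<subseteq> E i" "\<And>i. i \<notin> I \<Longrightarrow> Q i = {}" "(\<Union>i. Q i) = (\<Union>i\<in>I. E i)"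
proof -
  define Q where "Q i = (if i \<in> I then B i \<union> (E i - (\<Union>j\<in>I. B j) - (\<Union>j\<in>I \<inter> {..<i}. E j)) else {})" for i
  show thesis
  proof
    show "disjoint_family Q" unfolding disjoint_family_on_def
    proof (intro ballI impI)
      fix i j :: nat assume "i \<noteq> j"
      then show "Q i \<inter> Q j = {}" using disj[of i j] by (cases "i < j") (auto simp: Q_def not_less)
    qed
    show "Q i \<in> sets M" for i unfolding Q_def using sets by (auto intro!: sets.Un sets.Diff sets.countable_UN')
    show "B i \<subseteq> Q i" "Q i \<subseteq> E i" if "i \<in> I" for i using that sub[OF that] by (auto simp: Q_def)
    show "Q i = {}" if "i \<notin> I" for i using that by (simp add: Q_def)
    show "(\<Union>i. Q i) = (\<Union>i\<in>I. E i)"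
    proof (intro equalityI subsetI)
      fix x assume "x \<in> (\<Union>i. Q i)"
      then show "x \<in> (\<Union>i\<in>I. E i)" using sub by (auto simp: Q_def split: if_splits)
    next
      fix x assume "x \<in> (\<Union>i\<in>I. E i)"
      then have ex: "\<exists>i. i \<in> I \<and> x \<in> E i" by auto
      show "x \<in> (\<Union>i. Q i)"
      proof (cases "x \<in> (\<Union>j\<in>I. B j)")
        case True
        then show ?thesis by (auto simp: Q_def)
      next
        case False
        define i where "i = (LEAST i. i \<in> I \<and> x \<in> E i)"
        have i: "i \<in> I" "x \<in> E i" using LeastI_ex[OF ex] by (auto simp: i_def)
        have "\<not> (j \<in> I \<and> x \<in> E j)" if "j < i" for j using not_less_Least[OF that[unfolded i_def]] .
        then have "x \<in> Q i" using i False by (auto simp: Q_def)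
        then show ?thesis by blast
      qed
    qed
  qed
qed

context cz
begin

text \<open>
  Calderon-Zygmund decomposition in which the role of the dyadic cubes is played by disjoint sets
  between the selected Vitali balls and their fivefold enlargements.
\<close>

lemma cop_weak_hoelder:
  obtains C where "0 < C"
    "\<And>a b H R f l. 0 < a \<Longrightarrow> a < b \<Longrightarrow> hoelder_supp H R f \<Longrightarrow> 0 < l \<Longrightarrow>
      emeasure lborel {x. l < \<bar>cop K a b f x\<bar>} \<le> ennreal (C * L1 f / l)"
proof -
  let ?n = "DIM('a)" and ?V = "ball_vol TYPE('a)"
  obtain C2 where C2: "0 < C2"
    "\<And>a b M f. 0 < a \<Longrightarrow> a < b \<Longrightarrow> integrable lborel f \<Longrightarrow> (\<And>x. \<bar>f x\<bar> \<le> M) \<Longrightarrow>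
      (LBNN x. ennreal (cop K a b f x ^ 2)) \<le> ennreal (C2 * (LBINT x. f x ^ 2))" using cop_L2 by blast
  obtain C3 where C3: "0 < C3"
    "\<And>a b c \<rho> g. 0 < a \<Longrightarrow> 0 < \<rho> \<Longrightarrow> integrable lborel g \<Longrightarrow> (LBINT y. g y) = 0 \<Longrightarrow>
      (\<And>y. y \<notin> cball c \<rho> \<Longrightarrow> g y = 0) \<Longrightarrow>
      (LBNN x. ennreal \<bar>cop K a b g x\<bar> * ind (- cball c (4 * \<rho>)) x) \<le> ennreal (C3 * L1 g)" using cop_atom by blast
  show thesis
  proof
    \<comment> \<open>The first term is the measure of the exceptional balls, of radius 20 = 4 * 5
      because atoms live on fivefold balls and are estimated off four times those. The second is
      Markov's inequality for the bad part at height l / 2, the third Chebyshev's for the good part,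
      bounded by \<open>5 ^ ?n * l\<close> and with L^1 norm at most \<open>3 * N\<close>.\<close>
    show "0 < 20 ^ ?n + 4 * C3 + 12 * C2 * 5 ^ ?n" using C2 C3 by (intro add_pos_pos mult_pos_pos) auto
    fix a b H R l :: real and f :: "'a \<Rightarrow> real"
    assume a: "0 < a" and ab: "a < b" and f: "hoelder_supp H R f" and l: "0 < l"
    have f_int: "integrable lborel f" by (rule hoelder_supp_integrable[OF f])
    have [measurable]: "f \<in> borel_measurable borel" using f_int by auto
    define N where "N = L1 f"
    have N: "0 \<le> N" by (simp add: N_def)
    have f_abs: "integrable lborel (\<lambda>x. \<bar>f x\<bar>)" using f_int by simp
    obtain c :: "nat \<Rightarrow> 'a" and r :: "nat \<Rightarrow> real" and I :: "nat set" where sel: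
      "\<And>i. i \<in> I \<Longrightarrow> 0 < r i"
      "\<And>i j. i \<in> I \<Longrightarrow> j \<in> I \<Longrightarrow> i \<noteq> j \<Longrightarrow> cball (c i) (r i) \<inter> cball (c j) (r j) = {}"
      "\<And>i. i \<in> I \<Longrightarrow> (LBINT y. ind (cball (c i) (5 * r i)) y * \<bar>f y\<bar>) \<le> l * (?V * (5 * r i) ^ ?n)"
      "\<And>x t. 0 < t \<Longrightarrow> l * (?V * t ^ ?n) < (LBINT y. ind (cball x t) y * \<bar>f y\<bar>)
          \<Longrightarrow> x \<in> (\<Union>i\<in>I. cball (c i) (5 * r i))"
      "\<And>s. 0 \<le> s \<Longrightarrow> emeasure lborel (\<Union>i\<in>I. cball (c i) (s * r i)) \<le> ennreal (s ^ ?n * N / l)"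
      by (rule vitali_selection[OF f_abs abs_ge_zero l, folded N_def]) (rule that)
    obtain Q where Q: "disjoint_family Q" "\<And>i. Q i \<in> sets lborel" "\<And>i. i \<in> I \<Longrightarrow> cball (c i) (r i) \<subseteq> Q i"
      "\<And>i. i \<in> I \<Longrightarrow> Q i \<subseteq> cball (c i) (5 * r i)" "\<And>i. i \<notin> I \<Longrightarrow> Q i = {}"
      "(\<Union>i. Q i) = (\<Union>i\<in>I. cball (c i) (5 * r i))"
    proof (rule exists_disjoint_enlargement[where B = "\<lambda>i. cball (c i) (r i)" and E = "\<lambda>i. cball (c i) (5 * r i)" and I = I and M = lborel])
      show "cball (c i) (r i) \<subseteq> cball (c i) (5 * r i)" if "i \<in> I" for i
        using sel(1)[OF that] by (intro subset_cball) auto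
    qed (use sel(2) in auto)
    have [measurable]: "Q i \<in> sets borel" for i using Q(2)[of i] by simp
    define E where "E = (\<Union>i. Q i)"
    let ?q = "\<lambda>i. LBINT y. ind (Q i) y * \<bar>f y\<bar>"
    have [measurable]: "E \<in> sets borel" unfolding E_def by measurable
    have E_fin: "emeasure lborel E < \<infinity>"
      unfolding E_def Q(6) using sel(5)[of 5] by (simp add: le_less_trans[OF _ ennreal_less_top])
    have Q_fin: "emeasure lborel (Q i) < \<infinity>" for i
      using E_fin emeasure_mono[of "Q i" E lborel] by (auto simp: E_def intro: le_less_trans)
    have int_Q: "integrable lborel (\<lambda>y. ind (Q i) y * f y)" for i
      using integrable_real_mult_indicator[of "Q i" lborel f] f_int by (simp add: mult.commute)
    have int_Qabs: "integrable lborel (\<lambda>y. ind (Q i) y * \<bar>f y\<bar>)" for i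
      using integrable_real_mult_indicator[of "Q i" lborel "\<lambda>y. \<bar>f y\<bar>"] f_abs by (simp add: mult.commute)
    have int_1Q: "integrable lborel (ind (Q i) :: 'a \<Rightarrow> real)" for i
      using Q_fin by (intro integrable_real_indicator) auto
    define m where "m i = (LBINT y. ind (Q i) y * f y) / measure lborel (Q i)" for i
    have Q_pos: "?V * r i ^ ?n \<le> measure lborel (Q i)" if "i \<in> I" for i
    proof -
      have "measure lborel (cball (c i) (r i)) \<le> measure lborel (Q i)"
        using Q(3)[OF that] Q_fin[of i] by (intro measure_mono_fmeasurable) (auto simp: fmeasurable_def)
      then show ?thesis using sel(1)[OF that] by (simp add: content_cball)
    qed
    have m_measure: "\<bar>m i\<bar> * measure lborel (Q i) \<le> ?q i" for i
    proof -
      have "\<bar>m i\<bar> * measure lborel (Q i) \<le> \<bar>(LBINT y. ind (Q i) y * f y)\<bar>" by (simp add: m_def abs_divide)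
      also have "\<dots> \<le> (LBINT y. \<bar>ind (Q i) y * f y\<bar>)" by (rule integral_abs_bound)
      finally show ?thesis by (simp add: abs_mult)
    qed
    \<comment> \<open>The set \<open>Q i\<close> contains a ball of radius \<open>r i\<close> and
      lies in one of radius \<open>5 * r i\<close>, over which the mean is at most \<open>l\<close>;
      the ratio of the volumes is \<open>5 ^ ?n\<close>.\<close>
    have m_bound: "\<bar>m i\<bar> \<le> 5 ^ ?n * l" if i: "i \<in> I" for i
    proof -
      have pos: "0 < ?V * r i ^ ?n" using sel(1)[OF i] by simp
      have "\<bar>m i\<bar> * (?V * r i ^ ?n) \<le> \<bar>m i\<bar> * measure lborel (Q i)" by (intro mult_left_mono Q_pos i) auto
      also have "\<dots> \<le> ?q i" by (rule m_measure)
      also have "\<dots> \<le> (LBINT y. ind (cball (c i) (5 * r i)) y * \<bar>f y\<bar>)"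
        using integrable_real_mult_indicator[of "cball (c i) (5 * r i)" lborel "\<lambda>y. \<bar>f y\<bar>"] f_abs Q(4)[OF i]
        by (intro integral_mono int_Qabs) (auto simp: mult.commute[of "ind _ _"] split: split_indicator)
      also have "\<dots> \<le> l * (?V * (5 * r i) ^ ?n)" by (rule sel(3)[OF i])
      also have "\<dots> = 5 ^ ?n * l * (?V * r i ^ ?n)" by (simp add: power_mult_distrib)
      finally show ?thesis using pos by (simp only: mult_le_cancel_right)
    qed
    define \<beta> where "\<beta> i y = ind (Q i) y * (f y - m i)" for i y
    have \<beta>_int: "integrable lborel (\<beta> i)" for i unfolding \<beta>_def[abs_def] right_diff_distrib using int_Q int_1Q
      by (intro Bochner_Integration.integrable_diff integrable_mult_left)
    have [measurable]: "\<beta> i \<in> borel_measurable borel" for i using \<beta>_int[of i] by auto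
    have \<beta>_0: "(LBINT y. \<beta> i y) = 0" for i
    proof (cases "i \<in> I")
      case True
      have "(LBINT y. \<beta> i y) = (LBINT y. ind (Q i) y * f y) - measure lborel (Q i) * m i"
        unfolding \<beta>_def[abs_def] right_diff_distrib using int_Q int_1Q by simp
      moreover have "measure lborel (Q i) \<noteq> 0"
      proof -
        have "0 < ?V * r i ^ ?n" using sel(1)[OF True] by simp
        then show ?thesis using Q_pos[OF True] by linarith
      qed
      ultimately show ?thesis by (simp add: m_def)
    next
      case False
      then show ?thesis by (simp add: \<beta>_def Q(5))
    qed
    have \<beta>_abs: "(L1 (\<beta> i)) \<le> 2 * ?q i" for i
    proof -
      have "(L1 (\<beta> i)) \<le> (LBINT y. ind (Q i) y * \<bar>f y\<bar> + \<bar>m i\<bar> * ind (Q i) y)"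
      proof (rule integral_mono)
        show "integrable lborel (\<lambda>y. \<bar>\<beta> i y\<bar>)" by (intro integrable_abs \<beta>_int)
        show "integrable lborel (\<lambda>y. ind (Q i) y * \<bar>f y\<bar> + \<bar>m i\<bar> * ind (Q i) y)"
          by (intro Bochner_Integration.integrable_add integrable_mult_right int_Qabs int_1Q)
        show "\<bar>\<beta> i y\<bar> \<le> ind (Q i) y * \<bar>f y\<bar> + \<bar>m i\<bar> * ind (Q i) y" for y by (auto simp: \<beta>_def split: split_indicator)
      qed
      also have "\<dots> = ?q i + \<bar>m i\<bar> * measure lborel (Q i)"
        using int_Qabs[of i] int_1Q[of i] by simp
      finally show ?thesis using m_measure[of i] by simp
    qed
    define s where "s y = (\<Sum>i. \<beta> i y)" for y
    have s_Q: "s y = \<beta> i y" "finite {j. \<beta> j y \<noteq> 0}" if "y \<in> Q i" for i y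
    proof -
      have 0: "\<beta> j y = 0" if "j \<noteq> i" for j
        using Q(1) that \<open>y \<in> Q i\<close> by (auto simp: \<beta>_def disjoint_family_on_def indicator_def)
      then have "s y = (\<Sum>j\<in>{i}. \<beta> j y)" unfolding s_def by (intro suminf_finite) auto
      then show "s y = \<beta> i y" by simp
      show "finite {j. \<beta> j y \<noteq> 0}" by (rule finite_subset[of _ "{i}"]) (use 0 in auto)
    qed
    have s_E: "s y = 0" "\<And>i. \<beta> i y = 0" if "y \<notin> E" for y
    proof -
      show "\<beta> i y = 0" for i using that by (auto simp: \<beta>_def E_def)
      then show "s y = 0" by (simp add: s_def)
    qed
    \<comment> \<open>By disjointness at most one summand is nonzero at a point. So all partial sums
      obey the bound for \<open>s\<close>, which provides the dominating function for passing the
      infinite sum through the operator.\<close>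
    have partial: "(\<Sum>i<k. \<beta> i y) = 0 \<or> (\<Sum>i<k. \<beta> i y) = s y" for k y
    proof (cases "y \<in> E")
      case True
      then obtain i where i: "y \<in> Q i" by (auto simp: E_def)
      have 0: "\<beta> j y = 0" if "j \<noteq> i" for j
        using Q(1) that i by (auto simp: \<beta>_def disjoint_family_on_def indicator_def)
      have "(\<Sum>j<k. \<beta> j y) = (\<Sum>j<k. if j = i then \<beta> i y else 0)" using 0 by (intro sum.cong) auto
      then show ?thesis using s_Q(1)[OF i] by (simp add: sum.delta)
    qed (simp add: s_E)
    have summable_\<beta>: "summable (\<lambda>i. \<beta> i y)" for y
    proof (cases "y \<in> E")
      case True
      then obtain i where "y \<in> Q i" by (auto simp: E_def)
      then show ?thesis using s_Q(2) by (intro summable_finite[of "{j. \<beta> j y \<noteq> 0}"]) auto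
    qed (simp add: s_E)
    have lim_s: "(\<lambda>k. \<Sum>i<k. \<beta> i y) \<longlonglongrightarrow> s y" for y unfolding s_def by (rule summable_LIMSEQ[OF summable_\<beta>])
    have [measurable]: "s \<in> borel_measurable borel" unfolding s_def[abs_def] by measurable
    define w where "w y = \<bar>f y\<bar> + 5 ^ ?n * l * ind E y" for y
    have w_int: "integrable lborel w" unfolding w_def using f_abs E_fin
      by (intro Bochner_Integration.integrable_add integrable_mult_right integrable_real_indicator) auto
    have s_w: "\<bar>s y\<bar> \<le> w y" for y
    proof (cases "y \<in> E")
      case True
      then obtain i where i: "y \<in> Q i" by (auto simp: E_def)
      then have "i \<in> I" using Q(5) by blast
      then have "\<bar>m i\<bar> \<le> 5 ^ ?n * l" by (rule m_bound)
      then show ?thesis using s_Q(1)[OF i] i True by (auto simp: w_def \<beta>_def)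
    qed (use l in \<open>simp add: s_E w_def\<close>)
    have s_int: "integrable lborel s"
      by (rule Bochner_Integration.integrable_bound[OF w_int]) (auto intro!: AE_I2 order_trans[OF s_w])
    have s_abs: "L1 s \<le> 2 * N"
    proof -
      have "ennreal (L1 s) = (LBNN y. ennreal \<bar>s y\<bar>)" using s_int by (intro nn_integral_eq_integral[symmetric]) auto
      also have "\<dots> \<le> (LBNN y. (\<Sum>i. ennreal \<bar>\<beta> i y\<bar>))"
      proof (intro nn_integral_mono)
        fix y
        show "ennreal \<bar>s y\<bar> \<le> (\<Sum>i. ennreal \<bar>\<beta> i y\<bar>)"
        proof (cases "y \<in> E")
          case True
          then obtain i where i: "y \<in> Q i" by (auto simp: E_def)
          have "ennreal \<bar>\<beta> i y\<bar> = (\<Sum>i\<in>{i}. ennreal \<bar>\<beta> i y\<bar>)" by simp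
          also have "\<dots> \<le> (\<Sum>i. ennreal \<bar>\<beta> i y\<bar>)" by (intro sum_le_suminf) auto
          finally show ?thesis using s_Q(1)[OF i] by simp
        qed (simp add: s_E)
      qed
      also have "\<dots> = (\<Sum>i. (LBNN y. ennreal \<bar>\<beta> i y\<bar>))" by (intro nn_integral_suminf) measurable
      also have "\<dots> = (\<Sum>i. ennreal (L1 (\<beta> i)))"
        using \<beta>_int by (intro arg_cong[where f = suminf] ext nn_integral_eq_integral) auto
      also have "\<dots> \<le> (\<Sum>i. ennreal 2 * ennreal (?q i))"
        by (intro suminf_le) (auto simp: ennreal_mult'[symmetric] intro!: ennreal_leI \<beta>_abs simp del: ennreal_numeral)
      also have "\<dots> = ennreal 2 * (\<Sum>i. ennreal (?q i))" by (rule ennreal_suminf_cmult)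
      also have "\<dots> \<le> ennreal 2 * ennreal N"
        unfolding N_def by (intro mult_left_mono suminf_integral_disjoint_le f_int Q(1)) auto
      also have "\<dots> = ennreal (2 * N)" by (subst ennreal_mult') auto
      finally show ?thesis using N by (subst (asm) ennreal_le_iff) auto
    qed
    define E' where "E' = (\<Union>i\<in>I. cball (c i) (20 * r i))"
    have [measurable]: "E' \<in> sets borel" unfolding E'_def by (intro sets.countable_UN') auto
    have Ts_le: "ennreal \<bar>cop K a b s x\<bar> \<le> (\<Sum>i. ennreal \<bar>cop K a b (\<beta> i) x\<bar>)" for x
    proof (rule LIMSEQ_le_const2)
      have conv: "(\<lambda>k. (LBINT y. ctrunc K a b (x - y) * (\<Sum>i<k. \<beta> i y))) \<longlonglongrightarrow> cop K a b s x" unfolding cop_def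
      proof (rule integral_dominated_convergence[where w = "\<lambda>y. A / a ^ ?n * w y"])
        show "integrable lborel (\<lambda>y. A / a ^ ?n * w y)" using w_int by simp
        show "AE y in lborel. (\<lambda>k. ctrunc K a b (x - y) * (\<Sum>i<k. \<beta> i y)) \<longlonglongrightarrow> ctrunc K a b (x - y) * s y"
          by (intro AE_I2 tendsto_mult_left lim_s)
        show "AE y in lborel. norm (ctrunc K a b (x - y) * (\<Sum>i<k. \<beta> i y)) \<le> A / a ^ ?n * w y" for k
        proof (rule AE_I2)
          fix y
          have "\<bar>\<Sum>i<k. \<beta> i y\<bar> \<le> w y" using partial[of y k] s_w[of y] by auto
          then have "A / a ^ ?n * \<bar>\<Sum>i<k. \<beta> i y\<bar> \<le> A / a ^ ?n * w y" using A_pos a by (intro mult_left_mono) auto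
          then show "norm (ctrunc K a b (x - y) * (\<Sum>i<k. \<beta> i y)) \<le> A / a ^ ?n * w y"
            using ctrunc_mult_bound[OF a, of b "x - y" "\<Sum>i<k. \<beta> i y"] by simp
        qed
      qed measurable
      have eq: "(LBINT y. ctrunc K a b (x - y) * (\<Sum>i<k. \<beta> i y)) = (\<Sum>i<k. cop K a b (\<beta> i) x)" for k
        unfolding cop_def sum_distrib_left using \<beta>_int a by (intro Bochner_Integration.integral_sum cop_integrable)
      show "(\<lambda>k. ennreal \<bar>\<Sum>i<k. cop K a b (\<beta> i) x\<bar>) \<longlonglongrightarrow> ennreal \<bar>cop K a b s x\<bar>"
        using conv unfolding eq by (intro tendsto_ennrealI tendsto_rabs)
      show "\<exists>N. \<forall>k\<ge>N. ennreal \<bar>\<Sum>i<k. cop K a b (\<beta> i) x\<bar> \<le> (\<Sum>i. ennreal \<bar>cop K a b (\<beta> i) x\<bar>)"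
      proof (intro exI[of _ 0] allI impI)
        fix k :: nat
        have "ennreal \<bar>\<Sum>i<k. cop K a b (\<beta> i) x\<bar> \<le> ennreal (\<Sum>i<k. \<bar>cop K a b (\<beta> i) x\<bar>)" by (intro ennreal_leI sum_abs)
        also have "\<dots> = (\<Sum>i<k. ennreal \<bar>cop K a b (\<beta> i) x\<bar>)" by (intro sum_ennreal[symmetric]) auto
        also have "\<dots> \<le> (\<Sum>i. ennreal \<bar>cop K a b (\<beta> i) x\<bar>)" by (intro sum_le_suminf) auto
        finally show "ennreal \<bar>\<Sum>i<k. cop K a b (\<beta> i) x\<bar> \<le> (\<Sum>i. ennreal \<bar>cop K a b (\<beta> i) x\<bar>)" .
      qed
    qed
    have Ts: "(LBNN x. ennreal \<bar>cop K a b s x\<bar> * ind (- E') x) \<le> ennreal (2 * C3 * N)"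
    proof -
      have "(LBNN x. ennreal \<bar>cop K a b s x\<bar> * ind (- E') x)
        \<le> (LBNN x. (\<Sum>i. ennreal \<bar>cop K a b (\<beta> i) x\<bar> * ind (- E') x))"
        unfolding ennreal_suminf_multc by (intro nn_integral_mono mult_right_mono Ts_le) auto
      also have "\<dots> = (\<Sum>i. (LBNN x. ennreal \<bar>cop K a b (\<beta> i) x\<bar> * ind (- E') x))"
        by (intro nn_integral_suminf) measurable
      also have "\<dots> \<le> (\<Sum>i. ennreal (2 * C3) * ennreal (?q i))"
      proof (intro suminf_le)
        fix i
        show "(LBNN x. ennreal \<bar>cop K a b (\<beta> i) x\<bar> * ind (- E') x)
          \<le> ennreal (2 * C3) * ennreal (?q i)"
        proof (cases "i \<in> I")
          case True
          have "cball (c i) (4 * (5 * r i)) \<subseteq> E'" using True by (auto simp: E'_def)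
          then have "(LBNN x. ennreal \<bar>cop K a b (\<beta> i) x\<bar> * ind (- E') x)
            \<le> (LBNN x. ennreal \<bar>cop K a b (\<beta> i) x\<bar> * ind (- cball (c i) (4 * (5 * r i))) x)"
            by (intro nn_integral_mono mult_left_mono indicator_leI) auto
          also have "\<dots> \<le> ennreal (C3 * (L1 (\<beta> i)))"
          proof (rule C3(2))
            show "\<beta> i y = 0" if "y \<notin> cball (c i) (5 * r i)" for y
            proof -
              have "y \<notin> Q i" using that Q(4)[OF True] by blast
              then show ?thesis by (simp add: \<beta>_def)
            qed
          qed (use a \<beta>_int \<beta>_0 sel(1)[OF True] in auto)
          also have "C3 * (L1 (\<beta> i)) \<le> C3 * (2 * ?q i)"
            using C3 by (intro mult_left_mono \<beta>_abs) auto
          finally have "(LBNN x. ennreal \<bar>cop K a b (\<beta> i) x\<bar> * ind (- E') x)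
            \<le> ennreal (C3 * (2 * ?q i))" by (simp add: ennreal_leI)
          also have "\<dots> = ennreal (2 * C3) * ennreal (?q i)"
            using C3 by (subst ennreal_mult'[symmetric]) (auto simp: mult_ac)
          finally show ?thesis .
        next
          case False
          then have "\<beta> i = (\<lambda>_. 0)" by (simp add: \<beta>_def Q(5) fun_eq_iff)
          then show ?thesis by (simp add: cop_def)
        qed
      qed auto
      also have "\<dots> = ennreal (2 * C3) * (\<Sum>i. ennreal (?q i))" by (rule ennreal_suminf_cmult)
      also have "\<dots> \<le> ennreal (2 * C3) * ennreal N"
        unfolding N_def by (intro mult_left_mono suminf_integral_disjoint_le f_int Q(1)) auto
      also have "\<dots> = ennreal (2 * C3 * N)" using C3 by (subst ennreal_mult') auto
      finally show ?thesis .
    qed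
    define g where "g y = f y - s y" for y
    have g_int: "integrable lborel g" unfolding g_def[abs_def] using f_int s_int by simp
    have [measurable]: "g \<in> borel_measurable borel" using g_int by auto
    \<comment> \<open>Inside \<open>Q i\<close> the good part is the constant mean
      \<open>m i\<close>. Outside \<open>E\<close> it is \<open>f\<close>, and no ball centred there
      has mean above \<open>l\<close>.\<close>
    have g_bound: "\<bar>g y\<bar> \<le> 5 ^ ?n * l" for y
    proof (cases "y \<in> E")
      case True
      then obtain i where i: "y \<in> Q i" by (auto simp: E_def)
      then have "i \<in> I" using Q(5) by blast
      then show ?thesis using m_bound s_Q(1)[OF i] i by (simp add: g_def \<beta>_def)
    next
      case False
      have "\<bar>f y\<bar> \<le> l"
      proof (rule abs_le_of_averages[OF hoelder_supp_continuous[OF f] f_int])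
        fix t :: real assume "0 < t"
        then show "(LBINT z. ind (cball y t) z * \<bar>f z\<bar>) \<le> l * (?V * t ^ ?n)"
          using sel(4)[of t y] False unfolding E_def Q(6) not_less[symmetric] by blast
      qed
      also have "l \<le> 5 ^ ?n * l" using l by simp
      finally show ?thesis using False by (simp add: g_def s_E)
    qed
    have g_abs: "L1 g \<le> 3 * N"
    proof -
      have "L1 g \<le> (LBINT y. \<bar>f y\<bar> + \<bar>s y\<bar>)" using g_int f_int s_int by (intro integral_mono) (auto simp: g_def)
      also have "\<dots> = N + L1 s" using f_int s_int by (simp add: N_def)
      finally show ?thesis using s_abs by simp
    qed
    have g2: "(LBINT y. g y ^ 2) \<le> 5 ^ ?n * l * (3 * N)"
    proof -
      have "(LBINT y. g y ^ 2) \<le> (LBINT y. 5 ^ ?n * l * \<bar>g y\<bar>)"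
      proof (rule integral_mono')
        fix y
        have "\<bar>g y\<bar> * \<bar>g y\<bar> \<le> 5 ^ ?n * l * \<bar>g y\<bar>" by (intro mult_right_mono g_bound) auto
        then show "g y ^ 2 \<le> 5 ^ ?n * l * \<bar>g y\<bar>" by (simp add: power2_eq_square)
      qed (use g_int l in auto)
      also have "\<dots> = 5 ^ ?n * l * L1 g" by simp
      also have "\<dots> \<le> 5 ^ ?n * l * (3 * N)" using l by (intro mult_left_mono g_abs) auto
      finally show ?thesis .
    qed
    have good: "emeasure lborel {x. l / 2 < \<bar>cop K a b g x\<bar>} \<le> ennreal (12 * C2 * 5 ^ ?n * N / l)"
    proof -
      have "(LBNN x. ennreal (cop K a b g x ^ 2)) \<le> ennreal (C2 * (LBINT x. g x ^ 2))"
        by (rule C2(2)[OF a ab g_int g_bound])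
      also have "\<dots> \<le> ennreal (C2 * (5 ^ ?n * l * (3 * N)))" using C2 by (intro ennreal_leI mult_left_mono g2) auto
      finally have "emeasure lborel {x\<in>space lborel. l / 2 < \<bar>cop K a b g x\<bar>} \<le> ennreal (C2 * (5 ^ ?n * l * (3 * N)) / (l / 2) ^ 2)"
        using l by (intro emeasure_ge_square_le) auto
      also have "C2 * (5 ^ ?n * l * (3 * N)) / (l / 2) ^ 2 = 12 * C2 * 5 ^ ?n * N / l"
        using l by (simp add: power2_eq_square field_simps)
      finally show ?thesis by simp
    qed
    have bad: "emeasure lborel {x. l / 2 < \<bar>cop K a b s x\<bar>} \<le> ennreal (20 ^ ?n * N / l) + ennreal (4 * C3 * N / l)"
    proof -
      have "emeasure lborel {x\<in>space lborel. l / 2 < \<bar>cop K a b s x\<bar>} \<le> emeasure lborel E' + ennreal (2 * C3 * N / (l / 2))"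
        using l Ts by (intro emeasure_ge_integral_le) auto
      also have "\<dots> \<le> ennreal (20 ^ ?n * N / l) + ennreal (2 * C3 * N / (l / 2))"
        unfolding E'_def by (intro add_right_mono sel(5)) auto
      finally show ?thesis by (simp add: mult.assoc)
    qed
    have split: "cop K a b f x = cop K a b g x + cop K a b s x" for x
      using cop_diff[OF a f_int s_int, of b x] by (simp add: g_def[abs_def])
    have "emeasure lborel {x. l < \<bar>cop K a b f x\<bar>}
      \<le> emeasure lborel ({x. l / 2 < \<bar>cop K a b g x\<bar>} \<union> {x. l / 2 < \<bar>cop K a b s x\<bar>})"
    proof (intro emeasure_mono subsetI)
      fix x assume "x \<in> {x. l < \<bar>cop K a b f x\<bar>}"
      then have "l < \<bar>cop K a b g x + cop K a b s x\<bar>" by (simp add: split)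
      then show "x \<in> {x. l / 2 < \<bar>cop K a b g x\<bar>} \<union> {x. l / 2 < \<bar>cop K a b s x\<bar>}" by (auto simp: not_less)
    qed measurable
    also have "\<dots> \<le> emeasure lborel {x. l / 2 < \<bar>cop K a b g x\<bar>} + emeasure lborel {x. l / 2 < \<bar>cop K a b s x\<bar>}"
      by (intro emeasure_subadditive) measurable
    also have "\<dots> \<le> ennreal (12 * C2 * 5 ^ ?n * N / l) + (ennreal (20 ^ ?n * N / l) + ennreal (4 * C3 * N / l))"
      by (intro add_mono good bad)
    also have "\<dots> = ennreal (12 * C2 * 5 ^ ?n * N / l + (20 ^ ?n * N / l + 4 * C3 * N / l))" using C2 C3 N l by simp
    also have "12 * C2 * 5 ^ ?n * N / l + (20 ^ ?n * N / l + 4 * C3 * N / l) = (20 ^ ?n + 4 * C3 + 12 * C2 * 5 ^ ?n) * N / l"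
      by (simp add: add_divide_distrib distrib_right)
    finally show "emeasure lborel {x. l < \<bar>cop K a b f x\<bar>}
        \<le> ennreal ((20 ^ ?n + 4 * C3 + 12 * C2 * 5 ^ ?n) * L1 f / l)" by (simp add: N_def)
  qed
qed

text \<open>For fixed \<open>a\<close> the operator maps L^1 boundedly into bounded functions. An
  approximation fine enough in terms of \<open>a\<close> therefore changes the image by at most l /
  2 everywhere, and the constant stays free of \<open>a\<close>. The case of norm 0 is separate
  because the tolerance must be positive.\<close>

lemma cop_weak:
  obtains C where "0 < C"
    "\<And>a b f l. 0 < a \<Longrightarrow> a < b \<Longrightarrow> integrable lborel f \<Longrightarrow> 0 < l \<Longrightarrow>
      emeasure lborel {x. l < \<bar>cop K a b f x\<bar>} \<le> ennreal (C * L1 f / l)"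
proof -
  obtain C where C: "0 < C"
    "\<And>a b H R f l. 0 < a \<Longrightarrow> a < b \<Longrightarrow> hoelder_supp H R f \<Longrightarrow> 0 < l \<Longrightarrow>
      emeasure lborel {x. l < \<bar>cop K a b f x\<bar>} \<le> ennreal (C * L1 f / l)" using cop_weak_hoelder by blast
  show thesis
  proof
    show "0 < 4 * C" using C by simp
    fix a b l :: real and f :: "'a \<Rightarrow> real"
    assume a: "0 < a" and ab: "a < b" and f: "integrable lborel f" and l: "0 < l"
    have [measurable]: "f \<in> borel_measurable borel" using f by auto
    define N where "N = L1 f"
    show "emeasure lborel {x. l < \<bar>cop K a b f x\<bar>} \<le> ennreal (4 * C * L1 f / l)"
    proof (cases "N = 0")
      case True
      then have "\<bar>cop K a b f x\<bar> \<le> 0" for x using cop_bound[OF a f, of b x] by (simp add: N_def)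
      then have "{x. l < \<bar>cop K a b f x\<bar>} = {}" using l by (auto simp: not_less intro: order_trans)
      then show ?thesis by simp
    next
      case False
      then have N: "0 < N" by (simp add: N_def less_le)
      define e where "e = min N (l / 2 * (a ^ DIM('a) / A))"
      have e: "0 < e" using N l a A_pos by (simp add: e_def)
      obtain H R h where h: "hoelder_supp H R h" "(LBINT x. \<bar>f x - h x\<bar>) < e" using hoelder_dense[OF f e] by blast
      note h_int = hoelder_supp_integrable[OF h(1)]
      have [measurable]: "h \<in> borel_measurable borel" using h_int by auto
      have "L1 h \<le> (LBINT x. \<bar>f x\<bar> + \<bar>f x - h x\<bar>)" using f h_int by (intro integral_mono) auto
      also have "\<dots> = N + (LBINT x. \<bar>f x - h x\<bar>)" using f h_int by (simp add: N_def)
      also have "\<dots> \<le> 2 * N" using h(2) by (simp add: e_def)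
      finally have hN: "L1 h \<le> 2 * N" .
      have diff: "\<bar>cop K a b f x - cop K a b h x\<bar> \<le> l / 2" for x
      proof -
        have "\<bar>cop K a b f x - cop K a b h x\<bar> = \<bar>cop K a b (\<lambda>y. f y - h y) x\<bar>" using a f h_int by (simp add: cop_diff)
        also have "\<dots> \<le> A / a ^ DIM('a) * (LBINT y. \<bar>f y - h y\<bar>)" using a f h_int by (intro cop_bound) auto
        also have "\<dots> \<le> A / a ^ DIM('a) * (l / 2 * (a ^ DIM('a) / A))"
          using h(2) A_pos a by (intro mult_left_mono) (auto simp: e_def)
        also have "\<dots> = l / 2" using A_pos a by simp
        finally show ?thesis .
      qed
      have "emeasure lborel {x. l < \<bar>cop K a b f x\<bar>} \<le> emeasure lborel {x. l / 2 < \<bar>cop K a b h x\<bar>}"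
      proof (intro emeasure_mono subsetI)
        fix x assume "x \<in> {x. l < \<bar>cop K a b f x\<bar>}"
        moreover have "\<bar>cop K a b f x\<bar> \<le> \<bar>cop K a b f x - cop K a b h x\<bar> + \<bar>cop K a b h x\<bar>" by simp
        ultimately show "x \<in> {x. l / 2 < \<bar>cop K a b h x\<bar>}" using diff[of x] unfolding mem_Collect_eq by linarith
      qed measurable
      also have "\<dots> \<le> ennreal (C * L1 h / (l / 2))" using l by (intro C(2)[OF a ab h(1)]) auto
      also have "\<dots> \<le> ennreal (C * (2 * N) / (l / 2))"
        using C l hN by (intro ennreal_leI divide_right_mono mult_left_mono) auto
      finally show ?thesis by (simp add: N_def mult_ac)
    qed
  qed
qed

end

section \<open>Bounded functions on sets of finite measure\<close>

text \<open>Values of at least 1 are paid by the square, values between (1/2)^J and 1 by the dyadic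
  level they exceed, smaller ones by the remainder.\<close>

lemma abs_le_dyadic_levels:
  fixes h :: real
  shows "\<bar>h\<bar> \<le> h ^ 2 + (\<Sum>j<J. (1/2) ^ j * of_bool ((1/2) ^ Suc j < \<bar>h\<bar>)) + (1/2) ^ J"
proof -
  have nonneg: "0 \<le> (\<Sum>j<J. (1/2) ^ j * of_bool ((1/2) ^ Suc j < \<bar>h\<bar>) :: real)" by (intro sum_nonneg) auto
  consider "1 \<le> \<bar>h\<bar>" | "\<bar>h\<bar> \<le> (1/2) ^ J" | "\<bar>h\<bar> < 1" "(1/2) ^ J < \<bar>h\<bar>" by linarith
  then show ?thesis
  proof cases
    case 1
    then have "\<bar>h\<bar> * 1 \<le> \<bar>h\<bar> * \<bar>h\<bar>" by (intro mult_left_mono) auto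
    then have "\<bar>h\<bar> \<le> h ^ 2" by (simp add: power2_eq_square)
    moreover have "0 \<le> (1/2 :: real) ^ J" by simp
    ultimately show ?thesis using nonneg by linarith
  next
    case 2
    then show ?thesis using nonneg by (simp add: add_nonneg_nonneg add_increasing)
  next
    case 3
    define j where "j = (LEAST j. (1/2) ^ Suc j < \<bar>h\<bar>)"
    have J: "0 < J" using 3 by (cases J) auto
    then have "(1/2) ^ Suc (J - 1) < \<bar>h\<bar>" using 3 by simp
    then have j: "(1/2) ^ Suc j < \<bar>h\<bar>" "j \<le> J - 1" unfolding j_def by (rule LeastI, rule Least_le)
    have hj: "\<bar>h\<bar> \<le> (1/2) ^ j"
    proof (cases j)
      case (Suc i)
      then have "\<not> (1/2) ^ Suc i < \<bar>h\<bar>" using not_less_Least[of i "\<lambda>j. (1/2) ^ Suc j < \<bar>h\<bar>"] by (simp add: j_def)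
      then show ?thesis using Suc by simp
    qed (use 3 in simp)
    also have "(1/2::real) ^ j = (1/2) ^ j * of_bool ((1/2) ^ Suc j < \<bar>h\<bar>)" using j by simp
    also have "\<dots> \<le> (\<Sum>j<J. (1/2) ^ j * of_bool ((1/2) ^ Suc j < \<bar>h\<bar>))" using j J by (intro member_le_sum) auto
    finally have "\<bar>h\<bar> \<le> (\<Sum>j<J. (1/2) ^ j * of_bool ((1/2) ^ Suc j < \<bar>h\<bar>))" .
    moreover have "0 \<le> h ^ 2" "0 \<le> (1/2 :: real) ^ J" by simp_all
    ultimately show ?thesis by linarith
  qed
qed

context cz
begin

text \<open>The square term is bounded by the L^2 estimate. By weak type each of the
  \<open>J\<close> levels contributes at most a constant times the measure of \<open>F\<close>,
  since the factor 2^j from the height cancels. Growth that is only linear in \<open>J\<close> is an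
  L log L estimate in disguise, and the remainder lives on \<open>E\<close>.\<close>

lemma cop_indicator_integral:
  obtains C where "0 < C"
    "\<And>a b E F J. 0 < a \<Longrightarrow> a < b \<Longrightarrow> E \<in> sets borel \<Longrightarrow> F \<in> sets borel \<Longrightarrow> emeasure lborel E < \<infinity> \<Longrightarrow>
      emeasure lborel F < \<infinity> \<Longrightarrow>
      (LBINT x. ind E x * \<bar>cop K a b (ind F) x\<bar>) \<le> C * (real J + 1) * measure lborel F + (1/2) ^ J * measure lborel E"
proof -
  obtain C2 where C2: "0 < C2"
    "\<And>a b M f. 0 < a \<Longrightarrow> a < b \<Longrightarrow> integrable lborel f \<Longrightarrow> (\<And>x. \<bar>f x\<bar> \<le> M) \<Longrightarrow>
      (LBNN x. ennreal (cop K a b f x ^ 2)) \<le> ennreal (C2 * (LBINT x. f x ^ 2))" using cop_L2 by blast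
  obtain C1 where C1: "0 < C1"
    "\<And>a b f l. 0 < a \<Longrightarrow> a < b \<Longrightarrow> integrable lborel f \<Longrightarrow> 0 < l \<Longrightarrow>
      emeasure lborel {x. l < \<bar>cop K a b f x\<bar>} \<le> ennreal (C1 * L1 f / l)" using cop_weak by blast
  show thesis
  proof
    show "0 < C2 + 2 * C1" using C1 C2 by simp
    fix a b :: real and E F :: "'a set" and J :: nat
    assume a: "0 < a" "a < b" and [measurable]: "E \<in> sets borel" "F \<in> sets borel"
      and fin: "emeasure lborel E < \<infinity>" "emeasure lborel F < \<infinity>"
    have F_int: "integrable lborel (ind F :: 'a \<Rightarrow> real)" and E_int: "integrable lborel (ind E :: 'a \<Rightarrow> real)"
      using fin by (auto intro!: integrable_real_indicator)
    define h where "h = cop K a b (ind F)"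
    have [measurable]: "h \<in> borel_measurable borel" unfolding h_def by measurable
    have "(LBNN x. ennreal (h x ^ 2)) \<le> ennreal (C2 * (LBINT x. indicat_real F x ^ 2))"
      unfolding h_def by (rule C2(2)[OF a F_int, of 1]) (auto simp: indicator_def)
    also have "(LBINT x. indicat_real F x ^ 2) = (LBINT x. indicat_real F x)"
      by (intro Bochner_Integration.integral_cong) (auto simp: indicator_def)
    also have "\<dots> = measure lborel F" by simp
    finally have h2: "(LBNN x. ennreal (h x ^ 2)) \<le> ennreal (C2 * measure lborel F)" .
    then have h2_int: "integrable lborel (\<lambda>x. h x ^ 2)" by (intro integrableI_bounded) (auto intro: le_less_trans)
    then have h2': "(LBINT x. h x ^ 2) \<le> C2 * measure lborel F"
      using h2 C2 by (simp add: nn_integral_eq_integral ennreal_le_iff)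
    define L where "L j = {x. (1/2) ^ Suc j < \<bar>h x\<bar>}" for j
    have [measurable]: "L j \<in> sets borel" for j unfolding L_def by measurable
    have L_em: "emeasure lborel (L j) \<le> ennreal (C1 * measure lborel F * 2 ^ Suc j)" for j
    proof -
      have "emeasure lborel (L j) \<le> ennreal (C1 * (L1 (indicat_real F)) / (1/2) ^ Suc j)"
        unfolding L_def h_def by (intro C1(2) a F_int) auto
      also have "C1 * (L1 (indicat_real F)) / (1/2) ^ Suc j = C1 * measure lborel F * 2 ^ Suc j"
        by (simp add: power_divide)
      finally show ?thesis .
    qed
    have L_fin: "emeasure lborel (L j) < \<infinity>" for j by (rule le_less_trans[OF L_em]) simp
    have L_int: "integrable lborel (ind (L j) :: 'a \<Rightarrow> real)" for j
      using L_fin by (intro integrable_real_indicator) auto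
    have L_meas: "measure lborel (L j) \<le> C1 * measure lborel F * 2 ^ Suc j" for j
    proof -
      have "ennreal (measure lborel (L j)) \<le> ennreal (C1 * measure lborel F * 2 ^ Suc j)"
        using L_em[of j] L_fin[of j] by (simp add: emeasure_eq_ennreal_measure)
      then show ?thesis using C1 by (subst (asm) ennreal_le_iff) auto
    qed
    let ?S = "\<lambda>x. h x ^ 2 + (\<Sum>j<J. (1/2) ^ j * ind (L j) x) + (1/2) ^ J * ind E x"
    have S_int: "integrable lborel ?S"
      using h2_int L_int E_int by (intro Bochner_Integration.integrable_add Bochner_Integration.integrable_sum integrable_mult_right)
    have S_ge: "ind E x * \<bar>h x\<bar> \<le> ?S x" for x
    proof (cases "x \<in> E")
      case True
      then show ?thesis using abs_le_dyadic_levels[of "h x" J] by (simp add: L_def indicator_def)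
    next
      case False
      then show ?thesis by (auto intro!: add_nonneg_nonneg sum_nonneg)
    qed
    have "(LBINT x. ind E x * \<bar>h x\<bar>) \<le> (LBINT x. ?S x)"
    proof (rule integral_mono'[OF S_int S_ge])
      show "0 \<le> ?S x" for x by (intro add_nonneg_nonneg sum_nonneg mult_nonneg_nonneg) auto
    qed
    also have "\<dots> = (LBINT x. h x ^ 2) + (\<Sum>j<J. (1/2) ^ j * measure lborel (L j)) + (1/2) ^ J * measure lborel E"
    proof -
      have "integrable lborel (\<lambda>x. (\<Sum>j<J. (1/2) ^ j * ind (L j) x :: real))"
        using L_int by (intro Bochner_Integration.integrable_sum integrable_mult_right)
      moreover have "(LBINT x. (\<Sum>j<J. (1/2) ^ j * ind (L j) x :: real)) = (\<Sum>j<J. (1/2) ^ j * measure lborel (L j))"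
        using L_int by (subst Bochner_Integration.integral_sum) auto
      moreover have "integrable lborel (\<lambda>x. (1/2) ^ J * ind E x :: real)" using E_int by (rule integrable_mult_right)
      ultimately show ?thesis
        using h2_int by (subst Bochner_Integration.integral_add, (auto intro: Bochner_Integration.integrable_add)[2])+ simp
    qed
    also have "\<dots> \<le> C2 * measure lborel F + (\<Sum>j<J. 2 * C1 * measure lborel F) + (1/2) ^ J * measure lborel E"
    proof (intro add_mono sum_mono h2' order_refl)
      fix j
      have "(1/2) ^ j * measure lborel (L j) \<le> (1/2) ^ j * (C1 * measure lborel F * 2 ^ Suc j)"
        by (intro mult_left_mono L_meas) auto
      also have "\<dots> = 2 * C1 * measure lborel F" by (simp add: power_divide)
      finally show "(1/2) ^ j * measure lborel (L j) \<le> 2 * C1 * measure lborel F" .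
    qed
    also have "\<dots> = (C2 + 2 * C1 * real J) * measure lborel F + (1/2) ^ J * measure lborel E"
      by (simp add: algebra_simps)
    also have "\<dots> \<le> (C2 + 2 * C1) * (real J + 1) * measure lborel F + (1/2) ^ J * measure lborel E"
      using C1 C2 by (intro add_right_mono mult_right_mono) (auto simp: algebra_simps)
    finally show "(LBINT x. ind E x * \<bar>cop K a b (ind F) x\<bar>) \<le> (C2 + 2 * C1) * (real J + 1) * measure lborel F + (1/2) ^ J * measure lborel E"
      by (simp add: h_def)
  qed
qed

text \<open>
  By duality, the logarithmic bound for \<open>\<integral>\<^bsub>E\<^esub> \<bar>T\<^sup>t 1\<^bsub>F\<^esub>\<bar>\<close> with \<open>F = {T g > \<lambda>}\<close> yields
  exponential decay of the distribution function of \<open>T g\<close>.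
\<close>

lemma cop_restricted:
  obtains C where "0 < C"
    "\<And>a b E M g J. 0 < a \<Longrightarrow> a < b \<Longrightarrow> E \<in> sets borel \<Longrightarrow> emeasure lborel E < \<infinity> \<Longrightarrow> 0 < M \<Longrightarrow>
      g \<in> borel_measurable borel \<Longrightarrow> (\<And>x. \<bar>g x\<bar> \<le> M * ind E x) \<Longrightarrow>
      emeasure lborel {x. C * (real J + 1) * M < \<bar>cop K a b g x\<bar>} \<le> ennreal (2 * (1/2) ^ J * measure lborel E)"
proof -
  define K' where "K' = (\<lambda>x. K (- x))"
  interpret r: cz K' A unfolding K'_def by (rule cz_reflect)
  obtain C where C: "0 < C"
    "\<And>a b E F J. 0 < a \<Longrightarrow> a < b \<Longrightarrow> E \<in> sets borel \<Longrightarrow> F \<in> sets borel \<Longrightarrow> emeasure lborel E < \<infinity> \<Longrightarrow>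
      emeasure lborel F < \<infinity> \<Longrightarrow>
      (LBINT x. ind E x * \<bar>cop K' a b (ind F) x\<bar>) \<le> C * (real J + 1) * measure lborel F + (1/2) ^ J * measure lborel E"
    using r.cop_indicator_integral by blast
  obtain C1 where C1: "0 < C1"
    "\<And>a b f l. 0 < a \<Longrightarrow> a < b \<Longrightarrow> integrable lborel f \<Longrightarrow> 0 < l \<Longrightarrow>
      emeasure lborel {x. l < \<bar>cop K a b f x\<bar>} \<le> ennreal (C1 * L1 f / l)" using cop_weak by blast
  have half: "emeasure lborel {x. (C + 1) * (real J + 1) * M < cop K a b g x} \<le> ennreal ((1/2) ^ J * measure lborel E)"
    if a: "0 < a" "a < b" and [measurable]: "E \<in> sets borel" and fin: "emeasure lborel E < \<infinity>" and M: "0 < M"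
      and [measurable]: "g \<in> borel_measurable borel" and g: "\<And>x. \<bar>g x\<bar> \<le> M * ind E x" for a b E M g J
  proof -
    have E_int: "integrable lborel (ind E :: 'a \<Rightarrow> real)" using fin by (auto intro!: integrable_real_indicator)
    have g_int: "integrable lborel g"
      by (rule Bochner_Integration.integrable_bound[OF integrable_mult_right[OF E_int, of M]])
         (auto intro!: AE_I2 order_trans[OF g])
    \<comment> \<open>The summand 1 next to \<open>C\<close> is what survives: after duality the
      term \<open>C * (real J + 1) * measure lborel F\<close> is absorbed and at least the measure
      of \<open>F\<close> remains on the left.\<close>
    define t where "t = (C + 1) * (real J + 1) * M"
    have t: "0 < t" using C M by (simp add: t_def)
    define F where "F = {x. t < cop K a b g x}"
    have [measurable]: "F \<in> sets borel" unfolding F_def by measurable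
    \<comment> \<open>Weak type enters only to know that \<open>F\<close> has finite measure,
      without which the absorption would be void.\<close>
    have "emeasure lborel F \<le> emeasure lborel {x. t < \<bar>cop K a b g x\<bar>}" unfolding F_def by (intro emeasure_mono) auto
    also have "\<dots> \<le> ennreal (C1 * L1 g / t)" by (intro C1(2) a g_int t)
    finally have F_fin: "emeasure lborel F < \<infinity>" by (auto intro: le_less_trans)
    have F_int: "integrable lborel (ind F :: 'a \<Rightarrow> real)" using F_fin by (auto intro!: integrable_real_indicator)
    define h where "h = cop K' a b (ind F)"
    have [measurable]: "h \<in> borel_measurable borel" unfolding h_def by measurable
    have h_bound: "\<bar>h x\<bar> \<le> A / a ^ DIM('a) * (L1 (indicat_real F))" for x
      unfolding h_def by (rule r.cop_bound[OF a(1) F_int])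
    have Tg_bound: "\<bar>cop K a b g x\<bar> \<le> A / a ^ DIM('a) * L1 g" for x by (rule cop_bound[OF a(1) g_int])
    have int1: "integrable lborel (\<lambda>x. cop K a b g x * ind F x)"
    proof (rule Bochner_Integration.integrable_bound[OF integrable_mult_right[OF F_int, of "A / a ^ DIM('a) * L1 g"]])
      show "AE x in lborel. norm (cop K a b g x * ind F x) \<le> norm (A / a ^ DIM('a) * L1 g * ind F x)"
        using Tg_bound A_pos a by (intro AE_I2) (auto simp: abs_mult indicator_def)
    qed measurable
    have int2: "integrable lborel (\<lambda>x. M * (ind E x * \<bar>h x\<bar>))"
    proof (rule Bochner_Integration.integrable_bound[OF integrable_mult_right[OF E_int, of "M * (A / a ^ DIM('a) * (L1 (indicat_real F)))"]])
      show "AE x in lborel. norm (M * (ind E x * \<bar>h x\<bar>)) \<le> norm (M * (A / a ^ DIM('a) * (L1 (indicat_real F))) * ind E x)"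
      proof (rule AE_I2)
        fix x
        have "M * \<bar>h x\<bar> \<le> M * (A / a ^ DIM('a) * (L1 (indicat_real F)))"
          using h_bound M by (intro mult_left_mono) auto
        then show "norm (M * (ind E x * \<bar>h x\<bar>)) \<le> norm (M * (A / a ^ DIM('a) * (L1 (indicat_real F))) * ind E x)"
          using M A_pos a by (auto simp: indicator_def abs_mult)
      qed
    qed measurable
    have "t * measure lborel F = (LBINT x. t * ind F x)" by simp
    also have "\<dots> \<le> (LBINT x. cop K a b g x * ind F x)"
    proof (rule integral_mono[OF integrable_mult_right[OF F_int] int1])
      show "t * ind F x \<le> cop K a b g x * ind F x" for x by (auto simp: F_def indicator_def)
    qed
    also have "\<dots> = (LBINT y. g y * h y)" unfolding h_def K'_def by (rule cop_duality[OF a(1) g_int F_int])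
    also have "\<dots> \<le> (LBINT y. M * (ind E y * \<bar>h y\<bar>))"
    proof (rule integral_mono'[OF int2])
      fix y
      have "g y * h y \<le> \<bar>g y\<bar> * \<bar>h y\<bar>" unfolding abs_mult[symmetric] by simp
      also have "\<dots> \<le> (M * ind E y) * \<bar>h y\<bar>" by (intro mult_right_mono g) auto
      finally show "g y * h y \<le> M * (ind E y * \<bar>h y\<bar>)" by (simp add: mult.assoc)
    qed (use M in auto)
    also have "\<dots> = M * (LBINT y. ind E y * \<bar>h y\<bar>)" by simp
    also have "\<dots> \<le> M * (C * (real J + 1) * measure lborel F + (1/2) ^ J * measure lborel E)"
      unfolding h_def using M by (intro mult_left_mono C(2) a fin F_fin) auto
    finally have "M * ((C + 1) * (real J + 1) * measure lborel F) \<le> M * (C * (real J + 1) * measure lborel F + (1/2) ^ J * measure lborel E)"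
      by (simp add: t_def mult_ac)
    then have "(C + 1) * (real J + 1) * measure lborel F \<le> C * (real J + 1) * measure lborel F + (1/2) ^ J * measure lborel E"
      using M by simp
    moreover have "(C + 1) * (real J + 1) * measure lborel F = C * (real J + 1) * measure lborel F + measure lborel F + real J * measure lborel F"
      by (simp add: algebra_simps)
    moreover have "0 \<le> real J * measure lborel F" by simp
    ultimately have "measure lborel F \<le> (1/2) ^ J * measure lborel E" by linarith
    then have "emeasure lborel F \<le> ennreal ((1/2) ^ J * measure lborel E)"
      using F_fin by (simp add: emeasure_eq_ennreal_measure ennreal_leI)
    then show ?thesis by (simp add: F_def t_def)
  qed
  show thesis
  proof
    show "0 < C + 1" using C by simp
    fix a b M :: real and E :: "'a set" and g :: "'a \<Rightarrow> real" and J :: nat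
    assume a: "0 < a" "a < b" and E: "E \<in> sets borel" and fin: "emeasure lborel E < \<infinity>" and M: "0 < M"
      and g_meas [measurable]: "g \<in> borel_measurable borel" and g: "\<And>x. \<bar>g x\<bar> \<le> M * ind E x"
    let ?t = "(C + 1) * (real J + 1) * M"
    have "emeasure lborel {x. ?t < \<bar>cop K a b g x\<bar>}
      \<le> emeasure lborel ({x. ?t < cop K a b g x} \<union> {x. ?t < cop K a b (\<lambda>y. - g y) x})"
      by (intro emeasure_mono subsetI) (auto simp: cop_def abs_if split: if_splits)
    also have "\<dots> \<le> emeasure lborel {x. ?t < cop K a b g x} + emeasure lborel {x. ?t < cop K a b (\<lambda>y. - g y) x}"
      by (intro emeasure_subadditive) measurable
    also have "\<dots> \<le> ennreal ((1/2) ^ J * measure lborel E) + ennreal ((1/2) ^ J * measure lborel E)"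
      using g by (intro add_mono half a E fin M) auto
    also have "\<dots> = ennreal (2 * (1/2) ^ J * measure lborel E)" by (simp flip: ennreal_plus)
    finally show "emeasure lborel {x. ?t < \<bar>cop K a b g x\<bar>} \<le> ennreal (2 * (1/2) ^ J * measure lborel E)" .
  qed
qed

end

section \<open>Almost everywhere existence of the principal value\<close>

text \<open>The one-sided truncation of \<open>CZ_trunc\<close>. In general it is not integrable at
  infinity, so its estimates are limits of those for \<open>ctrunc\<close> as the outer radius
  grows.\<close>

definition cinf :: "('a::euclidean_space \<Rightarrow> real) \<Rightarrow> real \<Rightarrow> 'a \<Rightarrow> real" where
  "cinf K a x = ind {x. a < norm x} x * K x"

definition copi :: "('a::euclidean_space \<Rightarrow> real) \<Rightarrow> real \<Rightarrow> ('a \<Rightarrow> real) \<Rightarrow> 'a \<Rightarrow> real" where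
  "copi K a f x = (LBINT y. cinf K a (x - y) * f y)"

context cz
begin

lemma cinf_borel [measurable]: "cinf K a \<in> borel_measurable borel"
  unfolding cinf_def[abs_def] by measurable

lemma cinf_bound:
  assumes "0 < a"
  shows "\<bar>cinf K a x\<bar> \<le> A / a ^ DIM('a)"
proof -
  have "cinf K a x = ctrunc K a (norm x) x" by (auto simp: cinf_def ctrunc_def ann_def indicator_def)
  then show ?thesis using ctrunc_bound[OF assms] by simp
qed

lemma cinf_mult_bound:
  assumes "0 < a"
  shows "\<bar>cinf K a x * c\<bar> \<le> A / a ^ DIM('a) * \<bar>c\<bar>"
  using cinf_bound[OF assms] by (simp add: abs_mult mult_right_mono del: times_divide_eq_left)

lemma cinf_mult_integrable:
  assumes a: "0 < a" and f: "integrable lborel f"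
  shows "integrable lborel (\<lambda>y. cinf K a (x - y) * f y)"
proof (rule Bochner_Integration.integrable_bound)
  show "integrable lborel (\<lambda>y. A / a ^ DIM('a) * f y)" using f by simp
  show "AE y in lborel. norm (cinf K a (x - y) * f y) \<le> norm (A / a ^ DIM('a) * f y)"
    using cinf_mult_bound[OF a] A_pos a by (intro AE_I2) (simp add: abs_mult)
qed (use f in auto)

lemma copi_borel [measurable]:
  assumes [measurable]: "f \<in> borel_measurable borel"
  shows "copi K a f \<in> borel_measurable borel"
proof -
  have "(\<lambda>x. (LBINT y. cinf K a (x - y) * f y)) \<in> borel_measurable lborel"
    by (rule lborel.borel_measurable_lebesgue_integral) measurable
  then show ?thesis by (simp add: copi_def[abs_def])
qed

lemma copi_diff:
  assumes "0 < a" "integrable lborel f" "integrable lborel g"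
  shows "copi K a (\<lambda>y. f y - g y) x = copi K a f x - copi K a g x"
  unfolding copi_def right_diff_distrib by (intro Bochner_Integration.integral_diff cinf_mult_integrable assms)

lemma cop_tendsto_copi:
  assumes int: "integrable lborel (\<lambda>y. cinf K a (x - y) * f y)"
    and [measurable]: "f \<in> borel_measurable borel"
    and b: "filterlim b at_top sequentially"
  shows "(\<lambda>m. cop K a (b m) f x) \<longlonglongrightarrow> copi K a f x"
  unfolding cop_def copi_def
proof (rule integral_dominated_convergence[where w = "\<lambda>y. \<bar>cinf K a (x - y) * f y\<bar>"])
  show "AE y in lborel. (\<lambda>m. ctrunc K a (b m) (x - y) * f y) \<longlonglongrightarrow> cinf K a (x - y) * f y"
  proof (rule AE_I2)
    fix y
    have "\<forall>\<^sub>F m in sequentially. norm (x - y) \<le> b m" using b by (auto simp: filterlim_at_top)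
    then have "\<forall>\<^sub>F m in sequentially. ctrunc K a (b m) (x - y) * f y = cinf K a (x - y) * f y"
      by eventually_elim (auto simp: ctrunc_def ann_def cinf_def indicator_def)
    then show "(\<lambda>m. ctrunc K a (b m) (x - y) * f y) \<longlonglongrightarrow> cinf K a (x - y) * f y" by (rule tendsto_eventually)
  qed
  show "AE y in lborel. norm (ctrunc K a (b m) (x - y) * f y) \<le> \<bar>cinf K a (x - y) * f y\<bar>" for m
    by (intro AE_I2) (auto simp: ctrunc_def ann_def cinf_def indicator_def)
qed (use int in auto)

lemma copi_weak:
  obtains C where "0 < C"
    "\<And>a f l. 0 < a \<Longrightarrow> integrable lborel f \<Longrightarrow> 0 < l \<Longrightarrow>
      emeasure lborel {x. l < \<bar>copi K a f x\<bar>} \<le> ennreal (C * L1 f / l)"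
proof -
  obtain C where C: "0 < C"
    "\<And>a b f l. 0 < a \<Longrightarrow> a < b \<Longrightarrow> integrable lborel f \<Longrightarrow> 0 < l \<Longrightarrow>
      emeasure lborel {x. l < \<bar>cop K a b f x\<bar>} \<le> ennreal (C * L1 f / l)" using cop_weak by blast
  show thesis
  proof
    show "0 < C" by (rule C)
    fix a l :: real and f :: "'a \<Rightarrow> real"
    assume a: "0 < a" and f: "integrable lborel f" and l: "0 < l"
    have [measurable]: "f \<in> borel_measurable borel" using f by auto
    define b where "b m = a + 1 + real m" for m
    have b: "filterlim b at_top sequentially"
      unfolding b_def by (intro filterlim_tendsto_add_at_top[OF tendsto_const] filterlim_real_sequentially)
    have "emeasure lborel {x \<in> space lborel. l < \<bar>copi K a f x\<bar>} \<le> ennreal (C * L1 f / l)"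
    proof (rule emeasure_limit_le)
      show "AE x in lborel. (\<lambda>m. cop K a (b m) f x) \<longlonglongrightarrow> copi K a f x"
        using b by (intro AE_I2 cop_tendsto_copi cinf_mult_integrable a f) auto
      show "emeasure lborel {x \<in> space lborel. l < \<bar>cop K a (b m) f x\<bar>} \<le> ennreal (C * L1 f / l)" for m
        using C(2)[OF a _ f l, of "b m"] by (simp add: b_def)
    qed measurable
    then show "emeasure lborel {x. l < \<bar>copi K a f x\<bar>} \<le> ennreal (C * L1 f / l)" by simp
  qed
qed

text \<open>
  Cotlar's argument: outside the set where the maximal function of \<open>f\<close> or of the indicator of
  \<open>{\<bar>T\<^sub>e f\<bar> > l / 2}\<close> is large, \<open>T\<^sub>\<epsilon> f (x)\<close> is compared with \<open>T\<^sub>e f (z)\<close> for a well-chosen \<open>z\<close>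
  near \<open>x\<close>.
\<close>

lemma copi_Cotlar:
  obtains C where "0 < C"
    "\<And>e f l. 0 < e \<Longrightarrow> integrable lborel f \<Longrightarrow> 0 < l \<Longrightarrow>
      \<exists>Z\<in>sets borel. emeasure lborel Z \<le> ennreal (C * L1 f / l) \<and>
        (\<forall>\<epsilon> x. 2 * e \<le> \<epsilon> \<longrightarrow> x \<notin> Z \<longrightarrow> \<bar>copi K \<epsilon> f x\<bar> \<le> l)"
proof -
  let ?n = "DIM('a)" and ?V = "ball_vol TYPE('a)"
  obtain C where C: "0 < C"
    "\<And>a f l. 0 < a \<Longrightarrow> integrable lborel f \<Longrightarrow> 0 < l \<Longrightarrow>
      emeasure lborel {x. l < \<bar>copi K a f x\<bar>} \<le> ennreal (C * L1 f / l)" using copi_weak by blast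
  \<comment> \<open>The first bound makes the exceptional set of the local part \<open>f1\<close>
    fill at most a third of the ball \<open>B\<close>; the second makes the kernel comparison for
    the distant part at most l / 4.\<close>
  define \<gamma> where "\<gamma> = min (1 / (12 * 4 ^ ?n * C)) (1 / (A * ?V * 2 ^ ?n * 2))"
  have \<gamma>: "0 < \<gamma>" "\<gamma> * (12 * 4 ^ ?n * C) \<le> 1" "\<gamma> * (A * ?V * 2 ^ ?n * 2) \<le> 1"
  proof -
    have pos: "0 < 12 * 4 ^ ?n * C" "0 < A * ?V * 2 ^ ?n * 2" using C A_pos by auto
    then show "0 < \<gamma>" by (simp add: \<gamma>_def)
    have "\<gamma> \<le> 1 / (12 * 4 ^ ?n * C)" "\<gamma> \<le> 1 / (A * ?V * 2 ^ ?n * 2)" by (simp_all add: \<gamma>_def)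
    with pos show "\<gamma> * (12 * 4 ^ ?n * C) \<le> 1" "\<gamma> * (A * ?V * 2 ^ ?n * 2) \<le> 1" by (simp_all only: pos_le_divide_eq)
  qed
  show thesis
  proof
    show "0 < 5 ^ ?n / \<gamma> + 5 ^ ?n * 3 * 2 * C" using C \<gamma> by (intro add_pos_pos) auto
    fix e l :: real and f :: "'a \<Rightarrow> real"
    assume e: "0 < e" and f: "integrable lborel f" and l: "0 < l"
    have [measurable]: "f \<in> borel_measurable borel" using f by auto
    define N where "N = L1 f"
    have N: "0 \<le> N" by (simp add: N_def)
    have f_abs: "integrable lborel (\<lambda>x. \<bar>f x\<bar>)" using f by simp
    have \<gamma>l: "0 < \<gamma> * l" using \<gamma> l by simp
    obtain c1 :: "nat \<Rightarrow> 'a" and r1 :: "nat \<Rightarrow> real" and I1 :: "nat set" where sel1: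
      "\<And>i. i \<in> I1 \<Longrightarrow> 0 < r1 i"
      "\<And>i j. i \<in> I1 \<Longrightarrow> j \<in> I1 \<Longrightarrow> i \<noteq> j \<Longrightarrow> cball (c1 i) (r1 i) \<inter> cball (c1 j) (r1 j) = {}"
      "\<And>i. i \<in> I1 \<Longrightarrow> (LBINT y. ind (cball (c1 i) (5 * r1 i)) y * \<bar>f y\<bar>) \<le> \<gamma> * l * (?V * (5 * r1 i) ^ ?n)"
      "\<And>x t. 0 < t \<Longrightarrow> \<gamma> * l * (?V * t ^ ?n) < (LBINT y. ind (cball x t) y * \<bar>f y\<bar>)
          \<Longrightarrow> x \<in> (\<Union>i\<in>I1. cball (c1 i) (5 * r1 i))"
      "\<And>s. 0 \<le> s \<Longrightarrow> emeasure lborel (\<Union>i\<in>I1. cball (c1 i) (s * r1 i)) \<le> ennreal (s ^ ?n * N / (\<gamma> * l))"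
      by (rule vitali_selection[OF f_abs abs_ge_zero \<gamma>l, folded N_def]) (rule that)
    define Z1 where "Z1 = (\<Union>i\<in>I1. cball (c1 i) (5 * r1 i))"
    \<comment> \<open>One fixed truncation \<open>e\<close>, rather than a supremum over
      truncations, so that the weak type bound applies to \<open>G\<close>. Neither
      \<open>Z1\<close> nor \<open>Z2\<close> depends on \<open>\<epsilon>\<close> or
      \<open>x\<close>, which yields the maximal inequality.\<close>
    define G where "G = {z. l / 2 < \<bar>copi K e f z\<bar>}"
    have [measurable]: "G \<in> sets borel" unfolding G_def by measurable
    have G_le: "emeasure lborel G \<le> ennreal (C * N / (l / 2))" unfolding G_def N_def using l by (intro C(2) e f) auto
    then have G_fin: "emeasure lborel G < \<infinity>" by (rule le_less_trans) simp
    have G_meas: "measure lborel G \<le> C * N / (l / 2)"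
    proof -
      have "ennreal (measure lborel G) \<le> ennreal (C * N / (l / 2))"
        using G_le G_fin by (simp add: emeasure_eq_ennreal_measure)
      moreover have "0 \<le> C * N / (l / 2)" using C N l by simp
      ultimately show ?thesis by (simp only: ennreal_le_iff)
    qed
    have G_int: "integrable lborel (ind G :: 'a \<Rightarrow> real)" using G_fin by (intro integrable_real_indicator) auto
    obtain c2 :: "nat \<Rightarrow> 'a" and r2 :: "nat \<Rightarrow> real" and I2 :: "nat set" where sel2:
      "\<And>i. i \<in> I2 \<Longrightarrow> 0 < r2 i"
      "\<And>i j. i \<in> I2 \<Longrightarrow> j \<in> I2 \<Longrightarrow> i \<noteq> j \<Longrightarrow> cball (c2 i) (r2 i) \<inter> cball (c2 j) (r2 j) = {}"
      "\<And>i. i \<in> I2 \<Longrightarrow> (LBINT y. ind (cball (c2 i) (5 * r2 i)) y * ind G y) \<le> 1 / 3 * (?V * (5 * r2 i) ^ ?n)"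
      "\<And>x t. 0 < t \<Longrightarrow> 1 / 3 * (?V * t ^ ?n) < (LBINT y. ind (cball x t) y * ind G y)
          \<Longrightarrow> x \<in> (\<Union>i\<in>I2. cball (c2 i) (5 * r2 i))"
      "\<And>s. 0 \<le> s \<Longrightarrow> emeasure lborel (\<Union>i\<in>I2. cball (c2 i) (s * r2 i)) \<le> ennreal (s ^ ?n * (LBINT y. ind G y) / (1 / 3))"
      by (rule vitali_selection[OF G_int, of "1 / 3"]) (simp, simp, rule that)
    define Z2 where "Z2 = (\<Union>i\<in>I2. cball (c2 i) (5 * r2 i))"
    have [measurable]: "Z1 \<in> sets borel" "Z2 \<in> sets borel"
      unfolding Z1_def Z2_def by (auto intro!: sets.countable_UN')
    show "\<exists>Z\<in>sets borel. emeasure lborel Z \<le> ennreal ((5 ^ ?n / \<gamma> + 5 ^ ?n * 3 * 2 * C) * L1 f / l) \<and>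
        (\<forall>\<epsilon> x. 2 * e \<le> \<epsilon> \<longrightarrow> x \<notin> Z \<longrightarrow> \<bar>copi K \<epsilon> f x\<bar> \<le> l)"
    proof (intro bexI[of _ "Z1 \<union> Z2"] conjI allI impI)
      have "emeasure lborel (Z1 \<union> Z2) \<le> emeasure lborel Z1 + emeasure lborel Z2" by (intro emeasure_subadditive) auto
      also have "\<dots> \<le> ennreal (5 ^ ?n * N / (\<gamma> * l)) + ennreal (5 ^ ?n * (LBINT y. ind G y) / (1 / 3))"
        unfolding Z1_def Z2_def by (intro add_mono sel1(5) sel2(5)) auto
      also have "\<dots> \<le> ennreal (5 ^ ?n * N / (\<gamma> * l)) + ennreal (5 ^ ?n * (C * N / (l / 2)) / (1 / 3))"
        using G_meas by (intro add_left_mono ennreal_leI divide_right_mono mult_left_mono) auto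
      also have "\<dots> = ennreal (5 ^ ?n * N / (\<gamma> * l) + 5 ^ ?n * (C * N / (l / 2)) / (1 / 3))"
        using N C l \<gamma> by (intro ennreal_plus[symmetric]) auto
      also have "5 ^ ?n * N / (\<gamma> * l) + 5 ^ ?n * (C * N / (l / 2)) / (1 / 3) = (5 ^ ?n / \<gamma> + 5 ^ ?n * 3 * 2 * C) * N / l"
        using l \<gamma> by (simp add: field_simps)
      finally show "emeasure lborel (Z1 \<union> Z2) \<le> ennreal ((5 ^ ?n / \<gamma> + 5 ^ ?n * 3 * 2 * C) * L1 f / l)"
        by (simp add: N_def)
    next
      fix \<epsilon> x assume \<epsilon>: "2 * e \<le> \<epsilon>" and x: "x \<notin> Z1 \<union> Z2"
      have \<epsilon>0: "0 < \<epsilon>" using \<epsilon> e by linarith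
      have avg: "(LBINT y. ind (cball x t) y * \<bar>f y\<bar>) \<le> \<gamma> * l * (?V * t ^ ?n)" if "0 < t" for t
        using sel1(4)[OF that, of x] x unfolding Z1_def not_less[symmetric] by blast
      have avgG: "(LBINT y. ind (cball x t) y * ind G y) \<le> 1 / 3 * (?V * t ^ ?n)" if "0 < t" for t
        using sel2(4)[OF that, of x] x unfolding Z2_def not_less[symmetric] by blast
      define B where "B = cball x (\<epsilon> / 4)"
      have B_meas: "measure lborel B = ?V * (\<epsilon> / 4) ^ ?n" "emeasure lborel B < \<infinity>"
        using \<epsilon>0 emeasure_lborel_cball_finite[of x "\<epsilon> / 4"] by (auto simp: B_def content_cball)
      have B_pos: "0 < measure lborel B" using \<epsilon>0 by (simp add: B_meas)
      have [measurable]: "B \<in> sets borel" by (simp add: B_def)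
      define f1 where "f1 y = ind (cball x \<epsilon>) y * f y" for y
      define f2 where "f2 y = ind (- cball x \<epsilon>) y * f y" for y
      have f1_int: "integrable lborel f1" and f2_int: "integrable lborel f2"
        using integrable_real_mult_indicator[of "cball x \<epsilon>" lborel f] integrable_real_mult_indicator[of "- cball x \<epsilon>" lborel f] f
        by (simp_all add: f1_def[abs_def] f2_def[abs_def] mult.commute)
      have [measurable]: "f1 \<in> borel_measurable borel" "f2 \<in> borel_measurable borel" using f1_int f2_int by auto
      define G1 where "G1 = {z. l / 4 < \<bar>copi K e f1 z\<bar>}"
      have [measurable]: "G1 \<in> sets borel" unfolding G1_def by measurable
      have "L1 f1 \<le> \<gamma> * l * (?V * \<epsilon> ^ ?n)" using avg[OF \<epsilon>0] by (simp add: f1_def abs_mult)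
      then have "C * L1 f1 / (l / 4) \<le> C * (\<gamma> * l * (?V * \<epsilon> ^ ?n)) / (l / 4)"
        using C l by (intro divide_right_mono mult_left_mono) auto
      also have "\<dots> = \<gamma> * (12 * 4 ^ ?n * C) * (1 / 3 * measure lborel B)" using l by (simp add: B_meas power_divide)
      also have "\<dots> \<le> 1 * (1 / 3 * measure lborel B)" using B_pos by (intro mult_right_mono \<gamma>) auto
      finally have "C * L1 f1 / (l / 4) \<le> 1 / 3 * measure lborel B" by simp
      then have G1: "emeasure lborel G1 \<le> ennreal (1 / 3 * measure lborel B)"
        unfolding G1_def using l C(2)[OF e f1_int, of "l / 4"] by (auto intro: order_trans ennreal_leI)
      have "emeasure lborel (B \<inter> G) = ennreal (measure lborel (B \<inter> G))"
      proof (rule emeasure_eq_ennreal_measure)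
        have "emeasure lborel (B \<inter> G) \<le> emeasure lborel B" by (intro emeasure_mono) auto
        then show "emeasure lborel (B \<inter> G) \<noteq> top" using B_meas(2) by (auto simp: top_unique)
      qed
      also have "measure lborel (B \<inter> G) = (LBINT y. ind B y * ind G y)" by (simp flip: indicator_inter_arith)
      also have "\<dots> \<le> 1 / 3 * measure lborel B" unfolding B_meas unfolding B_def using \<epsilon>0 by (intro avgG) auto
      finally have BG: "emeasure lborel (B \<inter> G) \<le> ennreal (1 / 3 * measure lborel B)" by (simp add: ennreal_leI)
      \<comment> \<open>Two sets that each occupy at most a third of \<open>B\<close> do not cover
        it.\<close>
      have "\<exists>z. z \<in> B \<and> z \<notin> G \<and> z \<notin> G1"
      proof (rule ccontr)
        assume "\<not> ?thesis"
        then have "B \<subseteq> (B \<inter> G) \<union> G1" by blast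
        then have "emeasure lborel B \<le> emeasure lborel ((B \<inter> G) \<union> G1)" by (intro emeasure_mono) auto
        also have "\<dots> \<le> emeasure lborel (B \<inter> G) + emeasure lborel G1" by (intro emeasure_subadditive) auto
        also have "\<dots> \<le> ennreal (1 / 3 * measure lborel B) + ennreal (1 / 3 * measure lborel B)"
          by (intro add_mono BG G1)
        also have "\<dots> = ennreal (2 / 3 * measure lborel B)" by (subst ennreal_plus[symmetric]) auto
        finally have "ennreal (measure lborel B) \<le> ennreal (2 / 3 * measure lborel B)"
          using B_meas(2) by (simp add: emeasure_eq_ennreal_measure)
        then show False using B_pos by (subst (asm) ennreal_le_iff) auto
      qed
      then obtain z where z: "z \<in> B" "\<bar>copi K e f z\<bar> \<le> l / 2" "\<bar>copi K e f1 z\<bar> \<le> l / 4"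
        by (auto simp: G_def G1_def not_less)
      have zx: "norm (x - z) \<le> \<epsilon> / 4" using z(1) by (simp add: B_def dist_norm)
      have "copi K e f z - copi K e f1 z = copi K e (\<lambda>y. f y - f1 y) z" by (intro copi_diff[symmetric] e f f1_int)
      also have "(\<lambda>y. f y - f1 y) = f2" by (auto simp: f1_def f2_def fun_eq_iff indicator_def)
      finally have zf2: "copi K e f2 z = copi K e f z - copi K e f1 z" by simp
      define D where "D y = cinf K \<epsilon> (x - y) * f y - cinf K e (z - y) * f2 y" for y
      have D_int: "integrable lborel D"
        unfolding D_def[abs_def] using \<epsilon>0 e f f2_int by (intro Bochner_Integration.integrable_diff cinf_mult_integrable)
      have "copi K \<epsilon> f x - copi K e f2 z = (LBINT y. D y)"
        unfolding copi_def D_def using \<epsilon>0 e f f2_int by (intro Bochner_Integration.integral_diff[symmetric] cinf_mult_integrable)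
      then have "ennreal \<bar>copi K \<epsilon> f x - copi K e f2 z\<bar> \<le> (LBNN y. ennreal \<bar>D y\<bar>)"
        using integral_norm_bound_ennreal[OF D_int] by simp
      also have "\<dots> \<le> (LBNN y. ennreal (A * (\<epsilon> / 4)) * (ennreal \<bar>f y\<bar> * ennreal (norm (y - x) powr (- real ?n - 1)) * ind {y. \<epsilon> < norm (y - x)} y))"
      proof (intro nn_integral_mono)
        fix y
        show "ennreal \<bar>D y\<bar> \<le> ennreal (A * (\<epsilon> / 4)) * (ennreal \<bar>f y\<bar> * ennreal (norm (y - x) powr (- real ?n - 1)) * ind {y. \<epsilon> < norm (y - x)} y)"
        proof (cases "\<epsilon> < norm (y - x)")
          case True
          then have xy: "\<epsilon> < norm (x - y)" "y \<notin> cball x \<epsilon>" by (auto simp: norm_minus_commute dist_norm)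
          have "norm (x - y) \<le> norm (x - z) + norm (z - y)" using norm_triangle_ineq[of "x - z" "z - y"] by simp
          \<comment> \<open>Moving from \<open>x\<close> to \<open>z\<close> loses at most
            \<open>\<epsilon> / 4\<close>, and 3/4 of \<open>\<epsilon>\<close> still exceeds
            \<open>e\<close> because \<open>2 * e \<le> \<epsilon>\<close>. So the truncation at
            \<open>e\<close> does not affect the distant part.\<close>
          then have zy: "e < norm (z - y)" using zx xy \<epsilon> e by linarith
          have "\<bar>D y\<bar> = \<bar>K (x - y) - K (x - y - (x - z))\<bar> * \<bar>f y\<bar>"
            using xy zy by (simp add: D_def cinf_def f2_def abs_mult flip: left_diff_distrib)
          also have "\<dots> \<le> A * norm (x - z) / norm (x - y) ^ (?n + 1) * \<bar>f y\<bar>"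
            using xy zx \<epsilon>0 by (intro mult_right_mono smooth) auto
          also have "\<dots> \<le> A * (\<epsilon> / 4) / norm (x - y) ^ (?n + 1) * \<bar>f y\<bar>"
            using A_pos zx by (intro mult_right_mono divide_right_mono mult_left_mono) auto
          also have "\<dots> = A * (\<epsilon> / 4) * (\<bar>f y\<bar> * norm (y - x) powr (- real ?n - 1))"
          proof -
            have eq1: "norm (x - y) powr real (?n + 1) = norm (x - y) ^ (?n + 1)"
              using xy \<epsilon>0 by (intro powr_realpow) linarith
            have eq2: "- real ?n - 1 = - real (?n + 1)" by simp
            have "norm (y - x) powr (- real ?n - 1) = inverse (norm (x - y) ^ (?n + 1))"
              unfolding eq2 norm_minus_commute[of y x] powr_minus eq1 ..
            then show ?thesis by (simp only: divide_inverse mult_ac)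
          qed
          finally show ?thesis using True A_pos \<epsilon>0 by (simp add: ennreal_leI flip: ennreal_mult)
        next
          case False
          then have "D y = 0" by (auto simp: D_def cinf_def f2_def norm_minus_commute dist_norm)
          then show ?thesis by simp
        qed
      qed
      also have "\<dots> = ennreal (A * (\<epsilon> / 4)) * (LBNN y. ennreal \<bar>f y\<bar> * ennreal (norm (y - x) powr (- real ?n - 1)) * ind {y. \<epsilon> < norm (y - x)} y)"
        by (intro nn_integral_cmult) measurable
      also have "\<dots> \<le> ennreal (A * (\<epsilon> / 4)) * (ennreal (\<gamma> * l * ?V) * ennreal (2 ^ ?n * \<epsilon> powr (-1) / (1 - 2 powr (-1))))"
      proof (intro mult_left_mono nn_integral_far_le)
        fix t :: real assume t: "0 < t"
        have "(LBNN y. ennreal \<bar>f y\<bar> * ind (cball x t) y) = (LBNN y. ennreal (ind (cball x t) y * \<bar>f y\<bar>))"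
          by (intro nn_integral_cong) (auto simp: indicator_def)
        also have "\<dots> = ennreal (LBINT y. ind (cball x t) y * \<bar>f y\<bar>)"
          using integrable_real_mult_indicator[of "cball x t" lborel "\<lambda>y. \<bar>f y\<bar>"] f_abs
          by (intro nn_integral_eq_integral) (auto simp: mult.commute[of "ind _ _"])
        also have "\<dots> \<le> ennreal (\<gamma> * l * (?V * t ^ ?n))" by (intro ennreal_leI avg t)
        also have "\<dots> = ennreal (\<gamma> * l * ?V) * ennreal (t ^ ?n)"
          using \<gamma> l t by (subst ennreal_mult[symmetric]) (auto simp: mult_ac)
        finally show "(LBNN y. ennreal \<bar>f y\<bar> * ind (cball x t) y) \<le> ennreal (\<gamma> * l * ?V) * ennreal (t ^ ?n)" .
      qed (use \<epsilon>0 in auto)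
      also have "\<dots> = ennreal (A * (\<epsilon> / 4) * (\<gamma> * l * ?V * (2 ^ ?n * \<epsilon> powr (-1) / (1 - 2 powr (-1)))))"
        using A_pos \<epsilon>0 \<gamma> l by (simp add: powr_minus flip: ennreal_mult)
      also have "A * (\<epsilon> / 4) * (\<gamma> * l * ?V * (2 ^ ?n * \<epsilon> powr (-1) / (1 - 2 powr (-1)))) = \<gamma> * (A * ?V * 2 ^ ?n * 2) * (l / 4)"
        using \<epsilon>0 by (simp add: powr_minus field_simps)
      also have "ennreal (\<gamma> * (A * ?V * 2 ^ ?n * 2) * (l / 4)) \<le> ennreal (1 * (l / 4))"
        using l by (intro ennreal_leI mult_right_mono \<gamma>) auto
      finally have "\<bar>copi K \<epsilon> f x - copi K e f2 z\<bar> \<le> l / 4" using l by (subst (asm) ennreal_le_iff) auto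
      then show "\<bar>copi K \<epsilon> f x\<bar> \<le> l" using z(2,3) unfolding zf2 by linarith
    qed auto
  qed
qed


text \<open>Cotlar's sets for \<open>e = 1 / (m + 1)\<close> need not be monotone in
  \<open>m\<close>. Their lower limit, the increasing union of the \<open>W m\<close>, inherits the
  bound on the measure, and a point outside it avoids \<open>Z k\<close> for arbitrarily large
  \<open>k\<close>, which suffices for every positive \<open>\<epsilon>\<close>.\<close>

lemma copi_maximal:
  obtains C where "0 < C"
    "\<And>f l. integrable lborel f \<Longrightarrow> 0 < l \<Longrightarrow>
      \<exists>Z\<in>sets borel. emeasure lborel Z \<le> ennreal (C * L1 f / l) \<and>
        (\<forall>\<epsilon> x. 0 < \<epsilon> \<longrightarrow> x \<notin> Z \<longrightarrow> \<bar>copi K \<epsilon> f x\<bar> \<le> l)"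
proof -
  obtain C where C: "0 < C"
    "\<And>e f l. 0 < e \<Longrightarrow> integrable lborel f \<Longrightarrow> 0 < l \<Longrightarrow>
      \<exists>Z\<in>sets borel. emeasure lborel Z \<le> ennreal (C * L1 f / l) \<and>
        (\<forall>\<epsilon> x. 2 * e \<le> \<epsilon> \<longrightarrow> x \<notin> Z \<longrightarrow> \<bar>copi K \<epsilon> f x\<bar> \<le> l)" using copi_Cotlar by blast
  show thesis
  proof
    show "0 < C" by (rule C)
    fix f :: "'a \<Rightarrow> real" and l :: real
    assume f: "integrable lborel f" and l: "0 < l"
    have "\<exists>Z. Z \<in> sets borel \<and> emeasure lborel Z \<le> ennreal (C * L1 f / l) \<and>
        (\<forall>\<epsilon> x. 2 * inverse (real (Suc m)) \<le> \<epsilon> \<longrightarrow> x \<notin> Z \<longrightarrow> \<bar>copi K \<epsilon> f x\<bar> \<le> l)" for m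
      using C(2)[of "inverse (real (Suc m))", OF _ f l] by auto
    then obtain Z where Z: "\<And>m. Z m \<in> sets borel"
      "\<And>m. emeasure lborel (Z m) \<le> ennreal (C * L1 f / l)"
      "\<And>m \<epsilon> x. 2 * inverse (real (Suc m)) \<le> \<epsilon> \<Longrightarrow> x \<notin> Z m \<Longrightarrow> \<bar>copi K \<epsilon> f x\<bar> \<le> l" by metis
    define W where "W m = (\<Inter>k\<in>{m..}. Z k)" for m
    have [measurable]: "W m \<in> sets borel" for m unfolding W_def using Z(1) by (intro sets.countable_INT') auto
    have "incseq W" by (intro monoI) (auto simp: W_def)
    then have "emeasure lborel (\<Union>m. W m) = (SUP m. emeasure lborel (W m))"
      by (intro SUP_emeasure_incseq[symmetric]) auto
    also have "\<dots> \<le> ennreal (C * L1 f / l)"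
    proof (intro SUP_least)
      fix m
      have "emeasure lborel (W m) \<le> emeasure lborel (Z m)"
        using Z(1)[of m] by (intro emeasure_mono) (auto simp: W_def)
      then show "emeasure lborel (W m) \<le> ennreal (C * L1 f / l)" using Z(2)[of m] by (rule order_trans)
    qed
    finally have le: "emeasure lborel (\<Union>m. W m) \<le> ennreal (C * L1 f / l)" .
    have "\<bar>copi K \<epsilon> f x\<bar> \<le> l" if \<epsilon>: "0 < \<epsilon>" and x: "x \<notin> (\<Union>m. W m)" for \<epsilon> x
    proof -
      obtain m where m: "inverse (real (Suc m)) < \<epsilon> / 2" using reals_Archimedean[of "\<epsilon> / 2"] \<epsilon> by auto
      have "x \<notin> W m" using x by blast
      then obtain k where k: "m \<le> k" "x \<notin> Z k" by (auto simp: W_def)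
      have "inverse (real (Suc k)) \<le> inverse (real (Suc m))" using k(1) by (intro le_imp_inverse_le) auto
      then have "2 * inverse (real (Suc k)) \<le> \<epsilon>" using m by linarith
      then show ?thesis using k(2) by (intro Z(3)[of k])
    qed
    then show "\<exists>Z\<in>sets borel. emeasure lborel Z \<le> ennreal (C * L1 f / l) \<and>
        (\<forall>\<epsilon> x. 0 < \<epsilon> \<longrightarrow> x \<notin> Z \<longrightarrow> \<bar>copi K \<epsilon> f x\<bar> \<le> l)"
      using le by (intro bexI[of _ "\<Union>m. W m"] conjI allI impI) (auto intro: sets.countable_UN')
  qed
qed

end

section \<open>Convergence as the inner truncation tends to 0\<close>

definition osc_le :: "real \<Rightarrow> (real \<Rightarrow> real) \<Rightarrow> bool" where
  "osc_le e F \<longleftrightarrow> (\<exists>d>0. \<forall>s t. 0 < s \<longrightarrow> s < d \<longrightarrow> 0 < t \<longrightarrow> t < d \<longrightarrow> \<bar>F s - F t\<bar> \<le> e)"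

lemma convergent_at_right_0I:
  assumes osc: "\<And>m. osc_le (inverse (real (Suc m))) F"
  shows "\<exists>L. (F \<longlongrightarrow> L) (at_right 0)"
proof -
  have osc': "\<exists>d>0. \<forall>s t. 0 < s \<longrightarrow> s < d \<longrightarrow> 0 < t \<longrightarrow> t < d \<longrightarrow> \<bar>F s - F t\<bar> < e" if e: "0 < e" for e
  proof -
    obtain m where m: "inverse (real (Suc m)) < e" using reals_Archimedean[OF e] by blast
    obtain d where "0 < d" "\<And>s t. 0 < s \<Longrightarrow> s < d \<Longrightarrow> 0 < t \<Longrightarrow> t < d \<Longrightarrow> \<bar>F s - F t\<bar> \<le> inverse (real (Suc m))"
      using osc[of m] by (auto simp: osc_le_def)
    then show ?thesis using m by (intro exI[of _ d]) (auto intro: le_less_trans)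
  qed
  define u where "u m = F (inverse (real (Suc m)))" for m
  have small: "\<exists>M. \<forall>m\<ge>M. inverse (real (Suc m)) < d" if d: "0 < d" for d
  proof -
    obtain M where M: "inverse (real (Suc M)) < d" using reals_Archimedean[OF d] by blast
    have "inverse (real (Suc m)) < d" if "M \<le> m" for m
    proof -
      have "inverse (real (Suc m)) \<le> inverse (real (Suc M))" using that by (intro le_imp_inverse_le) auto
      then show ?thesis using M by linarith
    qed
    then show ?thesis by blast
  qed
  have "Cauchy u"
  proof (rule metric_CauchyI)
    fix e :: real assume "0 < e"
    then obtain d where d: "0 < d" "\<And>s t. 0 < s \<Longrightarrow> s < d \<Longrightarrow> 0 < t \<Longrightarrow> t < d \<Longrightarrow> \<bar>F s - F t\<bar> < e" using osc' by meson
    obtain M where "\<And>m. M \<le> m \<Longrightarrow> inverse (real (Suc m)) < d" using small[OF d(1)] by blast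
    then show "\<exists>M. \<forall>m\<ge>M. \<forall>n\<ge>M. dist (u m) (u n) < e"
      by (intro exI[of _ M] allI impI) (simp add: u_def dist_real_def d(2))
  qed
  then obtain L where L: "u \<longlonglongrightarrow> L" using Cauchy_convergent_iff convergent_def by blast
  have "(F \<longlongrightarrow> L) (at_right 0)"
  proof (rule tendstoI)
    fix e :: real assume e: "0 < e"
    then obtain d where d: "0 < d" "\<And>s t. 0 < s \<Longrightarrow> s < d \<Longrightarrow> 0 < t \<Longrightarrow> t < d \<Longrightarrow> \<bar>F s - F t\<bar> < e / 2"
      using osc'[of "e / 2"] by (auto simp del: less_divide_eq_numeral1)
    obtain M where M: "\<And>m. M \<le> m \<Longrightarrow> inverse (real (Suc m)) < d" using small[OF d(1)] by blast
    obtain M' where M': "\<And>m. M' \<le> m \<Longrightarrow> dist (u m) L < e / 2" using metric_LIMSEQ_D[OF L, of "e / 2"] e by auto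
    have "dist (F s) L < e" if s: "0 < s" "s < d" for s
    proof -
      let ?m = "max M M'"
      have "\<bar>F s - u ?m\<bar> < e / 2" unfolding u_def using s M[of ?m] by (intro d(2)) auto
      moreover have "\<bar>u ?m - L\<bar> < e / 2" using M'[of ?m] by (simp add: dist_real_def)
      ultimately show ?thesis unfolding dist_real_def by linarith
    qed
    then show "\<forall>\<^sub>F s in at_right 0. dist (F s) L < e" unfolding eventually_at_right_field using d(1) by auto
  qed
  then show ?thesis by blast
qed

lemma tendsto_imp_osc_le:
  assumes "(F \<longlongrightarrow> L) (at_right 0)" "0 < e"
  shows "osc_le e F"
proof -
  have "\<forall>\<^sub>F s in at_right 0. dist (F s) L < e / 2" using assms by (intro tendstoD) auto
  then obtain d where d: "0 < d" "\<And>s. 0 < s \<Longrightarrow> s < d \<Longrightarrow> dist (F s) L < e / 2" by (auto simp: eventually_at_right_field)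
  have "\<bar>F s - F t\<bar> \<le> e" if "0 < s" "s < d" "0 < t" "t < d" for s t
    using d(2)[of s] d(2)[of t] that unfolding dist_real_def by linarith
  then show ?thesis unfolding osc_le_def using d(1) by blast
qed

locale cz_pv = cz +
  assumes pv: "\<exists>L. ((\<lambda>\<epsilon>. (LBINT x. ctrunc K \<epsilon> 1 x)) \<longlongrightarrow> L) (at_right 0)"
begin

text \<open>After subtracting \<open>h x\<close> times the truncated integral of the kernel, whose
  limit exists by \<open>pv\<close>, the increments are integrals of the kernel against
  \<open>h y - h x\<close> over thin annuli. By the Hoelder condition they are of order the square
  root of the larger radius.\<close>

lemma copi_convergent_hoelder:
  assumes h: "hoelder_supp H R h"
  shows "\<exists>L. ((\<lambda>\<epsilon>. copi K \<epsilon> h x) \<longlongrightarrow> L) (at_right 0)"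
proof -
  have h_int: "integrable lborel h" by (rule hoelder_supp_integrable[OF h])
  have [measurable]: "h \<in> borel_measurable borel" using h_int by auto
  obtain C where C: "0 < C"
    "\<And>a c r. 0 < a \<Longrightarrow> c \<le> r \<Longrightarrow> 0 < r \<Longrightarrow>
      (LBNN y. ennreal (\<bar>ctrunc K a c y\<bar> * sqrt (norm y))) \<le> ennreal (C * sqrt r)" using ctrunc_sqrt_integral by blast
  have H: "0 \<le> H" by (rule hoelder_suppD[OF h])
  define \<Phi> where "\<Phi> \<epsilon> = (LBINT x. ctrunc K \<epsilon> 1 x)" for \<epsilon>
  obtain L where L: "(\<Phi> \<longlongrightarrow> L) (at_right 0)" using pv unfolding \<Phi>_def[abs_def] by blast
  define F where "F \<epsilon> = copi K \<epsilon> h x - h x * \<Phi> \<epsilon>" for \<epsilon>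
  have F_diff: "\<bar>F s - F t\<bar> \<le> H * (C * sqrt t)" if st: "0 < s" "s \<le> t" "t \<le> 1" for s t
  proof -
    have t: "0 < t" using st by linarith
    note int = cinf_mult_integrable[OF st(1) h_int, of x] cinf_mult_integrable[OF t h_int, of x]
      ctrunc_integrable[OF st(1)]
    have int_k: "integrable lborel (\<lambda>y. ctrunc K s t (x - y))" by (intro integrable_lborel_reflect int)
    have "copi K s h x - copi K t h x = (LBINT y. ctrunc K s t (x - y) * h y)"
      unfolding copi_def Bochner_Integration.integral_diff[OF int(1,2), symmetric]
      using st by (intro Bochner_Integration.integral_cong) (auto simp: cinf_def ctrunc_def ann_def indicator_def)
    moreover have "\<Phi> s - \<Phi> t = (LBINT y. ctrunc K s t y)"
    proof -
      have "\<Phi> s = (LBINT y. ctrunc K s t y + ctrunc K t 1 y)"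
        unfolding \<Phi>_def by (intro Bochner_Integration.integral_cong refl ctrunc_split st)
      also have "\<dots> = (LBINT y. ctrunc K s t y) + \<Phi> t"
        unfolding \<Phi>_def using st t by (intro Bochner_Integration.integral_add ctrunc_integrable)
      finally show ?thesis by simp
    qed
    moreover have "(LBINT y. ctrunc K s t y) = (LBINT y. ctrunc K s t (x - y))"
      by (intro lebesgue_integral_lborel_reflect[symmetric]) simp
    ultimately have "F s - F t = (LBINT y. ctrunc K s t (x - y) * h y) - h x * (LBINT y. ctrunc K s t (x - y))"
      by (simp add: F_def algebra_simps)
    also have "\<dots> = (LBINT y. ctrunc K s t (x - y) * h y - h x * ctrunc K s t (x - y))"
      using int_k cop_integrable[OF st(1) h_int, of t x] by simp
    also have "\<dots> = (LBINT y. ctrunc K s t (x - y) * (h y - h x))" by (simp add: algebra_simps)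
    finally have eq: "F s - F t = (LBINT y. ctrunc K s t (x - y) * (h y - h x))" .
    have "integrable lborel (\<lambda>y. ctrunc K s t (x - y) * h y - h x * ctrunc K s t (x - y))"
      using int_k cop_integrable[OF st(1) h_int, of t x] by simp
    then have "integrable lborel (\<lambda>y. ctrunc K s t (x - y) * (h y - h x))" by (simp add: algebra_simps)
    then have "ennreal \<bar>F s - F t\<bar> \<le> (LBNN y. ennreal \<bar>ctrunc K s t (x - y) * (h y - h x)\<bar>)"
      unfolding eq using integral_norm_bound_ennreal by fastforce
    also have "\<dots> \<le> (LBNN y. ennreal H * ennreal (\<bar>ctrunc K s t (x - y)\<bar> * sqrt (norm (x - y))))"
    proof (intro nn_integral_mono)
      fix y
      have "\<bar>ctrunc K s t (x - y) * (h y - h x)\<bar> \<le> \<bar>ctrunc K s t (x - y)\<bar> * (H * sqrt (norm (x - y)))"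
        unfolding abs_mult using hoelder_suppD(3)[OF h, of y x] by (intro mult_left_mono) (auto simp: norm_minus_commute)
      then show "ennreal \<bar>ctrunc K s t (x - y) * (h y - h x)\<bar> \<le> ennreal H * ennreal (\<bar>ctrunc K s t (x - y)\<bar> * sqrt (norm (x - y)))"
        using H by (simp flip: ennreal_mult add: ennreal_leI mult_ac)
    qed
    also have "\<dots> = ennreal H * (LBNN y. ennreal (\<bar>ctrunc K s t (x - y)\<bar> * sqrt (norm (x - y))))"
      by (intro nn_integral_cmult) measurable
    also have "(LBNN y. ennreal (\<bar>ctrunc K s t (x - y)\<bar> * sqrt (norm (x - y)))) = (LBNN y. ennreal (\<bar>ctrunc K s t y\<bar> * sqrt (norm y)))"
      by (rule nn_integral_lborel_reflect) measurable
    also have "ennreal H * \<dots> \<le> ennreal H * ennreal (C * sqrt t)" using st t by (intro mult_left_mono C(2)) auto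
    also have "\<dots> = ennreal (H * (C * sqrt t))" using H C t by (intro ennreal_mult[symmetric]) auto
    finally show ?thesis using H C t by (subst (asm) ennreal_le_iff) auto
  qed
  have "\<exists>L. (F \<longlongrightarrow> L) (at_right 0)"
  proof (rule convergent_at_right_0I)
    fix m
    have "((\<lambda>t. H * (C * sqrt t)) \<longlongrightarrow> H * (C * sqrt 0)) (at_right 0)" by (intro tendsto_intros)
    then have "((\<lambda>t. H * (C * sqrt t)) \<longlongrightarrow> 0) (at_right 0)" by simp
    then have "\<forall>\<^sub>F t in at_right 0. H * (C * sqrt t) < inverse (real (Suc m))" by (rule order_tendstoD) simp
    then obtain d where d: "0 < d" "\<And>t. 0 < t \<Longrightarrow> t < d \<Longrightarrow> H * (C * sqrt t) < inverse (real (Suc m))"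
      by (auto simp: eventually_at_right_field)
    have "\<bar>F s - F t\<bar> \<le> inverse (real (Suc m))" if "0 < s" "s < min d 1" "0 < t" "t < min d 1" for s t
    proof (cases "s \<le> t")
      case True
      then show ?thesis using F_diff[of s t] d(2)[of t] that by auto
    next
      case False
      then show ?thesis using F_diff[of t s] d(2)[of s] that by (auto simp: abs_minus_commute)
    qed
    then show "osc_le (inverse (real (Suc m))) F" unfolding osc_le_def using d(1) by (intro exI[of _ "min d 1"]) auto
  qed
  then obtain L' where "(F \<longlongrightarrow> L') (at_right 0)" by blast
  then have "((\<lambda>\<epsilon>. F \<epsilon> + h x * \<Phi> \<epsilon>) \<longlongrightarrow> L' + h x * L) (at_right 0)" by (intro tendsto_intros L)
  then show ?thesis by (auto simp: F_def)
qed

text \<open>Write \<open>f\<close> as a Hoelder function plus an error small in mean. The maximal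
  inequality keeps all truncations of the error below l / 3 off a set of measure
  \<open>1 / (m + 1)\<close>; the error enters the oscillation twice and the Hoelder part takes the
  last third. The exceptional sets are then intersected over \<open>m\<close>.\<close>

lemma copi_osc_null:
  assumes f: "integrable lborel f" and l: "0 < l"
  shows "AE x in lborel. osc_le l (\<lambda>\<epsilon>. copi K \<epsilon> f x)"
proof -
  obtain C where C: "0 < C"
    "\<And>f l. integrable lborel f \<Longrightarrow> 0 < l \<Longrightarrow>
      \<exists>Z\<in>sets borel. emeasure lborel Z \<le> ennreal (C * L1 f / l) \<and>
        (\<forall>\<epsilon> x. 0 < \<epsilon> \<longrightarrow> x \<notin> Z \<longrightarrow> \<bar>copi K \<epsilon> f x\<bar> \<le> l)" using copi_maximal by blast
  have "\<exists>Z. Z \<in> sets borel \<and> emeasure lborel Z \<le> ennreal (inverse (real (Suc m))) \<and>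
      (\<forall>x. x \<notin> Z \<longrightarrow> osc_le l (\<lambda>\<epsilon>. copi K \<epsilon> f x))" for m
  proof -
    define e where "e = inverse (real (Suc m)) * (l / 3) / C"
    have e: "0 < e" using l C by (simp add: e_def)
    obtain H R h where h: "hoelder_supp H R h" "(LBINT x. \<bar>f x - h x\<bar>) < e" using hoelder_dense[OF f e] by blast
    have h_int: "integrable lborel h" by (rule hoelder_supp_integrable[OF h(1)])
    have "integrable lborel (\<lambda>x. f x - h x)" "0 < l / 3" using f h_int l by auto
    then obtain Z where Z: "Z \<in> sets borel"
      "emeasure lborel Z \<le> ennreal (C * (LBINT x. \<bar>f x - h x\<bar>) / (l / 3))"
      "\<And>\<epsilon> x. 0 < \<epsilon> \<Longrightarrow> x \<notin> Z \<Longrightarrow> \<bar>copi K \<epsilon> (\<lambda>y. f y - h y) x\<bar> \<le> l / 3" using C(2)[of "\<lambda>x. f x - h x" "l / 3"] by blast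
    have "C * (LBINT x. \<bar>f x - h x\<bar>) / (l / 3) \<le> C * e / (l / 3)"
      using h(2) C l by (intro divide_right_mono mult_left_mono) auto
    also have "\<dots> = inverse (real (Suc m))" using C l by (simp add: e_def)
    finally have "emeasure lborel Z \<le> ennreal (inverse (real (Suc m)))" by (intro order_trans[OF Z(2)] ennreal_leI)
    moreover have "osc_le l (\<lambda>\<epsilon>. copi K \<epsilon> f x)" if x: "x \<notin> Z" for x
    proof -
      have "osc_le (l / 3) (\<lambda>\<epsilon>. copi K \<epsilon> h x)"
        using copi_convergent_hoelder[OF h(1), of x] l by (auto intro: tendsto_imp_osc_le)
      then obtain d where d: "0 < d" "\<And>s t. 0 < s \<Longrightarrow> s < d \<Longrightarrow> 0 < t \<Longrightarrow> t < d \<Longrightarrow> \<bar>copi K s h x - copi K t h x\<bar> \<le> l / 3"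
        unfolding osc_le_def by blast
      have near: "\<bar>copi K s f x - copi K s h x\<bar> \<le> l / 3" if "0 < s" for s
        using Z(3)[OF that x] that f h_int by (simp add: copi_diff)
      have "\<bar>copi K s f x - copi K t f x\<bar> \<le> l" if "0 < s" "s < d" "0 < t" "t < d" for s t
        using near[of s] near[of t] d(2)[of s t] that by linarith
      then show ?thesis unfolding osc_le_def using d(1) by blast
    qed
    ultimately show ?thesis using Z(1) by blast
  qed
  then obtain Z where Z: "\<And>m. Z m \<in> sets borel" "\<And>m. emeasure lborel (Z m) \<le> ennreal (inverse (real (Suc m)))"
    "\<And>m x. x \<notin> Z m \<Longrightarrow> osc_le l (\<lambda>\<epsilon>. copi K \<epsilon> f x)" by metis
  have Z_sets: "(\<Inter>m. Z m) \<in> sets lborel" using Z(1) by auto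
  have "emeasure lborel (\<Inter>m. Z m) \<le> 0"
  proof (rule LIMSEQ_le_const)
    show "(\<lambda>m. ennreal (inverse (real (Suc m)))) \<longlonglongrightarrow> 0" using tendsto_ennrealI[OF LIMSEQ_inverse_real_of_nat] by simp
    have "emeasure lborel (\<Inter>m. Z m) \<le> ennreal (inverse (real (Suc m)))" for m
    proof -
      have "emeasure lborel (\<Inter>m. Z m) \<le> emeasure lborel (Z m)" using Z(1)[of m] by (intro emeasure_mono) auto
      then show ?thesis using Z(2)[of m] by (rule order_trans)
    qed
    then show "\<exists>N. \<forall>m\<ge>N. emeasure lborel (\<Inter>m. Z m) \<le> ennreal (inverse (real (Suc m)))" by blast
  qed
  then have null: "(\<Inter>m. Z m) \<in> null_sets lborel" using Z_sets by (intro null_setsI) auto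
  show ?thesis by (rule AE_I'[OF null]) (use Z(3) in auto)
qed

lemma copi_convergent:
  assumes f: "integrable lborel f"
  shows "AE x in lborel. \<exists>L. ((\<lambda>\<epsilon>. copi K \<epsilon> f x) \<longlongrightarrow> L) (at_right 0)"
proof -
  have "AE x in lborel. \<forall>m. osc_le (inverse (real (Suc m))) (\<lambda>\<epsilon>. copi K \<epsilon> f x)"
    unfolding AE_all_countable by (intro allI copi_osc_null f) simp
  then show ?thesis by eventually_elim (rule convergent_at_right_0I, blast)
qed

end

section \<open>Distribution estimate by levels\<close>

text \<open>What the operator has to know about the size of \<open>f\<close>, without reference to
  rearrangements. In the application \<open>B k\<close> is f**(2^k t) plus a small positive term,
  see \<open>level_function_rearr\<close>. The weight in \<open>B_sum\<close> serves both the
  absolute convergence of the truncated integrals and the final bound.\<close>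

locale level_function =
  fixes f :: "'a::euclidean_space \<Rightarrow> real" and t :: real and B :: "nat \<Rightarrow> real"
  assumes f_borel [measurable]: "f \<in> borel_measurable borel"
    and t_pos: "0 < t"
    and B_pos: "0 < B k"
    and B_dec: "B (Suc k) \<le> B k"
    and B_sum: "summable (\<lambda>k. (real k + 1) * B k)"
    and em_level: "emeasure lborel {y. B k < \<bar>f y\<bar>} \<le> ennreal (2 ^ k * t)"
    and big_part: "(LBNN y. ennreal \<bar>f y\<bar> * ind {y. B 0 < \<bar>f y\<bar>} y) \<le> ennreal (t * B 0)"
begin

definition lev :: "nat \<Rightarrow> 'a set" where
  "lev k = {y. B (Suc k) < \<bar>f y\<bar> \<and> \<bar>f y\<bar> \<le> B k}"

lemma lev_borel [measurable]: "lev k \<in> sets borel"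
  unfolding lev_def by measurable

lemma em_lev: "emeasure lborel (lev k) \<le> ennreal (2 ^ Suc k * t)"
proof -
  have "emeasure lborel (lev k) \<le> emeasure lborel {y. B (Suc k) < \<bar>f y\<bar>}"
    by (intro emeasure_mono) (auto simp: lev_def)
  then show ?thesis using em_level[of "Suc k"] by (rule order_trans)
qed

lemma B_tendsto_0: "B \<longlonglongrightarrow> 0"
proof (rule Lim_null_comparison)
  show "(\<lambda>k. (real k + 1) * B k) \<longlonglongrightarrow> 0" by (rule summable_LIMSEQ_zero[OF B_sum])
  show "\<forall>\<^sub>F k in sequentially. norm (B k) \<le> (real k + 1) * B k"
    using B_pos by (intro always_eventually allI) (auto simp: algebra_simps less_imp_le)
qed

lemma ex_lev:
  assumes "f y \<noteq> 0" "\<bar>f y\<bar> \<le> B 0"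
  obtains k where "y \<in> lev k"
proof -
  have "\<forall>\<^sub>F k in sequentially. B k < \<bar>f y\<bar>" using assms(1) by (intro order_tendstoD[OF B_tendsto_0]) simp
  then obtain m where m: "B m < \<bar>f y\<bar>" by (auto simp: eventually_sequentially)
  define k where "k = (LEAST k. B k < \<bar>f y\<bar>)"
  have k: "B k < \<bar>f y\<bar>" unfolding k_def using m by (rule LeastI)
  then obtain j where j: "k = Suc j" using assms(2) by (cases k) auto
  then have "\<not> B j < \<bar>f y\<bar>" using not_less_Least[of j "\<lambda>k. B k < \<bar>f y\<bar>"] by (simp add: k_def)
  then show ?thesis using k j that[of j] by (simp add: lev_def)
qed

definition part :: "nat \<Rightarrow> 'a \<Rightarrow> real" where
  "part k y = ind (lev k) y * f y"

definition big :: "'a \<Rightarrow> real" where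
  "big y = ind {y. B 0 < \<bar>f y\<bar>} y * f y"

definition rest :: "nat \<Rightarrow> 'a \<Rightarrow> real" where
  "rest k y = ind {y. \<bar>f y\<bar> \<le> B k} y * f y"

lemma parts_borel [measurable]:
  "part k \<in> borel_measurable borel" "big \<in> borel_measurable borel" "rest k \<in> borel_measurable borel"
  unfolding part_def[abs_def] big_def[abs_def] rest_def[abs_def] by measurable

lemma f_split: "f y = big y + rest 0 y" "rest k y = part k y + rest (Suc k) y"
  using B_dec[of k] by (auto simp: big_def rest_def part_def lev_def indicator_def)

lemma big_abs: "(LBNN y. ennreal \<bar>big y\<bar>) \<le> ennreal (t * B 0)"
proof -
  have "(LBNN y. ennreal \<bar>big y\<bar>) = (LBNN y. ennreal \<bar>f y\<bar> * ind {y. B 0 < \<bar>f y\<bar>} y)"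
    by (intro nn_integral_cong) (auto simp: big_def indicator_def)
  then show ?thesis using big_part by simp
qed

lemma big_integrable: "integrable lborel big"
  by (rule integrableI_bounded) (auto intro: le_less_trans[OF big_abs])

lemma big_abs_le: "L1 big \<le> t * B 0"
proof -
  have "ennreal (L1 big) \<le> ennreal (t * B 0)"
    using big_abs big_integrable by (subst nn_integral_eq_integral[symmetric]) auto
  then show ?thesis using t_pos B_pos[of 0] by (subst (asm) ennreal_le_iff) auto
qed

lemma integrable_on_ball: "integrable lborel (\<lambda>y. ind (cball x r) y * f y)"
proof -
  have "integrable lborel (\<lambda>y. ind (cball x r) y * big y)"
    using integrable_real_mult_indicator[of "cball x r" lborel big] big_integrable by (simp add: mult.commute)
  moreover have "integrable lborel (\<lambda>y. ind (cball x r) y * rest 0 y)"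
  proof (rule Bochner_Integration.integrable_bound)
    show "integrable lborel (\<lambda>y. B 0 * ind (cball x r) y)"
      using emeasure_lborel_cball_finite[of x r] by (intro integrable_mult_right integrable_real_indicator) auto
    show "AE y in lborel. norm (ind (cball x r) y * rest 0 y) \<le> norm (B 0 * ind (cball x r) y)"
      using B_pos[of 0] by (intro AE_I2) (auto simp: rest_def indicator_def)
  qed auto
  ultimately have "integrable lborel (\<lambda>y. ind (cball x r) y * big y + ind (cball x r) y * rest 0 y)"
    by (rule Bochner_Integration.integrable_add)
  then show ?thesis by (simp only: distrib_left[symmetric] f_split(1)[symmetric])
qed

end

locale cz_level = cz K A + level_function f t B
  for K :: "'a::euclidean_space \<Rightarrow> real" and A :: real and f :: "'a \<Rightarrow> real" and t B
begin

text \<open>Split at radius \<open>2 ^ Suc k * a\<close>. Inside there are \<open>k + 1\<close>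
  dyadic shells of equal contribution. Outside the kernel is at most \<open>A / R ^ n\<close>, with
  n the dimension, and the level set has measure at most \<open>2 ^ Suc k * t\<close>, which
  \<open>R ^ n\<close> outweighs in every dimension.\<close>

lemma cinf_lev_integral:
  assumes a: "0 < a"
  shows "(LBNN y. ennreal \<bar>cinf K a (x - y)\<bar> * ind (lev k) y)
    \<le> ennreal (A * (2 ^ DIM('a) * ball_vol TYPE('a) + t / a ^ DIM('a)) * (real k + 1))"
proof -
  let ?n = "DIM('a)" and ?V = "ball_vol TYPE('a)"
  define R where "R = 2 ^ Suc k * a"
  have R: "0 < R" using a by (simp add: R_def)
  have "(LBNN y. ennreal \<bar>cinf K a (x - y)\<bar> * ind (lev k) y)
    \<le> (LBNN y. ennreal A * (ennreal (1 / norm (y - x) ^ ?n) * ind {y. a < norm (y - x) \<and> norm (y - x) \<le> 2 ^ Suc k * a} y)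
          + ennreal (A / R ^ ?n) * ind (lev k) y)"
  proof (intro nn_integral_mono)
    fix y
    show "ennreal \<bar>cinf K a (x - y)\<bar> * ind (lev k) y
      \<le> ennreal A * (ennreal (1 / norm (y - x) ^ ?n) * ind {y. a < norm (y - x) \<and> norm (y - x) \<le> 2 ^ Suc k * a} y)
          + ennreal (A / R ^ ?n) * ind (lev k) y"
    proof (cases "a < norm (y - x)")
      case True
      then have "x - y \<noteq> 0" using a by auto
      then have K: "\<bar>K (x - y)\<bar> \<le> A * (1 / norm (y - x) ^ ?n)"
        using size[of "x - y"] by (simp add: norm_minus_commute)
      show ?thesis
      proof (cases "norm (y - x) \<le> R")
        case le: True
        have "ennreal \<bar>cinf K a (x - y)\<bar> * ind (lev k) y \<le> ennreal \<bar>K (x - y)\<bar>" by (auto simp: cinf_def indicator_def)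
        also have "\<dots> \<le> ennreal A * ennreal (1 / norm (y - x) ^ ?n)"
          using K A_pos by (simp add: ennreal_leI flip: ennreal_mult)
        finally show ?thesis using True le by (simp add: R_def add_increasing2)
      next
        case False
        then have "A * (1 / norm (y - x) ^ ?n) \<le> A * (1 / R ^ ?n)"
          using A_pos R by (intro mult_left_mono divide_left_mono power_mono mult_pos_pos zero_less_power) auto
        then have "ennreal \<bar>cinf K a (x - y)\<bar> \<le> ennreal (A / R ^ ?n)"
          using K by (intro ennreal_leI) (auto simp: cinf_def indicator_def)
        then have "ennreal \<bar>cinf K a (x - y)\<bar> * ind (lev k) y \<le> ennreal (A / R ^ ?n) * ind (lev k) y"
          by (rule mult_right_mono) simp
        then show ?thesis by (rule add_increasing[OF zero_le])
      qed
    next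
      case False
      then have "cinf K a (x - y) = 0" by (simp add: cinf_def norm_minus_commute)
      then show ?thesis by simp
    qed
  qed
  also have "\<dots> = ennreal A * (LBNN y. ennreal (1 / norm (y - x) ^ ?n) * ind {y. a < norm (y - x) \<and> norm (y - x) \<le> 2 ^ Suc k * a} y)
      + ennreal (A / R ^ ?n) * emeasure lborel (lev k)" by (subst nn_integral_add) (auto simp: nn_integral_cmult)
  also have "\<dots> \<le> ennreal A * ennreal (real (Suc k) * 2 ^ ?n * ?V) + ennreal (A / R ^ ?n) * ennreal (2 ^ Suc k * t)"
    by (intro add_mono mult_left_mono nn_integral_log_le a em_lev) auto
  also have "\<dots> = ennreal (A * (real (Suc k) * 2 ^ ?n * ?V) + A / R ^ ?n * (2 ^ Suc k * t))"
    using A_pos R t_pos by (simp flip: ennreal_mult ennreal_plus)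
  also have "\<dots> \<le> ennreal (A * (2 ^ ?n * ?V + t / a ^ ?n) * (real k + 1))"
  proof (intro ennreal_leI)
    have "2 ^ Suc k \<le> (2 ^ Suc k :: real) ^ ?n" by (intro self_le_power one_le_power) auto
    then have "2 ^ Suc k / (2 ^ Suc k :: real) ^ ?n \<le> 1" by (simp add: divide_le_eq_1)
    then have "2 ^ Suc k / (2 ^ Suc k :: real) ^ ?n \<le> real k + 1" by linarith
    then have "A * (t / a ^ ?n) * (2 ^ Suc k / (2 ^ Suc k) ^ ?n) \<le> A * (t / a ^ ?n) * (real k + 1)"
      using A_pos t_pos a by (intro mult_left_mono) auto
    moreover have "A / R ^ ?n * (2 ^ Suc k * t) = A * (t / a ^ ?n) * (2 ^ Suc k / (2 ^ Suc k) ^ ?n)"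
      by (simp add: R_def power_mult_distrib mult_ac)
    ultimately have "A / R ^ ?n * (2 ^ Suc k * t) \<le> A * (t / a ^ ?n) * (real k + 1)" by (simp only:)
    moreover have "A * (2 ^ ?n * ?V + t / a ^ ?n) * (real k + 1) = A * (real (Suc k) * 2 ^ ?n * ?V) + A * (t / a ^ ?n) * (real k + 1)"
      by (simp add: distrib_left distrib_right mult_ac)
    ultimately show "A * (real (Suc k) * 2 ^ ?n * ?V) + A / R ^ ?n * (2 ^ Suc k * t) \<le> A * (2 ^ ?n * ?V + t / a ^ ?n) * (real k + 1)"
      by linarith
  qed
  finally show ?thesis .
qed

text \<open>This is the absolute convergence demanded by \<open>CZ_defined_at\<close>, at every
  point. The logarithmic bound on each level is summed with the help of \<open>B_sum\<close>; the
  part above \<open>B 0\<close> is integrable.\<close>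

lemma cinf_level_integrable:
  assumes a: "0 < a"
  shows "integrable lborel (\<lambda>y. cinf K a (x - y) * f y)"
proof -
  define c where "c = A * (2 ^ DIM('a) * ball_vol TYPE('a) + t / a ^ DIM('a))"
  have c: "0 \<le> c" using A_pos t_pos a by (simp add: c_def)
  have "integrable lborel (\<lambda>y. cinf K a (x - y) * rest 0 y)"
  proof (rule integrableI_bounded)
    have "(LBNN y. ennreal (norm (cinf K a (x - y) * rest 0 y)))
      \<le> (\<Sum>k. ennreal (B k) * (LBNN y. ennreal \<bar>cinf K a (x - y)\<bar> * ind (lev k) y))"
    proof (rule nn_integral_le_suminf)
      fix y assume "ennreal (norm (cinf K a (x - y) * rest 0 y)) \<noteq> 0"
      then have "f y \<noteq> 0" "\<bar>f y\<bar> \<le> B 0" by (auto simp: rest_def indicator_def split: if_splits)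
      then obtain k where k: "y \<in> lev k" by (rule ex_lev)
      have "ennreal (norm (cinf K a (x - y) * rest 0 y)) = ennreal \<bar>rest 0 y\<bar> * ennreal \<bar>cinf K a (x - y)\<bar>"
        by (simp add: abs_mult ennreal_mult mult.commute)
      also have "\<dots> \<le> ennreal (B k) * ennreal \<bar>cinf K a (x - y)\<bar>"
        using k B_pos[of k] by (intro mult_right_mono ennreal_leI) (auto simp: rest_def lev_def indicator_def)
      finally show "\<exists>k. ennreal (norm (cinf K a (x - y) * rest 0 y)) \<le> ennreal (B k) * (ennreal \<bar>cinf K a (x - y)\<bar> * ind (lev k) y)"
        using k by (intro exI[of _ k]) simp
    qed measurable
    also have "\<dots> \<le> (\<Sum>k. ennreal (c * ((real k + 1) * B k)))"
    proof (intro suminf_le)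
      fix k
      have "ennreal (B k) * (LBNN y. ennreal \<bar>cinf K a (x - y)\<bar> * ind (lev k) y) \<le> ennreal (B k) * ennreal (c * (real k + 1))"
        unfolding c_def by (intro mult_left_mono cinf_lev_integral a) auto
      also have "\<dots> = ennreal (c * ((real k + 1) * B k))"
        using B_pos[of k] c by (subst ennreal_mult[symmetric]) (auto simp: mult_ac)
      finally show "ennreal (B k) * (LBNN y. ennreal \<bar>cinf K a (x - y)\<bar> * ind (lev k) y) \<le> ennreal (c * ((real k + 1) * B k))" .
    qed auto
    also have "\<dots> < \<infinity>"
    proof -
      have "summable (\<lambda>k. c * ((real k + 1) * B k))" by (intro summable_mult B_sum)
      then have "(\<Sum>k. ennreal (c * ((real k + 1) * B k))) = ennreal (\<Sum>k. c * ((real k + 1) * B k))"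
        using c B_pos by (intro suminf_ennreal2) (auto simp: less_imp_le)
      then show ?thesis by simp
    qed
    finally show "(LBNN y. ennreal (norm (cinf K a (x - y) * rest 0 y))) < \<infinity>" .
  qed measurable
  with cinf_mult_integrable[OF a big_integrable, of x]
  have "integrable lborel (\<lambda>y. cinf K a (x - y) * big y + cinf K a (x - y) * rest 0 y)"
    by (rule Bochner_Integration.integrable_add)
  then show ?thesis by (simp only: distrib_left[symmetric] f_split(1)[symmetric])
qed

lemma ctrunc_level_integrable:
  assumes a: "0 < a" and [measurable]: "g \<in> borel_measurable borel" and g: "\<And>y. \<bar>g y\<bar> \<le> \<bar>f y\<bar>"
  shows "integrable lborel (\<lambda>y. ctrunc K a b (x - y) * g y)"
proof (rule Bochner_Integration.integrable_bound[OF cinf_level_integrable[OF a, of x]])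
  show "AE y in lborel. norm (ctrunc K a b (x - y) * g y) \<le> norm (cinf K a (x - y) * f y)"
    using g by (intro AE_I2) (auto simp: ctrunc_def ann_def cinf_def indicator_def abs_mult intro!: mult_left_mono)
qed measurable

lemma parts_le: "\<bar>big y\<bar> \<le> \<bar>f y\<bar>" "\<bar>part k y\<bar> \<le> \<bar>f y\<bar>" "\<bar>rest k y\<bar> \<le> \<bar>f y\<bar>"
  by (auto simp: big_def part_def rest_def indicator_def)

lemma cop_level_split:
  assumes a: "0 < a"
  shows "cop K a b f x = cop K a b big x + (\<Sum>k<m. cop K a b (part k) x) + cop K a b (rest m) x"
proof (induction m)
  case 0
  have "cop K a b f x = (LBINT y. ctrunc K a b (x - y) * big y + ctrunc K a b (x - y) * rest 0 y)"
    unfolding cop_def by (intro Bochner_Integration.integral_cong) (simp_all add: f_split(1)[of _] flip: distrib_left)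
  also have "\<dots> = cop K a b big x + cop K a b (rest 0) x"
    unfolding cop_def by (intro Bochner_Integration.integral_add ctrunc_level_integrable a parts_le) measurable
  finally show ?case by simp
next
  case (Suc m)
  have "cop K a b (rest m) x = (LBINT y. ctrunc K a b (x - y) * part m y + ctrunc K a b (x - y) * rest (Suc m) y)"
    unfolding cop_def f_split(2)[of m] distrib_left ..
  also have "\<dots> = cop K a b (part m) x + cop K a b (rest (Suc m)) x"
    unfolding cop_def by (intro Bochner_Integration.integral_add ctrunc_level_integrable a parts_le) measurable
  finally show ?case using Suc by simp
qed

lemma cop_rest_tendsto:
  assumes a: "0 < a"
  shows "(\<lambda>m. cop K a b (rest m) x) \<longlonglongrightarrow> 0"
proof -
  have "(\<lambda>m. cop K a b (rest m) x) \<longlonglongrightarrow> (\<integral>y. 0 \<partial>(lborel :: 'a measure))" unfolding cop_def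
  proof (rule integral_dominated_convergence[where w = "\<lambda>y. \<bar>ctrunc K a b (x - y) * f y\<bar>"])
    show "integrable lborel (\<lambda>y. \<bar>ctrunc K a b (x - y) * f y\<bar>)"
      by (intro integrable_abs ctrunc_level_integrable a) auto
    show "AE y in lborel. (\<lambda>m. ctrunc K a b (x - y) * rest m y) \<longlonglongrightarrow> 0"
    proof (rule AE_I2)
      fix y
      have "\<forall>\<^sub>F m in sequentially. rest m y = 0"
      proof (cases "f y = 0")
        case False
        then have "\<forall>\<^sub>F m in sequentially. B m < \<bar>f y\<bar>" by (intro order_tendstoD[OF B_tendsto_0]) simp
        then show ?thesis by eventually_elim (simp add: rest_def)
      qed (simp add: rest_def)
      then have "\<forall>\<^sub>F m in sequentially. ctrunc K a b (x - y) * rest m y = 0" by eventually_elim simp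
      then show "(\<lambda>m. ctrunc K a b (x - y) * rest m y) \<longlonglongrightarrow> 0" by (rule tendsto_eventually)
    qed
    show "AE y in lborel. norm (ctrunc K a b (x - y) * rest m y) \<le> \<bar>ctrunc K a b (x - y) * f y\<bar>" for m
      using parts_le(3)[of m] by (intro AE_I2) (auto simp: abs_mult intro!: mult_left_mono)
  qed measurable
  then show ?thesis by simp
qed

end

text \<open>The part above \<open>B 0\<close> is treated by weak type at height
  \<open>2 * C1 * B 0\<close>, on an exceptional set of measure t / 2. Level \<open>k\<close> is
  treated by \<open>cop_restricted\<close> with \<open>J = 2 * k + 4\<close>: the level set has
  measure at most \<open>2 ^ Suc k * t\<close>, so the exceptional set has measure at most
  \<open>t / 4 * (1/2) ^ k\<close>, which sums to another t / 2. The height is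
  \<open>2 * k + 5\<close>, at most \<open>5 * (k + 1)\<close>, times \<open>C2 * B k\<close>.
  Finite splittings with a vanishing remainder suffice.\<close>

lemma (in cz) cop_level_distribution:
  obtains C where "0 < C"
    "\<And>f t B a b. level_function f t B \<Longrightarrow> 0 < a \<Longrightarrow> a < b \<Longrightarrow>
      emeasure lborel {x. C * (\<Sum>k. (real k + 1) * B k) < \<bar>cop K a b f x\<bar>} \<le> ennreal t"
proof -
  obtain C1 where C1: "0 < C1"
    "\<And>a b f l. 0 < a \<Longrightarrow> a < b \<Longrightarrow> integrable lborel f \<Longrightarrow> 0 < l \<Longrightarrow>
      emeasure lborel {x. l < \<bar>cop K a b f x\<bar>} \<le> ennreal (C1 * L1 f / l)" using cop_weak by blast
  obtain C2 where C2: "0 < C2"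
    "\<And>a b E M g J. 0 < a \<Longrightarrow> a < b \<Longrightarrow> E \<in> sets borel \<Longrightarrow> emeasure lborel E < \<infinity> \<Longrightarrow> 0 < M \<Longrightarrow>
      g \<in> borel_measurable borel \<Longrightarrow> (\<And>x. \<bar>g x\<bar> \<le> M * ind E x) \<Longrightarrow>
      emeasure lborel {x. C2 * (real J + 1) * M < \<bar>cop K a b g x\<bar>} \<le> ennreal (2 * (1/2) ^ J * measure lborel E)"
    using cop_restricted by blast
  show thesis
  proof
    show "0 < 2 * C1 + 5 * C2" using C1 C2 by simp
    fix f :: "'a \<Rightarrow> real" and t a b :: real and B :: "nat \<Rightarrow> real"
    assume lf: "level_function f t B" and a: "0 < a" and ab: "a < b"
    interpret level_function f t B by (rule lf)
    interpret cz_level K A f t B ..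
    define s where "s = (\<Sum>k. (real k + 1) * B k)"
    define X where "X = {x. 2 * C1 * B 0 < \<bar>cop K a b big x\<bar>}"
    define Y where "Y k = {x. C2 * (real (2 * k + 4) + 1) * B k < \<bar>cop K a b (part k) x\<bar>}" for k
    have [measurable]: "X \<in> sets borel" "Y k \<in> sets borel" for k unfolding X_def Y_def by measurable
    have X: "emeasure lborel X \<le> ennreal (t / 2)"
    proof -
      have "emeasure lborel X \<le> ennreal (C1 * L1 big / (2 * C1 * B 0))"
        unfolding X_def using C1 B_pos[of 0] by (intro C1(2) a ab big_integrable) auto
      also have "\<dots> \<le> ennreal (C1 * (t * B 0) / (2 * C1 * B 0))"
        using C1 B_pos[of 0] by (intro ennreal_leI divide_right_mono mult_left_mono big_abs_le) auto
      also have "C1 * (t * B 0) / (2 * C1 * B 0) = t / 2" using C1 B_pos[of 0] by simp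
      finally show ?thesis .
    qed
    have Y: "emeasure lborel (Y k) \<le> ennreal (t / 4 * (1/2) ^ k)" for k
    proof -
      have fin: "emeasure lborel (lev k) < \<infinity>" by (rule le_less_trans[OF em_lev]) simp
      have "ennreal (measure lborel (lev k)) \<le> ennreal (2 ^ Suc k * t)"
        using em_lev[of k] fin by (simp add: emeasure_eq_ennreal_measure)
      then have lev: "measure lborel (lev k) \<le> 2 ^ Suc k * t" using t_pos by (subst (asm) ennreal_le_iff) auto
      have "emeasure lborel (Y k) \<le> ennreal (2 * (1/2) ^ (2 * k + 4) * measure lborel (lev k))" unfolding Y_def
      proof (rule C2(2)[OF a ab _ fin B_pos])
        show "\<bar>part k x\<bar> \<le> B k * ind (lev k) x" for x by (auto simp: part_def lev_def indicator_def)
      qed measurable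
      also have "\<dots> \<le> ennreal (2 * (1/2) ^ (2 * k + 4) * (2 ^ Suc k * t))"
        using lev by (intro ennreal_leI mult_left_mono) auto
      also have "2 * (1/2) ^ (2 * k + 4) * (2 ^ Suc k * t) = t / 4 * (1/2) ^ k"
      proof -
        have e1: "(1/2 :: real) ^ (2 * k + 4) = (1/2) ^ k * (1/2) ^ k * (1/16)"
          by (simp only: power_add mult_2) (simp add: eval_nat_numeral)
        have e2: "(1/2 :: real) ^ k * 2 ^ k = 1" by (simp flip: power_mult_distrib)
        have "2 * (1/2) ^ (2 * k + 4) * (2 ^ Suc k * t) = ((1/2) ^ k * 2 ^ k) * (t / 4 * (1/2) ^ k)"
          unfolding e1 by simp
        then show ?thesis by (simp only: e2 mult_1)
      qed
      finally show ?thesis .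
    qed
    have "{x. (2 * C1 + 5 * C2) * s < \<bar>cop K a b f x\<bar>} \<subseteq> X \<union> (\<Union>k. Y k)"
    proof (rule ccontr)
      assume "\<not> ?thesis"
      then obtain x where x: "(2 * C1 + 5 * C2) * s < \<bar>cop K a b f x\<bar>" "x \<notin> X" "\<And>k. x \<notin> Y k" by auto
      have nonneg: "0 \<le> (real k + 1) * B k" for k using B_pos[of k] by simp
      have sum_le: "(\<Sum>k<m. (real k + 1) * B k) \<le> s" for m
        unfolding s_def using nonneg by (intro sum_le_suminf B_sum) auto
      have B0: "B 0 \<le> s" using sum_le[of 1] by simp
      have bound: "\<bar>cop K a b f x\<bar> \<le> (2 * C1 + 5 * C2) * s + \<bar>cop K a b (rest m) x\<bar>" for m
      proof -
        have "\<bar>\<Sum>k<m. cop K a b (part k) x\<bar> \<le> (\<Sum>k<m. \<bar>cop K a b (part k) x\<bar>)" by (rule sum_abs)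
        also have "\<dots> \<le> (\<Sum>k<m. 5 * C2 * ((real k + 1) * B k))"
        proof (intro sum_mono)
          fix k
          have "\<bar>cop K a b (part k) x\<bar> \<le> C2 * (real (2 * k + 4) + 1) * B k"
            using x(3)[of k] by (simp add: Y_def not_less)
          also have "\<dots> \<le> C2 * (5 * (real k + 1)) * B k"
            using C2 B_pos[of k] by (intro mult_right_mono mult_left_mono) auto
          finally show "\<bar>cop K a b (part k) x\<bar> \<le> 5 * C2 * ((real k + 1) * B k)" by (simp add: mult_ac)
        qed
        also have "\<dots> = 5 * C2 * (\<Sum>k<m. (real k + 1) * B k)" by (rule sum_distrib_left[symmetric])
        also have "\<dots> \<le> 5 * C2 * s" using C2 by (intro mult_left_mono sum_le) auto
        finally have 1: "\<bar>\<Sum>k<m. cop K a b (part k) x\<bar> \<le> 5 * C2 * s" .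
        have "\<bar>cop K a b big x\<bar> \<le> 2 * C1 * B 0" using x(2) by (simp add: X_def)
        also have "\<dots> \<le> 2 * C1 * s" using C1 B0 by (intro mult_left_mono) auto
        finally show ?thesis using 1 unfolding cop_level_split[OF a, of b x m] by (simp add: distrib_right)
      qed
      have "(\<lambda>m. (2 * C1 + 5 * C2) * s + \<bar>cop K a b (rest m) x\<bar>) \<longlonglongrightarrow> (2 * C1 + 5 * C2) * s + \<bar>0\<bar>"
        by (intro tendsto_add tendsto_const tendsto_rabs cop_rest_tendsto a)
      then have "\<bar>cop K a b f x\<bar> \<le> (2 * C1 + 5 * C2) * s + \<bar>0\<bar>" by (rule LIMSEQ_le_const) (use bound in blast)
      with x(1) show False by simp
    qed
    then have "emeasure lborel {x. (2 * C1 + 5 * C2) * s < \<bar>cop K a b f x\<bar>} \<le> emeasure lborel (X \<union> (\<Union>k. Y k))"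
      by (intro emeasure_mono) auto
    also have "\<dots> \<le> emeasure lborel X + emeasure lborel (\<Union>k. Y k)" by (intro emeasure_subadditive) auto
    also have "\<dots> \<le> ennreal (t / 2) + (\<Sum>k. emeasure lborel (Y k))"
      by (intro add_mono X emeasure_subadditive_countably) auto
    also have "\<dots> \<le> ennreal (t / 2) + (\<Sum>k. 1 * ennreal (t / 4 * (1/2) ^ k))"
      using Y by (intro add_left_mono suminf_le) auto
    also have "(\<Sum>k. 1 * ennreal (t / 4 * (1/2) ^ k)) = 1 * ennreal (t / 4 / (1 - 1/2))"
      using t_pos by (intro suminf_ennreal_geometric) auto
    also have "ennreal (t / 2) + 1 * ennreal (t / 4 / (1 - 1/2)) = ennreal t" using t_pos by (simp flip: ennreal_plus)
    finally show "emeasure lborel {x. (2 * C1 + 5 * C2) * (\<Sum>k. (real k + 1) * B k) < \<bar>cop K a b f x\<bar>} \<le> ennreal t"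
      by (simp add: s_def)
  qed
qed

text \<open>Localization: for \<open>norm x \<le> real r\<close> and truncations up to 1, removing
  \<open>f\<close> outside the ball of radius \<open>r + 1\<close> changes the integral by an amount
  independent of the truncation. Inside that ball \<open>f\<close> is integrable.\<close>

lemma (in cz_pv) copi_level_convergent:
  assumes lf: "level_function f t B"
  shows "AE x in lborel. \<exists>L. ((\<lambda>\<epsilon>. copi K \<epsilon> f x) \<longlongrightarrow> L) (at_right 0)"
proof -
  interpret level_function f t B by (rule lf)
  interpret cz_level K A f t B ..
  have "AE x in lborel. \<forall>r::nat. norm x \<le> real r \<longrightarrow> (\<exists>L. ((\<lambda>\<epsilon>. copi K \<epsilon> f x) \<longlongrightarrow> L) (at_right 0))"
    unfolding AE_all_countable
  proof
    fix r :: nat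
    define g where "g y = ind (cball 0 (real r + 1)) y * f y" for y
    have g: "integrable lborel g" unfolding g_def[abs_def] by (rule integrable_on_ball)
    have diff: "copi K \<epsilon> f x = copi K \<epsilon> g x + (copi K 1 f x - copi K 1 g x)"
      if x: "norm x \<le> real r" and \<epsilon>: "0 < \<epsilon>" "\<epsilon> \<le> 1" for x \<epsilon>
    proof -
      note int = cinf_level_integrable[OF \<epsilon>(1), of x] cinf_mult_integrable[OF \<epsilon>(1) g, of x]
        cinf_level_integrable[of 1 x] cinf_mult_integrable[OF _ g, of 1 x]
      have "copi K \<epsilon> f x - copi K \<epsilon> g x = (LBINT y. cinf K \<epsilon> (x - y) * f y - cinf K \<epsilon> (x - y) * g y)"
        unfolding copi_def by (intro Bochner_Integration.integral_diff[symmetric] int)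
      also have "\<dots> = (LBINT y. cinf K 1 (x - y) * f y - cinf K 1 (x - y) * g y)"
      proof (intro Bochner_Integration.integral_cong refl)
        fix y
        show "cinf K \<epsilon> (x - y) * f y - cinf K \<epsilon> (x - y) * g y = cinf K 1 (x - y) * f y - cinf K 1 (x - y) * g y"
        proof (cases "norm y \<le> real r + 1")
          case False
          then have "1 < norm (x - y)" using x norm_triangle_ineq2[of y x] by (simp add: norm_minus_commute)
          then show ?thesis using \<epsilon> by (simp add: cinf_def)
        qed (simp add: g_def)
      qed
      also have "\<dots> = copi K 1 f x - copi K 1 g x"
        unfolding copi_def by (intro Bochner_Integration.integral_diff int) auto
      finally show ?thesis by simp
    qed
    show "AE x in lborel. norm x \<le> real r \<longrightarrow> (\<exists>L. ((\<lambda>\<epsilon>. copi K \<epsilon> f x) \<longlongrightarrow> L) (at_right 0))" using copi_convergent[OF g]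
    proof eventually_elim
      case (elim x)
      show ?case
      proof
        assume x: "norm x \<le> real r"
        obtain L where L: "((\<lambda>\<epsilon>. copi K \<epsilon> g x) \<longlongrightarrow> L) (at_right 0)" using elim by blast
        then have "((\<lambda>\<epsilon>. copi K \<epsilon> g x + (copi K 1 f x - copi K 1 g x)) \<longlongrightarrow> L + (copi K 1 f x - copi K 1 g x)) (at_right 0)"
          by (rule tendsto_add[OF _ tendsto_const])
        moreover have "\<forall>\<^sub>F \<epsilon> in at_right 0. copi K \<epsilon> g x + (copi K 1 f x - copi K 1 g x) = copi K \<epsilon> f x"
          unfolding eventually_at_right_field
          by (intro exI[of _ 1] conjI allI impI zero_less_one diff[OF x, symmetric] less_imp_le)
        ultimately have "((\<lambda>\<epsilon>. copi K \<epsilon> f x) \<longlongrightarrow> L + (copi K 1 f x - copi K 1 g x)) (at_right 0)"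
          by (rule Lim_transform_eventually)
        then show "\<exists>L. ((\<lambda>\<epsilon>. copi K \<epsilon> f x) \<longlongrightarrow> L) (at_right 0)" by (rule exI)
      qed
    qed
  qed
  then show ?thesis
  proof eventually_elim
    case (elim x)
    obtain r :: nat where "norm x \<le> real r" using real_arch_simple by blast
    then show ?case using elim by blast
  qed
qed

text \<open>The operator with inner radius \<open>1 / (m + 1)\<close> and outer radius
  \<open>m + 2\<close> is a difference of two one-sided truncations, the second of which tends to 0
  by dominated convergence. So the uniform bound passes to the limit \<open>u\<close>.\<close>

lemma (in cz) copi_level_distribution:
  obtains C where "0 < C"
    "\<And>f t B u. level_function f t B \<Longrightarrow> u \<in> borel_measurable borel \<Longrightarrow>
      (AE x in lborel. ((\<lambda>\<epsilon>. copi K \<epsilon> f x) \<longlongrightarrow> u x) (at_right 0)) \<Longrightarrow>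
      emeasure lborel {x. C * (\<Sum>k. (real k + 1) * B k) < \<bar>u x\<bar>} \<le> ennreal t"
proof -
  obtain C where C: "0 < C"
    "\<And>f t B a b. level_function f t B \<Longrightarrow> 0 < a \<Longrightarrow> a < b \<Longrightarrow>
      emeasure lborel {x. C * (\<Sum>k. (real k + 1) * B k) < \<bar>cop K a b f x\<bar>} \<le> ennreal t"
    using cop_level_distribution by blast
  show thesis
  proof
    show "0 < C" by (rule C)
    fix f u :: "'a \<Rightarrow> real" and t :: real and B :: "nat \<Rightarrow> real"
    assume lf: "level_function f t B" and [measurable]: "u \<in> borel_measurable borel"
      and conv: "AE x in lborel. ((\<lambda>\<epsilon>. copi K \<epsilon> f x) \<longlongrightarrow> u x) (at_right 0)"
    interpret level_function f t B by (rule lf)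
    interpret cz_level K A f t B ..
    define a where "a m = inverse (real (Suc m))" for m
    define b where "b m = real m + 2" for m
    have a: "0 < a m" "a m \<le> 1" "a m < b m" for m
    proof -
      show "0 < a m" by (simp add: a_def)
      have "a m \<le> inverse 1" unfolding a_def by (intro le_imp_inverse_le) auto
      then show "a m \<le> 1" by simp
      then show "a m < b m" by (simp add: b_def)
    qed
    have tail: "(\<lambda>m. copi K (b m) f x) \<longlonglongrightarrow> 0" for x
    proof -
      have "(\<lambda>m. copi K (b m) f x) \<longlonglongrightarrow> (\<integral>y. 0 \<partial>(lborel :: 'a measure))" unfolding copi_def
      proof (rule integral_dominated_convergence[where w = "\<lambda>y. \<bar>cinf K 1 (x - y) * f y\<bar>"])
        show "integrable lborel (\<lambda>y. \<bar>cinf K 1 (x - y) * f y\<bar>)" by (intro integrable_abs cinf_level_integrable) simp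
        show "AE y in lborel. (\<lambda>m. cinf K (b m) (x - y) * f y) \<longlonglongrightarrow> 0"
        proof (rule AE_I2)
          fix y
          obtain M :: nat where "norm (x - y) \<le> real M" using real_arch_simple by blast
          then have "\<forall>\<^sub>F m in sequentially. cinf K (b m) (x - y) * f y = 0"
            unfolding eventually_sequentially by (intro exI[of _ M]) (auto simp: cinf_def b_def)
          then show "(\<lambda>m. cinf K (b m) (x - y) * f y) \<longlonglongrightarrow> 0" by (rule tendsto_eventually)
        qed
        show "AE y in lborel. norm (cinf K (b m) (x - y) * f y) \<le> \<bar>cinf K 1 (x - y) * f y\<bar>" for m
          by (intro AE_I2) (auto simp: cinf_def indicator_def b_def)
      qed measurable
      then show ?thesis by simp
    qed
    have split: "copi K (a m) f x - copi K (b m) f x = cop K (a m) (b m) f x" for m x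
    proof -
      have "0 < b m" using a[of m] by linarith
      then have "copi K (a m) f x - copi K (b m) f x = (LBINT y. cinf K (a m) (x - y) * f y - cinf K (b m) (x - y) * f y)"
        unfolding copi_def by (intro Bochner_Integration.integral_diff[symmetric] cinf_level_integrable a)
      also have "\<dots> = cop K (a m) (b m) f x" unfolding cop_def using a[of m]
        by (intro Bochner_Integration.integral_cong) (auto simp: cinf_def ctrunc_def ann_def indicator_def)
      finally show ?thesis .
    qed
    have "emeasure lborel {x\<in>space lborel. C * (\<Sum>k. (real k + 1) * B k) < \<bar>u x\<bar>} \<le> ennreal t"
    proof (rule emeasure_limit_le[where f = "\<lambda>m. cop K (a m) (b m) f"])
      show "AE x in lborel. (\<lambda>m. cop K (a m) (b m) f x) \<longlonglongrightarrow> u x" using conv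
      proof eventually_elim
        case (elim x)
        have "filterlim a (at_right 0) sequentially"
          unfolding filterlim_at using LIMSEQ_inverse_real_of_nat by (simp add: a_def[abs_def])
        then have "(\<lambda>m. copi K (a m) f x) \<longlonglongrightarrow> u x" using elim by (rule filterlim_compose[rotated])
        then have "(\<lambda>m. copi K (a m) f x - copi K (b m) f x) \<longlonglongrightarrow> u x - 0" by (intro tendsto_diff tail)
        then show ?case by (simp add: split)
      qed
      show "emeasure lborel {x\<in>space lborel. C * (\<Sum>k. (real k + 1) * B k) < \<bar>cop K (a m) (b m) f x\<bar>} \<le> ennreal t" for m
        using C(2)[OF lf a(1) a(3)] by simp
    qed measurable
    then show "emeasure lborel {x. C * (\<Sum>k. (real k + 1) * B k) < \<bar>u x\<bar>} \<le> ennreal t" by simp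
  qed
qed

section \<open>The fundamental function of a weight\<close>

definition Fi :: "(real \<Rightarrow> ennreal) \<Rightarrow> real \<Rightarrow> ennreal" where
  "Fi w t = (LBNN s. w s * ind {0<..<t} s)"

definition Ai :: "real \<Rightarrow> (real \<Rightarrow> ennreal) \<Rightarrow> real \<Rightarrow> ennreal" where
  "Ai p w t = (LBNN s. w s * ennreal (s powr (-p)) * ind {t<..} s)"

text \<open>If E has measure t, then the averaged rearrangement of its indicator at s is min(1,
  t/s). By \<open>Gi_eq\<close> this is hence the p-th power of the Gamma norm of that indicator:
  the fundamental function of the space.\<close>

definition Gi :: "real \<Rightarrow> (real \<Rightarrow> ennreal) \<Rightarrow> real \<Rightarrow> ennreal" where
  "Gi p w t = Fi w t + ennreal (t powr p) * Ai p w t"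

lemma power_powr: "0 < (x :: real) \<Longrightarrow> (x ^ k) powr a = (x powr a) ^ k"
  by (simp add: powr_powr mult.commute flip: powr_realpow)

lemma AE_lborel_neq: "AE x in lborel. x \<noteq> (c :: real)"
  by (rule AE_I[where N = "{c}"]) auto

lemma Gi_eq:
  assumes [measurable]: "w \<in> borel_measurable borel" and t: "0 < t"
  shows "Gi p w t = (LBNN s. w s * ennreal (min 1 (t / s) powr p) * ind {0<..} s)"
proof -
  have "Gi p w t = (LBNN s. w s * ind {0<..<t} s)
      + (LBNN s. ennreal (t powr p) * (w s * ennreal (s powr (-p)) * ind {t<..} s))"
    unfolding Gi_def Fi_def Ai_def by (subst nn_integral_cmult) auto
  also have "\<dots> = (LBNN s. w s * ind {0<..<t} s + ennreal (t powr p) * (w s * ennreal (s powr (-p)) * ind {t<..} s))"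
    by (intro nn_integral_add[symmetric]) auto
  also have "\<dots> = (LBNN s. w s * ennreal (min 1 (t / s) powr p) * ind {0<..} s)"
  proof (rule nn_integral_cong_AE)
    show "AE s in lborel. w s * ind {0<..<t} s + ennreal (t powr p) * (w s * ennreal (s powr (-p)) * ind {t<..} s)
        = w s * ennreal (min 1 (t / s) powr p) * ind {0<..} s" using AE_lborel_neq[of t]
    proof eventually_elim
      case (elim s)
      consider "s \<le> 0" | "0 < s" "s < t" | "t < s" using elim by linarith
      then show ?case
      proof cases
        case 2
        then have "min 1 (t / s) = 1" by simp
        then show ?thesis using 2 by simp
      next
        case 3
        then have "min 1 (t / s) = t / s" using t by simp
        moreover have "(t / s) powr p = t powr p * s powr (-p)" using t 3 by (simp add: powr_divide powr_minus_divide)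
        ultimately show ?thesis using 3 t by (simp add: ennreal_mult mult_ac)
      qed (use t in auto)
    qed
  qed
  finally show ?thesis .
qed

lemma Gi_mono:
  assumes w: "w \<in> borel_measurable borel" and t: "0 < t" "t \<le> t'" and p: "0 < p"
  shows "Gi p w t \<le> Gi p w t'"
proof -
  have t': "0 < t'" using t by linarith
  show ?thesis unfolding Gi_eq[OF w t(1)] Gi_eq[OF w t']
  proof (intro nn_integral_mono)
    fix s :: real
    have "min 1 (t / s) powr p \<le> min 1 (t' / s) powr p" if "0 < s"
    proof (intro powr_mono2)
      have "t / s \<le> t' / s" using t that by (intro divide_right_mono) auto
      then show "min 1 (t / s) \<le> min 1 (t' / s)" by (intro min.mono) auto
    qed (use p t that in auto)
    then show "w s * ennreal (min 1 (t / s) powr p) * ind {0<..} s \<le> w s * ennreal (min 1 (t' / s) powr p) * ind {0<..} s"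
      by (auto simp: indicator_def intro!: mult_left_mono ennreal_leI)
  qed
qed

lemma Gi_scale_le:
  assumes w[measurable]: "w \<in> borel_measurable borel" and t: "0 < t" and l: "1 \<le> l" and p: "0 < p"
  shows "Gi p w (l * t) \<le> ennreal (l powr p) * Gi p w t"
proof -
  have lt: "0 < l * t" using t l by simp
  have "Gi p w (l * t) \<le> (LBNN s. ennreal (l powr p) * (w s * ennreal (min 1 (t / s) powr p) * ind {0<..} s))"
    unfolding Gi_eq[OF w lt]
  proof (intro nn_integral_mono)
    fix s :: real
    have "min 1 (l * t / s) powr p \<le> l powr p * min 1 (t / s) powr p" if s: "0 < s"
    proof -
      have "min 1 (l * t / s) \<le> l * min 1 (t / s)"
      proof (cases "s \<le> t")
        case True
        then have "min 1 (t / s) = 1" using s by simp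
        then show ?thesis using l by (simp add: min.coboundedI1)
      next
        case False
        then have "min 1 (t / s) = t / s" using s by simp
        then show ?thesis by simp
      qed
      then have "min 1 (l * t / s) powr p \<le> (l * min 1 (t / s)) powr p" using l t s p by (intro powr_mono2) auto
      also have "\<dots> = l powr p * min 1 (t / s) powr p" using l t s by (intro powr_mult)
      finally show ?thesis .
    qed
    then have "w s * ennreal (min 1 (l * t / s) powr p) \<le> w s * ennreal (l powr p * min 1 (t / s) powr p)" if "0 < s"
      using that by (intro mult_left_mono ennreal_leI) auto
    then show "w s * ennreal (min 1 (l * t / s) powr p) * ind {0<..} s
      \<le> ennreal (l powr p) * (w s * ennreal (min 1 (t / s) powr p) * ind {0<..} s)"
      by (auto simp: indicator_def ennreal_mult mult.left_commute)
  qed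
  also have "\<dots> = ennreal (l powr p) * Gi p w t" unfolding Gi_eq[OF w t] by (intro nn_integral_cmult) measurable
  finally show ?thesis .
qed

text \<open>The hypotheses on \<open>\<phi>\<close> and \<open>\<psi>\<close> both have this form.\<close>

definition half_cond :: "real \<Rightarrow> (real \<Rightarrow> ennreal) \<Rightarrow> real \<Rightarrow> bool" where
  "half_cond p w c \<longleftrightarrow> 0 < c \<and> c < 1 \<and>
     (\<forall>t>0. Fi w (c * t) + ennreal (c powr p * t powr p) * Ai p w t \<le> ennreal (1 / 2) * Gi p w t)"

text \<open>The left side of the condition leaves out the interval from \<open>c * t\<close> to
  \<open>t\<close>. Shrinking \<open>t\<close> further by the factor \<open>d\<close> with
  \<open>d powr p = 1 / 4\<close> makes the contribution of this interval at most a quarter of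
  \<open>Gi p w t\<close>, and 1/2 + 1/4 = 3/4.\<close>

lemma half_cond_step:
  assumes w[measurable]: "w \<in> borel_measurable borel" and p: "0 < p" and c: "half_cond p w c"
  obtains q where "0 < q" "q < 1" "\<And>t. 0 < t \<Longrightarrow> Gi p w (q * t) \<le> ennreal (3 / 4) * Gi p w t"
proof -
  have c01: "0 < c" "c < 1" and
    c': "\<And>t. 0 < t \<Longrightarrow> Fi w (c * t) + ennreal (c powr p * t powr p) * Ai p w t \<le> ennreal (1 / 2) * Gi p w t"
    using c by (auto simp: half_cond_def)
  define d :: real where "d = (1 / 4) powr (1 / p)"
  have d: "0 < d" "d \<le> 1" "d powr p = 1 / 4"
  proof -
    show "0 < d" by (simp add: d_def)
    have "(1 / 4 :: real) powr (1 / p) \<le> 1 powr (1 / p)" using p by (intro powr_mono2) auto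
    then show "d \<le> 1" by (simp add: d_def)
    show "d powr p = 1 / 4" using p by (simp add: d_def powr_powr)
  qed
  show thesis
  proof
    show "0 < c * d" using c01 d by simp
    show "c * d < 1" using c01 d by (meson less_eq_real_def mult_left_le order.strict_trans1)
    fix t :: real assume t: "0 < t"
    have cdt: "0 < c * d * t" using c01 d t by simp
    let ?m = "\<lambda>s. w s * ennreal (min 1 (t / s) powr p) * ind {0<..} s"
    have "Gi p w (c * d * t) \<le> (LBNN s. w s * ind {0<..<c * t} s
        + ennreal (c powr p * t powr p) * (w s * ennreal (s powr (-p)) * ind {t<..} s) + ennreal (1 / 4) * ?m s)"
      unfolding Gi_eq[OF w cdt]
    proof (intro nn_integral_mono)
      fix s :: real
      let ?r = "w s * ind {0<..<c * t} s + ennreal (c powr p * t powr p) * (w s * ennreal (s powr (-p)) * ind {t<..} s) + ennreal (1 / 4) * ?m s"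
      consider "s \<le> 0" | "0 < s" "s < c * t" | "c * t \<le> s" "0 < s" "s \<le> t" | "t < s" "0 < s" using t by linarith
      then show "w s * ennreal (min 1 (c * d * t / s) powr p) * ind {0<..} s \<le> ?r"
      proof cases
        case 1
        then show ?thesis by simp
      next
        case 2
        have "min 1 (c * d * t / s) powr p \<le> 1 powr p" using p cdt 2 by (intro powr_mono2) auto
        then have "w s * ennreal (min 1 (c * d * t / s) powr p) \<le> w s * ennreal 1"
          by (intro mult_left_mono ennreal_leI) auto
        then show ?thesis using 2 by (simp add: add_increasing2 add.assoc)
      next
        case 3
        have "c * d * t / s \<le> d" using 3 d by (simp add: divide_le_eq mult.commute mult_left_mono)
        then have "min 1 (c * d * t / s) powr p \<le> d powr p" using p cdt 3 by (intro powr_mono2) auto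
        then have "w s * ennreal (min 1 (c * d * t / s) powr p) \<le> w s * ennreal (1 / 4)"
          unfolding d by (intro mult_left_mono ennreal_leI) auto
        moreover have "min 1 (t / s) = 1" using 3 by simp
        ultimately show ?thesis using 3 by (simp add: add_increasing mult.commute)
      next
        case 4
        have "min 1 (c * d * t / s) powr p \<le> (c * t / s) powr p"
        proof (intro powr_mono2)
          have "c * d * t / s \<le> c * t / s" using 4 c01 d t by (intro divide_right_mono) (auto simp: mult_left_le)
          then show "min 1 (c * d * t / s) \<le> c * t / s" by (simp add: min.coboundedI2)
        qed (use p cdt 4 in auto)
        also have "\<dots> = c powr p * t powr p * s powr (-p)"
          using 4 c01 t by (simp add: powr_divide powr_mult powr_minus_divide)
        finally have "w s * ennreal (min 1 (c * d * t / s) powr p) \<le> w s * ennreal (c powr p * t powr p * s powr (-p))"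
          by (intro mult_left_mono ennreal_leI) auto
        also have "\<dots> = ennreal (c powr p * t powr p) * (w s * ennreal (s powr (-p)))"
          by (simp add: ennreal_mult mult_ac)
        finally show ?thesis using 4 by (simp add: add_increasing add_increasing2)
      qed
    qed
    also have "\<dots> = Fi w (c * t) + ennreal (c powr p * t powr p) * Ai p w t + ennreal (1 / 4) * Gi p w t"
      unfolding Gi_eq[OF w t] Fi_def Ai_def
      by (subst nn_integral_cmult[symmetric], measurable)+ (intro nn_integral_add3, measurable)
    also have "\<dots> \<le> ennreal (1 / 2) * Gi p w t + ennreal (1 / 4) * Gi p w t" by (intro add_right_mono c' t)
    also have "\<dots> = ennreal (1 / 2 + 1 / 4) * Gi p w t" by (subst ennreal_plus) (auto simp: distrib_right)
    finally show "Gi p w (c * d * t) \<le> ennreal (3 / 4) * Gi p w t" by simp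
  qed
qed

text \<open>Iteration along blocks of \<open>N\<close> halvings, where
  \<open>(1 / 2) ^ N < q\<close>. An incomplete last block is paid by the constant 4/3.\<close>

lemma Gi_decay:
  assumes w: "w \<in> borel_measurable borel" and p: "0 < p" and c: "half_cond p w c"
  obtains C h where "0 < C" "0 < h" "h < 1"
    "\<And>k t. 0 < t \<Longrightarrow> Gi p w (t / 2 ^ k) \<le> ennreal (C * h ^ k) * Gi p w t"
proof -
  obtain q where q: "0 < q" "q < 1" "\<And>t. 0 < t \<Longrightarrow> Gi p w (q * t) \<le> ennreal (3 / 4) * Gi p w t"
    using half_cond_step[OF assms] by blast
  obtain N where N: "(1 / 2) ^ N < q" using real_arch_pow_inv[of q "1 / 2"] q by auto
  have N0: "0 < N" using N q by (cases N) auto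
  have step: "Gi p w (t / 2 ^ N) \<le> ennreal (3 / 4) * Gi p w t" if t: "0 < t" for t
  proof -
    have "t / 2 ^ N \<le> q * t" using N t by (simp add: power_divide field_simps)
    then have "Gi p w (t / 2 ^ N) \<le> Gi p w (q * t)" using t p by (intro Gi_mono w) auto
    also have "\<dots> \<le> ennreal (3 / 4) * Gi p w t" by (rule q(3)[OF t])
    finally show ?thesis .
  qed
  have steps: "Gi p w (t / 2 ^ (N * j)) \<le> ennreal ((3 / 4) ^ j) * Gi p w t" if t: "0 < t" for t j
  proof (induction j)
    case (Suc j)
    have "Gi p w (t / 2 ^ (N * Suc j)) = Gi p w ((t / 2 ^ (N * j)) / 2 ^ N)" by (simp add: power_add mult.commute)
    also have "\<dots> \<le> ennreal (3 / 4) * Gi p w (t / 2 ^ (N * j))" using t by (intro step) auto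
    also have "\<dots> \<le> ennreal (3 / 4) * (ennreal ((3 / 4) ^ j) * Gi p w t)" by (intro mult_left_mono Suc) auto
    also have "\<dots> = ennreal ((3 / 4) ^ Suc j) * Gi p w t"
      by (subst mult.assoc[symmetric], subst ennreal_mult[symmetric]) auto
    finally show ?case .
  qed simp
  define h :: real where "h = (3 / 4) powr (1 / real N)"
  have h: "0 < h" "h < 1" "h ^ N = 3 / 4"
  proof -
    show "0 < h" by (simp add: h_def)
    have "(3 / 4 :: real) powr (1 / real N) < 1 powr (1 / real N)" using N0 by (intro powr_less_mono2) auto
    then show "h < 1" by (simp add: h_def)
    have "h ^ N = h powr real N" using \<open>0 < h\<close> by (simp add: powr_realpow)
    also have "\<dots> = 3 / 4" using N0 by (simp add: h_def powr_powr)
    finally show "h ^ N = 3 / 4" .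
  qed
  show thesis
  proof
    show "0 < (4 / 3 :: real)" "0 < h" "h < 1" using h by auto
    fix k and t :: real assume t: "0 < t"
    define j where "j = k div N"
    have j: "N * j \<le> k" "k \<le> N * Suc j" using N0 dividend_less_times_div[of N k] by (auto simp: j_def)
    have "t / 2 ^ k \<le> t / 2 ^ (N * j)" using t j by (intro divide_left_mono power_increasing) auto
    then have "Gi p w (t / 2 ^ k) \<le> Gi p w (t / 2 ^ (N * j))" using t p by (intro Gi_mono w) auto
    also have "\<dots> \<le> ennreal ((3 / 4) ^ j) * Gi p w t" by (rule steps[OF t])
    also have "(3 / 4) ^ j \<le> 4 / 3 * h ^ k"
    proof -
      have "(3 / 4) ^ Suc j = h ^ (N * Suc j)" by (simp only: power_mult h)
      also have "\<dots> \<le> h ^ k" using j h by (intro power_decreasing) auto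
      finally show ?thesis by simp
    qed
    finally show "Gi p w (t / 2 ^ k) \<le> ennreal (4 / 3 * h ^ k) * Gi p w t" by (simp add: ennreal_leI mult_right_mono)
  qed
qed


locale gweight =
  fixes p :: real and w :: "real \<Rightarrow> ennreal"
  assumes p: "1 < p"
    and w_borel [measurable]: "w \<in> borel_measurable borel"
    and G1: "Gi p w 1 < \<infinity>"
    and F_nz: "0 < t \<Longrightarrow> Fi w t \<noteq> 0"
begin

lemma Gi_fin: "0 < t \<Longrightarrow> Gi p w t < \<infinity>"
proof -
  assume t: "0 < t"
  show ?thesis
  proof (cases "1 \<le> t")
    case True
    have "Gi p w (t * 1) \<le> ennreal (t powr p) * Gi p w 1" using True p by (intro Gi_scale_le) auto
    also have "\<dots> < \<infinity>" using G1 by (simp add: ennreal_mult_less_top)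
    finally show ?thesis by simp
  next
    case False
    then have "Gi p w t \<le> Gi p w 1" using t p by (intro Gi_mono) auto
    then show ?thesis using G1 by (rule le_less_trans)
  qed
qed

definition F :: "real \<Rightarrow> real" where "F t = enn2real (Fi w t)"
definition a :: "real \<Rightarrow> real" where "a t = ind {0<..} t * enn2real (Ai p w t)"
definition g :: "real \<Rightarrow> real" where "g t = F t + t powr p * a t"

lemma Fi_eq: "0 < t \<Longrightarrow> Fi w t = ennreal (F t)"
  using Gi_fin[of t] by (simp add: F_def Gi_def)

lemma Ai_eq: "0 < t \<Longrightarrow> Ai p w t = ennreal (a t)"
  using Gi_fin[of t] by (auto simp: a_def Gi_def ennreal_mult_less_top)

lemma F_pos: "0 < t \<Longrightarrow> 0 < F t"
proof -
  assume t: "0 < t"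
  have "F t \<noteq> 0" using Fi_eq[OF t] F_nz[OF t] by force
  moreover have "0 \<le> F t" by (simp add: F_def)
  ultimately show ?thesis by simp
qed

lemma a_nonneg: "0 \<le> a t"
  by (simp add: a_def)

lemma Gi_eq_g: "0 < t \<Longrightarrow> Gi p w t = ennreal (g t)"
  using F_pos[of t] a_nonneg[of t] by (simp add: Gi_def Fi_eq Ai_eq g_def ennreal_plus ennreal_mult)

lemma g_pos: "0 < t \<Longrightarrow> 0 < g t"
  using F_pos[of t] a_nonneg[of t] by (simp add: g_def add_pos_nonneg)

lemma F_mono: "0 < s \<Longrightarrow> s \<le> t \<Longrightarrow> F s \<le> F t"
proof -
  assume s: "0 < s" "s \<le> t"
  have "Fi w s \<le> Fi w t" unfolding Fi_def using s by (intro nn_integral_mono) (auto simp: indicator_def)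
  then show ?thesis using s F_pos[of t] by (simp add: Fi_eq)
qed

lemma a_mono: "0 < s \<Longrightarrow> s \<le> t \<Longrightarrow> a t \<le> a s"
proof -
  assume s: "0 < s" "s \<le> t"
  have "Ai p w t \<le> Ai p w s" unfolding Ai_def using s by (intro nn_integral_mono) (auto simp: indicator_def)
  then show ?thesis using s a_nonneg[of s] by (simp add: Ai_eq)
qed

text \<open>The weight may be wild, but its tail integral is continuous since points are null sets.
  This makes the integrand in \<open>Gi_integral\<close> continuous, so that \<open>g\<close>
  becomes continuously differentiable.\<close>

lemma a_continuous: "continuous_on {0<..} a"
proof -
  define v where "v s = enn2real (w s * ennreal (s powr (-p)))" for s
  have [measurable]: "v \<in> borel_measurable borel" unfolding v_def[abs_def] by measurable
  have cont: "isCont a t" if t: "0 < t" for t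
  proof -
    define c where "c = t / 2"
    have c: "0 < c" "c < t" using t by (auto simp: c_def)
    have AEfin: "AE s in lborel. w s * ennreal (s powr (-p)) * ind {c<..} s \<noteq> \<infinity>"
      using Ai_eq[OF c(1)] by (intro nn_integral_PInf_AE) (auto simp: Ai_def)
    have v_eq: "AE s in lborel. w s * ennreal (s powr (-p)) * ind {x<..} s = ennreal (ind {x<..} s * v s)" if "c \<le> x" for x
      using AEfin by eventually_elim (use that in \<open>auto simp: v_def indicator_def less_top\<close>)
    have int: "integrable lborel (\<lambda>s. ind {x<..} s * v s)" and a_eq: "a x = (LBINT s. ind {x<..} s * v s)" if x: "c \<le> x" for x
    proof -
      have eq: "(LBNN s. ennreal (ind {x<..} s * v s)) = ennreal (a x)"
        using x c v_eq[OF x] Ai_eq[of x] unfolding Ai_def by (subst nn_integral_cong_AE[of _ "\<lambda>s. w s * ennreal (s powr (-p)) * ind {x<..} s"]) auto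
      show "integrable lborel (\<lambda>s. ind {x<..} s * v s)" using eq by (intro integrableI_nonneg) (auto simp: v_def)
      then have "ennreal (LBINT s. ind {x<..} s * v s) = ennreal (a x)"
        using eq by (subst nn_integral_eq_integral[symmetric]) (auto simp: v_def)
      then show "a x = (LBINT s. ind {x<..} s * v s)"
        using a_nonneg[of x] by (subst (asm) ennreal_inj) (auto simp: v_def)
    qed
    have "((\<lambda>x. a x) \<longlongrightarrow> a t) (at t)" unfolding tendsto_at_iff_sequentially
    proof (intro allI impI)
      fix X :: "nat \<Rightarrow> real" assume X: "\<forall>i. X i \<in> UNIV - {t}" "X \<longlonglongrightarrow> t"
      have ev: "\<forall>\<^sub>F i in sequentially. c < X i" using X(2) c by (intro order_tendstoD)
      have "(\<lambda>i. (LBINT s. ind {max c (X i)<..} s * v s)) \<longlonglongrightarrow> (LBINT s. ind {t<..} s * v s)"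
      proof (rule integral_dominated_convergence[where w = "\<lambda>s. ind {c<..} s * v s"])
        show "integrable lborel (\<lambda>s. ind {c<..} s * v s)" by (rule int) simp
        show "AE s in lborel. (\<lambda>i. ind {max c (X i)<..} s * v s) \<longlonglongrightarrow> ind {t<..} s * v s" using AE_lborel_neq[of t]
        proof eventually_elim
          case (elim s)
          have "\<forall>\<^sub>F i in sequentially. ind {max c (X i)<..} s * v s = ind {t<..} s * v s"
          proof (cases "s < t")
            case True
            then have "\<forall>\<^sub>F i in sequentially. s < X i" using X(2) by (intro order_tendstoD)
            then show ?thesis by eventually_elim (use True in auto)
          next
            case False
            then have "t < s" using elim by simp
            then have "\<forall>\<^sub>F i in sequentially. X i < s" using X(2) by (intro order_tendstoD)
            then show ?thesis by eventually_elim (use \<open>t < s\<close> c in auto)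
          qed
          then show ?case by (rule tendsto_eventually)
        qed
        show "AE s in lborel. norm (ind {max c (X i)<..} s * v s) \<le> ind {c<..} s * v s" for i
          by (intro AE_I2) (auto simp: indicator_def v_def)
      qed measurable
      then have "(\<lambda>i. a (max c (X i))) \<longlonglongrightarrow> a t" using c by (simp add: a_eq[symmetric])
      moreover have "\<forall>\<^sub>F i in sequentially. a (max c (X i)) = (a \<circ> X) i"
        using ev by eventually_elim (simp add: max_def)
      ultimately show "(a \<circ> X) \<longlonglongrightarrow> a t" by (rule Lim_transform_eventually)
    qed
    then show ?thesis by (simp add: isCont_def)
  qed
  then show ?thesis by (intro continuous_at_imp_continuous_on) auto
qed

lemma a_borel [measurable]: "a \<in> borel_measurable borel"
proof -
  have "(\<lambda>s. ind {0<..} s * a s) \<in> borel_measurable borel"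
    using borel_measurable_continuous_on_indicator[of "{0<..}" a] a_continuous by (simp add: mult.commute)
  moreover have "(\<lambda>s. ind {0<..} s * a s) = a" by (auto simp: a_def fun_eq_iff indicator_def)
  ultimately show ?thesis by simp
qed

lemma F_nonpos: "t \<le> 0 \<Longrightarrow> F t = 0"
  by (simp add: F_def Fi_def)

lemma F_borel [measurable]: "F \<in> borel_measurable borel"
proof -
  have "mono F"
  proof (rule monoI)
    fix s t :: real assume "s \<le> t"
    then show "F s \<le> F t" using F_mono[of s t] F_nonpos[of s] by (cases "0 < s") (auto simp: F_def)
  qed
  then show ?thesis by (rule borel_measurable_mono)
qed

lemma g_borel [measurable]: "g \<in> borel_measurable borel"
  unfolding g_def[abs_def] by measurable

lemma nn_integral_powr: "0 < t \<Longrightarrow> (LBNN s. ennreal (p * s powr (p - 1)) * ind {0<..<t} s) = ennreal (t powr p)"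
proof -
  assume t: "0 < t"
  have "(LBNN s. ennreal (p * s powr (p - 1)) * ind {0<..<t} s) = (LBNN s. ennreal (p * s powr (p - 1)) * ind {0..t} s)"
  proof (rule nn_integral_cong_AE)
    show "AE s in lborel. ennreal (p * s powr (p - 1)) * ind {0<..<t} s = ennreal (p * s powr (p - 1)) * ind {0..t} s"
      using AE_lborel_neq[of 0] AE_lborel_neq[of t] by eventually_elim (auto simp: indicator_def)
  qed
  \<comment> \<open>The absolute value makes the antiderivative differentiable from both sides at 0,
    as the theorem on closed intervals demands; \<open>1 < p\<close> gives the derivative 0
    there.\<close>
  also have "\<dots> = ennreal (\<bar>t\<bar> powr p - \<bar>0\<bar> powr p)"
  proof (rule nn_integral_FTC_Icc)
    fix s assume s: "s \<in> {0..t}"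
    show "((\<lambda>s. \<bar>s\<bar> powr p) has_real_derivative p * s powr (p - 1)) (at s)"
    proof (cases "s = 0")
      case False
      then have "0 < s" using s by simp
      then have "((\<lambda>s. s powr p) has_real_derivative p * s powr (p - 1)) (at s)"
        by (auto intro!: derivative_eq_intros)
      then show ?thesis
        by (rule has_field_derivative_transform_within[where d = s]) (use \<open>0 < s\<close> in \<open>auto simp: dist_real_def\<close>)
    next
      case True
      have "((\<lambda>y::real. \<bar>y\<bar> powr (p - 1)) \<longlongrightarrow> \<bar>0\<bar> powr (p - 1)) (at 0)"
        using p by (intro tendsto_powr2 tendsto_rabs tendsto_ident_at tendsto_const) (auto simp: eventually_at_filter)
      then have lim: "((\<lambda>y::real. \<bar>y\<bar> powr (p - 1)) \<longlongrightarrow> 0) (at 0)" by simp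
      have "((\<lambda>y. (\<bar>y\<bar> powr p - \<bar>0\<bar> powr p) / (y - 0)) \<longlongrightarrow> 0) (at 0)"
      proof (rule Lim_null_comparison[OF _ lim])
        show "\<forall>\<^sub>F y in at 0. norm ((\<bar>y\<bar> powr p - \<bar>0\<bar> powr p) / (y - 0)) \<le> \<bar>y\<bar> powr (p - 1)"
          by (auto simp: eventually_at_filter powr_diff abs_divide)
      qed
      then show ?thesis using True by (simp add: has_field_derivative_iff)
    qed
    show "0 \<le> p * s powr (p - 1)" using p by simp
  qed (use t in auto)
  finally show ?thesis using t by simp
qed

text \<open>Tonelli. In terms of the theorem it says that t times P(Q_p \<phi>)(t) is g(t), which
  identifies the denominator of \<psi>, and it exhibits \<open>g\<close> as a primitive.\<close>

lemma Gi_integral: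
  assumes t: "0 < t"
  shows "(LBNN s. ennreal (p * s powr (p - 1)) * Ai p w s * ind {0<..<t} s) = Gi p w t"
proof -
  let ?k = "\<lambda>s u. ennreal (p * s powr (p - 1)) * ind {0<..<t} s * ind {0<..} (u - s)" and ?w = "\<lambda>u. w u * ennreal (u powr (-p))"
  have "(LBNN s. ennreal (p * s powr (p - 1)) * Ai p w s * ind {0<..<t} s)
    = (LBNN s. (LBNN u. ?w u * ?k s u))"
  proof (intro nn_integral_cong)
    fix s :: real
    define c where "c = ennreal (p * s powr (p - 1)) * ind {0<..<t} s"
    have "(LBNN u. ?w u * (c * ind {0<..} (u - s)))
      = (LBNN u. c * (?w u * ind {s<..} u))"
      by (intro nn_integral_cong) (auto simp: indicator_def mult.commute)
    also have "\<dots> = c * Ai p w s" unfolding Ai_def by (intro nn_integral_cmult) measurable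
    finally show "ennreal (p * s powr (p - 1)) * Ai p w s * ind {0<..<t} s
      = (LBNN u. ?w u * ?k s u)"
      by (simp add: c_def mult_ac)
  qed
  also have "\<dots> = (LBNN u. (LBNN s. ?w u * ?k s u))"
    by (rule lborel_pair.Fubini'[symmetric]) measurable
  also have "\<dots> = (LBNN u. w u * ennreal (min 1 (t / u) powr p) * ind {0<..} u)"
  proof (intro nn_integral_cong)
    fix u :: real
    have "(LBNN s. ?w u * ?k s u)
      = ?w u * (LBNN s. ?k s u)"
      by (intro nn_integral_cmult) measurable
    also have "(LBNN s. ?k s u)
      = (LBNN s. ennreal (p * s powr (p - 1)) * ind {0<..<min t u} s)"
      by (intro nn_integral_cong) (auto simp: indicator_def)
    also have "?w u * \<dots> = w u * ennreal (min 1 (t / u) powr p) * ind {0<..} u"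
    proof (cases "0 < u")
      case True
      have "u powr (-p) * min t u powr p = min 1 (t / u) powr p"
      proof (cases "t \<le> u")
        case le: True
        then have "min 1 (t / u) = t / u" "min t u = t" using True by (auto simp: min_def)
        then show ?thesis using True t by (simp add: powr_divide powr_minus_divide)
      next
        case False
        then have "min 1 (t / u) = 1" "min t u = u" using True by (auto simp: min_def)
        then show ?thesis using True by (simp flip: powr_add)
      qed
      then have "ennreal (u powr (-p)) * ennreal (min t u powr p) = ennreal (min 1 (t / u) powr p)"
        by (simp flip: ennreal_mult)
      then show ?thesis using True t by (simp add: nn_integral_powr mult.assoc)
    next
      case False
      then have "{0<..<min t u} = {}" by auto
      then show ?thesis using False by simp
    qed
    finally show "(LBNN s. ?w u * ?k s u)
      = w u * ennreal (min 1 (t / u) powr p) * ind {0<..} u" .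
  qed
  also have "\<dots> = Gi p w t" by (rule Gi_eq[OF w_borel t, symmetric])
  finally show ?thesis .
qed

lemma g_derivative:
  assumes t: "0 < t"
  shows "(g has_real_derivative p * t powr (p - 1) * a t) (at t)"
proof -
  define c where "c = t / 2"
  define d where "d = 2 * t"
  have c: "0 < c" "c < t" "t < d" using t by (auto simp: c_def d_def)
  define v where "v s = p * s powr (p - 1) * a s" for s
  have v_cont: "continuous_on {c..d} v"
    unfolding v_def using c by (intro continuous_intros continuous_on_subset[OF a_continuous]) auto
  have v_nonneg: "0 \<le> v s" for s using p a_nonneg by (simp add: v_def)
  have eq: "g x = g c + integral {c..x} v" if x: "x \<in> {c..d}" for x
  proof -
    have x': "c \<le> x" "0 < x" using x c by auto
    have v_int: "v integrable_on {c..x}"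
      using x by (intro integrable_continuous_interval continuous_on_subset[OF v_cont]) auto
    have I0: "0 \<le> integral {c..x} v" using v_int v_nonneg by (intro integral_nonneg) auto
    have I: "(LBNN s. ennreal (v s) * ind {c..x} s) = ennreal (integral {c..x} v)"
      using v_nonneg by (intro nn_integral_has_integral_lebesgue' integrable_integral v_int) auto
    let ?V = "\<lambda>s. ennreal (p * s powr (p - 1)) * Ai p w s"
    have Vv: "?V s = ennreal (v s)" if "0 < s" for s using that p a_nonneg by (simp add: v_def Ai_eq ennreal_mult)
    have [measurable]: "(\<lambda>s. ?V s * ind {0<..} s) \<in> borel_measurable borel"
    proof -
      have "(\<lambda>s. ennreal (p * s powr (p - 1) * (ind {0<..} s * a s))) \<in> borel_measurable borel" by measurable
      moreover have "?V s * ind {0<..} s = ennreal (p * s powr (p - 1) * (ind {0<..} s * a s))" for s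
        using Vv[of s] by (auto simp: indicator_def v_def mult_ac)
      ultimately show ?thesis by simp
    qed
    have "Gi p w x = (LBNN s. ?V s * ind {0<..<x} s)" using x' by (simp add: Gi_integral)
    also have "\<dots> = (LBNN s. (?V s * ind {0<..} s) * ind {0<..<c} s + (?V s * ind {0<..} s) * ind {c..x} s)"
    proof (rule nn_integral_cong_AE)
      show "AE s in lborel. ?V s * ind {0<..<x} s = (?V s * ind {0<..} s) * ind {0<..<c} s + (?V s * ind {0<..} s) * ind {c..x} s"
        using AE_lborel_neq[of x] by eventually_elim (use x' c in \<open>auto simp: indicator_def\<close>)
    qed
    also have "\<dots> = (LBNN s. (?V s * ind {0<..} s) * ind {0<..<c} s) + (LBNN s. (?V s * ind {0<..} s) * ind {c..x} s)"
      by (intro nn_integral_add) measurable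
    also have "(LBNN s. (?V s * ind {0<..} s) * ind {0<..<c} s) = Gi p w c"
      unfolding Gi_integral[OF c(1), symmetric] by (intro nn_integral_cong) (auto simp: indicator_def)
    also have "(LBNN s. (?V s * ind {0<..} s) * ind {c..x} s) = ennreal (integral {c..x} v)"
      unfolding I[symmetric] by (intro nn_integral_cong) (use c in \<open>auto simp: indicator_def Vv\<close>)
    finally have "ennreal (g x) = ennreal (g c + integral {c..x} v)" using x' c I0 g_pos[of c] by (simp add: Gi_eq_g)
    then show ?thesis using g_pos[OF x'(2)] g_pos[OF c(1)] I0 by (subst (asm) ennreal_inj) auto
  qed
  have "((\<lambda>x. integral {c..x} v) has_real_derivative v t) (at t within {c..d})"
    using c by (intro integral_has_real_derivative v_cont) auto
  then have "((\<lambda>x. g c + integral {c..x} v) has_real_derivative v t) (at t within {c..d})"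
    by (auto intro!: derivative_eq_intros)
  then have "(g has_real_derivative v t) (at t within {c..d})"
    by (rule has_field_derivative_transform_within[where d = 1]) (use c in \<open>auto simp: eq[symmetric]\<close>)
  moreover have "at t within {c..d} = at t" using c by (intro at_within_interior) auto
  ultimately show ?thesis by (simp add: v_def)
qed

section \<open>The dual weight and its fundamental function\<close>

definition pc :: real where "pc = p / (p - 1)"

lemma pc: "1 < pc" "p * pc = p + pc" "pc * (p - 1) = p" "p * (pc - 1) = pc" "(pc - 1) * (p - 1) = 1"
  using p by (auto simp: pc_def field_simps)

text \<open>The weight \<open>\<psi>\<close>. With \<open>H(t) = t\<^bsup>-p\<^esup> g(t)\<close> one has \<open>\<psi>(t) t\<^bsup>-p'\<^esup> = F g' / g\<^bsup>p'+1\<^esup>\<close> and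
  \<open>\<psi> = - a H' / H\<^bsup>p'+1\<^esup>\<close>.\<close>

definition psi :: "real \<Rightarrow> real" where
  "psi t = F t * (p * t powr (p - 1) * a t) * t powr pc / g t powr (pc + 1)"

definition H :: "real \<Rightarrow> real" where "H t = g t * t powr (-p)"

lemma psi_borel [measurable]: "psi \<in> borel_measurable borel"
  unfolding psi_def[abs_def] by measurable

lemma F_nonneg: "0 \<le> F t"
  by (simp add: F_def)

lemma g_nonneg: "0 \<le> g t"
  using F_nonneg a_nonneg by (simp add: g_def)

lemma psi_nonneg: "0 \<le> psi t"
  using p F_nonneg a_nonneg by (simp add: psi_def)

lemma H_pos: "0 < t \<Longrightarrow> 0 < H t"
  using g_pos by (simp add: H_def)

lemma H_eq: "0 < t \<Longrightarrow> H t = F t * t powr (-p) + a t"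
proof -
  assume "0 < t"
  then have "t powr p * t powr (-p) = 1" by (simp flip: powr_add)
  moreover have "(u + x * v) * y = u * y + (x * y) * v" for u v x y :: real by (simp add: algebra_simps)
  then have "H t = F t * t powr (-p) + (t powr p * t powr (-p)) * a t" unfolding H_def g_def .
  ultimately show ?thesis by simp
qed

lemma psi_eq_g:
  assumes t: "0 < t"
  shows "psi t * t powr (-pc) = F t * (p * t powr (p - 1) * a t) * g t powr (- pc - 1)"
proof -
  have "t powr pc * t powr (-pc) = 1" using t by (simp flip: powr_add)
  moreover have "g t powr (- pc - 1) = inverse (g t powr (pc + 1))" by (simp flip: powr_minus)
  ultimately show ?thesis by (simp add: psi_def divide_inverse mult_ac)
qed

lemma psi_eq_H:
  assumes t: "0 < t"
  shows "psi t = a t * (p * t powr (- p - 1) * F t) * H t powr (- pc - 1)"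
proof -
  have "H t powr (- pc - 1) = g t powr (- pc - 1) * t powr (-p * (- pc - 1))"
    using g_pos[OF t] by (simp add: H_def powr_mult powr_powr)
  moreover have "t powr (- p - 1) * t powr (-p * (- pc - 1)) = t powr (p - 1) * t powr pc"
    using pc(2) by (simp add: algebra_simps flip: powr_add)
  moreover have "g t powr (- pc - 1) = inverse (g t powr (pc + 1))" by (simp flip: powr_minus)
  ultimately show ?thesis by (simp add: psi_def divide_inverse mult_ac)
qed

lemma H_derivative:
  assumes t: "0 < t"
  shows "(H has_real_derivative - (p * t powr (- p - 1) * F t)) (at t)"
proof -
  have "(H has_real_derivative (p * t powr (p - 1) * a t) * t powr (-p) + (- p * t powr (- p - 1)) * g t) (at t)"
    unfolding H_def[abs_def] using t by (auto intro!: derivative_eq_intros g_derivative)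
  moreover have "(p * t powr (p - 1) * a t) * t powr (-p) + (- p * t powr (- p - 1)) * g t = - (p * t powr (- p - 1) * F t)"
  proof -
    have "t powr (p - 1) * t powr (-p) = t powr (-1)" "t powr (- p - 1) * t powr p = t powr (-1)"
      by (simp_all flip: powr_add)
    then have "p * a t * (t powr (p - 1) * t powr (-p)) = p * a t * (t powr (- p - 1) * t powr p)" by simp
    then show ?thesis by (simp add: g_def algebra_simps)
  qed
  ultimately show ?thesis by simp
qed

lemma FTC_g:
  assumes t: "0 < t" "t \<le> T" and q: "0 < q"
  shows "(LBNN s. ennreal ((p * s powr (p - 1) * a s) * g s powr (- q - 1)) * ind {t..T} s)
    = ennreal ((g t powr (-q) - g T powr (-q)) / q)"
proof -
  have "(LBNN s. ennreal ((p * s powr (p - 1) * a s) * g s powr (- q - 1)) * ind {t..T} s)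
    = ennreal (- (g T powr (-q)) / q - (- (g t powr (-q)) / q))"
  proof (rule nn_integral_FTC_Icc)
    fix s assume "s \<in> {t..T}"
    then have s: "0 < s" using t by simp
    show "((\<lambda>s. - (g s powr (-q)) / q) has_real_derivative (p * s powr (p - 1) * a s) * g s powr (- q - 1)) (at s)"
      using g_pos[OF s] q by (auto intro!: derivative_eq_intros g_derivative s)
    show "0 \<le> (p * s powr (p - 1) * a s) * g s powr (- q - 1)" using p a_nonneg by simp
  qed (use t in auto)
  also have "- (g T powr (-q)) / q - (- (g t powr (-q)) / q) = (g t powr (-q) - g T powr (-q)) / q"
    by (simp add: diff_divide_distrib)
  finally show ?thesis .
qed

lemma FTC_H:
  assumes t: "0 < e" "e \<le> t" and q: "0 < q"
  shows "(LBNN s. ennreal ((p * s powr (- p - 1) * F s) * H s powr (- q - 1)) * ind {e..t} s)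
    = ennreal ((H t powr (-q) - H e powr (-q)) / q)"
proof -
  have [measurable]: "H \<in> borel_measurable borel" unfolding H_def[abs_def] by measurable
  have "(LBNN s. ennreal ((p * s powr (- p - 1) * F s) * H s powr (- q - 1)) * ind {e..t} s)
    = ennreal (H t powr (-q) / q - H e powr (-q) / q)"
  proof (rule nn_integral_FTC_Icc)
    fix s assume "s \<in> {e..t}"
    then have s: "0 < s" using t by simp
    show "((\<lambda>s. H s powr (-q) / q) has_real_derivative (p * s powr (- p - 1) * F s) * H s powr (- q - 1)) (at s)"
      using H_pos[OF s] q by (auto intro!: derivative_eq_intros H_derivative s)
    show "0 \<le> (p * s powr (- p - 1) * F s) * H s powr (- q - 1)" using p F_nonneg by simp
  qed (use t in auto)
  then show ?thesis by (simp add: diff_divide_distrib)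
qed

end

lemma nn_integral_le_incseq:
  fixes B :: "nat \<Rightarrow> 'a set"
  assumes [measurable]: "f \<in> borel_measurable M" "\<And>n. B n \<in> sets M"
    and B: "incseq B" "D \<subseteq> (\<Union>n. B n)" and le: "\<And>n. (\<integral>\<^sup>+s. f s * ind (B n) s \<partial>M) \<le> c"
  shows "(\<integral>\<^sup>+s. f s * ind D s \<partial>M) \<le> c"
proof -
  have "(\<integral>\<^sup>+s. f s * ind D s \<partial>M) \<le> (\<integral>\<^sup>+s. (SUP n. f s * ind (B n) s) \<partial>M)"
  proof (intro nn_integral_mono)
    fix s
    show "f s * ind D s \<le> (SUP n. f s * ind (B n) s)"
    proof (cases "s \<in> D")
      case True
      then obtain n where "s \<in> B n" using B by auto
      then have "f s * ind D s \<le> f s * ind (B n) s" using True by simp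
      also have "\<dots> \<le> (SUP n. f s * ind (B n) s)" by (intro SUP_upper) simp
      finally show ?thesis .
    qed simp
  qed
  also have "\<dots> = (SUP n. \<integral>\<^sup>+s. f s * ind (B n) s \<partial>M)"
  proof (rule nn_integral_monotone_convergence_SUP)
    show "incseq (\<lambda>n s. f s * ind (B n) s)"
    proof (intro monoI le_funI)
      fix m n :: nat and s assume "m \<le> n"
      then have "B m \<subseteq> B n" using B(1) by (simp add: incseqD)
      then show "f s * ind (B m) s \<le> f s * ind (B n) s" by (auto simp: indicator_def)
    qed
  qed measurable
  also have "\<dots> \<le> c" by (intro SUP_least le)
  finally show ?thesis .
qed

context gweight
begin

abbreviation W :: "real \<Rightarrow> ennreal" where "W t \<equiv> ennreal (psi t)"

text \<open>Replacing \<open>F\<close> by the larger \<open>g\<close> turns the integrand into g'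
  g^(-p'), an exact derivative.\<close>

lemma psi_upper_inf:
  assumes t: "0 < t"
  shows "Ai pc W t \<le> ennreal (g t powr (1 - pc) / (pc - 1))"
  unfolding Ai_def
proof (rule nn_integral_le_incseq[where B = "\<lambda>n. {t..t + real n}"])
  show "incseq (\<lambda>n. {t..t + real n})" by (intro monoI) auto
  show "{t<..} \<subseteq> (\<Union>n. {t..t + real n})"
  proof
    fix s assume "s \<in> {t<..}"
    moreover obtain n :: nat where "s - t \<le> real n" using real_arch_simple by blast
    ultimately show "s \<in> (\<Union>n. {t..t + real n})" by (auto intro!: exI[of _ n])
  qed
  fix n :: nat
  have "(LBNN s. W s * ennreal (s powr (-pc)) * ind {t..t + real n} s)
    \<le> (LBNN s. ennreal ((p * s powr (p - 1) * a s) * g s powr (- (pc - 1) - 1)) * ind {t..t + real n} s)"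
  proof (intro nn_integral_mono)
    fix s
    show "W s * ennreal (s powr (-pc)) * ind {t..t + real n} s
      \<le> ennreal ((p * s powr (p - 1) * a s) * g s powr (- (pc - 1) - 1)) * ind {t..t + real n} s"
    proof (cases "s \<in> {t..t + real n}")
      case True
      then have s: "0 < s" using t by simp
      have "F s \<le> g s" using a_nonneg by (simp add: g_def)
      then have "psi s * s powr (-pc) \<le> g s * (p * s powr (p - 1) * a s) * g s powr (- pc - 1)"
        unfolding psi_eq_g[OF s] using p a_nonneg by (intro mult_right_mono) auto
      also have "\<dots> = (p * s powr (p - 1) * a s) * g s powr (- (pc - 1) - 1)"
      proof -
        have "g s * g s powr (- pc - 1) = g s powr (- (pc - 1) - 1)" using g_pos[OF s] by (simp add: powr_mult_base)
        then show ?thesis by (simp add: mult_ac)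
      qed
      finally show ?thesis using True psi_nonneg by (simp add: ennreal_leI flip: ennreal_mult)
    qed simp
  qed
  also have "\<dots> = ennreal ((g t powr (- (pc - 1)) - g (t + real n) powr (- (pc - 1))) / (pc - 1))"
    using t pc by (intro FTC_g) auto
  also have "\<dots> \<le> ennreal (g t powr (1 - pc) / (pc - 1))" using pc by (intro ennreal_leI divide_right_mono) auto
  finally show "(LBNN s. W s * ennreal (s powr (-pc)) * ind {t..t + real n} s) \<le> ennreal (g t powr (1 - pc) / (pc - 1))" .
qed measurable

lemma H_powr_g:
  assumes t: "0 < t"
  shows "H t powr (1 - pc) = t powr pc * g t powr (1 - pc)" "H t powr (-pc) = t powr pc * (t powr p * g t powr (-pc))"
proof -
  have "H t powr (1 - pc) = g t powr (1 - pc) * t powr (-p * (1 - pc))"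
    using g_pos[OF t] by (simp add: H_def powr_mult powr_powr)
  moreover have "-p * (1 - pc) = pc" using pc(4) by (simp add: algebra_simps)
  ultimately show "H t powr (1 - pc) = t powr pc * g t powr (1 - pc)" by (simp add: mult.commute)
  have "H t powr (-pc) = g t powr (-pc) * t powr (-p * -pc)"
    using g_pos[OF t] by (simp add: H_def powr_mult powr_powr)
  moreover have "-p * -pc = pc + p" using pc(2) by simp
  ultimately show "H t powr (-pc) = t powr pc * (t powr p * g t powr (-pc))" by (simp only: powr_add mult_ac)
qed

text \<open>The same with \<open>H\<close> in place of \<open>g\<close>: replacing \<open>a\<close>
  by the larger \<open>H\<close> turns \<open>psi\<close> into - H' H^(-p'). Then
  \<open>H_powr_g\<close> rewrites the result in terms of \<open>g\<close>.\<close>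

lemma psi_upper_zero:
  assumes t: "0 < t"
  shows "Fi W t \<le> ennreal (t powr pc * g t powr (1 - pc) / (pc - 1))"
  unfolding Fi_def
proof (rule nn_integral_le_incseq[where B = "\<lambda>n. {t / real (Suc n)..t}"])
  have dec: "t / real (Suc n) \<le> t / real (Suc m)" if "m \<le> n" for m n using t that by (intro divide_left_mono) auto
  show "incseq (\<lambda>n. {t / real (Suc n)..t})" using dec by (intro monoI) (auto intro: order_trans)
  show "{0<..<t} \<subseteq> (\<Union>n. {t / real (Suc n)..t})"
  proof
    fix s assume s: "s \<in> {0<..<t}"
    obtain n :: nat where "t / s \<le> real n" using real_arch_simple by blast
    then have "t \<le> real n * s" using s by (simp add: field_simps)
    also have "\<dots> \<le> real (Suc n) * s" using s by (intro mult_right_mono) auto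
    finally have "t / real (Suc n) \<le> s" by (simp add: field_simps)
    then show "s \<in> (\<Union>n. {t / real (Suc n)..t})" using s by auto
  qed
  fix n :: nat
  define e where "e = t / real (Suc n)"
  have e: "0 < e" "e \<le> t" using t dec[of 0 n] by (auto simp: e_def)
  have "(LBNN s. W s * ind {e..t} s)
    \<le> (LBNN s. ennreal ((p * s powr (- p - 1) * F s) * H s powr (- (pc - 1) - 1)) * ind {e..t} s)"
  proof (intro nn_integral_mono)
    fix s
    show "W s * ind {e..t} s \<le> ennreal ((p * s powr (- p - 1) * F s) * H s powr (- (pc - 1) - 1)) * ind {e..t} s"
    proof (cases "s \<in> {e..t}")
      case True
      then have s: "0 < s" using e by simp
      have "a s \<le> H s" using F_nonneg H_eq[OF s] by simp
      then have "psi s \<le> H s * (p * s powr (- p - 1) * F s) * H s powr (- pc - 1)"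
        unfolding psi_eq_H[OF s] using p F_nonneg by (intro mult_right_mono) auto
      also have "\<dots> = (p * s powr (- p - 1) * F s) * H s powr (- (pc - 1) - 1)"
      proof -
        have "H s * H s powr (- pc - 1) = H s powr (- (pc - 1) - 1)" using H_pos[OF s] by (simp add: powr_mult_base)
        then show ?thesis by (simp add: mult_ac)
      qed
      finally show ?thesis using True by (simp add: ennreal_leI)
    qed simp
  qed
  also have "\<dots> = ennreal ((H t powr (- (pc - 1)) - H e powr (- (pc - 1))) / (pc - 1))"
    using e pc by (intro FTC_H) auto
  also have "\<dots> \<le> ennreal (H t powr (1 - pc) / (pc - 1))" using pc by (intro ennreal_leI divide_right_mono) auto
  finally show "(LBNN s. W s * ind {t / real (Suc n)..t} s) \<le> ennreal (t powr pc * g t powr (1 - pc) / (pc - 1))"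
    by (simp only: e_def H_powr_g(1)[OF t])
qed measurable

lemma psi_upper:
  assumes t: "0 < t"
  shows "Gi pc W t \<le> ennreal (2 / (pc - 1) * (t powr pc * g t powr (1 - pc)))"
proof -
  have "Gi pc W t \<le> ennreal (t powr pc * g t powr (1 - pc) / (pc - 1)) + ennreal (t powr pc) * ennreal (g t powr (1 - pc) / (pc - 1))"
    unfolding Gi_def by (intro add_mono mult_left_mono psi_upper_zero psi_upper_inf t) auto
  also have "\<dots> = ennreal (t powr pc * g t powr (1 - pc) / (pc - 1) + t powr pc * (g t powr (1 - pc) / (pc - 1)))"
    using pc(1) by (simp flip: ennreal_mult ennreal_plus)
  also have "t powr pc * g t powr (1 - pc) / (pc - 1) + t powr pc * (g t powr (1 - pc) / (pc - 1)) = 2 / (pc - 1) * (t powr pc * g t powr (1 - pc))"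
    by simp
  finally show ?thesis .
qed

lemma powr_double_le:
  fixes x y :: real
  assumes "0 < x" "2 * x \<le> y"
  shows "x powr (-pc) / 2 \<le> x powr (-pc) - y powr (-pc)"
proof -
  have "y powr (-pc) \<le> (2 * x) powr (-pc)" using assms pc by (intro powr_mono2') auto
  also have "\<dots> = 2 powr (-pc) * x powr (-pc)" by (rule powr_mult)
  also have "\<dots> \<le> 2 powr (-1) * x powr (-pc)" using pc by (intro mult_right_mono powr_mono) auto
  finally show ?thesis by (simp add: powr_minus)
qed

text \<open>Beyond \<open>t\<close> the increasing factor \<open>F\<close> is at least
  \<open>F t\<close>, and what remains is exactly integrable. Doubling of \<open>g\<close> at
  \<open>T\<close> ensures that the boundary term at \<open>T\<close> takes away at most
  half.\<close>

lemma psi_lower_inf: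
  assumes t: "0 < t" and T: "t \<le> T" "2 * g t \<le> g T"
  shows "ennreal (F t * g t powr (-pc) / (2 * pc)) \<le> Ai pc W t"
proof -
  have "F t * g t powr (-pc) / (2 * pc) = F t / pc * (g t powr (-pc) / 2)" by simp
  also have "\<dots> \<le> F t / pc * (g t powr (-pc) - g T powr (-pc))"
    using pc F_nonneg by (intro mult_left_mono powr_double_le g_pos t T) auto
  also have "\<dots> = F t * ((g t powr (-pc) - g T powr (-pc)) / pc)" by simp
  finally have "ennreal (F t * g t powr (-pc) / (2 * pc)) \<le> ennreal (F t * ((g t powr (-pc) - g T powr (-pc)) / pc))"
    by (rule ennreal_leI)
  also have "\<dots> = ennreal (F t) * ennreal ((g t powr (-pc) - g T powr (-pc)) / pc)"
    using F_nonneg by (rule ennreal_mult')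
  also have "\<dots> = ennreal (F t) * (LBNN s. ennreal ((p * s powr (p - 1) * a s) * g s powr (- pc - 1)) * ind {t..T} s)"
    using pc by (subst FTC_g[OF t T(1)]) auto
  also have "\<dots> = (LBNN s. ennreal (F t) * (ennreal ((p * s powr (p - 1) * a s) * g s powr (- pc - 1)) * ind {t..T} s))"
    by (intro nn_integral_cmult[symmetric]) measurable
  also have "\<dots> \<le> Ai pc W t" unfolding Ai_def
  proof (rule nn_integral_mono_AE)
    show "AE s in lborel. ennreal (F t) * (ennreal ((p * s powr (p - 1) * a s) * g s powr (- pc - 1)) * ind {t..T} s)
      \<le> W s * ennreal (s powr (-pc)) * ind {t<..} s" using AE_lborel_neq[of t]
    proof eventually_elim
      case (elim s)
      show ?case
      proof (cases "s \<in> {t..T}")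
        case True
        then have s: "0 < s" "t < s" using t elim by auto
        have "F t * ((p * s powr (p - 1) * a s) * g s powr (- pc - 1)) \<le> psi s * s powr (-pc)"
          unfolding psi_eq_g[OF s(1)] mult.assoc using p a_nonneg F_mono[OF t, of s] s by (intro mult_right_mono) auto
        then show ?thesis using True s F_nonneg psi_nonneg p a_nonneg by (simp add: ennreal_leI flip: ennreal_mult)
      qed simp
    qed
  qed
  finally show ?thesis .
qed

text \<open>Below \<open>t\<close> the decreasing factor \<open>a\<close> is at least
  \<open>a t\<close>, and doubling of \<open>H\<close> at \<open>e\<close> controls the boundary
  term.\<close>

lemma psi_lower_zero:
  assumes t: "0 < t" and e: "0 < e" "e \<le> t" "2 * H t \<le> H e"
  shows "ennreal (a t * H t powr (-pc) / (2 * pc)) \<le> Fi W t"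
proof -
  have [measurable]: "H \<in> borel_measurable borel" unfolding H_def[abs_def] by measurable
  have "a t * H t powr (-pc) / (2 * pc) = a t / pc * (H t powr (-pc) / 2)" by simp
  also have "\<dots> \<le> a t / pc * (H t powr (-pc) - H e powr (-pc))"
    using pc a_nonneg by (intro mult_left_mono powr_double_le H_pos t e) auto
  also have "\<dots> = a t * ((H t powr (-pc) - H e powr (-pc)) / pc)" by simp
  finally have "ennreal (a t * H t powr (-pc) / (2 * pc)) \<le> ennreal (a t * ((H t powr (-pc) - H e powr (-pc)) / pc))"
    by (rule ennreal_leI)
  also have "\<dots> = ennreal (a t) * ennreal ((H t powr (-pc) - H e powr (-pc)) / pc)"
    using a_nonneg by (rule ennreal_mult')
  also have "\<dots> = ennreal (a t) * (LBNN s. ennreal ((p * s powr (- p - 1) * F s) * H s powr (- pc - 1)) * ind {e..t} s)"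
    using pc by (subst FTC_H[OF e(1,2)]) auto
  also have "\<dots> = (LBNN s. ennreal (a t) * (ennreal ((p * s powr (- p - 1) * F s) * H s powr (- pc - 1)) * ind {e..t} s))"
    by (intro nn_integral_cmult[symmetric]) measurable
  also have "\<dots> \<le> Fi W t" unfolding Fi_def
  proof (rule nn_integral_mono_AE)
    show "AE s in lborel. ennreal (a t) * (ennreal ((p * s powr (- p - 1) * F s) * H s powr (- pc - 1)) * ind {e..t} s)
      \<le> W s * ind {0<..<t} s" using AE_lborel_neq[of t]
    proof eventually_elim
      case (elim s)
      show ?case
      proof (cases "s \<in> {e..t}")
        case True
        then have s: "0 < s" "s < t" using e elim by auto
        have "a t * ((p * s powr (- p - 1) * F s) * H s powr (- pc - 1)) \<le> psi s"
          unfolding psi_eq_H[OF s(1)] mult.assoc using p F_nonneg a_mono[OF s(1), of t] s by (intro mult_right_mono) auto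
        then show ?thesis using True s F_nonneg p a_nonneg by (simp add: ennreal_leI flip: ennreal_mult)
      qed simp
    qed
  qed
  finally show ?thesis .
qed

text \<open>The two partial bounds carry \<open>F t\<close> and \<open>a t\<close> separately; with
  the right powers of \<open>t\<close> they add up to \<open>g t\<close>.\<close>

lemma psi_lower:
  assumes t: "0 < t" and T: "t \<le> T" "2 * g t \<le> g T" and e: "0 < e" "e \<le> t" "2 * H t \<le> H e"
  shows "ennreal (t powr pc * g t powr (1 - pc) / (2 * pc)) \<le> Gi pc W t"
proof -
  have "t powr pc * g t powr (1 - pc) = t powr pc * (g t * g t powr (-pc))"
    using g_pos[OF t] by (simp add: powr_mult_base)
  also have "\<dots> = a t * H t powr (-pc) + t powr pc * (F t * g t powr (-pc))"
    unfolding H_powr_g(2)[OF t] by (simp add: g_def algebra_simps)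
  finally have "t powr pc * g t powr (1 - pc) / (2 * pc) = a t * H t powr (-pc) / (2 * pc) + t powr pc * (F t * g t powr (-pc) / (2 * pc))"
    by (simp add: add_divide_distrib)
  then have "ennreal (t powr pc * g t powr (1 - pc) / (2 * pc))
    = ennreal (a t * H t powr (-pc) / (2 * pc)) + ennreal (t powr pc) * ennreal (F t * g t powr (-pc) / (2 * pc))"
    using a_nonneg F_nonneg pc by (simp flip: ennreal_mult ennreal_plus)
  also have "\<dots> \<le> Gi pc W t"
    unfolding Gi_def by (intro add_mono mult_left_mono psi_lower_zero[OF t e] psi_lower_inf[OF t T]) auto
  finally show ?thesis .
qed

text \<open>Otherwise \<open>H\<close>, and with it the smaller \<open>a\<close>, would stay bounded
  near 0, against the divergence of the integral of \<open>w s * s powr (-p)\<close> there.\<close>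

lemma ex_H_double:
  assumes inf: "\<And>c. 0 < c \<Longrightarrow> (LBNN s. w s * ennreal (s powr (-p)) * ind {0<..<c} s) = \<infinity>"
    and t: "0 < t"
  obtains e where "0 < e" "e \<le> t" "2 * H t \<le> H e"
proof (rule ccontr)
  assume "\<not> thesis"
  then have "\<not> 2 * H t \<le> H e" if "0 < e" "e \<le> t" for e
    using \<open>\<And>e. 0 < e \<Longrightarrow> e \<le> t \<Longrightarrow> 2 * H t \<le> H e \<Longrightarrow> thesis\<close> that by blast
  then have neg: "H e < 2 * H t" if "0 < e" "e \<le> t" for e using that by (meson not_le)
  have "(LBNN s. w s * ennreal (s powr (-p)) * ind {0<..<t} s) \<le> ennreal (2 * H t)"
  proof (rule nn_integral_le_incseq[where B = "\<lambda>n. {t / real (Suc n)<..<t}"])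
    have dec: "t / real (Suc n) \<le> t / real (Suc m)" if "m \<le> n" for m n using t that by (intro divide_left_mono) auto
    show "incseq (\<lambda>n. {t / real (Suc n)<..<t})"
    proof (rule monoI)
      fix m n :: nat assume "m \<le> n"
      then show "{t / real (Suc m)<..<t} \<subseteq> {t / real (Suc n)<..<t}"
        using dec[of m n] by (simp add: greaterThanLessThan_subseteq_greaterThanLessThan)
    qed
    show "{0<..<t} \<subseteq> (\<Union>n. {t / real (Suc n)<..<t})"
    proof
      fix s assume s: "s \<in> {0<..<t}"
      obtain n :: nat where "t / s \<le> real n" using real_arch_simple by blast
      then have "t \<le> real n * s" using s by (simp add: field_simps)
      also have "\<dots> < real (Suc n) * s" using s by (intro mult_strict_right_mono) auto
      finally have "t / real (Suc n) < s" by (simp add: field_simps)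
      then show "s \<in> (\<Union>n. {t / real (Suc n)<..<t})" using s by auto
    qed
    fix n :: nat
    define e where "e = t / real (Suc n)"
    have e: "0 < e" "e \<le> t" using t dec[of 0 n] by (auto simp: e_def)
    have "(LBNN s. w s * ennreal (s powr (-p)) * ind {e<..<t} s) \<le> Ai p w e"
      unfolding Ai_def by (intro nn_integral_mono) (auto simp: indicator_def)
    also have "\<dots> = ennreal (a e)" by (rule Ai_eq[OF e(1)])
    also have "\<dots> \<le> ennreal (2 * H t)"
    proof (rule ennreal_leI)
      have "0 \<le> F e * e powr (-p)" using F_nonneg by simp
      then show "a e \<le> 2 * H t" using neg[OF e] H_eq[OF e(1)] by linarith
    qed
    finally show "(LBNN s. w s * ennreal (s powr (-p)) * ind {t / real (Suc n)<..<t} s) \<le> ennreal (2 * H t)"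
      by (simp only: e_def)
  qed measurable
  then show False using inf[OF t] by (simp add: top_unique)
qed

lemma g_decay:
  assumes "half_cond p w c"
  obtains C q where "0 < C" "0 < q" "q < 1" "\<And>k t. 0 < t \<Longrightarrow> g (t / 2 ^ k) \<le> C * q ^ k * g t"
proof -
  obtain C q where C: "0 < C" "0 < q" "q < 1"
    "\<And>k t. 0 < t \<Longrightarrow> Gi p w (t / 2 ^ k) \<le> ennreal (C * q ^ k) * Gi p w t"
    by (rule Gi_decay[OF w_borel _ assms]) (use p in auto)
  show thesis
  proof
    fix k and t :: real assume t: "0 < t"
    have "ennreal (g (t / 2 ^ k)) \<le> ennreal (C * q ^ k * g t)"
      using C(4)[OF t, of k] t C by (simp add: Gi_eq_g g_nonneg flip: ennreal_mult)
    then show "g (t / 2 ^ k) \<le> C * q ^ k * g t" using C g_nonneg by (subst (asm) ennreal_le_iff) auto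
  qed (use C in auto)
qed

text \<open>Decay of \<open>g\<close> under repeated halving, read backwards, says that
  \<open>g\<close> grows without bound under repeated doubling.\<close>

lemma ex_g_double:
  assumes "half_cond p w c" and t: "0 < t"
  obtains T where "t \<le> T" "2 * g t \<le> g T"
proof -
  obtain C q where C: "0 < C" "0 < q" "q < 1" "\<And>k t. 0 < t \<Longrightarrow> g (t / 2 ^ k) \<le> C * q ^ k * g t"
    using g_decay[OF assms(1)] by blast
  obtain k where k: "q ^ k < 1 / (2 * C)" using real_arch_pow_inv[of "1 / (2 * C)" q] C by auto
  have "g t = g ((2 ^ k * t) / 2 ^ k)" by simp
  also have "\<dots> \<le> C * q ^ k * g (2 ^ k * t)" using t by (intro C(4)) auto
  also have "\<dots> \<le> C * (1 / (2 * C)) * g (2 ^ k * t)" using k C g_nonneg by (intro mult_right_mono mult_left_mono) auto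
  finally have "2 * g t \<le> g (2 ^ k * t)" using C by simp
  moreover have "t \<le> 2 ^ k * t" using t by simp
  ultimately show ?thesis using that by blast
qed

text \<open>The condition on \<open>\<psi>\<close> is a growth bound for \<open>g\<close>, since the fundamental function of \<open>\<psi>\<close> is
  comparable to \<open>t\<^bsup>p'\<^esup> g(t)\<^bsup>1-p'\<^esup>\<close>.\<close>

lemma g_growth:
  assumes inf: "\<And>c. 0 < c \<Longrightarrow> (LBNN s. w s * ennreal (s powr (-p)) * ind {0<..<c} s) = \<infinity>"
    and c: "half_cond p w c" and d: "half_cond pc W d"
  obtains C q where "0 < C" "0 < q" "q < 1" "\<And>k t. 0 < t \<Longrightarrow> g t \<le> C * q ^ k * (2 ^ k) powr p * g (t / 2 ^ k)"
proof -
  have W: "W \<in> borel_measurable borel" by measurable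
  obtain C q where C: "0 < C" "0 < q" "q < 1"
    "\<And>k t. 0 < t \<Longrightarrow> Gi pc W (t / 2 ^ k) \<le> ennreal (C * q ^ k) * Gi pc W t"
    by (rule Gi_decay[OF W _ d]) (use pc in auto)
  define B where "B = 4 * C * pc / (pc - 1)"
  have B: "0 < B" using C pc by (simp add: B_def)
  show thesis
  proof
    show "0 < B powr (p - 1)" using B by simp
    show "0 < q powr (p - 1)" using C by simp
    have "q powr (p - 1) < 1 powr (p - 1)" using C p by (intro powr_less_mono2) auto
    then show "q powr (p - 1) < 1" by simp
    fix k and t :: real assume t: "0 < t"
    define s where "s = t / 2 ^ k"
    have s: "0 < s" using t by (simp add: s_def)
    define L where "L u = u powr pc * g u powr (1 - pc)" for u
    have L: "0 < L u" if "0 < u" for u using that g_pos[OF that] by (simp add: L_def)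
    obtain T where T: "s \<le> T" "2 * g s \<le> g T" using ex_g_double[OF c s] .
    obtain e where e: "0 < e" "e \<le> s" "2 * H s \<le> H e" using ex_H_double[OF inf s] .
    have "ennreal (L s / (2 * pc)) \<le> Gi pc W s" unfolding L_def by (rule psi_lower[OF s T e])
    also have "\<dots> \<le> ennreal (C * q ^ k) * Gi pc W t" unfolding s_def by (rule C(4)[OF t])
    also have "\<dots> \<le> ennreal (C * q ^ k) * ennreal (2 / (pc - 1) * L t)"
      unfolding L_def by (intro mult_left_mono psi_upper t) auto
    also have "\<dots> = ennreal (C * q ^ k * (2 / (pc - 1) * L t))"
      using C L[OF t] pc by (intro ennreal_mult[symmetric]) auto
    finally have "L s / (2 * pc) \<le> C * q ^ k * (2 / (pc - 1) * L t)"
      using C L[OF t] pc by (subst (asm) ennreal_le_iff) auto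
    then have le: "L s \<le> B * q ^ k * L t" using pc by (simp add: B_def field_simps)
    \<comment> \<open>The exponent \<open>p - 1\<close> is inverse to \<open>pc - 1\<close>. So this
      power turns the comparison function of the dual weight back into the reciprocal of
      \<open>g\<close>, and a decay of \<open>L\<close> becomes a growth bound for
      \<open>g\<close>.\<close>
    have L_pow: "L u powr (p - 1) = u powr p / g u" if u: "0 < u" for u
    proof -
      have e1: "(1 - pc) * (p - 1) = - 1" using pc(5) by (simp add: algebra_simps)
      have "L u powr (p - 1) = u powr (pc * (p - 1)) * g u powr ((1 - pc) * (p - 1))"
        unfolding L_def by (simp add: powr_mult powr_powr)
      also have "\<dots> = u powr p * g u powr (- 1)" by (simp only: pc e1)
      finally show ?thesis using g_pos[OF u] by (simp add: powr_minus divide_inverse)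
    qed
    have "L s powr (p - 1) \<le> (B * q ^ k * L t) powr (p - 1)" using le L[OF s] p by (intro powr_mono2) auto
    also have "\<dots> = B powr (p - 1) * (q powr (p - 1)) ^ k * L t powr (p - 1)"
      by (simp only: powr_mult power_powr[OF C(2)])
    finally have "s powr p / g s \<le> B powr (p - 1) * (q powr (p - 1)) ^ k * (t powr p / g t)"
      by (simp only: L_pow[OF s] L_pow[OF t])
    moreover have tp: "t powr p = (2 ^ k) powr p * s powr p" using t by (simp add: s_def flip: powr_mult)
    ultimately have "s powr p * (1 / g s) \<le> s powr p * (B powr (p - 1) * (q powr (p - 1)) ^ k * (2 ^ k) powr p * (1 / g t))"
      by (simp add: mult_ac)
    then have "1 / g s \<le> B powr (p - 1) * (q powr (p - 1)) ^ k * (2 ^ k) powr p * (1 / g t)"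
      using s by (simp only: mult_le_cancel_left) (simp add: not_less)
    then have "g t \<le> B powr (p - 1) * (q powr (p - 1)) ^ k * (2 ^ k) powr p * g s"
      using g_pos[OF s] g_pos[OF t] by (simp add: field_simps)
    then show "g t \<le> B powr (p - 1) * (q powr (p - 1)) ^ k * (2 ^ k) powr p * g (t / 2 ^ k)" by (simp add: s_def)
  qed
qed

end

section \<open>Averages of decreasing functions and their dilations\<close>

text \<open>With each point \<open>S\<close> contains every smaller positive one. So up to its right
  end point it is an interval starting at 0, or it is the whole half-line; the latter is exhausted
  by bounded intervals.\<close>

lemma nn_integral_initial_le:
  fixes v1 v2 :: "real \<Rightarrow> ennreal"
  assumes [measurable]: "v1 \<in> borel_measurable borel" "v2 \<in> borel_measurable borel"
    and le: "\<And>s. 0 < s \<Longrightarrow> (LBNN u. v1 u * ind {0<..<s} u) \<le> B * (LBNN u. v2 u * ind {0<..<s} u)"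
    and S: "S \<subseteq> {0<..}" "\<And>s u. s \<in> S \<Longrightarrow> 0 < u \<Longrightarrow> u \<le> s \<Longrightarrow> u \<in> S"
  shows "(LBNN u. v1 u * ind S u) \<le> B * (LBNN u. v2 u * ind S u)"
proof (cases "bdd_above S \<and> S \<noteq> {}")
  case True
  define s where "s = Sup S"
  have s: "0 < s" using True S(1) cSup_upper[of _ S] by (force simp: s_def)
  have eq: "AE u in lborel. ind S u = (ind {0<..<s} u :: ennreal)" using AE_lborel_neq[of s]
  proof eventually_elim
    case (elim u)
    have "u \<in> S \<longleftrightarrow> u \<in> {0<..<s}"
    proof
      assume u: "u \<in> S"
      then have "u \<le> s" unfolding s_def using True by (intro cSup_upper) auto
      then show "u \<in> {0<..<s}" using u S(1) elim by auto
    next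
      assume u: "u \<in> {0<..<s}"
      then obtain x where "x \<in> S" "u < x" using less_cSupD[of S u] True by (auto simp: s_def)
      then show "u \<in> S" using S(2)[of x u] u by auto
    qed
    then show ?case by (simp add: indicator_def)
  qed
  have "(LBNN u. v1 u * ind S u) = (LBNN u. v1 u * ind {0<..<s} u)"
    by (rule nn_integral_cong_AE) (use eq in eventually_elim, simp)
  also have "\<dots> \<le> B * (LBNN u. v2 u * ind {0<..<s} u)" by (rule le[OF s])
  also have "(LBNN u. v2 u * ind {0<..<s} u) = (LBNN u. v2 u * ind S u)"
    by (rule nn_integral_cong_AE) (use eq in eventually_elim, simp)
  finally show ?thesis .
next
  case False
  show ?thesis
  proof (cases "S = {}")
    case False
    have S_eq: "S = {0<..}"
    proof (intro equalityI S(1) subsetI)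
      fix u :: real assume u: "u \<in> {0<..}"
      obtain x where "x \<in> S" "u < x" using False \<open>\<not> (bdd_above S \<and> S \<noteq> {})\<close> by (meson bdd_above.I not_le)
      then show "u \<in> S" using S(2)[of x u] u by auto
    qed
    show ?thesis unfolding S_eq
    proof (rule nn_integral_le_incseq[where B = "\<lambda>n. {0<..<real (Suc n)}"])
      show "incseq (\<lambda>n. {0<..<real (Suc n)})" by (intro monoI) auto
      show "{0<..} \<subseteq> (\<Union>n. {0<..<real (Suc n)})"
      proof
        fix u :: real assume "u \<in> {0<..}"
        moreover obtain n where "u < real n" using reals_Archimedean2 by blast
        ultimately show "u \<in> (\<Union>n. {0<..<real (Suc n)})" by (intro UN_I[of n]) auto
      qed
      fix n
      have "(LBNN u. v1 u * ind {0<..<real (Suc n)} u) \<le> B * (LBNN u. v2 u * ind {0<..<real (Suc n)} u)"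
        by (rule le) simp
      also have "\<dots> \<le> B * (LBNN u. v2 u * ind {0<..} u)"
        by (intro mult_left_mono nn_integral_mono) (auto simp: indicator_def)
      finally show "(LBNN u. v1 u * ind {0<..<real (Suc n)} u) \<le> B * (LBNN u. v2 u * ind {0<..} u)" .
    qed measurable
  qed simp
qed

text \<open>The layer cake formula for \<open>e\<close> reduces the claim to its superlevel sets, which are initial intervals.\<close>

lemma Hardy_lemma:
  fixes v1 v2 :: "real \<Rightarrow> ennreal" and e :: "real \<Rightarrow> real"
  assumes [measurable]: "v1 \<in> borel_measurable borel" "v2 \<in> borel_measurable borel" "e \<in> borel_measurable borel"
    and e: "\<And>s u. 0 < u \<Longrightarrow> u \<le> s \<Longrightarrow> e s \<le> e u"
    and le: "\<And>s. 0 < s \<Longrightarrow> (LBNN u. v1 u * ind {0<..<s} u) \<le> B * (LBNN u. v2 u * ind {0<..<s} u)"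
  shows "(LBNN u. ennreal (e u) * v1 u * ind {0<..} u) \<le> B * (LBNN u. ennreal (e u) * v2 u * ind {0<..} u)"
proof -
  let ?S = "\<lambda>r. {u. 0 < u \<and> r < e u}"
  have cake: "(LBNN u. ennreal (e u) * v u * ind {0<..} u)
      = (LBNN r. (LBNN u. v u * ind (?S r) u) * ind {0<..} r)"
    if [measurable]: "v \<in> borel_measurable borel" for v :: "real \<Rightarrow> ennreal"
  proof -
    have "ennreal (e u) * v u * ind {0<..} u = (LBNN r. v u * ind (?S r) u * ind {0<..} r)" for u
    proof -
      have "(LBNN r. v u * ind (?S r) u * ind {0<..} r)
        = (LBNN r. v u * ind {0<..} u * ind {0<..<e u} r)" by (intro nn_integral_cong) (auto simp: indicator_def)
      also have "\<dots> = v u * ind {0<..} u * emeasure lborel {0<..<e u}" by (intro nn_integral_cmult_indicator) auto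
      also have "emeasure lborel {0<..<e u} = ennreal (e u)" by (cases "0 \<le> e u") (auto simp: ennreal_neg)
      finally show ?thesis by (simp add: mult_ac)
    qed
    then have "(LBNN u. ennreal (e u) * v u * ind {0<..} u)
      = (LBNN u. (LBNN r. v u * ind (?S r) u * ind {0<..} r))" by simp
    also have "\<dots> = (LBNN u. (LBNN r. v u * ind {0<..} u * ind {0<..} (e u - r) * ind {0<..} r))"
      by (intro nn_integral_cong) (auto simp: indicator_def)
    also have "\<dots> = (LBNN r. (LBNN u. v u * ind {0<..} u * ind {0<..} (e u - r) * ind {0<..} r))"
      by (rule lborel_pair.Fubini') measurable
    also have "\<dots> = (LBNN r. (LBNN u. v u * ind {0<..} u * ind {0<..} (e u - r)) * ind {0<..} r)"
      by (intro nn_integral_cong nn_integral_multc) measurable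
    also have "\<dots> = (LBNN r. (LBNN u. v u * ind (?S r) u) * ind {0<..} r)"
    proof (intro nn_integral_cong)
      fix r
      have "(LBNN u. v u * ind {0<..} u * ind {0<..} (e u - r)) = (LBNN u. v u * ind (?S r) u)"
        by (intro nn_integral_cong) (auto simp: indicator_def)
      then show "(LBNN u. v u * ind {0<..} u * ind {0<..} (e u - r)) * ind {0<..} r
        = (LBNN u. v u * ind (?S r) u) * ind {0<..} r" by (rule arg_cong)
    qed
    finally show ?thesis .
  qed
  have meas: "(\<lambda>r. (LBNN u. v2 u * ind (?S r) u) * ind {0<..} r) \<in> borel_measurable lborel"
  proof -
    have "(\<lambda>r. (LBNN u. v2 u * ind {0<..} u * ind {0<..} (e u - r)) * ind {0<..} r) \<in> borel_measurable lborel"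
      by measurable
    moreover have "(LBNN u. v2 u * ind {0<..} u * ind {0<..} (e u - r)) = (LBNN u. v2 u * ind (?S r) u)" for r
      by (intro nn_integral_cong) (auto simp: indicator_def)
    ultimately show ?thesis by simp
  qed
  have "(LBNN u. ennreal (e u) * v1 u * ind {0<..} u)
    \<le> (LBNN r. B * ((LBNN u. v2 u * ind (?S r) u) * ind {0<..} r))" unfolding cake[OF assms(1)]
  proof (intro nn_integral_mono)
    fix r :: real
    have "(LBNN u. v1 u * ind (?S r) u) \<le> B * (LBNN u. v2 u * ind (?S r) u)"
    proof (rule nn_integral_initial_le[OF assms(1,2) le])
      show "u \<in> ?S r" if "s \<in> ?S r" "0 < u" "u \<le> s" for s u
        using that e[of u s] by auto
    qed auto
    then show "(LBNN u. v1 u * ind (?S r) u) * ind {0<..} r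
      \<le> B * ((LBNN u. v2 u * ind (?S r) u) * ind {0<..} r)"
      by (simp add: mult.assoc[symmetric] mult_right_mono)
  qed
  also have "\<dots> = B * (LBNN r. (LBNN u. v2 u * ind (?S r) u) * ind {0<..} r)"
    by (rule nn_integral_cmult[OF meas])
  finally show ?thesis unfolding cake[OF assms(2)] .
qed

text \<open>In the application \<open>\<rho>\<close> is f*, so that \<open>m\<close> is f** and
  \<open>I t\<close> is \<open>t * m t\<close>.\<close>

locale decr =
  fixes \<rho> :: "real \<Rightarrow> real"
  assumes \<rho>_borel [measurable]: "\<rho> \<in> borel_measurable borel"
    and \<rho>_nonneg: "0 \<le> \<rho> t"
    and \<rho>_decr: "0 < s \<Longrightarrow> s \<le> t \<Longrightarrow> \<rho> t \<le> \<rho> s"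
    and \<rho>_fin: "(LBNN s. ennreal (\<rho> s) * ind {0<..<t} s) < \<infinity>"
begin

definition I :: "real \<Rightarrow> real" where
  "I t = enn2real (LBNN s. ennreal (\<rho> s) * ind {0<..<t} s)"

definition m :: "real \<Rightarrow> real" where "m t = I t / t"

lemma I_eq: "(LBNN s. ennreal (\<rho> s) * ind {0<..<t} s) = ennreal (I t)"
  using \<rho>_fin[of t] by (simp add: I_def less_top)

lemma I_nonneg: "0 \<le> I t"
  by (simp add: I_def)

lemma m_nonneg: "0 < t \<Longrightarrow> 0 \<le> m t"
  by (simp add: m_def I_nonneg)

lemma \<rho>_integral_interval:
  assumes "0 \<le> s" "s \<le> t"
  shows "(LBNN u. ennreal (\<rho> u) * ind {s<..<t} u) = ennreal (I t - I s)" "I s \<le> I t"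
proof -
  have "ennreal (I t) = (LBNN u. ennreal (\<rho> u) * ind {0<..<s} u + ennreal (\<rho> u) * ind {s<..<t} u)"
    unfolding I_eq[symmetric]
  proof (rule nn_integral_cong_AE)
    show "AE u in lborel. ennreal (\<rho> u) * ind {0<..<t} u = ennreal (\<rho> u) * ind {0<..<s} u + ennreal (\<rho> u) * ind {s<..<t} u"
      using AE_lborel_neq[of s] by eventually_elim (use assms in \<open>auto simp: indicator_def\<close>)
  qed
  also have "\<dots> = (LBNN u. ennreal (\<rho> u) * ind {0<..<s} u) + (LBNN u. ennreal (\<rho> u) * ind {s<..<t} u)"
    by (intro nn_integral_add) measurable
  finally have eq: "ennreal (I t) = ennreal (I s) + (LBNN u. ennreal (\<rho> u) * ind {s<..<t} u)" by (simp only: I_eq)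
  then have "ennreal (I s) \<le> ennreal (I t)" by simp
  then show le: "I s \<le> I t" using I_nonneg by simp
  have "ennreal (I t) - ennreal (I s) = (LBNN u. ennreal (\<rho> u) * ind {s<..<t} u)"
    unfolding eq by (rule ennreal_add_diff_cancel_left) simp
  then show "(LBNN u. ennreal (\<rho> u) * ind {s<..<t} u) = ennreal (I t - I s)"
    using I_nonneg[of s] by (simp add: ennreal_minus)
qed

lemma I_mono: "0 \<le> s \<Longrightarrow> s \<le> t \<Longrightarrow> I s \<le> I t"
  by (rule \<rho>_integral_interval(2))

lemma I_diff_le:
  assumes "0 < s" "s \<le> t"
  shows "I t - I s \<le> (t - s) * \<rho> s" "(t - s) * \<rho> t \<le> I t - I s"
proof -
  have "ennreal (I t - I s) = (LBNN u. ennreal (\<rho> u) * ind {s<..<t} u)"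
    using assms by (intro \<rho>_integral_interval(1)[symmetric]) auto
  also have "\<dots> \<le> (LBNN u. ennreal (\<rho> s) * ind {s<..<t} u)"
    using assms \<rho>_decr by (intro nn_integral_mono) (auto simp: indicator_def intro!: ennreal_leI)
  also have "\<dots> = ennreal (\<rho> s) * ennreal (t - s)" using assms by (simp add: nn_integral_cmult_indicator)
  also have "\<dots> = ennreal ((t - s) * \<rho> s)" using \<rho>_nonneg assms by (simp add: mult.commute flip: ennreal_mult)
  finally show "I t - I s \<le> (t - s) * \<rho> s" using \<rho>_nonneg[of s] assms by (subst (asm) ennreal_le_iff) auto
  have "ennreal ((t - s) * \<rho> t) = (LBNN u. ennreal (\<rho> t) * ind {s<..<t} u)"
    using assms \<rho>_nonneg by (simp add: nn_integral_cmult_indicator mult.commute flip: ennreal_mult)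
  also have "\<dots> \<le> (LBNN u. ennreal (\<rho> u) * ind {s<..<t} u)"
    using assms \<rho>_decr by (intro nn_integral_mono) (auto simp: indicator_def intro!: ennreal_leI)
  also have "\<dots> = ennreal (I t - I s)" using assms by (intro \<rho>_integral_interval(1)) auto
  finally show "(t - s) * \<rho> t \<le> I t - I s" using I_mono[of s t] assms by (subst (asm) ennreal_le_iff) auto
qed

lemma \<rho>_le_m:
  assumes t: "0 < t"
  shows "\<rho> t \<le> m t"
proof -
  have "ennreal (t * \<rho> t) = (LBNN u. ennreal (\<rho> t) * ind {0<..<t} u)"
    using t \<rho>_nonneg by (simp add: nn_integral_cmult_indicator mult.commute flip: ennreal_mult)
  also have "\<dots> \<le> (LBNN u. ennreal (\<rho> u) * ind {0<..<t} u)"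
    using \<rho>_decr by (intro nn_integral_mono) (auto simp: indicator_def intro!: ennreal_leI)
  also have "\<dots> = ennreal (I t)" by (rule I_eq)
  finally have "t * \<rho> t \<le> I t" using I_nonneg by simp
  then show ?thesis using t by (simp add: m_def pos_le_divide_eq mult.commute)
qed

lemma m_decr:
  assumes "0 < s" "s \<le> t"
  shows "m t \<le> m s"
proof -
  have "I t \<le> I s + (t - s) * \<rho> s" using I_diff_le(1)[OF assms] by simp
  also have "\<dots> \<le> I s + (t - s) * (I s / s)"
    using assms \<rho>_le_m[of s] by (intro add_left_mono mult_left_mono) (auto simp: m_def)
  also have "\<dots> = t * (I s / s)" using assms by (simp add: field_simps)
  finally show ?thesis using assms by (simp add: m_def pos_divide_le_eq mult.commute)
qed

text \<open>Combines that \<open>m\<close> decreases with the fact that \<open>t * m t\<close>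
  increases.\<close>

lemma m_scale:
  assumes "0 < s" "0 < t"
  shows "m s * min 1 (s / t) \<le> m t"
proof (cases "t \<le> s")
  case True
  then have "min 1 (s / t) = 1" using assms by simp
  then show ?thesis using m_decr[of t s] assms True by simp
next
  case False
  then have "min 1 (s / t) = s / t" using assms by simp
  then show ?thesis using I_mono[of s t] assms False by (simp add: m_def divide_right_mono)
qed

lemma I_0: "t \<le> 0 \<Longrightarrow> I t = 0"
  by (simp add: I_def)

lemma I_borel [measurable]: "I \<in> borel_measurable borel"
proof -
  have "mono I"
  proof (rule monoI)
    fix s t :: real assume "s \<le> t"
    then show "I s \<le> I t" using I_mono[of s t] I_0[of s] I_nonneg[of t] by (cases "0 \<le> s") auto
  qed
  then show ?thesis by (rule borel_measurable_mono)
qed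

lemma m_borel [measurable]: "m \<in> borel_measurable borel"
  unfolding m_def[abs_def] by measurable

lemma I_continuous_pos: "continuous_on {0<..} I"
proof -
  have "isCont I t" if t: "0 < t" for t
  proof -
    define c where "c = t / 2"
    have c: "0 < c" "c < t" using t by (auto simp: c_def)
    have bound: "\<bar>I x - I t\<bar> \<le> \<rho> c * \<bar>x - t\<bar>" if x: "c \<le> x" for x
    proof (cases "x \<le> t")
      case True
      have "(t - x) * \<rho> x \<le> (t - x) * \<rho> c" using True x c by (intro mult_left_mono \<rho>_decr) auto
      then show ?thesis using I_diff_le(1)[of x t] I_mono[of x t] True x c by (simp add: mult.commute[of "\<rho> c"])
    next
      case False
      have "(x - t) * \<rho> t \<le> (x - t) * \<rho> c" using False c by (intro mult_left_mono \<rho>_decr) auto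
      then have "I x - I t \<le> (x - t) * \<rho> c" using I_diff_le(1)[of t x] False t by linarith
      then show ?thesis using I_mono[of t x] False t by (simp add: mult.commute[of "\<rho> c"])
    qed
    have "((\<lambda>x. I x - I t) \<longlongrightarrow> 0) (at t)"
    proof (rule Lim_null_comparison)
      have "\<forall>\<^sub>F x in at t. c < x" using c by (intro order_tendstoD[OF tendsto_ident_at])
      then show "\<forall>\<^sub>F x in at t. norm (I x - I t) \<le> \<rho> c * \<bar>x - t\<bar>" by eventually_elim (use bound in auto)
      have "((\<lambda>x. \<rho> c * \<bar>x - t\<bar>) \<longlongrightarrow> \<rho> c * \<bar>t - t\<bar>) (at t)" by (intro tendsto_intros)
      then show "((\<lambda>x. \<rho> c * \<bar>x - t\<bar>) \<longlongrightarrow> 0) (at t)" by simp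
    qed
    then show ?thesis by (simp add: isCont_def LIM_zero_iff)
  qed
  then show ?thesis by (intro continuous_at_imp_continuous_on) auto
qed

text \<open>Intermediate value theorem. The point of the proof is that \<open>I\<close> becomes
  small near 0, as otherwise the integral of \<open>\<rho>\<close> up to \<open>t\<close> would be
  at most \<open>I t / 2\<close>.\<close>

lemma ex_I_half:
  assumes t: "0 < t" "0 < I t"
  obtains s where "0 < s" "s \<le> t" "I s = I t / 2"
proof -
  have "\<exists>x. 0 < x \<and> x \<le> t \<and> I x \<le> I t / 2"
  proof (rule ccontr)
    assume "\<not> ?thesis"
    then have neg: "I t / 2 < I x" if "0 < x" "x \<le> t" for x using that by (meson not_le)
    have "(LBNN s. ennreal (\<rho> s) * ind {0<..<t} s) \<le> ennreal (I t / 2)"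
    proof (rule nn_integral_le_incseq[where B = "\<lambda>n. {t / real (Suc n)<..<t}"])
      have dec: "t / real (Suc n) \<le> t / real (Suc m)" if "m \<le> n" for m n using t that by (intro divide_left_mono) auto
      show "incseq (\<lambda>n. {t / real (Suc n)<..<t})"
      proof (rule monoI)
        fix m n :: nat assume "m \<le> n"
        then show "{t / real (Suc m)<..<t} \<subseteq> {t / real (Suc n)<..<t}"
          using dec[of m n] by (simp add: greaterThanLessThan_subseteq_greaterThanLessThan)
      qed
      show "{0<..<t} \<subseteq> (\<Union>n. {t / real (Suc n)<..<t})"
      proof
        fix s assume s: "s \<in> {0<..<t}"
        obtain n :: nat where "t / s \<le> real n" using real_arch_simple by blast
        then have "t \<le> real n * s" using s by (simp add: field_simps)
        also have "\<dots> < real (Suc n) * s" using s by (intro mult_strict_right_mono) auto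
        finally have "t / real (Suc n) < s" by (simp add: field_simps)
        then show "s \<in> (\<Union>n. {t / real (Suc n)<..<t})" using s by auto
      qed
      fix n :: nat
      have e: "0 < t / real (Suc n)" "t / real (Suc n) \<le> t" using t dec[of 0 n] by auto
      have "(LBNN s. ennreal (\<rho> s) * ind {t / real (Suc n)<..<t} s) = ennreal (I t - I (t / real (Suc n)))"
        using e by (intro \<rho>_integral_interval(1)) auto
      also have "\<dots> \<le> ennreal (I t / 2)" using neg[OF e] by (intro ennreal_leI) linarith
      finally show "(LBNN s. ennreal (\<rho> s) * ind {t / real (Suc n)<..<t} s) \<le> ennreal (I t / 2)" .
    qed measurable
    then show False using t by (simp add: I_eq)
  qed
  then obtain x where x: "0 < x" "x \<le> t" "I x \<le> I t / 2" by blast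
  have "\<exists>s\<ge>x. s \<le> t \<and> I s = I t / 2" using x t I_nonneg by (intro IVT' continuous_on_subset[OF I_continuous_pos]) auto
  then obtain s where "x \<le> s" "s \<le> t" "I s = I t / 2" by blast
  then show ?thesis using x that[of s] by simp
qed

text \<open>The integrand is \<open>p * I s powr (p - 1) * \<rho> s\<close>, formally the derivative
  of \<open>I s powr p\<close>. As \<open>\<rho>\<close> may jump, two inequalities with constants
  replace the exact formula; this one only uses that \<open>I\<close> increases.\<close>

lemma power_average_upper:
  assumes p: "1 < p" and t: "0 < t"
  shows "(LBNN s. ennreal (p * s powr (p - 1) * (m s powr (p - 1) * \<rho> s)) * ind {0<..<t} s) \<le> ennreal (p * I t powr p)"
proof -
  have "(LBNN s. ennreal (p * s powr (p - 1) * (m s powr (p - 1) * \<rho> s)) * ind {0<..<t} s)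
    \<le> (LBNN s. ennreal (p * I t powr (p - 1)) * (ennreal (\<rho> s) * ind {0<..<t} s))"
  proof (intro nn_integral_mono)
    fix s
    show "ennreal (p * s powr (p - 1) * (m s powr (p - 1) * \<rho> s)) * ind {0<..<t} s
      \<le> ennreal (p * I t powr (p - 1)) * (ennreal (\<rho> s) * ind {0<..<t} s)"
    proof (cases "s \<in> {0<..<t}")
      case True
      then have "s powr (p - 1) * m s powr (p - 1) = I s powr (p - 1)" by (simp add: m_def flip: powr_mult)
      then have "p * s powr (p - 1) * (m s powr (p - 1) * \<rho> s) = p * I s powr (p - 1) * \<rho> s" by simp
      also have "\<dots> \<le> p * I t powr (p - 1) * \<rho> s"
        using True p \<rho>_nonneg I_nonneg I_mono[of s t] by (intro mult_right_mono mult_left_mono powr_mono2) auto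
      finally show ?thesis using True p \<rho>_nonneg by (simp add: ennreal_leI flip: ennreal_mult)
    qed simp
  qed
  also have "\<dots> = ennreal (p * I t powr (p - 1)) * ennreal (I t)" by (subst nn_integral_cmult) (auto simp: I_eq)
  also have "\<dots> = ennreal (p * (I t * I t powr (p - 1)))" using p I_nonneg by (simp add: mult_ac flip: ennreal_mult)
  also have "I t * I t powr (p - 1) = I t powr p" using I_nonneg[of t] by (simp add: powr_mult_base)
  finally show ?thesis .
qed

text \<open>Only the part beyond the point \<open>u\<close> with \<open>I u = I t / 2\<close> is
  kept: there \<open>I s\<close> is at least half of \<open>I t\<close>, and \<open>\<rho>\<close>
  still has half of its mass. This explains the constant \<open>2 powr p / p\<close>.\<close>

lemma power_average_lower:
  assumes p: "1 < p" and t: "0 < t"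
  shows "ennreal (I t powr p) \<le> ennreal (2 powr p / p) * (LBNN s. ennreal (p * s powr (p - 1) * (m s powr (p - 1) * \<rho> s)) * ind {0<..<t} s)"
proof (cases "I t = 0")
  case False
  then have It: "0 < I t" using I_nonneg[of t] by simp
  obtain u where u: "0 < u" "u \<le> t" "I u = I t / 2" using ex_I_half[OF t It] .
  have eq: "2 powr p / p * (p * I u powr (p - 1) * (I t - I u)) = I t powr p"
  proof -
    have It_eq: "I t = 2 * I u" using u by simp
    have "I u powr (p - 1) * I u = I u powr p"
      using I_nonneg[of u] powr_mult_base[of "I u" "p - 1"] by (simp add: mult.commute)
    then show ?thesis unfolding It_eq using p I_nonneg[of u] by (simp add: powr_mult)
  qed
  have \<rho>_meas: "(\<lambda>s. ennreal (\<rho> s) * ind {u<..<t} s) \<in> borel_measurable lborel" by measurable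
  have start: "ennreal (I t powr p) = ennreal (2 powr p / p) * (ennreal (p * I u powr (p - 1)) * ennreal (I t - I u))"
  proof -
    have a: "0 \<le> 2 powr p / p" "0 \<le> p * I u powr (p - 1)" "0 \<le> I t - I u" using p I_mono[of u t] u by auto
    show ?thesis
      unfolding ennreal_mult[OF a(2,3), symmetric] ennreal_mult[OF a(1) mult_nonneg_nonneg[OF a(2,3)], symmetric]
      by (simp only: eq)
  qed
  have "ennreal (I t - I u) = (LBNN s. ennreal (\<rho> s) * ind {u<..<t} s)"
    using u by (intro \<rho>_integral_interval(1)[symmetric]) auto
  then have "ennreal (p * I u powr (p - 1)) * ennreal (I t - I u) = (LBNN s. ennreal (p * I u powr (p - 1)) * (ennreal (\<rho> s) * ind {u<..<t} s))"
    by (simp only: nn_integral_cmult \<rho>_meas)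
  also have "\<dots> \<le> (LBNN s. ennreal (p * s powr (p - 1) * (m s powr (p - 1) * \<rho> s)) * ind {0<..<t} s)"
  proof (intro nn_integral_mono)
    fix s
    show "ennreal (p * I u powr (p - 1)) * (ennreal (\<rho> s) * ind {u<..<t} s)
      \<le> ennreal (p * s powr (p - 1) * (m s powr (p - 1) * \<rho> s)) * ind {0<..<t} s"
    proof (cases "s \<in> {u<..<t}")
      case True
      then have s: "0 < s" using u by simp
      have "p * I u powr (p - 1) * \<rho> s \<le> p * I s powr (p - 1) * \<rho> s"
        using True p u \<rho>_nonneg I_nonneg I_mono[of u s] by (intro mult_right_mono mult_left_mono powr_mono2) auto
      also have "\<dots> = p * s powr (p - 1) * (m s powr (p - 1) * \<rho> s)"
      proof -
        have "s powr (p - 1) * m s powr (p - 1) = I s powr (p - 1)" using s by (simp add: m_def flip: powr_mult)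
        then show ?thesis by simp
      qed
      finally show ?thesis using True s p \<rho>_nonneg by (simp add: ennreal_leI flip: ennreal_mult)
    qed simp
  qed
  finally show ?thesis unfolding start by (rule mult_left_mono) simp
qed simp

end

section \<open>Weighted norms of dilated averages\<close>

locale decr_weight = decr \<rho> + gweight p w for \<rho> :: "real \<Rightarrow> real" and p w
begin

definition N :: "real \<Rightarrow> ennreal" where
  "N l = (LBNN t. ennreal (m (l * t) powr p) * w t * ind {0<..} t)"

text \<open>A power of \<open>m\<close> cannot be fed into a comparison of fundamental functions
  directly. But \<open>t powr p * m t powr p\<close> is comparable to the integral of
  \<open>p * s powr (p - 1) * e s\<close> up to \<open>t\<close>, and \<open>e\<close> is
  decreasing, as Hardy's lemma requires.\<close>

definition e :: "real \<Rightarrow> real" where "e s = m s powr (p - 1) * \<rho> s"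

definition J :: "real \<Rightarrow> ennreal" where
  "J t = (LBNN s. ennreal (p * s powr (p - 1) * e s) * ind {0<..<t} s)"

lemma e_borel [measurable]: "e \<in> borel_measurable borel"
  unfolding e_def[abs_def] by measurable

lemma e_nonneg: "0 \<le> e s"
  by (simp add: e_def \<rho>_nonneg)

lemma e_decr: "0 < u \<Longrightarrow> u \<le> s \<Longrightarrow> e s \<le> e u"
  unfolding e_def using p by (intro mult_mono powr_mono2 m_decr \<rho>_decr m_nonneg \<rho>_nonneg) auto

text \<open>The weight that multiplies \<open>e s\<close> once the order of integration is exchanged
  in the dilated norm, see \<open>J_integral\<close>. Its primitive at \<open>u\<close> is the
  fundamental function at \<open>u / l\<close>, see \<open>v_integral\<close>.\<close>

definition v :: "real \<Rightarrow> real \<Rightarrow> ennreal" where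
  "v l s = ennreal (p * s powr (p - 1)) * ennreal (l powr (-p)) * Ai p w (s / l)"

lemma Ai_borel [measurable]: "Ai p w \<in> borel_measurable borel"
proof -
  have "(\<lambda>t. (LBNN s. w s * ennreal (s powr (-p)) * ind {0<..} (s - t))) \<in> borel_measurable lborel" by measurable
  moreover have "(LBNN s. w s * ennreal (s powr (-p)) * ind {0<..} (s - t)) = Ai p w t" for t
    unfolding Ai_def by (intro nn_integral_cong) (auto simp: indicator_def)
  ultimately show ?thesis by simp
qed

lemma v_borel [measurable]: "v l \<in> borel_measurable borel"
  unfolding v_def[abs_def] by measurable

lemma v_integral:
  assumes l: "0 < l" and u: "0 < u"
  shows "(LBNN s. v l s * ind {0<..<u} s) = Gi p w (u / l)"
proof -
  have "(LBNN s. v l s * ind {0<..<u} s) = ennreal \<bar>l\<bar> * (LBNN s. v l (0 + l * s) * ind {0<..<u} (0 + l * s))"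
    using l by (intro nn_integral_real_affine) auto
  also have "\<dots> = (LBNN s. ennreal \<bar>l\<bar> * (v l (0 + l * s) * ind {0<..<u} (0 + l * s)))"
    by (intro nn_integral_cmult[symmetric]) measurable
  also have "\<dots> = (LBNN s. ennreal (p * s powr (p - 1)) * Ai p w s * ind {0<..<u / l} s)"
  proof (intro nn_integral_cong)
    fix s
    show "ennreal \<bar>l\<bar> * (v l (0 + l * s) * ind {0<..<u} (0 + l * s)) = ennreal (p * s powr (p - 1)) * Ai p w s * ind {0<..<u / l} s"
    proof (cases "s \<in> {0<..<u / l}")
      case True
      then have s: "0 < s" "l * s < u" using l by (auto simp: field_simps)
      have "l * (p * (l * s) powr (p - 1) * l powr (-p)) = (l * (l powr (p - 1) * l powr (-p))) * (p * s powr (p - 1))"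
        using l s by (simp add: powr_mult)
      also have "l * (l powr (p - 1) * l powr (-p)) = 1"
      proof -
        have "l powr (p - 1) * l powr (-p) = l powr (- 1)" by (simp flip: powr_add)
        then have "l * (l powr (p - 1) * l powr (-p)) = l * l powr (- 1)" by (rule arg_cong)
        also have "\<dots> = 1" using l by (simp add: powr_minus_divide)
        finally show ?thesis .
      qed
      finally have "ennreal l * (ennreal (p * (l * s) powr (p - 1)) * ennreal (l powr (-p))) = ennreal (p * s powr (p - 1))"
        using l p by (simp flip: ennreal_mult)
      then show ?thesis unfolding v_def mult.assoc[symmetric] using True s l by simp
    next
      case False
      then have "l * s \<notin> {0<..<u}" using l by (auto simp: field_simps zero_less_mult_iff)
      then show ?thesis using False by simp
    qed
  qed
  also have "\<dots> = Gi p w (u / l)" using l u by (intro Gi_integral) simp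
  finally show ?thesis .
qed

lemma J_integral:
  assumes l: "0 < l"
  shows "(LBNN t. ennreal ((l * t) powr (-p)) * J (l * t) * w t * ind {0<..} t)
    = (LBNN s. ennreal (e s) * v l s * ind {0<..} s)"
proof -
  let ?e = "\<lambda>s. ennreal (p * s powr (p - 1) * e s)" and ?w = "\<lambda>t. ennreal ((l * t) powr (-p)) * w t * ind {0<..} t"
  let ?j = "\<lambda>s t. ?e s * ind {0<..} s * ind {0<..} (l * t - s)"
  have "(LBNN t. ennreal ((l * t) powr (-p)) * J (l * t) * w t * ind {0<..} t)
    = (LBNN t. (LBNN s. ?j s t
        * ?w t))"
  proof (intro nn_integral_cong)
    fix t
    have "J (l * t) = (LBNN s. ?j s t)"
      unfolding J_def by (intro nn_integral_cong) (auto simp: indicator_def)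
    then have "ennreal ((l * t) powr (-p)) * J (l * t) * w t * ind {0<..} t
      = (LBNN s. ?j s t) * ?w t"
      by (simp add: mult_ac)
    also have "\<dots> = (LBNN s. ?j s t
        * ?w t)" by (intro nn_integral_multc[symmetric]) measurable
    finally show "ennreal ((l * t) powr (-p)) * J (l * t) * w t * ind {0<..} t = \<dots>" .
  qed
  also have "\<dots> = (LBNN s. (LBNN t. ?j s t
        * ?w t))" by (rule lborel_pair.Fubini') measurable
  also have "\<dots> = (LBNN s. ennreal (e s) * v l s * ind {0<..} s)"
  proof (intro nn_integral_cong)
    fix s
    show "(LBNN t. ?j s t
        * ?w t) = ennreal (e s) * v l s * ind {0<..} s"
    proof (cases "0 < s")
      case True
      have "(LBNN t. ?j s t
        * ?w t)
        = (LBNN t. ?e s * ennreal (l powr (-p)) * (w t * ennreal (t powr (-p)) * ind {s / l<..} t))"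
      proof (intro nn_integral_cong)
        fix t
        have "0 < t" if "s < l * t" using that True l by (meson less_trans zero_less_mult_pos)
        moreover have "s / l < t \<longleftrightarrow> s < l * t" using l by (simp add: pos_divide_less_eq mult.commute)
        ultimately show "?j s t
            * ?w t
          = ?e s * ennreal (l powr (-p)) * (w t * ennreal (t powr (-p)) * ind {s / l<..} t)"
          using True l by (auto simp: indicator_def powr_mult ennreal_mult mult_ac)
      qed
      also have "\<dots> = ?e s * ennreal (l powr (-p)) * Ai p w (s / l)"
        unfolding Ai_def by (intro nn_integral_cmult) measurable
      finally show ?thesis using True p e_nonneg by (simp add: v_def ennreal_mult mult_ac)
    qed simp
  qed
  finally show ?thesis .
qed

text \<open>Up to constants \<open>N l\<close> is the integral of the decreasing \<open>e\<close>
  against \<open>v l\<close>. The hypothesis compares the primitives of \<open>v l\<close> and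
  \<open>v 1\<close>, so Hardy's lemma compares the integrals. The factor \<open>2 powr p\<close> is
  the product of the constants \<open>2 powr p / p\<close> and \<open>p\<close> of the two average
  estimates.\<close>

lemma dilation_bound:
  assumes l: "0 < l" and le: "\<And>u. 0 < u \<Longrightarrow> g (u / l) \<le> B * g u" and B: "0 \<le> B"
  shows "N l \<le> ennreal (2 powr p * B) * N 1"
proof -
  have "N l \<le> (LBNN t. ennreal (2 powr p / p) * (ennreal ((l * t) powr (-p)) * J (l * t) * w t * ind {0<..} t))"
    unfolding N_def
  proof (intro nn_integral_mono)
    fix t
    show "ennreal (m (l * t) powr p) * w t * ind {0<..} t
      \<le> ennreal (2 powr p / p) * (ennreal ((l * t) powr (-p)) * J (l * t) * w t * ind {0<..} t)"
    proof (cases "0 < t")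
      case True
      then have lt: "0 < l * t" using l by simp
      have "m (l * t) powr p = (l * t) powr (-p) * I (l * t) powr p"
        using lt I_nonneg[of "l * t"] by (simp add: m_def powr_divide powr_minus_divide)
      then have "ennreal (m (l * t) powr p) = ennreal ((l * t) powr (-p)) * ennreal (I (l * t) powr p)"
        by (simp add: ennreal_mult)
      also have "\<dots> \<le> ennreal ((l * t) powr (-p)) * (ennreal (2 powr p / p) * J (l * t))"
        unfolding J_def e_def by (intro mult_left_mono power_average_lower p lt) auto
      finally have "ennreal (m (l * t) powr p) * w t \<le> ennreal ((l * t) powr (-p)) * (ennreal (2 powr p / p) * J (l * t)) * w t"
        by (rule mult_right_mono) simp
      then show ?thesis using True by (simp add: mult_ac)
    qed simp
  qed
  also have "\<dots> = ennreal (2 powr p / p) * (LBNN t. ennreal ((l * t) powr (-p)) * J (l * t) * w t * ind {0<..} t)"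
  proof (intro nn_integral_cmult)
    have "(\<lambda>t. J t) \<in> borel_measurable lborel"
    proof -
      have "(\<lambda>t. (LBNN s. ennreal (p * s powr (p - 1) * e s) * ind {0<..} s * ind {0<..} (t - s))) \<in> borel_measurable lborel"
        by measurable
      moreover have "(LBNN s. ennreal (p * s powr (p - 1) * e s) * ind {0<..} s * ind {0<..} (t - s)) = J t" for t
        unfolding J_def by (intro nn_integral_cong) (auto simp: indicator_def)
      ultimately show ?thesis by simp
    qed
    then have [measurable]: "J \<in> borel_measurable borel" by simp
    show "(\<lambda>t. ennreal ((l * t) powr (-p)) * J (l * t) * w t * ind {0<..} t) \<in> borel_measurable lborel" by measurable
  qed
  also have "\<dots> = ennreal (2 powr p / p) * (LBNN s. ennreal (e s) * v l s * ind {0<..} s)"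
    by (simp only: J_integral[OF l])
  also have "\<dots> \<le> ennreal (2 powr p / p) * (ennreal B * (LBNN s. ennreal (e s) * v 1 s * ind {0<..} s))"
  proof (intro mult_left_mono Hardy_lemma e_decr)
    fix u :: real assume u: "0 < u"
    have "(LBNN s. v l s * ind {0<..<u} s) = ennreal (g (u / l))" using u l by (simp add: v_integral Gi_eq_g)
    also have "\<dots> \<le> ennreal (B * g u)" by (intro ennreal_leI le u)
    also have "\<dots> = ennreal B * (LBNN s. v 1 s * ind {0<..<u} s)"
      using u B g_nonneg by (simp add: v_integral Gi_eq_g ennreal_mult)
    finally show "(LBNN s. v l s * ind {0<..<u} s) \<le> ennreal B * (LBNN s. v 1 s * ind {0<..<u} s)" .
  qed auto
  also have "(LBNN s. ennreal (e s) * v 1 s * ind {0<..} s) = (LBNN t. ennreal ((1 * t) powr (-p)) * J (1 * t) * w t * ind {0<..} t)"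
    by (rule J_integral[symmetric]) simp
  also have "\<dots> \<le> (LBNN t. ennreal p * (ennreal (m (1 * t) powr p) * w t * ind {0<..} t))"
  proof (intro nn_integral_mono)
    fix t :: real
    show "ennreal ((1 * t) powr (-p)) * J (1 * t) * w t * ind {0<..} t \<le> ennreal p * (ennreal (m (1 * t) powr p) * w t * ind {0<..} t)"
    proof (cases "0 < t")
      case True
      have "ennreal (t powr (-p)) * J t \<le> ennreal (t powr (-p)) * ennreal (p * I t powr p)"
        unfolding J_def e_def by (intro mult_left_mono power_average_upper p True) auto
      also have "\<dots> = ennreal p * ennreal (m t powr p)"
        using True p I_nonneg[of t] by (simp add: m_def powr_divide powr_minus_divide flip: ennreal_mult)
      finally have "ennreal (t powr (-p)) * J t * w t \<le> ennreal p * ennreal (m t powr p) * w t"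
        by (rule mult_right_mono) simp
      then show ?thesis using True by (simp add: mult.assoc)
    qed simp
  qed
  also have "\<dots> = ennreal p * N 1" unfolding N_def by (intro nn_integral_cmult) measurable
  finally have "N l \<le> ennreal (2 powr p / p) * (ennreal B * (ennreal p * N 1))" by (simp add: mult_left_mono)
  also have "\<dots> = ennreal (2 powr p / p * B * p) * N 1"
  proof -
    have "ennreal (2 powr p / p * B * p) = ennreal (2 powr p / p) * ennreal B * ennreal p"
      using p B by (subst ennreal_mult, simp, simp, subst ennreal_mult) auto
    then show ?thesis by (simp only: mult.assoc)
  qed
  also have "2 powr p / p * B * p = 2 powr p * B" using p by simp
  finally show ?thesis .
qed

end

section \<open>Rearrangements\<close>

lemma lebesgue_borel_representative:
  fixes f :: "real^'n \<Rightarrow> real"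
  assumes "f \<in> borel_measurable lebesgue"
  obtains f' where "f' \<in> borel_measurable borel" "AE x in lebesgue. f x = f' x" "AE x in lborel. f x = f' x"
proof -
  obtain f' where "f' \<in> borel_measurable lborel" "AE x in lborel. f x = f' x"
    using completion_ex_borel_measurable_real[OF assms] by blast
  then show ?thesis using that[of f'] AE_completion by auto
qed

lemma rearr_cong:
  fixes f f' :: "real^'n \<Rightarrow> real"
  assumes "f \<in> borel_measurable lebesgue" "f' \<in> borel_measurable lebesgue" "AE x in lebesgue. f x = f' x"
  shows "rearr f = rearr f'"
proof -
  have "emeasure lebesgue {x. \<bar>f x\<bar> > r} = emeasure lebesgue {x. \<bar>f' x\<bar> > r}" for r
  proof (rule emeasure_eq_AE)
    show "AE x in lebesgue. x \<in> {x. \<bar>f x\<bar> > r} \<longleftrightarrow> x \<in> {x. \<bar>f' x\<bar> > r}" using assms(3) by eventually_elim simp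
    show "{x. \<bar>f x\<bar> > r} \<in> sets lebesgue" "{x. \<bar>f' x\<bar> > r} \<in> sets lebesgue"
      using borel_measurable_less[OF borel_measurable_const borel_measurable_abs[OF assms(1)], of r]
        borel_measurable_less[OF borel_measurable_const borel_measurable_abs[OF assms(2)], of r] by simp_all
  qed
  then show ?thesis by (simp add: rearr_def fun_eq_iff)
qed

lemma rearr_antimono: "s \<le> t \<Longrightarrow> rearr f t \<le> rearr f s"
  unfolding rearr_def by (intro INF_superset_mono) (auto intro: order_trans ennreal_leI)

definition dfun :: "('a::euclidean_space \<Rightarrow> real) \<Rightarrow> real \<Rightarrow> ennreal" where
  "dfun f r = emeasure lborel {x. r < \<bar>f x\<bar>}"

lemma dfun_borel [measurable]:
  fixes f :: "'a::euclidean_space \<Rightarrow> real"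
  assumes [measurable]: "f \<in> borel_measurable borel"
  shows "dfun f \<in> borel_measurable borel"
proof -
  have "(\<lambda>r. (LBNN x. ind {0<..} (\<bar>f x\<bar> - r))) \<in> borel_measurable lborel" by measurable
  moreover have "(LBNN x. ind {0<..} (\<bar>f x\<bar> - r)) = dfun f r" for r
  proof -
    have "(LBNN x. ind {0<..} (\<bar>f x\<bar> - r)) = (\<integral>\<^sup>+x. ind {x. r < \<bar>f x\<bar>} x \<partial>(lborel :: 'a measure))"
      by (intro nn_integral_cong) (auto simp: indicator_def)
    then show ?thesis by (simp add: dfun_def)
  qed
  ultimately show ?thesis by simp
qed

lemma dfun_antimono:
  assumes [measurable]: "f \<in> borel_measurable borel" and "r \<le> r'"
  shows "dfun f r' \<le> dfun f r"
  unfolding dfun_def using assms(2) by (intro emeasure_mono) auto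

lemma rearr_dfun:
  fixes f :: "real^'n \<Rightarrow> real"
  assumes [measurable]: "f \<in> borel_measurable borel"
  shows "rearr f t = (INF r\<in>{r. 0 < r \<and> dfun f r \<le> ennreal t}. ennreal r)"
proof -
  have "{x. r < \<bar>f x\<bar>} \<in> sets borel" for r by measurable
  then have "emeasure lebesgue {x. r < \<bar>f x\<bar>} = dfun f r" for r by (simp add: dfun_def)
  then show ?thesis by (simp add: rearr_def)
qed

lemma dfun_le_of_rearr_less:
  fixes f :: "real^'n \<Rightarrow> real"
  assumes f[measurable]: "f \<in> borel_measurable borel" and less: "rearr f s < ennreal r"
  shows "dfun f r \<le> ennreal s"
proof -
  obtain r' where r': "0 < r'" "dfun f r' \<le> ennreal s" "ennreal r' < ennreal r"
    using less unfolding rearr_dfun[OF f] INF_less_iff by auto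
  then have "dfun f r \<le> dfun f r'" by (intro dfun_antimono f) (simp add: ennreal_less_iff)
  then show ?thesis using r' by simp
qed

lemma rearr_le_of_dfun_le:
  fixes f :: "real^'n \<Rightarrow> real"
  assumes f[measurable]: "f \<in> borel_measurable borel" and "0 < r" "dfun f r \<le> ennreal s"
  shows "rearr f s \<le> ennreal r"
  unfolding rearr_dfun[OF f] using assms by (intro INF_lower) auto

text \<open>As the distribution function decreases, the set on the right is an interval from 0 with
  right end f*(s). Written as an integral, the rearrangement is seen to be measurable and is
  accessible to Tonelli's theorem.\<close>

lemma rearr_eq_nn_integral:
  fixes f :: "real^'n \<Rightarrow> real"
  assumes f[measurable]: "f \<in> borel_measurable borel"
  shows "rearr f s = (LBNN r. ind {0<..} r * ind {r. ennreal s < dfun f r} r)"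
proof -
  let ?S = "{r. 0 < r \<and> ennreal s < dfun f r}"
  have meas[measurable]: "?S \<in> sets borel" by measurable
  have eq: "(LBNN r. ind {0<..} r * ind {r. ennreal s < dfun f r} r) = emeasure lborel ?S"
  proof -
    have "(LBNN r. ind {0<..} r * ind {r. ennreal s < dfun f r} r) = (LBNN r. ind ?S r)"
      by (intro nn_integral_cong) (auto simp: indicator_def)
    then show ?thesis by simp
  qed
  have lower: "0 < r \<and> ennreal s < dfun f r" if "0 < r" "ennreal r < rearr f s" for r
    using that rearr_le_of_dfun_le[OF f that(1), of s] by (meson leD not_le_imp_less)
  have upper: "ennreal r \<le> rearr f s" if "ennreal s < dfun f r" for r
    using that dfun_le_of_rearr_less[OF f, of s r] by (meson leD not_le_imp_less)
  show ?thesis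
  proof (cases "rearr f s")
    case (real b)
    have "ennreal b = emeasure lborel {0<..<b}" using real by simp
    also have "\<dots> \<le> emeasure lborel ?S"
    proof (rule emeasure_mono)
      show "{0<..<b} \<subseteq> ?S" using lower real by (auto simp: ennreal_less_iff)
    qed simp
    finally have 1: "ennreal b \<le> emeasure lborel ?S" .
    have "emeasure lborel ?S \<le> emeasure lborel {0<..b}"
    proof (rule emeasure_mono)
      show "?S \<subseteq> {0<..b}" using upper real by auto
    qed simp
    then have "emeasure lborel ?S \<le> ennreal b" using real by simp
    then show ?thesis using 1 real eq by simp
  next
    case top
    then have "?S = {0<..}" using lower by (auto simp: less_top)
    moreover have "emeasure lborel {0 :: real<..} = \<infinity>"
    proof (rule ccontr)
      assume fin: "emeasure lborel {0 :: real<..} \<noteq> \<infinity>"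
      then obtain c where c: "0 \<le> c" "emeasure lborel {0 :: real<..} = ennreal c"
        by (cases "emeasure lborel {0 :: real<..}") auto
      have "emeasure lborel {0<..<c + 1} \<le> emeasure lborel {0 :: real<..}" by (rule emeasure_mono) auto
      then show False using c by simp
    qed
    ultimately show ?thesis using top eq by simp
  qed
qed

lemma rearr_borel [measurable]:
  fixes f :: "real^'n \<Rightarrow> real"
  assumes f[measurable]: "f \<in> borel_measurable borel"
  shows "rearr f \<in> borel_measurable borel"
proof -
  have "(\<lambda>s. (LBNN r. ind {0<..} r * ind {z. ennreal (fst z) < dfun f (snd z)} (s, r))) \<in> borel_measurable lborel"
    by measurable
  moreover have "(LBNN r. ind {0<..} r * ind {z. ennreal (fst z) < dfun f (snd z)} (s, r)) = rearr f s" for s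
    unfolding rearr_eq_nn_integral[OF f] by (intro nn_integral_cong) (auto simp: indicator_def)
  ultimately show ?thesis by simp
qed

lemma emeasure_lborel_less_ennreal:
  assumes "0 \<le> t"
  shows "emeasure lborel {s. 0 < s \<and> s < t \<and> ennreal s < c} = min (ennreal t) c"
proof (cases c)
  case (real b)
  then have "{s. 0 < s \<and> s < t \<and> ennreal s < c} = {0<..<min t b}" by (auto simp: ennreal_less_iff)
  then show ?thesis using real assms by (simp add: min_def ennreal_le_iff)
next
  case top
  then have "{s. 0 < s \<and> s < t \<and> ennreal s < c} = {0<..<t}" by auto
  then show ?thesis using top assms by simp
qed

text \<open>Hardy-Littlewood inequality by the layer cake formula: at height r the part of
  \<open>E\<close> where |f| > r has measure at most the minimum of t and the distribution function,
  and this minimum is the measure of the parameters s < t with f*(s) > r, up to boundary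
  points.\<close>

lemma nn_integral_le_rearr:
  fixes f :: "real^'n \<Rightarrow> real"
  assumes f[measurable]: "f \<in> borel_measurable borel" and E[measurable]: "E \<in> sets borel"
    and le: "emeasure lborel E \<le> ennreal t" and t: "0 \<le> t"
  shows "(LBNN x. ennreal \<bar>f x\<bar> * ind E x) \<le> (LBNN s. rearr f s * ind {0<..<t} s)"
proof -
  let ?k = "\<lambda>r s. ind {0<..} r * ind {z. ennreal (fst z) < dfun f (snd z)} (s, r)"
    and ?l = "\<lambda>x r. ind {0<..} r * ind {0<..} (\<bar>f x\<bar> - r) * ind E x"
  have "(LBNN x. ennreal \<bar>f x\<bar> * ind E x) = (LBNN x. (LBNN r. ?l x r))"
  proof (intro nn_integral_cong)
    fix x
    have "(LBNN r. ?l x r) = (LBNN r. ind E x * ind {0<..<\<bar>f x\<bar>} r)"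
      by (intro nn_integral_cong) (auto simp: indicator_def)
    also have "\<dots> = ind E x * ennreal \<bar>f x\<bar>" by (subst nn_integral_cmult_indicator) auto
    finally show "ennreal \<bar>f x\<bar> * ind E x = (LBNN r. ?l x r)"
      by (simp add: mult.commute)
  qed
  also have "\<dots> = (LBNN r. (LBNN x. ?l x r))"
    by (rule lborel_pair.Fubini') measurable
  also have "\<dots> \<le> (LBNN r. (LBNN s. ?k r s * ind {0<..<t} s))"
  proof (intro nn_integral_mono)
    fix r :: real
    show "(LBNN x. ?l x r)
      \<le> (LBNN s. ?k r s * ind {0<..<t} s)"
    proof (cases "0 < r")
      case True
      have [measurable]: "{x. r < \<bar>f x\<bar>} \<in> sets borel" by measurable
      have "(LBNN x. ?l x r) = (LBNN x. ind ({x. r < \<bar>f x\<bar>} \<inter> E) x)"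
        using True by (intro nn_integral_cong) (auto simp: indicator_def)
      also have "\<dots> = emeasure lborel ({x. r < \<bar>f x\<bar>} \<inter> E)" by simp
      also have "\<dots> \<le> min (ennreal t) (dfun f r)"
      proof (rule min.boundedI)
        have "emeasure lborel ({x. r < \<bar>f x\<bar>} \<inter> E) \<le> emeasure lborel E" by (rule emeasure_mono) auto
        then show "emeasure lborel ({x. r < \<bar>f x\<bar>} \<inter> E) \<le> ennreal t" using le by simp
        show "emeasure lborel ({x. r < \<bar>f x\<bar>} \<inter> E) \<le> dfun f r" unfolding dfun_def by (rule emeasure_mono) auto
      qed
      also have "\<dots> = (LBNN s. ind {s. 0 < s \<and> s < t \<and> ennreal s < dfun f r} s)"
        using t by (simp add: emeasure_lborel_less_ennreal)
      also have "\<dots> = (LBNN s. ?k r s * ind {0<..<t} s)"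
        using True by (intro nn_integral_cong) (auto simp: indicator_def)
      finally show ?thesis .
    qed simp
  qed
  also have "\<dots> = (LBNN s. (LBNN r. ?k r s * ind {0<..<t} s))"
    by (rule lborel_pair.Fubini') measurable
  also have "\<dots> = (LBNN s. rearr f s * ind {0<..<t} s)"
  proof (intro nn_integral_cong)
    fix s
    have "(LBNN r. ?k r s * ind {0<..<t} s)
      = (LBNN r. ?k r s) * ind {0<..<t} s"
      by (rule nn_integral_multc) measurable
    also have "(LBNN r. ?k r s) = rearr f s"
      unfolding rearr_eq_nn_integral[OF f] by (intro nn_integral_cong) (auto simp: indicator_def)
    finally show "(LBNN r. ?k r s * ind {0<..<t} s) = rearr f s * ind {0<..<t} s" .
  qed
  finally show ?thesis .
qed

lemma rearr_avg_borel:
  fixes f :: "real^'n \<Rightarrow> real"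
  assumes f: "f \<in> borel_measurable borel"
  shows "rearr_avg f t = ennreal (1 / t) * (LBNN s. rearr f s * ind {0<..<t} s)"
  using rearr_borel[OF f] by (simp add: rearr_avg_def P_avg_def nn_integral_completion)

lemma epowr_less_top: "epowr x a < \<infinity> \<longleftrightarrow> x < \<infinity>"
  by (simp add: epowr_def less_top)

lemma Gamma_norm_finite:
  "Gamma_norm p \<phi> f < \<infinity> \<longleftrightarrow> (\<integral>\<^sup>+t\<in>{0<..}. epowr (rearr_avg f t) p * ennreal (\<phi> t) \<partial>lebesgue) < \<infinity>"
  by (simp only: Gamma_norm_def epowr_less_top)

text \<open>An infinite integral up to \<open>t\<close> makes the average infinite at every larger
  argument. There the weight is positive, so the norm would be infinite.\<close>

lemma rearr_avg_finite:
  fixes f :: "real^'n \<Rightarrow> real"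
  assumes fin: "Gamma_norm p \<phi> f < \<infinity>" and \<phi>: "\<And>t. 0 < t \<Longrightarrow> 0 < \<phi> t" and t: "0 < t"
  shows "(\<integral>\<^sup>+s\<in>{0<..<t}. rearr f s \<partial>lebesgue) < \<infinity>"
proof (rule ccontr)
  assume inf: "\<not> ?thesis"
  have avg: "rearr_avg f u = \<infinity>" if "t < u" for u
  proof -
    have "(\<integral>\<^sup>+s\<in>{0<..<t}. rearr f s \<partial>lebesgue) \<le> (\<integral>\<^sup>+s\<in>{0<..<u}. rearr f s \<partial>lebesgue)"
      using that by (intro nn_integral_mono) (auto simp: indicator_def)
    then have "(\<integral>\<^sup>+s\<in>{0<..<u}. rearr f s \<partial>lebesgue) = \<infinity>"
      using inf by (simp add: top.not_eq_extremum[symmetric] top_unique)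
    then show ?thesis using that t by (simp add: rearr_avg_def P_avg_def ennreal_mult_top)
  qed
  have "\<infinity> = (\<integral>\<^sup>+u. \<infinity> * ind {t<..<t + 1} u \<partial>(lebesgue :: real measure))" by (subst nn_integral_cmult_indicator) auto
  also have "\<dots> \<le> (\<integral>\<^sup>+u\<in>{0<..}. epowr (rearr_avg f u) p * ennreal (\<phi> u) \<partial>lebesgue)"
  proof (intro nn_integral_mono)
    fix u
    show "\<infinity> * ind {t<..<t + 1} u \<le> epowr (rearr_avg f u) p * ennreal (\<phi> u) * ind {0<..} u"
    proof (cases "u \<in> {t<..<t + 1}")
      case True
      then have "0 < ennreal (\<phi> u)" using \<phi>[of u] t by simp
      then have "\<infinity> * ennreal (\<phi> u) = \<infinity>" by (simp add: ennreal_top_mult)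
      then show ?thesis using True t avg[of u] by (simp add: epowr_def)
    qed simp
  qed
  finally show False using fin Gamma_norm_finite[of p \<phi> f] by (simp add: top_unique)
qed

lemma decr_rearr:
  fixes f :: "real^'n \<Rightarrow> real"
  assumes f[measurable]: "f \<in> borel_measurable borel"
    and fin: "\<And>t. 0 < t \<Longrightarrow> (LBNN s. rearr f s * ind {0<..<t} s) < \<infinity>"
  defines "r \<equiv> \<lambda>t. if 0 < t then enn2real (rearr f t) else 0"
  shows "decr r" "\<And>t. 0 < t \<Longrightarrow> rearr f t = ennreal (r t)" "\<And>t. 0 < t \<Longrightarrow> rearr_avg f t = ennreal (decr.m r t)"
proof -
  show eq: "rearr f t = ennreal (r t)" if t: "0 < t" for t
  proof -
    have "rearr f t * ennreal t = (LBNN s. rearr f t * ind {0<..<t} s)"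
      using t by (subst nn_integral_cmult_indicator) auto
    also have "\<dots> \<le> (LBNN s. rearr f s * ind {0<..<t} s)"
      using rearr_antimono[of _ t f] by (intro nn_integral_mono) (auto simp: indicator_def)
    also have "\<dots> < \<infinity>" by (rule fin[OF t])
    finally have "rearr f t \<noteq> \<infinity>" using t by (auto simp: ennreal_top_mult)
    then show ?thesis using t by (simp add: r_def less_top)
  qed
  have int: "(LBNN s. ennreal (r s) * ind {0<..<t} s) = (LBNN s. rearr f s * ind {0<..<t} s)" for t
    by (intro nn_integral_cong) (auto simp: indicator_def eq)
  show d: "decr r"
  proof
    show "r \<in> borel_measurable borel" unfolding r_def by measurable
    show "0 \<le> r t" for t by (simp add: r_def)
    show "r t \<le> r s" if "0 < s" "s \<le> t" for s t
      using rearr_antimono[OF that(2), of f] that eq[of s] eq[of t] \<open>\<And>t. 0 \<le> r t\<close> by simp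
    show "(LBNN s. ennreal (r s) * ind {0<..<t} s) < \<infinity>" for t unfolding int using fin[of t] by (cases "0 < t") auto
  qed
  interpret decr r by (rule d)
  show "rearr_avg f t = ennreal (decr.m r t)" if "0 < t" for t
    using that I_nonneg[of t] unfolding rearr_avg_borel[OF f] int[symmetric] I_eq m_def by (simp flip: ennreal_mult)
qed

section \<open>Weights\<close>

text \<open>The definition of a weight provides measurability only through integrability on compact
  sets, so the half-line is exhausted by compact intervals.\<close>

lemma weight_measurable:
  assumes "weight \<phi>"
  shows "(\<lambda>t. ind {0<..} t * \<phi> t) \<in> borel_measurable lebesgue"
proof (rule borel_measurable_LIMSEQ_real)
  fix n :: nat
  have "\<phi> absolutely_integrable_on {1 / real (Suc n)..real (Suc n)}"
  proof -
    have "0 < 1 / real (Suc n)" by simp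
    then have "{1 / real (Suc n)..real (Suc n)} \<subseteq> {0<..}"
      by (intro subsetI) (simp only: atLeastAtMost_iff greaterThan_iff, linarith)
    then show ?thesis using assms unfolding weight_def by blast
  qed
  then have "integrable lebesgue (\<lambda>t. ind {1 / real (Suc n)..real (Suc n)} t *\<^sub>R \<phi> t)"
    by (simp add: set_integrable_def)
  then show "(\<lambda>t. ind {1 / real (Suc n)..real (Suc n)} t *\<^sub>R \<phi> t) \<in> borel_measurable lebesgue"
    by (rule borel_measurable_integrable)
next
  fix t :: real
  show "(\<lambda>n. ind {1 / real (Suc n)..real (Suc n)} t *\<^sub>R \<phi> t) \<longlonglongrightarrow> ind {0<..} t * \<phi> t"
  proof (cases "0 < t")
    case True
    obtain n0 :: nat where n0: "max t (1 / t) \<le> real n0" using real_arch_simple by blast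
    have "\<forall>\<^sub>F n in sequentially. ind {1 / real (Suc n)..real (Suc n)} t *\<^sub>R \<phi> t = ind {0<..} t * \<phi> t"
      using eventually_ge_at_top[of n0]
    proof eventually_elim
      case (elim n)
      then have n: "t \<le> real (Suc n)" "1 / t \<le> real (Suc n)" using n0 by auto
      then have "1 / real (Suc n) \<le> t" using True by (simp add: field_simps)
      then show ?case using n True by simp
    qed
    then show ?thesis by (rule tendsto_eventually)
  next
    case False
    have "t \<notin> {1 / real (Suc n)..real (Suc n)}" for n
    proof -
      have "0 < 1 / real (Suc n)" by simp
      then show ?thesis using False unfolding atLeastAtMost_iff by linarith
    qed
    then show ?thesis using False by simp
  qed
qed

lemma weight_borel_representative:
  assumes "weight \<phi>"
  obtains w where "w \<in> borel_measurable borel" "AE t in lebesgue. ennreal (\<phi> t) * ind {0<..} t = w t * ind {0<..} t"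
proof -
  obtain w where w: "w \<in> borel_measurable lborel" "AE t in lborel. ind {0<..} t * \<phi> t = w t"
    using completion_ex_borel_measurable_real[OF weight_measurable[OF assms]] by blast
  show ?thesis
  proof (rule that)
    show "(\<lambda>t. ennreal (w t)) \<in> borel_measurable borel" using w(1) by simp
    show "AE t in lebesgue. ennreal (\<phi> t) * ind {0<..} t = ennreal (w t) * ind {0<..} t"
      using AE_completion[OF w(2)] by eventually_elim (auto simp: indicator_def)
  qed
qed

lemma nn_integral_weight:
  assumes "AE t in lebesgue. ennreal (\<phi> t) * ind {0<..} t = w t * ind {0<..} t"
    and S: "S \<subseteq> {0<..}"
  shows "(\<integral>\<^sup>+t\<in>S. ennreal (\<phi> t) * h t \<partial>lebesgue) = (LBNN t. w t * h t * ind S t)"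
proof -
  have "(\<integral>\<^sup>+t\<in>S. ennreal (\<phi> t) * h t \<partial>lebesgue) = (\<integral>\<^sup>+t. w t * h t * ind S t \<partial>lebesgue)"
  proof (rule nn_integral_cong_AE)
    show "AE t in lebesgue. ennreal (\<phi> t) * h t * ind S t = w t * h t * ind S t"
      using assms(1) by eventually_elim (use S in \<open>auto simp: indicator_def split: if_splits\<close>)
  qed
  then show ?thesis by (simp add: nn_integral_completion)
qed

lemma weight_transfer:
  assumes ae: "AE t in lebesgue. ennreal (\<phi> t) * ind {0<..} t = w t * ind {0<..} t"
  shows "(\<integral>\<^sup>+s\<in>{0<..<t}. ennreal (\<phi> s) \<partial>lebesgue) = Fi w t"
    and "0 < t \<Longrightarrow> (\<integral>\<^sup>+s\<in>{t<..}. ennreal (\<phi> s) * ennreal (s powr (-p)) \<partial>lebesgue) = Ai p w t"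
proof -
  have "{0<..<t} \<subseteq> {0<..}" by auto
  then show "(\<integral>\<^sup>+s\<in>{0<..<t}. ennreal (\<phi> s) \<partial>lebesgue) = Fi w t"
    using nn_integral_weight[OF ae, of "{0<..<t}" "\<lambda>_. 1"] by (simp add: Fi_def)
  show "(\<integral>\<^sup>+s\<in>{t<..}. ennreal (\<phi> s) * ennreal (s powr (-p)) \<partial>lebesgue) = Ai p w t" if "0 < t"
    using that nn_integral_weight[OF ae, of "{t<..}" "\<lambda>s. ennreal (s powr (-p))"] by (simp add: Ai_def)
qed

lemma gweight_of_weight:
  assumes p: "1 < p" and ae: "AE t in lebesgue. ennreal (\<phi> t) * ind {0<..} t = w t * ind {0<..} t"
    and w[measurable]: "w \<in> borel_measurable borel"
    and \<phi>: "\<And>t. 0 < t \<Longrightarrow> 0 < \<phi> t"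
    and fin: "(\<integral>\<^sup>+s\<in>{0<..}. ennreal (\<phi> s * min 1 (s powr (-p))) \<partial>lebesgue) < \<infinity>"
  shows "gweight p w"
proof
  have "(\<integral>\<^sup>+s\<in>{0<..}. ennreal (\<phi> s * min 1 (s powr (-p))) \<partial>lebesgue) = (\<integral>\<^sup>+s\<in>{0<..}. ennreal (\<phi> s) * ennreal (min 1 (s powr (-p))) \<partial>lebesgue)"
    by (intro nn_integral_cong) (auto simp: indicator_def ennreal_mult' ennreal_mult'')
  also have "\<dots> = (LBNN s. w s * ennreal (min 1 (s powr (-p))) * ind {0<..} s)"
    by (rule nn_integral_weight[OF ae]) simp
  also have "\<dots> = Gi p w 1" unfolding Gi_eq[OF w zero_less_one]
  proof (intro nn_integral_cong)
    fix s :: real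
    have "min 1 (s powr (-p)) = min 1 (1 / s) powr p" if s: "0 < s"
    proof (cases "s \<le> 1")
      case True
      then have "1 \<le> s powr (-p)" "1 \<le> 1 / s" using s p powr_mono2'[of "-p" s 1] by auto
      then show ?thesis by simp
    next
      case False
      then have "s powr (-p) \<le> 1" "1 / s \<le> 1" using s p powr_mono2'[of "-p" 1 s] by auto
      then show ?thesis using s by (simp add: min_def powr_divide powr_minus_divide)
    qed
    then show "w s * ennreal (min 1 (s powr (-p))) * ind {0<..} s = w s * ennreal (min 1 (1 / s) powr p) * ind {0<..} s"
      by (cases "0 < s") auto
  qed
  finally show "Gi p w 1 < \<infinity>" using fin by simp
  show "Fi w t \<noteq> 0" if t: "0 < t" for t
  proof
    assume "Fi w t = 0"
    then have "AE s in lborel. w s * ind {0<..<t} s = 0" unfolding Fi_def by (subst (asm) nn_integral_0_iff_AE) auto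
    then have "AE s in lebesgue. w s * ind {0<..<t} s = 0" by (rule AE_completion)
    then have "AE s in lebesgue. s \<notin> {0<..<t}" using ae
    proof eventually_elim
      case (elim s)
      show ?case
      proof
        assume s: "s \<in> {0<..<t}"
        then have "ennreal (\<phi> s) = 0" using elim by simp
        then show False using \<phi>[of s] s by simp
      qed
    qed
    then have "{0<..<t} \<in> null_sets lebesgue" by (subst AE_iff_null_sets) auto
    then show False using t by (simp add: null_sets_def)
  qed
qed (use p in auto)

context gweight
begin

text \<open>Equality holds at every \<open>t\<close>, not merely almost everywhere: the values of
  \<open>\<phi>\<close> enter only through integrals, for which a Borel representative is as
  good.\<close>

lemma dual_weight_eq_psi:
  assumes ae: "AE t in lebesgue. ennreal (\<phi> t) * ind {0<..} t = w t * ind {0<..} t" and t: "0 < t"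
  shows "dual_weight p (\<lambda>s. ennreal (\<phi> s)) t = W t"
proof -
  have P: "P_avg (\<lambda>s. ennreal (\<phi> s)) t = ennreal (F t / t)"
    using t F_nonneg by (simp add: P_avg_def weight_transfer(1)[OF ae] Fi_eq flip: ennreal_mult)
  have Q: "Q_op p (\<lambda>s. ennreal (\<phi> s)) s = ennreal (p * s powr (p - 1)) * Ai p w s" if "0 < s" for s
    using that by (simp add: Q_op_def weight_transfer(2)[OF ae])
  have "(\<integral>\<^sup>+s\<in>{0<..<t}. Q_op p (\<lambda>s. ennreal (\<phi> s)) s \<partial>lebesgue)
    = (LBNN s. ennreal (p * s powr (p - 1)) * Ai p w s * ind {0<..<t} s)"
    unfolding nn_integral_completion by (intro nn_integral_cong) (auto simp: indicator_def Q)
  then have PQ: "P_avg (Q_op p (\<lambda>s. ennreal (\<phi> s))) t = ennreal (g t / t)"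
    using t g_nonneg by (simp add: P_avg_def Gi_integral Gi_eq_g flip: ennreal_mult)
  have q: "0 \<le> F t / t" "0 \<le> p * t powr (p - 1) * a t" "0 < (g t / t) powr (pc + 1)"
    using t p F_nonneg[of t] a_nonneg[of t] g_pos[of t] by auto
  have num: "ennreal (F t / t) * (ennreal (p * t powr (p - 1)) * ennreal (a t)) = ennreal (F t / t * (p * t powr (p - 1) * a t))"
  proof -
    have "0 \<le> p * t powr (p - 1)" using p by simp
    from ennreal_mult[OF this a_nonneg[of t]] show ?thesis by (simp only: ennreal_mult[OF q(1,2)])
  qed
  have den: "epowr (ennreal (g t / t)) (p / (p - 1) + 1) = ennreal ((g t / t) powr (pc + 1))"
    using t g_nonneg[of t] by (simp add: epowr_def pc_def)
  have "dual_weight p (\<lambda>s. ennreal (\<phi> s)) t = ennreal (F t / t * (p * t powr (p - 1) * a t)) / ennreal ((g t / t) powr (pc + 1))"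
    by (simp only: dual_weight_def P PQ Q[OF t] Ai_eq[OF t] num den)
  also have "\<dots> = ennreal (F t / t * (p * t powr (p - 1) * a t) / (g t / t) powr (pc + 1))"
    by (rule divide_ennreal[OF mult_nonneg_nonneg[OF q(1,2)] q(3)])
  also have "F t / t * (p * t powr (p - 1) * a t) / (g t / t) powr (pc + 1) = psi t"
  proof -
    have "t powr (pc + 1) = t powr pc * t" using t by (simp add: powr_add)
    then show ?thesis using t g_pos[OF t] by (simp add: psi_def powr_divide)
  qed
  finally show ?thesis .
qed

lemma half_cond_dual:
  assumes ae: "AE t in lebesgue. ennreal (\<phi> t) * ind {0<..} t = w t * ind {0<..} t"
  shows "(\<integral>\<^sup>+s\<in>{0<..<t}. dual_weight p (\<lambda>s. ennreal (\<phi> s)) s \<partial>lebesgue) = Fi W t"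
    and "0 < t \<Longrightarrow> (\<integral>\<^sup>+s\<in>{t<..}. dual_weight p (\<lambda>s. ennreal (\<phi> s)) s * ennreal (s powr (-q)) \<partial>lebesgue) = Ai q W t"
  unfolding Fi_def Ai_def nn_integral_completion using dual_weight_eq_psi[OF ae]
  by (auto intro!: nn_integral_cong simp: indicator_def)

end

section \<open>Calderon-Zygmund kernels\<close>

text \<open>On the ball of radius |x| / 4 around \<open>x\<close> the kernel differs from its value
  at \<open>x\<close> by at most A / |x|^n. The integral condition bounds the mean of |K| there,
  since |z| is at least 3 |x| / 4 on that ball; this is the origin of
  \<open>4 / (3 * r)\<close>.\<close>

lemma kernel_size:
  fixes K :: "'a::euclidean_space \<Rightarrow> real"
  assumes [measurable]: "K \<in> borel_measurable borel"
    and smooth: "\<And>x y. 3 * norm y < norm x \<Longrightarrow> \<bar>K x - K (x - y)\<bar> \<le> A * norm y / norm x ^ (DIM('a) + 1)"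
    and A: "0 \<le> A" and C: "0 \<le> C"
    and int: "\<And>R. 0 < R \<Longrightarrow> (LBNN x. ennreal (norm x * \<bar>K x\<bar>) * ind {x. norm x < R} x) \<le> ennreal (C * R)"
    and x: "x \<noteq> 0"
  shows "\<bar>K x\<bar> \<le> (A + 3 * C * 4 ^ DIM('a) / ball_vol TYPE('a)) / norm x ^ DIM('a)"
proof -
  define r where "r = norm x"
  have r: "0 < r" using x by (simp add: r_def)
  define v where "v = ball_vol TYPE('a) * (r / 4) ^ DIM('a)"
  have bv: "0 < ball_vol TYPE('a)" by simp
  have v: "0 < v" using r by (simp add: v_def)
  have em: "emeasure lborel (cball x (r / 4)) = ennreal v" using r by (simp add: emeasure_cball v_def)
  have pt: "\<bar>K x\<bar> \<le> A / r ^ DIM('a) + (4 / (3 * r)) * (norm z * \<bar>K z\<bar>)" "norm z < 2 * r" if z: "z \<in> cball x (r / 4)" for z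
  proof -
    have d: "norm (x - z) \<le> r / 4" using z by (simp add: dist_norm)
    have nz: "3 * r / 4 \<le> norm z" "norm z \<le> 5 * r / 4"
      using d norm_triangle_ineq2[of x z] norm_triangle_ineq2[of z x] by (auto simp: r_def norm_minus_commute)
    then show "norm z < 2 * r" using r by simp
    have "\<bar>K x - K (x - (x - z))\<bar> \<le> A * norm (x - z) / norm x ^ (DIM('a) + 1)"
      using d r by (intro smooth) (simp add: r_def[symmetric])
    then have "\<bar>K x - K z\<bar> \<le> A * norm (x - z) / r ^ (DIM('a) + 1)" by (simp add: r_def)
    also have "\<dots> \<le> A * r / r ^ (DIM('a) + 1)" using d r A by (intro divide_right_mono mult_left_mono) auto
    also have "\<dots> = A / r ^ DIM('a)" using r by simp
    finally have "\<bar>K x\<bar> \<le> A / r ^ DIM('a) + 1 * \<bar>K z\<bar>" by linarith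
    also have "1 * \<bar>K z\<bar> \<le> (4 / (3 * r) * norm z) * \<bar>K z\<bar>"
      using nz r by (intro mult_right_mono) (auto simp: field_simps)
    finally show "\<bar>K x\<bar> \<le> A / r ^ DIM('a) + (4 / (3 * r)) * (norm z * \<bar>K z\<bar>)" by (simp add: mult.assoc)
  qed
  have "ennreal (\<bar>K x\<bar> * v) = (LBNN z. ennreal \<bar>K x\<bar> * ind (cball x (r / 4)) z)"
    using v by (simp add: nn_integral_cmult_indicator em ennreal_mult)
  also have "\<dots> \<le> (LBNN z. ennreal (A / r ^ DIM('a)) * ind (cball x (r / 4)) z
      + ennreal (4 / (3 * r)) * (ennreal (norm z * \<bar>K z\<bar>) * ind {z. norm z < 2 * r} z))"
  proof (intro nn_integral_mono)
    fix z
    show "ennreal \<bar>K x\<bar> * ind (cball x (r / 4)) z \<le> ennreal (A / r ^ DIM('a)) * ind (cball x (r / 4)) z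
      + ennreal (4 / (3 * r)) * (ennreal (norm z * \<bar>K z\<bar>) * ind {z. norm z < 2 * r} z)"
    proof (cases "z \<in> cball x (r / 4)")
      case True
      have "ennreal \<bar>K x\<bar> \<le> ennreal (A / r ^ DIM('a) + (4 / (3 * r)) * (norm z * \<bar>K z\<bar>))"
        by (rule ennreal_leI[OF pt(1)[OF True]])
      also have "\<dots> = ennreal (A / r ^ DIM('a)) + ennreal (4 / (3 * r)) * ennreal (norm z * \<bar>K z\<bar>)"
      proof -
        have nn: "0 \<le> A / r ^ DIM('a)" "0 \<le> 4 / (3 * r)" "0 \<le> norm z * \<bar>K z\<bar>" using A r by auto
        show ?thesis by (simp only: ennreal_plus[OF nn(1) mult_nonneg_nonneg[OF nn(2,3)]] ennreal_mult[OF nn(2,3)])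
      qed
      finally show ?thesis using True pt(2)[OF True] by simp
    qed simp
  qed
  also have "\<dots> = (LBNN z. ennreal (A / r ^ DIM('a)) * ind (cball x (r / 4)) z)
      + (LBNN z. ennreal (4 / (3 * r)) * (ennreal (norm z * \<bar>K z\<bar>) * ind {z. norm z < 2 * r} z))"
    by (intro nn_integral_add) measurable
  also have "\<dots> = ennreal (A / r ^ DIM('a)) * ennreal v
      + ennreal (4 / (3 * r)) * (LBNN z. ennreal (norm z * \<bar>K z\<bar>) * ind {z. norm z < 2 * r} z)"
    by (subst nn_integral_cmult, measurable, simp add: nn_integral_cmult_indicator em)
  also have "\<dots> \<le> ennreal (A / r ^ DIM('a)) * ennreal v + ennreal (4 / (3 * r)) * ennreal (C * (2 * r))"
    using r by (intro add_left_mono mult_left_mono int) auto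
  also have "\<dots> = ennreal (A / r ^ DIM('a) * v + 4 / (3 * r) * (C * (2 * r)))"
  proof -
    have nn: "0 \<le> A / r ^ DIM('a)" "0 \<le> v" "0 \<le> 4 / (3 * r)" "0 \<le> C * (2 * r)" using A C r v by auto
    show ?thesis
      by (simp only: ennreal_plus[OF mult_nonneg_nonneg[OF nn(1,2)] mult_nonneg_nonneg[OF nn(3,4)]] ennreal_mult[OF nn(1,2)] ennreal_mult[OF nn(3,4)])
  qed
  finally have "\<bar>K x\<bar> * v \<le> A / r ^ DIM('a) * v + 4 / (3 * r) * (C * (2 * r))"
    using A C r v by (subst (asm) ennreal_le_iff) auto
  also have "4 / (3 * r) * (C * (2 * r)) \<le> 3 * C" using r C by simp
  also have "3 * C = (3 * C / v) * v" using v by simp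
  finally have "\<bar>K x\<bar> * v \<le> (A / r ^ DIM('a) + 3 * C / v) * v" by (simp add: distrib_right)
  then have "\<bar>K x\<bar> \<le> A / r ^ DIM('a) + 3 * C / v" using v by (rule mult_right_le_imp_le)
  also have "3 * C / v = 3 * C * 4 ^ DIM('a) / ball_vol TYPE('a) / r ^ DIM('a)"
    using r bv by (simp add: v_def power_divide)
  finally show ?thesis by (simp add: r_def add_divide_distrib)
qed

text \<open>The smoothness condition makes the kernel continuous off the origin, and its value at
  the single point 0 does not affect Borel measurability.\<close>

lemma kernel_borel:
  fixes K :: "'a::euclidean_space \<Rightarrow> real"
  assumes smooth: "\<And>x y. 3 * norm y < norm x \<Longrightarrow> \<bar>K x - K (x - y)\<bar> \<le> A * norm y / norm x ^ (DIM('a) + 1)"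
  shows "K \<in> borel_measurable borel"
proof (rule borel_measurable_continuous_countable_exceptions[of "{0}"])
  show "continuous_on (- {0}) K"
  proof (intro continuous_at_imp_continuous_on ballI)
    fix x :: 'a assume x: "x \<in> - {0}"
    have "((\<lambda>z. K z - K x) \<longlongrightarrow> 0) (at x)"
    proof (rule Lim_null_comparison)
      have "((\<lambda>z. 3 * norm (x - z)) \<longlongrightarrow> 3 * norm (x - x)) (at x)" by (intro tendsto_intros)
      then have "\<forall>\<^sub>F z in at x. 3 * norm (x - z) < norm x" using x by (intro order_tendstoD) auto
      then show "\<forall>\<^sub>F z in at x. norm (K z - K x) \<le> A * norm (x - z) / norm x ^ (DIM('a) + 1)"
      proof eventually_elim
        case (elim z)
        then show ?case using smooth[of "x - z" x] by (simp add: abs_minus_commute)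
      qed
      have "((\<lambda>z. A * norm (x - z) / norm x ^ (DIM('a) + 1)) \<longlongrightarrow> A * norm (x - x) / norm x ^ (DIM('a) + 1)) (at x)"
        using x by (intro tendsto_intros) auto
      then show "((\<lambda>z. A * norm (x - z) / norm x ^ (DIM('a) + 1)) \<longlongrightarrow> 0) (at x)" by simp
    qed
    then show "isCont K x" by (simp add: isCont_def LIM_zero_iff)
  qed
qed auto

lemma ctrunc_integral_eq:
  fixes K :: "'a::euclidean_space \<Rightarrow> real"
  assumes [measurable]: "K \<in> borel_measurable borel"
  shows "(LINT x:{x. a < norm x \<and> norm x < b}|lebesgue. K x) = (LBINT x. ctrunc K a b x)"
proof -
  have "(LINT x:{x. a < norm x \<and> norm x < b}|lebesgue. K x) = (LBINT x. ind {x. a < norm x \<and> norm x < b} x *\<^sub>R K x)"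
    unfolding set_lebesgue_integral_def by (rule integral_completion) measurable
  also have "\<dots> = (LBINT x. ctrunc K a b x)"
  proof (rule integral_cong_AE)
    have "sphere (0 :: 'a) b \<in> null_sets lborel"
      using negligible_sphere[of 0 b] by (simp add: negligible_iff_null_sets null_sets_completion_iff)
    then have "AE x in lborel. x \<notin> sphere (0 :: 'a) b" by (rule AE_not_in)
    then show "AE x in lborel. ind {x. a < norm x \<and> norm x < b} x *\<^sub>R K x = ctrunc K a b x"
      by eventually_elim (auto simp: ctrunc_def ann_def indicator_def)
    show "ctrunc K a b \<in> borel_measurable lborel" unfolding ctrunc_def[abs_def] ann_def by measurable
  qed measurable
  finally show ?thesis .
qed

lemma CZ_kernel_cz_pv:
  fixes K :: "real^'n \<Rightarrow> real"
  assumes K: "CZ_kernel K"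
  obtains A where "cz_pv K A"
proof -
  note K' = K[unfolded CZ_kernel_def]
  obtain C1 where C1: "0 < C1" "\<And>\<epsilon> N. 0 < \<epsilon> \<Longrightarrow> \<epsilon> < N \<Longrightarrow> \<bar>LINT x:{x. \<epsilon> < norm x \<and> norm x < N}|lebesgue. K x\<bar> \<le> C1"
    using K'[THEN conjunct2, THEN conjunct1] by blast
  obtain L where L: "((\<lambda>\<epsilon>. LINT x:{x. \<epsilon> < norm x \<and> norm x < 1}|lebesgue. K x) \<longlongrightarrow> L) (at_right 0)"
    using K'[THEN conjunct2, THEN conjunct2, THEN conjunct1] zero_less_one by blast
  obtain C2 where C2: "0 < C2" "\<And>R. 0 < R \<Longrightarrow> (\<integral>\<^sup>+x\<in>{x. norm x < R}. ennreal (norm x * \<bar>K x\<bar>) \<partial>lebesgue) \<le> ennreal (C2 * R)"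
    using K'[THEN conjunct2, THEN conjunct2, THEN conjunct2, THEN conjunct1] by blast
  obtain C4 where C4: "0 < C4" "\<And>R x1 x2 x3 y. 0 < R \<Longrightarrow>
        dist x1 x2 \<le> R / 2 \<and> dist x1 x3 \<le> R / 2 \<and> dist x2 x3 \<le> R / 2 \<and>
        dist x1 y > R \<and> dist x2 y > R \<and> dist x3 y > R \<Longrightarrow>
        \<bar>K (x1 - y) - K (x2 - y)\<bar> \<le> C4 * (norm (x1 - x2) / norm (x3 - y) ^ (CARD('n) + 1))"
    using K'[THEN conjunct2, THEN conjunct2, THEN conjunct2, THEN conjunct2, THEN conjunct2] by blast
  \<comment> \<open>The fourth condition with \<open>R = 2 * norm y\<close>, the pole at 0, and
    \<open>x3 = x1 = x\<close>, \<open>x2 = x - y\<close>. The factor 3 ensures that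
    \<open>x - y\<close> still has norm above \<open>R\<close>; the case \<open>y = 0\<close> is
    separate because \<open>R\<close> must be positive.\<close>
  have smooth: "\<bar>K x - K (x - y)\<bar> \<le> C4 * norm y / norm x ^ (DIM(real^'n) + 1)" if xy: "3 * norm y < norm x" for x y
  proof (cases "y = 0")
    case False
    have "dist x (x - y) \<le> 2 * norm y / 2" "dist x x \<le> 2 * norm y / 2" "dist (x - y) x \<le> 2 * norm y / 2"
      by (auto simp: dist_norm)
    moreover have "dist x 0 > 2 * norm y" "dist (x - y) 0 > 2 * norm y"
      using xy norm_triangle_ineq2[of x y] norm_ge_zero[of y] unfolding dist_norm diff_zero by linarith+
    ultimately have "\<bar>K (x - 0) - K (x - y - 0)\<bar> \<le> C4 * (norm (x - (x - y)) / norm (x - 0) ^ (CARD('n) + 1))"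
      using False by (intro C4(2)[of "2 * norm y"]) auto
    then show ?thesis by simp
  qed simp
  have K_borel: "K \<in> borel_measurable borel" by (rule kernel_borel[OF smooth])
  define A2 where "A2 = C4 + 3 * C2 * 4 ^ DIM(real^'n) / ball_vol TYPE(real^'n)"
  have size: "\<bar>K x\<bar> \<le> A2 / norm x ^ DIM(real^'n)" if "x \<noteq> 0" for x unfolding A2_def
  proof (rule kernel_size[OF K_borel smooth _ _ _ that])
    show "(LBNN x. ennreal (norm x * \<bar>K x\<bar>) * ind {x. norm x < R} x) \<le> ennreal (C2 * R)" if "0 < R" for R
      using C2(2)[OF that] by (simp add: nn_integral_completion)
  qed (use C2 C4 in auto)
  define A where "A = C1 + A2"
  have "0 \<le> 3 * C2 * 4 ^ DIM(real^'n) / ball_vol TYPE(real^'n)" using C2 by (intro divide_nonneg_nonneg) auto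
  then have A: "0 < A" "C1 \<le> A" "A2 \<le> A" "C4 \<le> A" using C1 C4 by (auto simp: A_def A2_def)
  have "cz_pv K A"
  proof
    show "\<bar>K x\<bar> \<le> A / norm x ^ DIM(real^'n)" if "x \<noteq> 0" for x
      using size[OF that] divide_right_mono[OF A(3), of "norm x ^ DIM(real^'n)"] by simp
    show "\<bar>K x - K (x - y)\<bar> \<le> A * norm y / norm x ^ (DIM(real^'n) + 1)" if "3 * norm y < norm x" for x y
    proof -
      have "C4 * norm y / norm x ^ (DIM(real^'n) + 1) \<le> A * norm y / norm x ^ (DIM(real^'n) + 1)"
        by (intro divide_right_mono mult_right_mono A(4)) auto
      then show ?thesis using smooth[OF that] by simp
    qed
    show "\<bar>(LBINT x. ctrunc K a b x)\<bar> \<le> A" if "0 < a" "a < b" for a b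
      using C1(2)[OF that] A(2) unfolding ctrunc_integral_eq[OF K_borel] by simp
    show "\<exists>L. ((\<lambda>\<epsilon>. (LBINT x. ctrunc K \<epsilon> 1 x)) \<longlongrightarrow> L) (at_right 0)"
      using L unfolding ctrunc_integral_eq[OF K_borel] by blast
  qed (use A K_borel in auto)
  then show ?thesis by (rule that)
qed

section \<open>The estimate for the operator\<close>

text \<open>On each dyadic interval a decreasing function is at most its value at the left end, and
  the length of the interval equals that end point.\<close>

lemma dyadic_average_le:
  fixes h :: "real \<Rightarrow> ennreal"
  assumes h: "\<And>s u. 0 < s \<Longrightarrow> s \<le> u \<Longrightarrow> h u \<le> h s" and t: "0 < t"
  shows "(LBNN s. h s * ind {0<..<t} s) \<le> (\<Sum>j. h (t / 2 ^ Suc j) * ennreal (t / 2 ^ Suc j))"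
proof -
  have "(LBNN s. h s * ind {0<..<t} s)
    \<le> (\<Sum>j. h (t / 2 ^ Suc j) * (LBNN s. ind {t / 2 ^ Suc j..<t / 2 ^ j} s))"
  proof (rule nn_integral_le_suminf)
    fix s assume "h s * ind {0<..<t} s \<noteq> 0"
    then have s: "s \<in> {0<..<t}" by (auto split: split_indicator_asm)
    then have "0 < 1 / t" "1 / t < 1 / s" by (auto intro: divide_strict_left_mono)
    then obtain j where "2 ^ j * (1 / t) < 1 / s" "1 / s \<le> 2 ^ Suc j * (1 / t)"
      using exists_dyadic_shell[of "1 / t" "1 / s"] by blast
    then have "t / 2 ^ Suc j \<le> s" "s < t / 2 ^ j" using s t by (auto simp: field_simps)
    then show "\<exists>j. h s * ind {0<..<t} s \<le> h (t / 2 ^ Suc j) * ind {t / 2 ^ Suc j..<t / 2 ^ j} s"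
      using s h[of "t / 2 ^ Suc j" s] t by (intro exI[of _ j]) simp
  qed measurable
  also have "\<dots> = (\<Sum>j. h (t / 2 ^ Suc j) * ennreal (t / 2 ^ Suc j))"
  proof (intro arg_cong[where f = suminf] ext)
    fix j :: nat
    have "t / 2 ^ Suc j \<le> t / 2 ^ j" "t / 2 ^ j - t / 2 ^ Suc j = t / 2 ^ Suc j" using t by (auto simp: field_simps)
    then have "emeasure lborel {t / 2 ^ Suc j..<t / 2 ^ j} = ennreal (t / 2 ^ Suc j)"
      by (simp only: emeasure_lborel_Ico)
    then show "h (t / 2 ^ Suc j) * (LBNN s. ind {t / 2 ^ Suc j..<t / 2 ^ j} s) = h (t / 2 ^ Suc j) * ennreal (t / 2 ^ Suc j)"
      by (simp only: nn_integral_indicator sets_lborel atLeastLessThan_borel)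
  qed
  finally show ?thesis .
qed

lemma double_suminf_geometric:
  assumes "0 \<le> q" "q < 1" "0 \<le> c"
  shows "(\<Sum>j. \<Sum>k. ennreal (c * q ^ j * q ^ k) * L) = ennreal (c / (1 - q) / (1 - q)) * L"
proof -
  have inner: "(\<Sum>k. ennreal (c * q ^ j * q ^ k) * L) = L * ennreal (c / (1 - q) * q ^ j)" for j
  proof -
    have "(\<Sum>k. ennreal (c * q ^ j * q ^ k) * L) = (\<Sum>k. L * ennreal (c * q ^ j * q ^ k))"
      by (intro arg_cong[where f = suminf] ext mult.commute)
    also have "\<dots> = L * ennreal (c * q ^ j / (1 - q))" using assms by (intro suminf_ennreal_geometric) auto
    finally show ?thesis by (simp only: times_divide_eq_left)
  qed
  have "(\<Sum>j. L * ennreal (c / (1 - q) * q ^ j)) = L * ennreal (c / (1 - q) / (1 - q))"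
    using assms by (intro suminf_ennreal_geometric) auto
  then show ?thesis unfolding inner by (simp only: mult.commute)
qed

lemma epowr_mono: "0 \<le> p \<Longrightarrow> x \<le> y \<Longrightarrow> epowr x p \<le> epowr y p"
  by (auto simp: epowr_def top_unique less_top intro!: ennreal_leI powr_mono2 enn2real_mono)

text \<open>With \<open>Z\<close> the sum of the \<open>p\<close>-th powers on the right, each \<open>z j k\<close> is at most \<open>Z powr (1 / p)\<close>.\<close>

lemma epowr_double_suminf_le:
  fixes z :: "nat \<Rightarrow> nat \<Rightarrow> real"
  assumes r: "0 < r" "r < 1" and c: "0 \<le> c" and p: "0 < p" and z: "\<And>j k. 0 \<le> z j k"
  shows "epowr (\<Sum>j. \<Sum>k. ennreal (c * r ^ j * r ^ k * z j k)) p
    \<le> ennreal (1 + (c / (1 - r) / (1 - r)) powr p) * (\<Sum>j. \<Sum>k. ennreal (z j k powr p))"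
proof (cases "(\<Sum>j. \<Sum>k. ennreal (z j k powr p))")
  case (real Z)
  define S where "S = c / (1 - r) / (1 - r)"
  have S: "0 \<le> S" using r c by (simp add: S_def)
  have z_le: "z j k \<le> Z powr (1 / p)" for j k
  proof -
    have "ennreal (z j k powr p) \<le> (\<Sum>k. ennreal (z j k powr p))" by (rule ennreal_term_le_suminf)
    also have "\<dots> \<le> (\<Sum>j. \<Sum>k. ennreal (z j k powr p))" by (rule ennreal_term_le_suminf)
    finally have "z j k powr p \<le> Z" using real by simp
    then have "(z j k powr p) powr (1 / p) \<le> Z powr (1 / p)" using p by (intro powr_mono2) auto
    then show ?thesis using p z[of j k] by (simp add: powr_powr)
  qed
  have "(\<Sum>j. \<Sum>k. ennreal (c * r ^ j * r ^ k * z j k)) \<le> (\<Sum>j. \<Sum>k. ennreal (c * r ^ j * r ^ k) * ennreal (Z powr (1 / p)))"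
  proof (intro suminf_le)
    fix j k
    have "c * r ^ j * r ^ k * z j k \<le> c * r ^ j * r ^ k * Z powr (1 / p)"
      using r c by (intro mult_left_mono z_le) auto
    then show "ennreal (c * r ^ j * r ^ k * z j k) \<le> ennreal (c * r ^ j * r ^ k) * ennreal (Z powr (1 / p))"
      using r c by (simp add: ennreal_leI flip: ennreal_mult)
  qed auto
  also have "\<dots> = ennreal S * ennreal (Z powr (1 / p))"
    unfolding S_def using r c by (intro double_suminf_geometric) auto
  also have "\<dots> = ennreal (S * Z powr (1 / p))" using S by (simp add: ennreal_mult)
  finally have "epowr (\<Sum>j. \<Sum>k. ennreal (c * r ^ j * r ^ k * z j k)) p \<le> epowr (ennreal (S * Z powr (1 / p))) p"
    using p by (intro epowr_mono) auto
  also have "\<dots> = ennreal (S powr p * Z)" using S p real by (simp add: epowr_def powr_mult powr_powr)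
  also have "\<dots> \<le> ennreal ((1 + S powr p) * Z)" using real by (intro ennreal_leI mult_right_mono) auto
  also have "\<dots> = ennreal (1 + S powr p) * ennreal Z" by (rule ennreal_mult) (use real in auto)
  finally show ?thesis unfolding real(2) S_def .
next
  case top
  \<comment> \<open>The summand 1 keeps the constant away from 0: a product of 0 and infinity is 0
    in \<open>ennreal\<close>, which would spoil the infinite case when
    \<open>c = 0\<close>.\<close>
  have "0 < 1 + (c / (1 - r) / (1 - r)) powr p" by (intro add_pos_nonneg) auto
  then have "ennreal (1 + (c / (1 - r) / (1 - r)) powr p) \<noteq> 0" by (simp only: ennreal_eq_0_iff not_le)
  then show ?thesis unfolding top by (simp only: ennreal_mult_top top_greatest if_False infinity_ennreal_def)
qed

lemma linear_le_geometric:
  fixes r :: real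
  assumes "0 < r" "r < 1"
  shows "real k + 1 \<le> (1 / (1 - r) ^ 2) / r ^ k"
proof -
  have "(\<lambda>k. of_nat (Suc k) * r ^ k) sums (1 / (1 - r) ^ 2)" using assms by (intro geometric_deriv_sums) auto
  then have "summable (\<lambda>k. of_nat (Suc k) * r ^ k)" "(\<Sum>k. of_nat (Suc k) * r ^ k) = 1 / (1 - r) ^ 2"
    by (auto simp only: sums_iff)
  then have "(\<Sum>k\<in>{k}. of_nat (Suc k) * r ^ k) \<le> 1 / (1 - r) ^ 2"
    using assms sum_le_suminf[of "\<lambda>k. of_nat (Suc k) * r ^ k" "{k}"] by simp
  then show ?thesis using assms by (simp add: pos_le_divide_eq add.commute mult_ac)
qed

context decr_weight
begin

text \<open>By \<open>m_scale\<close> the function \<open>m\<close> dominates \<open>m s\<close>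
  times the averaged rearrangement of the indicator of a set of measure \<open>s\<close>, and
  \<open>g s\<close> is the p-th power of the norm of that indicator.\<close>

lemma m_powr_g_le:
  assumes s: "0 < s"
  shows "ennreal (m s powr p * g s) \<le> N 1"
proof -
  have "ennreal (m s powr p * g s) = ennreal (m s powr p) * Gi p w s"
    using s g_nonneg by (simp add: Gi_eq_g ennreal_mult)
  also have "\<dots> = (LBNN t. ennreal (m s powr p) * (w t * ennreal (min 1 (s / t) powr p) * ind {0<..} t))"
    unfolding Gi_eq[OF w_borel s] by (intro nn_integral_cmult[symmetric]) measurable
  also have "\<dots> \<le> N 1" unfolding N_def
  proof (intro nn_integral_mono)
    fix t :: real
    show "ennreal (m s powr p) * (w t * ennreal (min 1 (s / t) powr p) * ind {0<..} t) \<le> ennreal (m (1 * t) powr p) * w t * ind {0<..} t"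
    proof (cases "0 < t")
      case True
      have "m s powr p * min 1 (s / t) powr p = (m s * min 1 (s / t)) powr p" by (rule powr_mult[symmetric])
      also have "\<dots> \<le> m t powr p"
        using s True m_nonneg[of s] p m_scale[of s t] by (intro powr_mono2 mult_nonneg_nonneg) auto
      finally have "ennreal (m s powr p) * ennreal (min 1 (s / t) powr p) \<le> ennreal (m t powr p)"
        by (simp add: ennreal_leI flip: ennreal_mult)
      then have "ennreal (m s powr p) * ennreal (min 1 (s / t) powr p) * w t \<le> ennreal (m t powr p) * w t"
        by (rule mult_right_mono) simp
      then show ?thesis using True by (simp add: mult_ac)
    qed simp
  qed
  finally show ?thesis .
qed

text \<open>A finite norm bounds \<open>m s powr p * g s\<close>, and the condition on \<phi> makes
  \<open>g (2 ^ k * t)\<close> grow geometrically in \<open>k\<close>. Hence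
  \<open>m (2 ^ k * t)\<close> decays geometrically, which absorbs the linear factor.\<close>

lemma m_summable:
  assumes N: "N 1 < \<infinity>" and c: "half_cond p w c" and t: "0 < t"
  shows "summable (\<lambda>k. (real k + 1) * m (2 ^ k * t))"
proof -
  obtain C h where C: "0 < C" "0 < h" "h < 1" "\<And>k t. 0 < t \<Longrightarrow> g (t / 2 ^ k) \<le> C * h ^ k * g t"
    using g_decay[OF c] by blast
  define M where "M = enn2real (N 1)"
  have M: "0 \<le> M" "N 1 = ennreal M" using N by (auto simp: M_def less_top)
  define q where "q = h powr (1 / p)"
  have q: "0 < q" "q < 1" using C p powr_less_mono2[of "1 / p" h 1] by (auto simp: q_def)
  have bound: "m (2 ^ k * t) \<le> (M * C / g t) powr (1 / p) * q ^ k" for k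
  proof -
    define s where "s = 2 ^ k * t"
    have s: "0 < s" "s / 2 ^ k = t" using t by (auto simp: s_def)
    have "m s powr p * g s \<le> M" using m_powr_g_le[OF s(1)] M by simp
    have "m s powr p * g t \<le> m s powr p * (C * h ^ k * g s)"
      using C(4)[OF s(1), of k] s by (intro mult_left_mono) auto
    also have "\<dots> = C * h ^ k * (m s powr p * g s)" by simp
    also have "\<dots> \<le> C * h ^ k * M" using C \<open>m s powr p * g s \<le> M\<close> by (intro mult_left_mono) auto
    finally have "m s powr p \<le> M * C / g t * h ^ k" using g_pos[OF t] by (simp add: field_simps)
    then have "(m s powr p) powr (1 / p) \<le> (M * C / g t * h ^ k) powr (1 / p)" using p by (intro powr_mono2) auto
    also have "\<dots> = (M * C / g t) powr (1 / p) * q ^ k"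
      unfolding q_def power_powr[OF C(2), symmetric] by (rule powr_mult)
    finally show ?thesis using p m_nonneg[OF s(1)] by (simp add: powr_powr s_def)
  qed
  show ?thesis
  proof (rule summable_comparison_test')
    have "summable (\<lambda>k. of_nat (Suc k) * q ^ k)" using geometric_deriv_sums[of q] q by (auto simp: sums_iff)
    then show "summable (\<lambda>k. (M * C / g t) powr (1 / p) * (of_nat (Suc k) * q ^ k))" by (rule summable_mult)
    fix k :: nat
    show "norm ((real k + 1) * m (2 ^ k * t)) \<le> (M * C / g t) powr (1 / p) * (of_nat (Suc k) * q ^ k)"
    proof -
      have "norm ((real k + 1) * m (2 ^ k * t)) = (real k + 1) * m (2 ^ k * t)"
        using t m_nonneg by (simp add: abs_mult)
      also have "\<dots> \<le> (real k + 1) * ((M * C / g t) powr (1 / p) * q ^ k)" by (intro mult_left_mono bound) auto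
      finally show ?thesis by (simp add: mult_ac add.commute)
    qed
  qed
qed

text \<open>The term \<open>d / 2 ^ k\<close> makes the heights strictly positive even where
  \<open>m\<close> vanishes, and strictly larger than \<open>\<rho>\<close>, as
  \<open>dfun_le_of_rearr_less\<close> requires. Its total cost \<open>4 * d\<close>, from the sum
  of (k + 1) / 2^k, is removed in the limit.\<close>

lemma level_function_rearr:
  fixes f :: "real^'n \<Rightarrow> real"
  assumes f[measurable]: "f \<in> borel_measurable borel" and \<rho>: "\<And>t. 0 < t \<Longrightarrow> rearr f t = ennreal (\<rho> t)"
    and N: "N 1 < \<infinity>" and c: "half_cond p w c" and t: "0 < t" and d: "0 < d"
  shows "level_function f t (\<lambda>k. m (2 ^ k * t) + d / 2 ^ k)"
    and "(\<Sum>k. (real k + 1) * (m (2 ^ k * t) + d / 2 ^ k)) = (\<Sum>k. (real k + 1) * m (2 ^ k * t)) + 4 * d"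
proof -
  have s1: "summable (\<lambda>k. (real k + 1) * m (2 ^ k * t))" by (rule m_summable[OF N c t])
  have "(\<lambda>k. of_nat (Suc k) * (1 / 2 :: real) ^ k) sums (1 / (1 - 1 / 2) ^ 2)" by (rule geometric_deriv_sums) simp
  then have "(\<lambda>k. d * (of_nat (Suc k) * (1 / 2 :: real) ^ k)) sums (d * (1 / (1 - 1 / 2) ^ 2))" by (rule sums_mult)
  moreover have "d * (of_nat (Suc k) * (1 / 2 :: real) ^ k) = (real k + 1) * (d / 2 ^ k)" for k
    by (simp add: power_divide)
  ultimately have s2: "(\<lambda>k. (real k + 1) * (d / 2 ^ k)) sums (4 * d)" by (simp add: power2_eq_square mult.commute)
  have s3: "(\<lambda>k. (real k + 1) * (m (2 ^ k * t) + d / 2 ^ k)) sums ((\<Sum>k. (real k + 1) * m (2 ^ k * t)) + 4 * d)"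
    using sums_add[OF summable_sums[OF s1] s2] by (simp add: distrib_left)
  then show "(\<Sum>k. (real k + 1) * (m (2 ^ k * t) + d / 2 ^ k)) = (\<Sum>k. (real k + 1) * m (2 ^ k * t)) + 4 * d"
    by (simp add: sums_iff)
  have em: "emeasure lborel {y. m (2 ^ k * t) + d / 2 ^ k < \<bar>f y\<bar>} \<le> ennreal (2 ^ k * t)" for k :: nat
  proof -
    have k: "0 < 2 ^ k * t" using t by simp
    have "\<rho> (2 ^ k * t) < m (2 ^ k * t) + d / 2 ^ k"
      using \<rho>_le_m[OF k] d by (intro le_less_trans[OF \<rho>_le_m[OF k]]) simp
    then have "rearr f (2 ^ k * t) < ennreal (m (2 ^ k * t) + d / 2 ^ k)"
      using \<rho>[OF k] \<rho>_nonneg by (simp add: ennreal_less_iff)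
    then show ?thesis using dfun_le_of_rearr_less[OF f] by (simp add: dfun_def)
  qed
  show "level_function f t (\<lambda>k. m (2 ^ k * t) + d / 2 ^ k)"
  proof
    show "0 < m (2 ^ k * t) + d / 2 ^ k" for k using m_nonneg[of "2 ^ k * t"] t d by (simp add: add_nonneg_pos)
    show "m (2 ^ Suc k * t) + d / 2 ^ Suc k \<le> m (2 ^ k * t) + d / 2 ^ k" for k
      using t d by (intro add_mono m_decr divide_left_mono) auto
    show "summable (\<lambda>k. (real k + 1) * (m (2 ^ k * t) + d / 2 ^ k))" using s3 by (simp add: sums_iff)
    have "(LBNN y. ennreal \<bar>f y\<bar> * ind {y. m (2 ^ 0 * t) + d / 2 ^ 0 < \<bar>f y\<bar>} y) \<le> (LBNN s. rearr f s * ind {0<..<t} s)"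
      using em[of 0] t by (intro nn_integral_le_rearr f) auto
    also have "\<dots> = (LBNN s. ennreal (\<rho> s) * ind {0<..<t} s)" by (intro nn_integral_cong) (auto simp: indicator_def \<rho>)
    also have "\<dots> = ennreal (t * m t)" using t by (simp add: I_eq m_def)
    also have "\<dots> \<le> ennreal (t * (m (2 ^ 0 * t) + d / 2 ^ 0))" using t d by (intro ennreal_leI mult_left_mono) auto
    finally show "(LBNN y. ennreal \<bar>f y\<bar> * ind {y. m (2 ^ 0 * t) + d / 2 ^ 0 < \<bar>f y\<bar>} y) \<le> ennreal (t * (m (2 ^ 0 * t) + d / 2 ^ 0))" .
  qed (use em t in auto)
qed

text \<open>Dilation by \<open>2 ^ k\<close> decays because of the condition on \<phi>. Dilation by
  \<open>1 / 2 ^ j\<close> may cost \<open>(2 ^ j) powr p\<close>, but the condition on \<psi> gains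
  a geometric factor. That power is exactly what the factor 2^-j from averaging compensates in
  \<open>Gamma_bound\<close>.\<close>

lemma N_dilation:
  assumes inf: "\<And>c. 0 < c \<Longrightarrow> (LBNN s. w s * ennreal (s powr (-p)) * ind {0<..<c} s) = \<infinity>"
    and c: "half_cond p w c" "half_cond pc W d"
  obtains C q where "0 < C" "0 < q" "q < 1"
    "\<And>j k. N (2 ^ k / 2 ^ j) \<le> ennreal (C * q ^ j * q ^ k * (2 ^ j) powr p) * N 1"
proof -
  obtain C1 q1 where C1: "0 < C1" "0 < q1" "q1 < 1" "\<And>k t. 0 < t \<Longrightarrow> g (t / 2 ^ k) \<le> C1 * q1 ^ k * g t"
    using g_decay[OF c(1)] by blast
  obtain C2 q2 where C2: "0 < C2" "0 < q2" "q2 < 1" "\<And>k t. 0 < t \<Longrightarrow> g t \<le> C2 * q2 ^ k * (2 ^ k) powr p * g (t / 2 ^ k)"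
    using g_growth[OF inf c] by blast
  define q where "q = max q1 q2"
  show ?thesis
  proof (rule that)
    show "0 < 2 powr p * (C1 * C2)" "0 < q" "q < 1" using C1 C2 by (auto simp: q_def)
    fix j k :: nat
    have "N (2 ^ k / 2 ^ j) \<le> ennreal (2 powr p * (C2 * q ^ j * (2 ^ j) powr p * (C1 * q ^ k))) * N 1"
    proof (rule dilation_bound)
      fix u :: real assume u: "0 < u"
      define v where "v = 2 ^ j * (u / 2 ^ k)"
      have v: "0 < v" "v / 2 ^ j = u / 2 ^ k" "u / (2 ^ k / 2 ^ j) = v" using u by (auto simp: v_def)
      have "g v \<le> C2 * q2 ^ j * (2 ^ j) powr p * g (u / 2 ^ k)" using C2(4)[OF v(1), of j] v(2) by simp
      also have "\<dots> \<le> C2 * q2 ^ j * (2 ^ j) powr p * (C1 * q1 ^ k * g u)"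
        using C2 by (intro mult_left_mono C1(4) u) auto
      also have "\<dots> = C2 * C1 * (2 ^ j) powr p * g u * (q2 ^ j * q1 ^ k)" by simp
      also have "\<dots> \<le> C2 * C1 * (2 ^ j) powr p * g u * (q ^ j * q ^ k)"
        using C1 C2 g_nonneg[of u] by (intro mult_left_mono mult_mono power_mono mult_nonneg_nonneg) (auto simp: q_def)
      finally show "g (u / (2 ^ k / 2 ^ j)) \<le> C2 * q ^ j * (2 ^ j) powr p * (C1 * q ^ k) * g u"
        unfolding v(3) by (simp only: mult_ac)
    qed (use C1 C2 in \<open>auto simp: q_def\<close>)
    also have "2 powr p * (C2 * q ^ j * (2 ^ j) powr p * (C1 * q ^ k)) = 2 powr p * (C1 * C2) * q ^ j * q ^ k * (2 ^ j) powr p"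
      by (simp only: mult_ac)
    finally show "N (2 ^ k / 2 ^ j) \<le> ennreal (2 powr p * (C1 * C2) * q ^ j * q ^ k * (2 ^ j) powr p) * N 1" .
  qed
qed

lemma rearr_operator_le:
  fixes f :: "real^'n \<Rightarrow> real"
  assumes K: "cz_pv K A"
    and f[measurable]: "f \<in> borel_measurable borel" and \<rho>: "\<And>t. 0 < t \<Longrightarrow> rearr f t = ennreal (\<rho> t)"
    and N: "N 1 < \<infinity>" and c: "half_cond p w c"
  obtains u C where "u \<in> borel_measurable borel" "0 < C"
    "\<And>a x. 0 < a \<Longrightarrow> integrable lborel (\<lambda>y. cinf K a (x - y) * f y)"
    "AE x in lborel. ((\<lambda>\<epsilon>. copi K \<epsilon> f x) \<longlongrightarrow> u x) (at_right 0)"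
    "\<And>t. 0 < t \<Longrightarrow> rearr u t \<le> ennreal (C * (\<Sum>k. (real k + 1) * m (2 ^ k * t)))"
proof -
  interpret K: cz_pv K A by (rule K)
  have level: "level_function f t (\<lambda>k. m (2 ^ k * t) + d / 2 ^ k)"
    "(\<Sum>k. (real k + 1) * (m (2 ^ k * t) + d / 2 ^ k)) = (\<Sum>k. (real k + 1) * m (2 ^ k * t)) + 4 * d" if "0 < t" "0 < d" for t d
    by (rule level_function_rearr[OF f _ N c that], rule \<rho>, assumption)+
  have cl: "cz_level K A f t (\<lambda>k. m (2 ^ k * t) + d / 2 ^ k)" if "0 < t" "0 < d" for t d
    using K.cz_axioms level(1)[OF that] by (simp add: cz_level_def)
  have int: "integrable lborel (\<lambda>y. cinf K a (x - y) * f y)" if "0 < a" for a x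
    using cz_level.cinf_level_integrable[OF cl[OF zero_less_one zero_less_one] that] .
  have conv: "AE x in lborel. \<exists>L. ((\<lambda>\<epsilon>. copi K \<epsilon> f x) \<longlongrightarrow> L) (at_right 0)"
    by (rule K.copi_level_convergent[OF level(1)[OF zero_less_one zero_less_one]])
  \<comment> \<open>A limit along a fixed sequence is Borel measurable everywhere, also where the
    truncations diverge.\<close>
  define u where "u x = lim (\<lambda>n. copi K (1 / real (Suc n)) f x)" for x
  have u[measurable]: "u \<in> borel_measurable borel"
    unfolding u_def[abs_def] by (intro borel_measurable_lim_metric K.copi_borel f)
  have lim: "AE x in lborel. ((\<lambda>\<epsilon>. copi K \<epsilon> f x) \<longlongrightarrow> u x) (at_right 0)" using conv
  proof eventually_elim
    case (elim x)
    then obtain L where L: "((\<lambda>\<epsilon>. copi K \<epsilon> f x) \<longlongrightarrow> L) (at_right 0)" by blast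
    have "filterlim (\<lambda>n. 1 / real (Suc n)) (at_right 0) sequentially" unfolding filterlim_at
    proof
      show "(\<lambda>n. 1 / real (Suc n)) \<longlonglongrightarrow> 0" using LIMSEQ_inverse_real_of_nat by (simp add: inverse_eq_divide)
    qed simp
    from filterlim_compose[OF L this] have "u x = L" unfolding u_def by (rule limI)
    then show ?case using L by simp
  qed
  obtain C where C: "0 < C" "\<And>f t B u. level_function f t B \<Longrightarrow> u \<in> borel_measurable borel \<Longrightarrow>
      AE x in lborel. ((\<lambda>\<epsilon>. copi K \<epsilon> f x) \<longlongrightarrow> u x) (at_right 0) \<Longrightarrow>
      emeasure lborel {x. C * (\<Sum>k. (real k + 1) * B k) < \<bar>u x\<bar>} \<le> ennreal t" using K.copi_level_distribution by blast
  have bound: "rearr u t \<le> ennreal (C * (\<Sum>k. (real k + 1) * m (2 ^ k * t)))" if t: "0 < t" for t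
  proof (rule ennreal_le_epsilon)
    fix e :: real assume e: "0 < e"
    \<comment> \<open>Chosen so that the perturbation \<open>4 * d\<close> of the sum raises the
      bound by exactly \<open>e\<close>.\<close>
    define d where "d = e / (4 * C)"
    define S where "S = (\<Sum>k. (real k + 1) * m (2 ^ k * t))"
    have d: "0 < d" "C * (S + 4 * d) = C * S + e" using e C(1) by (auto simp: d_def distrib_left)
    have S: "0 \<le> S" unfolding S_def using t m_nonneg by (intro suminf_nonneg m_summable[OF N c t]) auto
    have "dfun u (C * (S + 4 * d)) \<le> ennreal t"
      using C(2)[OF level(1)[OF t d(1)] u lim] unfolding level(2)[OF t d(1)] S_def[symmetric] dfun_def .
    then have "rearr u t \<le> ennreal (C * S + e)"
      unfolding d(2) using e C(1) S by (intro rearr_le_of_dfun_le u) (auto intro: add_nonneg_pos)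
    also have "\<dots> = ennreal (C * S) + ennreal e" using e C(1) S by (intro ennreal_plus) auto
    finally show "rearr u t \<le> ennreal (C * S) + ennreal e" .
  qed
  show ?thesis by (rule that[OF u C(1) int lim bound])
qed

lemma rearr_avg_double_sum:
  fixes u :: "real^'n \<Rightarrow> real"
  assumes u: "u \<in> borel_measurable borel" and C: "0 < C"
    and bound: "\<And>t. 0 < t \<Longrightarrow> rearr u t \<le> ennreal (C * (\<Sum>k. (real k + 1) * m (2 ^ k * t)))"
    and N: "N 1 < \<infinity>" and c: "half_cond p w c" and t: "0 < t"
  shows "rearr_avg u t \<le> (\<Sum>j. \<Sum>k. ennreal (C * ((real k + 1) * m (2 ^ k / 2 ^ Suc j * t) / 2 ^ Suc j)))"
proof -
  have step: "ennreal (1 / t) * (rearr u (t / 2 ^ Suc j) * ennreal (t / 2 ^ Suc j))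
    \<le> (\<Sum>k. ennreal (C * ((real k + 1) * m (2 ^ k / 2 ^ Suc j * t) / 2 ^ Suc j)))" for j
  proof -
    define s where "s = t / 2 ^ Suc j"
    have s: "0 < s" using t by (simp add: s_def)
    have sm: "summable (\<lambda>k. (real k + 1) * m (2 ^ k * s))" by (rule m_summable[OF N c s])
    have sums: "(\<lambda>k. C * ((real k + 1) * m (2 ^ k * s) / 2 ^ Suc j)) sums (C * ((\<Sum>k. (real k + 1) * m (2 ^ k * s)) / 2 ^ Suc j))"
      by (intro sums_mult sums_divide summable_sums sm)
    have "ennreal (1 / t) * (rearr u s * ennreal s) = rearr u s * (ennreal s * ennreal (1 / t))"
      by (simp only: mult_ac)
    also have "ennreal s * ennreal (1 / t) = ennreal (1 / 2 ^ Suc j)"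
      using t s by (subst ennreal_mult[symmetric]) (auto simp: s_def)
    also have "rearr u s * ennreal (1 / 2 ^ Suc j) \<le> ennreal (C * (\<Sum>k. (real k + 1) * m (2 ^ k * s))) * ennreal (1 / 2 ^ Suc j)"
      by (intro mult_right_mono bound s) simp
    also have "\<dots> = ennreal (C * ((\<Sum>k. (real k + 1) * m (2 ^ k * s)) / 2 ^ Suc j))"
      by (subst ennreal_mult''[symmetric]) auto
    also have "\<dots> = (\<Sum>k. ennreal (C * ((real k + 1) * m (2 ^ k * s) / 2 ^ Suc j)))"
      using sums m_nonneg s C by (intro suminf_ennreal_eq[symmetric] mult_nonneg_nonneg divide_nonneg_nonneg) auto
    finally have "ennreal (1 / t) * (rearr u s * ennreal s) \<le> (\<Sum>k. ennreal (C * ((real k + 1) * m (2 ^ k * s) / 2 ^ Suc j)))" .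
    moreover have "2 ^ k * s = 2 ^ k / 2 ^ Suc j * t" for k :: nat by (simp add: s_def)
    ultimately show ?thesis by (simp only: s_def[symmetric])
  qed
  have "rearr_avg u t \<le> ennreal (1 / t) * (\<Sum>j. rearr u (t / 2 ^ Suc j) * ennreal (t / 2 ^ Suc j))"
    unfolding rearr_avg_borel[OF u] using t by (intro mult_left_mono dyadic_average_le rearr_antimono) auto
  also have "\<dots> = (\<Sum>j. ennreal (1 / t) * (rearr u (t / 2 ^ Suc j) * ennreal (t / 2 ^ Suc j)))"
    by (rule ennreal_suminf_cmult[symmetric])
  also have "\<dots> \<le> (\<Sum>j. \<Sum>k. ennreal (C * ((real k + 1) * m (2 ^ k / 2 ^ Suc j * t) / 2 ^ Suc j)))"
    by (intro suminf_le step) auto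
  finally show ?thesis .
qed

text \<open>The geometric ratio \<open>h\<close> from \<open>N_dilation\<close> is distributed by
  \<open>q = h powr (1 / 4)\<close> and \<open>r = q powr (1 / p)\<close>. One factor
  \<open>r ^ k\<close> absorbs \<open>real k + 1\<close> through \<open>linear_le_geometric\<close>;
  a factor \<open>r ^ j * r ^ k\<close> is reserved for exchanging the double sum with the p-th
  power. Both are divided out in \<open>z\<close>, which costs \<open>q ^ j * q ^ (2 * k)\<close>
  after raising to the power \<open>p\<close>. Enough of \<open>h\<close> is left for the norms of
  the \<open>z j k\<close> to be bounded by \<open>q ^ j * q ^ k\<close> and summed.\<close>

lemma Gamma_bound:
  fixes u :: "real^'n \<Rightarrow> real"
  assumes u: "u \<in> borel_measurable borel" and C: "0 < C"
    and bound: "\<And>t. 0 < t \<Longrightarrow> rearr u t \<le> ennreal (C * (\<Sum>k. (real k + 1) * m (2 ^ k * t)))"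
    and N: "N 1 < \<infinity>"
    and inf: "\<And>c. 0 < c \<Longrightarrow> (LBNN s. w s * ennreal (s powr (-p)) * ind {0<..<c} s) = \<infinity>"
    and c: "half_cond p w c" "half_cond pc W d"
  shows "(LBNN t. w t * epowr (rearr_avg u t) p * ind {0<..} t) < \<infinity>"
proof -
  obtain C1 h where C1: "0 < C1" "0 < h" "h < 1"
    "\<And>j k. N (2 ^ k / 2 ^ j) \<le> ennreal (C1 * h ^ j * h ^ k * (2 ^ j) powr p) * N 1"
    using N_dilation[OF inf c] by blast
  define q where "q = h powr (1 / 4)"
  have q: "0 < q" "q < 1" "q ^ 4 = h"
    using C1 powr_less_mono2[of "1 / 4" h 1] by (auto simp: q_def powr_powr simp flip: powr_realpow)
  define r where "r = q powr (1 / p)"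
  have r: "0 < r" "r < 1" "r powr p = q" using q p powr_less_mono2[of "1 / p" q 1] by (auto simp: r_def powr_powr)
  define D where "D = 1 / (1 - r) ^ 2"
  have D: "0 < D" using r by (simp add: D_def)
  define z where "z j k t = D / (r ^ j * (r ^ k * r ^ k)) / 2 ^ Suc j * m (2 ^ k / 2 ^ Suc j * t)" for j k :: nat and t
  have z_nonneg: "0 \<le> z j k t" if "0 < t" for j k t
    unfolding z_def using that r D by (intro mult_nonneg_nonneg divide_nonneg_nonneg m_nonneg) auto
  have avg: "rearr_avg u t \<le> (\<Sum>j. \<Sum>k. ennreal (C * r ^ j * r ^ k * z j k t))" if t: "0 < t" for t
  proof -
    have "rearr_avg u t \<le> (\<Sum>j. \<Sum>k. ennreal (C * ((real k + 1) * m (2 ^ k / 2 ^ Suc j * t) / 2 ^ Suc j)))"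
      by (rule rearr_avg_double_sum[OF u C bound N c(1) t])
    also have "\<dots> \<le> (\<Sum>j. \<Sum>k. ennreal (C * r ^ j * r ^ k * z j k t))"
    proof (intro suminf_le ennreal_leI)
      fix j k
      have "C * ((real k + 1) * m (2 ^ k / 2 ^ Suc j * t) / 2 ^ Suc j) \<le> C * (D / r ^ k * m (2 ^ k / 2 ^ Suc j * t) / 2 ^ Suc j)"
        using C t linear_le_geometric[OF r(1,2), of k]
        by (intro mult_left_mono divide_right_mono mult_right_mono m_nonneg) (auto simp: D_def)
      also have "\<dots> = C * r ^ j * r ^ k * z j k t" using r by (simp add: z_def)
      finally show "C * ((real k + 1) * m (2 ^ k / 2 ^ Suc j * t) / 2 ^ Suc j) \<le> C * r ^ j * r ^ k * z j k t" .
    qed auto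
    finally show ?thesis .
  qed
  define E where "E = ennreal (1 + (C / (1 - r) / (1 - r)) powr p)"
  have [measurable]: "z j k \<in> borel_measurable borel" for j k unfolding z_def[abs_def] by measurable
  have term_le: "(LBNN t. w t * ennreal (z j k t powr p) * ind {0<..} t) \<le> ennreal (D powr p * C1 * q ^ j * q ^ k) * N 1" for j k
  proof -
    define b where "b = D / (r ^ j * (r ^ k * r ^ k)) / 2 ^ Suc j"
    have b: "0 < b" using D r by (simp add: b_def)
    have bp: "b powr p = D powr p / (q ^ j * (q ^ k * q ^ k)) / (2 ^ Suc j) powr p"
      using D r by (simp only: b_def powr_divide powr_mult power_powr)
    have "(LBNN t. w t * ennreal (z j k t powr p) * ind {0<..} t)
      = (LBNN t. ennreal (b powr p) * (ennreal (m (2 ^ k / 2 ^ Suc j * t) powr p) * w t * ind {0<..} t))"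
    proof (intro nn_integral_cong)
      fix t
      have "z j k t powr p = b powr p * m (2 ^ k / 2 ^ Suc j * t) powr p"
        unfolding z_def b_def[symmetric] by (rule powr_mult)
      then have "ennreal (z j k t powr p) = ennreal (b powr p) * ennreal (m (2 ^ k / 2 ^ Suc j * t) powr p)"
        by (simp only: ennreal_mult[OF powr_ge_zero powr_ge_zero])
      then show "w t * ennreal (z j k t powr p) * ind {0<..} t
        = ennreal (b powr p) * (ennreal (m (2 ^ k / 2 ^ Suc j * t) powr p) * w t * ind {0<..} t)"
        by (simp only: mult_ac)
    qed
    also have "\<dots> = ennreal (b powr p) * N (2 ^ k / 2 ^ Suc j)" unfolding N_def by (rule nn_integral_cmult) measurable
    also have "\<dots> \<le> ennreal (b powr p) * (ennreal (C1 * h ^ Suc j * h ^ k * (2 ^ Suc j) powr p) * N 1)"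
      by (intro mult_left_mono C1(4)) simp
    also have "\<dots> = ennreal (b powr p * (C1 * h ^ Suc j * h ^ k * (2 ^ Suc j) powr p)) * N 1"
    proof -
      have nn: "0 \<le> b powr p" "0 \<le> C1 * h ^ Suc j * h ^ k * (2 ^ Suc j) powr p" using C1 by auto
      show ?thesis unfolding ennreal_mult[OF nn] by (rule mult.assoc[symmetric])
    qed
    also have "\<dots> \<le> ennreal (D powr p * C1 * q ^ j * q ^ k) * N 1"
    proof (intro mult_right_mono ennreal_leI)
      have "b powr p * (C1 * h ^ Suc j * h ^ k * (2 ^ Suc j) powr p) = D powr p * C1 * (h ^ Suc j * h ^ k / (q ^ j * (q ^ k * q ^ k)))"
        unfolding bp by simp
      also have "h ^ Suc j * h ^ k / (q ^ j * (q ^ k * q ^ k)) \<le> q ^ j * q ^ k"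
      proof -
        have "h ^ Suc j * h ^ k = q ^ (4 * Suc j + 4 * k)"
          unfolding q(3)[symmetric] by (simp only: power_mult[symmetric] power_add)
        also have "\<dots> \<le> q ^ (j + k + (j + (k + k)))" using q by (intro power_decreasing) auto
        also have "\<dots> = q ^ j * q ^ k * (q ^ j * (q ^ k * q ^ k))" by (simp only: power_add)
        finally show ?thesis using q by (simp only: pos_divide_le_eq zero_less_power mult_pos_pos)
      qed
      then have "D powr p * C1 * (h ^ Suc j * h ^ k / (q ^ j * (q ^ k * q ^ k))) \<le> D powr p * C1 * (q ^ j * q ^ k)"
        using C1 by (intro mult_left_mono) auto
      finally show "b powr p * (C1 * h ^ Suc j * h ^ k * (2 ^ Suc j) powr p) \<le> D powr p * C1 * q ^ j * q ^ k"
        by (simp only: mult.assoc)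
    qed simp
    finally show ?thesis .
  qed
  have "(LBNN t. w t * epowr (rearr_avg u t) p * ind {0<..} t)
    \<le> (LBNN t. E * (\<Sum>j. \<Sum>k. w t * ennreal (z j k t powr p) * ind {0<..} t))"
  proof (intro nn_integral_mono)
    fix t
    show "w t * epowr (rearr_avg u t) p * ind {0<..} t \<le> E * (\<Sum>j. \<Sum>k. w t * ennreal (z j k t powr p) * ind {0<..} t)"
    proof (cases "0 < t")
      case True
      have "epowr (rearr_avg u t) p \<le> epowr (\<Sum>j. \<Sum>k. ennreal (C * r ^ j * r ^ k * z j k t)) p"
        using p by (intro epowr_mono avg True) auto
      also have "\<dots> \<le> E * (\<Sum>j. \<Sum>k. ennreal (z j k t powr p))"
        unfolding E_def using r C p by (intro epowr_double_suminf_le z_nonneg True) auto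
      finally have "w t * epowr (rearr_avg u t) p \<le> w t * (E * (\<Sum>j. \<Sum>k. ennreal (z j k t powr p)))"
        by (rule mult_left_mono) simp
      also have "\<dots> = E * (w t * (\<Sum>j. \<Sum>k. ennreal (z j k t powr p)))" by (rule mult.left_commute)
      also have "\<dots> = E * (\<Sum>j. \<Sum>k. w t * ennreal (z j k t powr p))" by (simp only: ennreal_suminf_cmult)
      finally show ?thesis using True by (simp only: indicator_simps greaterThan_iff mult_1_right)
    qed simp
  qed
  also have "\<dots> = E * (\<Sum>j. \<Sum>k. (LBNN t. w t * ennreal (z j k t powr p) * ind {0<..} t))"
    by (subst nn_integral_cmult, measurable) (subst nn_integral_suminf, measurable, subst nn_integral_suminf, measurable)
  also have "\<dots> \<le> E * (\<Sum>j. \<Sum>k. ennreal (D powr p * C1 * q ^ j * q ^ k) * N 1)"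
    by (intro mult_left_mono suminf_le term_le) auto
  also have "\<dots> = E * (ennreal (D powr p * C1 / (1 - q) / (1 - q)) * N 1)"
    using q C1 by (subst double_suminf_geometric) auto
  also have "\<dots> < \<infinity>" using N by (simp add: E_def ennreal_mult_less_top)
  finally show ?thesis .
qed

end

lemma CZ_trunc_copi:
  fixes K :: "real^'n \<Rightarrow> real"
  assumes K[measurable]: "K \<in> borel_measurable borel" and f: "f \<in> borel_measurable lebesgue"
    and f'[measurable]: "f' \<in> borel_measurable borel" and ae: "AE y in lebesgue. f y = f' y"
  shows "CZ_trunc K f r x = copi K r f' x"
    and "integrable lborel (\<lambda>y. cinf K r (x - y) * f' y) \<Longrightarrow> set_integrable lebesgue {y. norm (x - y) > r} (\<lambda>y. K (x - y) * f y)"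
proof -
  have [measurable]: "cinf K r \<in> borel_measurable borel" unfolding cinf_def[abs_def] by measurable
  have m1: "(\<lambda>y. cinf K r (x - y) * f' y) \<in> borel_measurable lborel" by measurable
  have m2: "(\<lambda>y. ind {y. norm (x - y) > r} y *\<^sub>R (K (x - y) * f y)) \<in> borel_measurable lebesgue"
  proof -
    have "(\<lambda>y. cinf K r (x - y)) \<in> borel_measurable lebesgue" by (intro measurable_completion) measurable
    then have "(\<lambda>y. cinf K r (x - y) * f y) \<in> borel_measurable lebesgue" using f by (rule borel_measurable_times)
    moreover have "cinf K r (x - y) * f y = ind {y. norm (x - y) > r} y *\<^sub>R (K (x - y) * f y)" for y
      by (simp add: cinf_def indicator_def)
    ultimately show ?thesis by simp
  qed
  have eq: "AE y in lebesgue. ind {y. norm (x - y) > r} y *\<^sub>R (K (x - y) * f y) = cinf K r (x - y) * f' y"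
    using ae by eventually_elim (simp add: cinf_def indicator_def)
  have m3: "(\<lambda>y. cinf K r (x - y) * f' y) \<in> borel_measurable lebesgue" by (rule measurable_completion[OF m1])
  have "CZ_trunc K f r x = (\<integral>y. cinf K r (x - y) * f' y \<partial>lebesgue)"
    unfolding CZ_trunc_def set_lebesgue_integral_def by (rule integral_cong_AE[OF m2 m3 eq])
  then show "CZ_trunc K f r x = copi K r f' x" by (simp add: integral_completion[OF m1] copi_def)
  assume "integrable lborel (\<lambda>y. cinf K r (x - y) * f' y)"
  then have "integrable lebesgue (\<lambda>y. cinf K r (x - y) * f' y)" by (simp add: integrable_completion[OF m1])
  then show "set_integrable lebesgue {y. norm (x - y) > r} (\<lambda>y. K (x - y) * f y)"
    unfolding set_integrable_def using integrable_cong_AE[OF m2 m3 eq] by simp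
qed

theorem theorem6p1:
  fixes p p' :: real
    and \<phi> :: "real \<Rightarrow> real"
    and \<psi> :: "real \<Rightarrow> ennreal"
    and K :: "real^'n \<Rightarrow> real"
  assumes p: "1 < p"
    and p': "p' = p / (p - 1)"
    and nontriv: "nontrivial_weight p \<phi>"
    and fin: "(\<integral>\<^sup>+s\<in>{0<..}. ennreal (\<phi> s * min 1 (s powr (-p))) \<partial>lebesgue) < \<infinity>"
    and infin: "(\<integral>\<^sup>+s\<in>{0<..}. ennreal (\<phi> s * max 1 (s powr (-p))) \<partial>lebesgue) = \<infinity>"
    and \<psi>: "\<psi> = dual_weight p (\<lambda>s. ennreal (\<phi> s))"
    and K: "CZ_kernel K"
    and cond: "\<exists>c. 0 < c \<and> c < 1 \<and> (\<forall>t>0.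
          (\<integral>\<^sup>+s\<in>{0<..<c * t}. ennreal (\<phi> s) \<partial>lebesgue)
            + ennreal (c powr p * t powr p)
              * (\<integral>\<^sup>+s\<in>{t<..}. ennreal (\<phi> s) * ennreal (s powr (-p)) \<partial>lebesgue)
          \<le> ennreal (1 / 2) *
            ((\<integral>\<^sup>+s\<in>{0<..<t}. ennreal (\<phi> s) \<partial>lebesgue)
              + ennreal (t powr p)
                * (\<integral>\<^sup>+s\<in>{t<..}. ennreal (\<phi> s) * ennreal (s powr (-p)) \<partial>lebesgue))
        \<and> (\<integral>\<^sup>+s\<in>{0<..<c * t}. \<psi> s \<partial>lebesgue)
            + ennreal (c powr p' * t powr p')
              * (\<integral>\<^sup>+s\<in>{t<..}. \<psi> s * ennreal (s powr (-p')) \<partial>lebesgue)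
          \<le> ennreal (1 / 2) *
            ((\<integral>\<^sup>+s\<in>{0<..<t}. \<psi> s \<partial>lebesgue)
              + ennreal (t powr p')
                * (\<integral>\<^sup>+s\<in>{t<..}. \<psi> s * ennreal (s powr (-p')) \<partial>lebesgue)))"
  shows "CZ_maps_into K (Gamma_space p \<phi>) (Gamma_space p \<phi>)"
proof -
  have weight: "weight \<phi>" and \<phi>_pos: "\<And>t. 0 < t \<Longrightarrow> 0 < \<phi> t"
    using nontriv by (auto simp: nontrivial_weight_def weight_def)
  obtain w where w: "w \<in> borel_measurable borel"
    and ae: "AE t in lebesgue. ennreal (\<phi> t) * ind {0<..} t = w t * ind {0<..} t"
    using weight_borel_representative[OF weight] .
  interpret gweight p w by (rule gweight_of_weight[OF p ae w \<phi>_pos fin])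
  have p'_eq: "p' = pc" by (simp add: p' pc_def)
  obtain c where hc: "half_cond p w c" "half_cond pc W c" using cond
  proof (elim exE conjE, goal_cases)
    case (1 c)
    note h = 1(4)[rule_format, unfolded \<psi> p'_eq weight_transfer(1)[OF ae] half_cond_dual(1)[OF ae]]
    have "half_cond p w c" "half_cond pc W c"
      unfolding half_cond_def Gi_def using 1(2,3) h weight_transfer(2)[OF ae] half_cond_dual(2)[OF ae] by auto
    then show ?case by (rule 1(1))
  qed
  have inf: "(LBNN s. w s * ennreal (s powr (-p)) * ind {0<..<b} s) = \<infinity>" if "0 < b" for b
  proof -
    have "(\<integral>\<^sup>+t\<in>{0<..<b}. ennreal (\<phi> t) * ennreal (t powr (-p)) \<partial>lebesgue) = \<infinity>"
      using nontriv that by (simp add: nontrivial_weight_def ennreal_mult'')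
    moreover have "{0<..<b} \<subseteq> {0<..}" by auto
    ultimately show ?thesis using nn_integral_weight[OF ae] by simp
  qed
  obtain A where cz: "cz_pv K A" using CZ_kernel_cz_pv[OF K] .
  then have K_borel: "K \<in> borel_measurable borel" by (simp add: cz_pv_def cz_def)
  show ?thesis unfolding CZ_maps_into_def
  proof (intro ballI)
    fix f :: "real^'n \<Rightarrow> real" assume "f \<in> Gamma_space p \<phi>"
    then have f: "f \<in> borel_measurable lebesgue" "Gamma_norm p \<phi> f < \<infinity>" by (auto simp: Gamma_space_def)
    obtain f' :: "real^'n \<Rightarrow> real" where f': "f' \<in> borel_measurable borel" "AE x in lebesgue. f x = f' x"
      using lebesgue_borel_representative[OF f(1)] by blast
    have f'_leb: "f' \<in> borel_measurable lebesgue" using f'(1) by (intro measurable_completion) simp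
    have "rearr f = rearr f'" by (rule rearr_cong[OF f(1) f'_leb f'(2)])
    then have norm_f': "Gamma_norm p \<phi> f' < \<infinity>" using f(2) by (simp add: Gamma_norm_def rearr_avg_def)
    define r where "r t = (if 0 < t then enn2real (rearr f' t) else 0)" for t
    have "(LBNN s. rearr f' s * ind {0<..<t} s) < \<infinity>" if "0 < t" for t
      using rearr_avg_finite[OF norm_f' \<phi>_pos that] by (simp add: nn_integral_completion)
    note decr = decr_rearr[OF f'(1) this, folded r_def]
    interpret D: decr_weight r p w using decr(1) gweight_axioms by (simp add: decr_weight_def)
    have "D.N 1 = (LBNN t. w t * epowr (rearr_avg f' t) p * ind {0<..} t)" unfolding D.N_def
    proof (intro nn_integral_cong)
      fix t
      show "ennreal (D.m (1 * t) powr p) * w t * ind {0<..} t = w t * epowr (rearr_avg f' t) p * ind {0<..} t"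
        using decr(3)[of t] D.m_nonneg[of t] by (cases "0 < t") (auto simp: epowr_def mult.commute)
    qed
    also have "\<dots> = (\<integral>\<^sup>+t\<in>{0<..}. ennreal (\<phi> t) * epowr (rearr_avg f' t) p \<partial>lebesgue)"
      by (rule nn_integral_weight[OF ae, symmetric]) simp
    also have "\<dots> < \<infinity>" using norm_f' unfolding Gamma_norm_finite by (simp only: mult.commute)
    finally have N: "D.N 1 < \<infinity>" .
    obtain u :: "real^'n \<Rightarrow> real" and C where u: "u \<in> borel_measurable borel" "0 < C"
      "\<And>a x. 0 < a \<Longrightarrow> integrable lborel (\<lambda>y. cinf K a (x - y) * f' y)"
      "AE x in lborel. ((\<lambda>\<epsilon>. copi K \<epsilon> f' x) \<longlongrightarrow> u x) (at_right 0)"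
      "\<And>t. 0 < t \<Longrightarrow> rearr u t \<le> ennreal (C * (\<Sum>k. (real k + 1) * D.m (2 ^ k * t)))"
      using D.rearr_operator_le[OF cz f'(1) decr(2) N hc(1)] by blast
    \<comment> \<open>Changing \<open>f\<close> on a null set changes no truncated integral, at any
      point and for any truncation, so the operator may be computed from \<open>f'\<close>.\<close>
    note trunc = CZ_trunc_copi[OF K_borel f(1) f']
    have lim: "AE x in lebesgue. ((\<lambda>\<epsilon>. copi K \<epsilon> f' x) \<longlongrightarrow> u x) (at_right 0)" by (rule AE_completion[OF u(4)])
    have def: "AE x in lebesgue. CZ_defined_at K f x" using lim
    proof eventually_elim
      case (elim x)
      then show ?case unfolding CZ_defined_at_def trunc(1) using trunc(2)[OF u(3)] by blast
    qed
    have op: "AE x in lebesgue. u x = CZ_operator K f x" using lim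
    proof eventually_elim
      case (elim x)
      then show ?case unfolding CZ_operator_def trunc(1) by (intro tendsto_Lim[symmetric]) auto
    qed
    have u_leb: "u \<in> borel_measurable lebesgue" using u(1) by (intro measurable_completion) simp
    \<comment> \<open>Where the limit fails to exist, \<open>CZ_operator\<close> has an unspecified
      value; completeness of the Lebesgue measure makes it measurable all the same, being almost
      everywhere equal to \<open>u\<close>.\<close>
    have op_leb: "CZ_operator K f \<in> borel_measurable lebesgue" by (rule borel_measurable_AE[OF u_leb op])
    have "(\<integral>\<^sup>+t\<in>{0<..}. ennreal (\<phi> t) * epowr (rearr_avg u t) p \<partial>lebesgue) = (LBNN t. w t * epowr (rearr_avg u t) p * ind {0<..} t)"
      by (rule nn_integral_weight[OF ae]) simp
    also have "\<dots> < \<infinity>" by (rule D.Gamma_bound[OF u(1,2,5) N inf hc])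
    finally have "Gamma_norm p \<phi> u < \<infinity>" unfolding Gamma_norm_finite by (simp only: mult.commute)
    moreover have "rearr u = rearr (CZ_operator K f)" by (rule rearr_cong[OF u_leb op_leb op])
    ultimately have "Gamma_norm p \<phi> (CZ_operator K f) < \<infinity>" by (simp add: Gamma_norm_def rearr_avg_def)
    then show "(AE x in lebesgue. CZ_defined_at K f x) \<and> CZ_operator K f \<in> Gamma_space p \<phi>"
      using def op_leb by (simp add: Gamma_space_def)
  qed
qed

end
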